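(* Let $p$ be an odd prime, $\Gamma=C_p\rtimes C_r=\langle \sigma, \tau : \sigma^p = 1 = \tau^r,\ \tau\sigma\tau^{-1} = \sigma^s\rangle$ with the class of $s$ in $(\mathbb{Z}/p\mathbb{Z})^\times$ of exact order $r$, and $G=\Gamma\times\{1,j\}$ with $j$ of order 2. Let $I\subset D\subset G$ be subgroups with $I$ normal in $D$ and $D/I$ cyclic, and $\varphi$ a generator of $D/I$. Then, up to projective equivalence, \[\Phi({}_pA_{I,\varphi}^-)\sim\begin{cases}0&\text{unless } p\mid\#I \text{ and } j\notin D,\\ \bigoplus_{1\le i\le r,\ e\mid i}(L_1^i\oplus L_2^{i+1})&\text{if } D=\langle\sigma,\tau^{r/e}\rangle,\ I=\langle\sigma,\tau^{r/d}\rangle\ (d\mid e\mid r),\\ \bigoplus_{1\le i\le r,\ \frac e2\mid i,\ e\nmid i}(L_1^i\oplus L_2^{i+1})&\text{if } D=\langle\sigma,\tau^{r/e}j\rangle,\ I=\langle\sigma,(\tau^{r/e}j)^{e/d}\rangle\ (d\mid e\mid r,\ e \text{ even}).\end{cases}\]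
   Context: $A_{I,\varphi}=\mathbb{Z}[G]\otimes_{\mathbb{Z}[D]}\mathbb{Z}[D/I]/(1-\varphi^{-1}+\#I)$, ${}_pA_{I,\varphi}^-=(\mathbb{Z}_p\otimes A_{I,\varphi})/(1+j)$, a finite module over $\mathbb{Z}_p[G]/(1+j)\cong\mathbb{Z}_p[\Gamma]$. For a finite $\mathbb{Z}_p[\Gamma]$-module $X$, $\Phi(X)$ is the projective equivalence class of the kernel of a surjection $F\to X$ from a finitely generated projective $\mathbb{Z}_p[\Gamma]$-module $F$ (lattices $L,L'$ are projectively equivalent if $L\oplus F'\cong L'\oplus F$ with $F,F'$ finitely generated projective); $0$ denotes the class of projective lattices. Let $\rho\in\mathbb{Z}_p^\times$ be the root of unity with $\rho\equiv s\pmod p$; $L_1^i$ is $\mathbb{Z}_p$ with $\sigma$ trivial and $\tau$ acting by $\rho^i$. With $\zeta$ a primitive $p$-th root of unity, $\mathbb{Q}_p(\zeta)$ is a $\mathbb{Q}_p[\Gamma]$-module ($\sigma$ multiplies by $\zeta$, $\tau$ acts as $\zeta\mapsto\zeta^s$), and $L_2^i=(1-\zeta)^i\mathbb{Z}_p[\zeta]$. The classes of $L_1^i,L_2^i$ depend only on $i$ mod $r$. *)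

theory Defs
  imports "HOL-Algebra.UnivPoly" "HOL-Algebra.IntRing" "HOL-Algebra.Free_Abelian_Groups"
    "HOL-Algebra.Multiplicative_Group" "HOL-Number_Theory.Pocklington"
begin

section \<open>Modules over a not necessarily commutative ring\<close>

locale left_module = R?: ring R + M?: abelian_group M
  for R :: "('r, 'a) ring_scheme" (structure) and M :: "('r, 'm, 'c) module_scheme" (structure) +
  assumes smult_closed:
      "\<lbrakk>a \<in> carrier R; x \<in> carrier M\<rbrakk> \<Longrightarrow> a \<odot>\<^bsub>M\<^esub> x \<in> carrier M"
    and smult_l_distr:
      "\<lbrakk>a \<in> carrier R; b \<in> carrier R; x \<in> carrier M\<rbrakk> \<Longrightarrow>
      (a \<oplus>\<^bsub>R\<^esub> b) \<odot>\<^bsub>M\<^esub> x = a \<odot>\<^bsub>M\<^esub> x \<oplus>\<^bsub>M\<^esub> b \<odot>\<^bsub>M\<^esub> x"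
    and smult_r_distr:
      "\<lbrakk>a \<in> carrier R; x \<in> carrier M; y \<in> carrier M\<rbrakk> \<Longrightarrow>
      a \<odot>\<^bsub>M\<^esub> (x \<oplus>\<^bsub>M\<^esub> y) = a \<odot>\<^bsub>M\<^esub> x \<oplus>\<^bsub>M\<^esub> a \<odot>\<^bsub>M\<^esub> y"
    and smult_assoc:
      "\<lbrakk>a \<in> carrier R; b \<in> carrier R; x \<in> carrier M\<rbrakk> \<Longrightarrow>
      (a \<otimes>\<^bsub>R\<^esub> b) \<odot>\<^bsub>M\<^esub> x = a \<odot>\<^bsub>M\<^esub> (b \<odot>\<^bsub>M\<^esub> x)"
    and smult_one: "x \<in> carrier M \<Longrightarrow> \<one>\<^bsub>R\<^esub> \<odot>\<^bsub>M\<^esub> x = x"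

text \<open>
  The record type of modules extends that of rings; its multiplication and unit play no role
  for modules and are left unspecified.
\<close>

definition mk_mod ::
    "'m set \<Rightarrow> 'm \<Rightarrow> ('m \<Rightarrow> 'm \<Rightarrow> 'm) \<Rightarrow> ('r \<Rightarrow> 'm \<Rightarrow> 'm) \<Rightarrow> ('r, 'm) module" where
  "mk_mod S z pl sm =
     \<lparr>carrier = S, monoid.mult = undefined, monoid.one = undefined, ring.zero = z, ring.add = pl, smult = sm\<rparr>"

definition reg_mod :: "('r, 'a) ring_scheme \<Rightarrow> ('r, 'r) module" where
  "reg_mod R = mk_mod (carrier R) \<zero>\<^bsub>R\<^esub> (\<oplus>\<^bsub>R\<^esub>) (\<otimes>\<^bsub>R\<^esub>)"

definition restrict_scalars :: "('r \<Rightarrow> 's) \<Rightarrow> ('s, 'm) module \<Rightarrow> ('r, 'm) module" where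
  "restrict_scalars f M =
     mk_mod (carrier M) \<zero>\<^bsub>M\<^esub> (\<oplus>\<^bsub>M\<^esub>) (\<lambda>a x. f a \<odot>\<^bsub>M\<^esub> x)"

text \<open>The quotient by a submodule with underlying set \<open>N\<close>.\<close>

definition quot_mod :: "('r, 'm) module \<Rightarrow> 'm set \<Rightarrow> ('r, 'm set) module" where
  "quot_mod M N = mk_mod (a_rcosets\<^bsub>M\<^esub> N) N (\<lambda>C C'. C <+>\<^bsub>M\<^esub> C')
     (\<lambda>a C. \<Union>x\<in>C. N +>\<^bsub>M\<^esub> (a \<odot>\<^bsub>M\<^esub> x))"

definition oplus_mod :: "('r, 'm) module \<Rightarrow> ('r, 'n) module \<Rightarrow> ('r, 'm \<times> 'n) module" where
  "oplus_mod M N = mk_mod (carrier M \<times> carrier N) (\<zero>\<^bsub>M\<^esub>, \<zero>\<^bsub>N\<^esub>)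
     (\<lambda>u v. (fst u \<oplus>\<^bsub>M\<^esub> fst v, snd u \<oplus>\<^bsub>N\<^esub> snd v))
     (\<lambda>a u. (a \<odot>\<^bsub>M\<^esub> fst u, a \<odot>\<^bsub>N\<^esub> snd u))"

text \<open>The direct sum of a family indexed by a finite set.\<close>

definition dsum_mod :: "'i set \<Rightarrow> ('i \<Rightarrow> ('r, 'm) module) \<Rightarrow> ('r, 'i \<Rightarrow> 'm) module" where
  "dsum_mod I M = mk_mod (\<Pi>\<^sub>E i\<in>I. carrier (M i)) (\<lambda>i\<in>I. \<zero>\<^bsub>M i\<^esub>)
     (\<lambda>u v. \<lambda>i\<in>I. u i \<oplus>\<^bsub>M i\<^esub> v i) (\<lambda>a u. \<lambda>i\<in>I. a \<odot>\<^bsub>M i\<^esub> u i)"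

definition lmod_hom ::
    "('r, 'a) ring_scheme \<Rightarrow> ('r, 'm) module \<Rightarrow> ('r, 'n) module \<Rightarrow> ('m \<Rightarrow> 'n) set" where
  "lmod_hom R M N = {h \<in> carrier M \<rightarrow> carrier N.
     (\<forall>x\<in>carrier M. \<forall>y\<in>carrier M. h (x \<oplus>\<^bsub>M\<^esub> y) = h x \<oplus>\<^bsub>N\<^esub> h y) \<and>
     (\<forall>a\<in>carrier R. \<forall>x\<in>carrier M. h (a \<odot>\<^bsub>M\<^esub> x) = a \<odot>\<^bsub>N\<^esub> h x)}"

definition lmod_iso ::
    "('r, 'a) ring_scheme \<Rightarrow> ('r, 'm) module \<Rightarrow> ('r, 'n) module \<Rightarrow> bool" where
  "lmod_iso R M N \<longleftrightarrow> (\<exists>h \<in> lmod_hom R M N. bij_betw h (carrier M) (carrier N))"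

definition ker_mod :: "('r, 'm) module \<Rightarrow> ('r, 'n) module \<Rightarrow> ('m \<Rightarrow> 'n) \<Rightarrow> ('r, 'm) module" where
  "ker_mod M N h = M\<lparr>carrier := {x \<in> carrier M. h x = \<zero>\<^bsub>N\<^esub>}\<rparr>"


section \<open>Projective equivalence\<close>

text \<open>
  Finitely generated projective means: a direct summand of some \<open>R\<^sup>n\<close>.  A complement is isomorphic
  to a submodule of \<open>R\<^sup>n\<close>, and so is every finitely generated projective module.  Hence letting
  the existentially quantified modules below have elements of type \<^typ>\<open>nat \<Rightarrow> 'r\<close>
  (the type of the elements of \<open>R\<^sup>n\<close>) loses nothing.
\<close>

definition fg_projective :: "('r, 'a) ring_scheme \<Rightarrow> ('r, 'm) module \<Rightarrow> bool" where
  "fg_projective R P \<longleftrightarrow> left_module R P \<and>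
     (\<exists>n::nat. \<exists>Q :: ('r, nat \<Rightarrow> 'r) module. left_module R Q \<and>
        lmod_iso R (oplus_mod P Q) (dsum_mod {..<n} (\<lambda>_. reg_mod R)))"

definition proj_equiv ::
    "('r, 'a) ring_scheme \<Rightarrow> ('r, 'm) module \<Rightarrow> ('r, 'n) module \<Rightarrow> bool" where
  "proj_equiv R L L' \<longleftrightarrow>
     (\<exists>(F :: ('r, nat \<Rightarrow> 'r) module) (F' :: ('r, nat \<Rightarrow> 'r) module).
        fg_projective R F \<and> fg_projective R F' \<and>
        lmod_iso R (oplus_mod L F') (oplus_mod L' F))"

text \<open>
  Projective equivalence classes, as sets of modules with elements of type \<^typ>\<open>nat \<Rightarrow> 'r\<close>;
  every lattice over \<open>\<int>\<^sub>p[\<Gamma>]\<close> is isomorphic to a module of this type.  A module that is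
  projectively equivalent to a lattice embeds into a lattice, so is a lattice itself; therefore
  the definitions need not mention lattices.
\<close>

definition proj_class ::
    "('r, 'a) ring_scheme \<Rightarrow> ('r, 'm) module \<Rightarrow> ('r, nat \<Rightarrow> 'r) module set" where
  "proj_class R M = {L. left_module R L \<and> proj_equiv R L M}"

definition fg_projective_class :: "('r, 'a) ring_scheme \<Rightarrow> ('r, nat \<Rightarrow> 'r) module set" where
  "fg_projective_class R = {L. fg_projective R L}"

text \<open>
  The modules projectively equivalent to the kernel of some surjection \<open>F \<rightarrow> N\<close> with \<open>F\<close> finitely
  generated projective. An equation \<open>Phi R N = proj_class R M\<close> entails in particular that all
  such kernels are projectively equivalent to \<open>M\<close>.
\<close>

definition Phi ::
    "('r, 'a) ring_scheme \<Rightarrow> ('r, 'm) module \<Rightarrow> ('r, nat \<Rightarrow> 'r) module set" where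
  "Phi R N = {L. left_module R L \<and>
     (\<exists>(F :: ('r, nat \<Rightarrow> 'r) module) f. fg_projective R F \<and>
        f \<in> lmod_hom R F N \<and> f ` carrier F = carrier N \<and>
        proj_equiv R L (ker_mod F N f))}"


section \<open>Tensor products\<close>

text \<open>
  \<open>tensor R M act N\<close> is \<open>M \<otimes>\<^sub>R N\<close> for an \<open>(S,R)\<close>-bimodule \<open>M\<close>, given as a left \<open>S\<close>-module
  together with a right action \<open>act\<close> of \<open>R\<close>, and a left \<open>R\<close>-module \<open>N\<close>: the free abelian group
  on \<open>M \<times> N\<close> modulo the usual relations, with \<open>S\<close> acting through \<open>M\<close>.
\<close>

definition tensor_rel ::
    "('r, 'a) ring_scheme \<Rightarrow> ('s, 'm) module \<Rightarrow> ('m \<Rightarrow> 'r \<Rightarrow> 'm) \<Rightarrow> ('r, 'n) module \<Rightarrow>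
     (('m \<times> 'n) \<Rightarrow>\<^sub>0 int) set" where
  "tensor_rel R M act N = generate (free_Abelian_group (carrier M \<times> carrier N))
     ({frag_of (x \<oplus>\<^bsub>M\<^esub> x', y) - frag_of (x, y) - frag_of (x', y) | x x' y.
         x \<in> carrier M \<and> x' \<in> carrier M \<and> y \<in> carrier N} \<union>
      {frag_of (x, y \<oplus>\<^bsub>N\<^esub> y') - frag_of (x, y) - frag_of (x, y') | x y y'.
         x \<in> carrier M \<and> y \<in> carrier N \<and> y' \<in> carrier N} \<union>
      {frag_of (act x a, y) - frag_of (x, a \<odot>\<^bsub>N\<^esub> y) | x a y.
         x \<in> carrier M \<and> a \<in> carrier R \<and> y \<in> carrier N})"

text \<open>The endomorphism \<open>f \<otimes> h\<close> of \<open>M \<otimes>\<^sub>R N\<close>.\<close>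

definition tensor_map ::
    "('r, 'a) ring_scheme \<Rightarrow> ('s, 'm) module \<Rightarrow> ('m \<Rightarrow> 'r \<Rightarrow> 'm) \<Rightarrow> ('r, 'n) module \<Rightarrow>
     ('m \<Rightarrow> 'm) \<Rightarrow> ('n \<Rightarrow> 'n) \<Rightarrow> (('m \<times> 'n) \<Rightarrow>\<^sub>0 int) set \<Rightarrow> (('m \<times> 'n) \<Rightarrow>\<^sub>0 int) set" where
  "tensor_map R M act N f h C =
     (\<Union>c\<in>C. tensor_rel R M act N #>\<^bsub>free_Abelian_group (carrier M \<times> carrier N)\<^esub>
        frag_extend (\<lambda>(x, y). frag_of (f x, h y)) c)"

definition tensor ::
    "('r, 'a) ring_scheme \<Rightarrow> ('s, 'm) module \<Rightarrow> ('m \<Rightarrow> 'r \<Rightarrow> 'm) \<Rightarrow> ('r, 'n) module \<Rightarrow>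
     ('s, (('m \<times> 'n) \<Rightarrow>\<^sub>0 int) set) module" where
  "tensor R M act N =
     (let T = free_Abelian_group (carrier M \<times> carrier N) Mod tensor_rel R M act N
      in mk_mod (carrier T) \<one>\<^bsub>T\<^esub> (\<otimes>\<^bsub>T\<^esub>)
           (\<lambda>a. tensor_map R M act N (\<lambda>x. a \<odot>\<^bsub>M\<^esub> x) id))"


section \<open>Group rings of finite groups\<close>

definition group_ring :: "('k, 'a) ring_scheme \<Rightarrow> ('g, 'b) monoid_scheme \<Rightarrow> ('g \<Rightarrow> 'k) ring" where
  "group_ring R G =
     \<lparr>carrier = carrier G \<rightarrow>\<^sub>E carrier R,
      monoid.mult = (\<lambda>a b. \<lambda>g\<in>carrier G.
        \<Oplus>\<^bsub>R\<^esub>h\<in>carrier G. a h \<otimes>\<^bsub>R\<^esub> b (inv\<^bsub>G\<^esub> h \<otimes>\<^bsub>G\<^esub> g)),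
      monoid.one = (\<lambda>g\<in>carrier G. if g = \<one>\<^bsub>G\<^esub> then \<one>\<^bsub>R\<^esub> else \<zero>\<^bsub>R\<^esub>),
      ring.zero = (\<lambda>g\<in>carrier G. \<zero>\<^bsub>R\<^esub>),
      ring.add = (\<lambda>a b. \<lambda>g\<in>carrier G. a g \<oplus>\<^bsub>R\<^esub> b g)\<rparr>"

definition gr_of ::
    "('k, 'a) ring_scheme \<Rightarrow> ('g, 'b) monoid_scheme \<Rightarrow> 'g \<Rightarrow> 'g \<Rightarrow> 'k" where
  "gr_of R G h = (\<lambda>g\<in>carrier G. if g = h then \<one>\<^bsub>R\<^esub> else \<zero>\<^bsub>R\<^esub>)"

text \<open>The map of group rings \<open>R[G] \<rightarrow> R[H]\<close> induced by a group homomorphism \<open>f\<close>.\<close>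

definition gr_map ::
    "('k, 'a) ring_scheme \<Rightarrow> ('g, 'b) monoid_scheme \<Rightarrow> ('h, 'c) monoid_scheme \<Rightarrow>
     ('g \<Rightarrow> 'h) \<Rightarrow> ('g \<Rightarrow> 'k) \<Rightarrow> 'h \<Rightarrow> 'k" where
  "gr_map R G H f a = (\<lambda>y\<in>carrier H. \<Oplus>\<^bsub>R\<^esub>x\<in>{x\<in>carrier G. f x = y}. a x)"


section \<open>The $p$-adic integers and $\mathbb{Z}_p[\zeta]$\<close>

text \<open>The inverse limit of the rings \<open>\<int>/p\<^sup>n\<close>, residues being represented in \<open>{0..<p\<^sup>n}\<close>.\<close>

definition padic_int :: "nat \<Rightarrow> (nat \<Rightarrow> int) ring" where
  "padic_int p =
     \<lparr>carrier = {x. \<forall>n. x n \<in> {0..<int p ^ n} \<and> x (Suc n) mod int p ^ n = x n},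
      monoid.mult = (\<lambda>x y n. (x n * y n) mod int p ^ n),
      monoid.one = (\<lambda>n. 1 mod int p ^ n),
      ring.zero = (\<lambda>n. 0),
      ring.add = (\<lambda>x y n. (x n + y n) mod int p ^ n)\<rparr>"

text \<open>\<open>\<int>\<^sub>p[\<zeta>]\<close> is \<open>\<int>\<^sub>p[X]\<close> modulo the cyclotomic polynomial \<open>1 + X + \<dots> + X\<^sup>p\<^sup>-\<^sup>1\<close>.\<close>

definition cyclo_ideal :: "nat \<Rightarrow> (nat \<Rightarrow> nat \<Rightarrow> int) set" where
  "cyclo_ideal p = (let P = UP (padic_int p)
     in PIdl\<^bsub>P\<^esub> (\<Oplus>\<^bsub>P\<^esub>k\<in>{..<p}. monom P \<one>\<^bsub>padic_int p\<^esub> k))"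

definition Zp_zeta :: "nat \<Rightarrow> (nat \<Rightarrow> nat \<Rightarrow> int) set ring" where
  "Zp_zeta p = UP (padic_int p) Quot cyclo_ideal p"

definition zeta_const :: "nat \<Rightarrow> (nat \<Rightarrow> int) \<Rightarrow> (nat \<Rightarrow> nat \<Rightarrow> int) set" where
  "zeta_const p c = cyclo_ideal p +>\<^bsub>UP (padic_int p)\<^esub> monom (UP (padic_int p)) c 0"

definition zeta :: "nat \<Rightarrow> (nat \<Rightarrow> nat \<Rightarrow> int) set" where
  "zeta p = cyclo_ideal p +>\<^bsub>UP (padic_int p)\<^esub> monom (UP (padic_int p)) \<one>\<^bsub>padic_int p\<^esub> 1"

text \<open>The \<open>\<int>\<^sub>p\<close>-algebra endomorphism of \<open>\<int>\<^sub>p[\<zeta>]\<close> given by \<open>\<zeta> \<mapsto> \<zeta>\<^sup>s\<close>.\<close>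

definition zeta_aut ::
    "nat \<Rightarrow> nat \<Rightarrow> (nat \<Rightarrow> nat \<Rightarrow> int) set \<Rightarrow> (nat \<Rightarrow> nat \<Rightarrow> int) set" where
  "zeta_aut p s C =
     the_elem (eval (padic_int p) (Zp_zeta p) (zeta_const p) (zeta p [^]\<^bsub>Zp_zeta p\<^esub> s) ` C)"


section \<open>The lattices over $\mathbb{Z}_p[\Gamma]$\<close>

text \<open>
  The \<open>\<int>\<^sub>p[\<Gamma>]\<close>-module with underlying \<open>\<int>\<^sub>p\<close>-module \<open>M\<close> on which \<open>\<sigma>\<close> and \<open>\<tau>\<close> act by \<open>S\<close> and \<open>T\<close>;
  the elements of \<open>\<Gamma>\<close> are the \<open>\<sigma>\<^sup>k\<tau>\<^sup>l\<close> with \<open>k < p\<close> and \<open>l < r\<close>, without repetition.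
\<close>

definition gamma_mod ::
    "nat \<Rightarrow> nat \<Rightarrow> ('g, 'b) monoid_scheme \<Rightarrow> 'g \<Rightarrow> 'g \<Rightarrow>
     (nat \<Rightarrow> int, 'm) module \<Rightarrow> ('m \<Rightarrow> 'm) \<Rightarrow> ('m \<Rightarrow> 'm) \<Rightarrow> ('g \<Rightarrow> nat \<Rightarrow> int, 'm) module" where
  "gamma_mod p r G \<sigma> \<tau> M S T = mk_mod (carrier M) \<zero>\<^bsub>M\<^esub> (\<oplus>\<^bsub>M\<^esub>)
     (\<lambda>a x. \<Oplus>\<^bsub>M\<^esub>k\<in>{..<p}. \<Oplus>\<^bsub>M\<^esub>l\<in>{..<r}.
        a (\<sigma> [^]\<^bsub>G\<^esub> k \<otimes>\<^bsub>G\<^esub> \<tau> [^]\<^bsub>G\<^esub> l) \<odot>\<^bsub>M\<^esub> (S ^^ k) ((T ^^ l) x))"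

definition L1 ::
    "nat \<Rightarrow> nat \<Rightarrow> ('g, 'b) monoid_scheme \<Rightarrow> 'g \<Rightarrow> 'g \<Rightarrow> (nat \<Rightarrow> int) \<Rightarrow> nat \<Rightarrow>
     ('g \<Rightarrow> nat \<Rightarrow> int, nat \<Rightarrow> int) module" where
  "L1 p r G \<sigma> \<tau> \<rho> i = gamma_mod p r G \<sigma> \<tau> (reg_mod (padic_int p))
     id (\<lambda>x. \<rho> [^]\<^bsub>padic_int p\<^esub> i \<otimes>\<^bsub>padic_int p\<^esub> x)"

definition L2 ::
    "nat \<Rightarrow> nat \<Rightarrow> nat \<Rightarrow> ('g, 'b) monoid_scheme \<Rightarrow> 'g \<Rightarrow> 'g \<Rightarrow> nat \<Rightarrow>
     ('g \<Rightarrow> nat \<Rightarrow> int, (nat \<Rightarrow> nat \<Rightarrow> int) set) module" where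
  "L2 p r s G \<sigma> \<tau> i = (let Z = Zp_zeta p in
     gamma_mod p r G \<sigma> \<tau>
       (mk_mod {(\<one>\<^bsub>Z\<^esub> \<ominus>\<^bsub>Z\<^esub> zeta p) [^]\<^bsub>Z\<^esub> i \<otimes>\<^bsub>Z\<^esub> x | x. x \<in> carrier Z} \<zero>\<^bsub>Z\<^esub> (\<oplus>\<^bsub>Z\<^esub>)
          (\<lambda>c x. zeta_const p c \<otimes>\<^bsub>Z\<^esub> x))
       (\<lambda>x. zeta p \<otimes>\<^bsub>Z\<^esub> x) (zeta_aut p s))"


section \<open>The module $A_{I,\varphi}$ and its minus part at $p$\<close>

definition A_mod ::
    "'g monoid \<Rightarrow> 'g set \<Rightarrow> 'g set \<Rightarrow> 'g set \<Rightarrow>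
     ('g \<Rightarrow> int, ((('g \<Rightarrow> int) \<times> ('g set \<Rightarrow> int) set) \<Rightarrow>\<^sub>0 int) set) module" where
  "A_mod G D I \<phi> =
     (let H = G\<lparr>carrier := D\<rparr>; Q = H Mod I;
          ZG = group_ring \<Z> G; ZQ = group_ring \<Z> Q;
          \<alpha> = (\<one>\<^bsub>ZQ\<^esub> \<ominus>\<^bsub>ZQ\<^esub> gr_of \<Z> Q (inv\<^bsub>Q\<^esub> \<phi>)) \<oplus>\<^bsub>ZQ\<^esub> [card I] \<cdot>\<^bsub>ZQ\<^esub> \<one>\<^bsub>ZQ\<^esub>
      in tensor (group_ring \<Z> H) (reg_mod ZG) (\<lambda>x a. x \<otimes>\<^bsub>ZG\<^esub> gr_map \<Z> H G id a)
           (restrict_scalars (gr_map \<Z> H Q (\<lambda>d. I #>\<^bsub>G\<^esub> d))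
              (quot_mod (reg_mod ZQ) (PIdl\<^bsub>ZQ\<^esub> \<alpha>))))"

text \<open>
  \<open>\<int>\<^sub>p \<otimes>\<^sub>\<int> A\<close> for a \<open>\<int>[G]\<close>-module \<open>A\<close>, with \<open>(\<Sum>\<^sub>g a\<^sub>g g) (x \<otimes> y) = \<Sum>\<^sub>g a\<^sub>g x \<otimes> g y\<close>.
\<close>

definition padic_tensor ::
    "nat \<Rightarrow> 'g monoid \<Rightarrow> ('g \<Rightarrow> int, 'm) module \<Rightarrow>
     ('g \<Rightarrow> nat \<Rightarrow> int, (((nat \<Rightarrow> int) \<times> 'm) \<Rightarrow>\<^sub>0 int) set) module" where
  "padic_tensor p G A =
     (let Zp = padic_int p;
          act = (\<lambda>x (k::int). [k] \<cdot>\<^bsub>Zp\<^esub> x);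
          A\<^sub>Z = mk_mod (carrier A) \<zero>\<^bsub>A\<^esub> (\<oplus>\<^bsub>A\<^esub>) (\<lambda>(k::int) y. [k] \<cdot>\<^bsub>A\<^esub> y);
          T = tensor \<Z> (reg_mod Zp) act A\<^sub>Z
      in mk_mod (carrier T) \<zero>\<^bsub>T\<^esub> (\<oplus>\<^bsub>T\<^esub>)
           (\<lambda>a t. \<Oplus>\<^bsub>T\<^esub>g\<in>carrier G.
              a g \<odot>\<^bsub>T\<^esub> tensor_map \<Z> (reg_mod Zp) act A\<^sub>Z id (\<lambda>y. gr_of \<Z> G g \<odot>\<^bsub>A\<^esub> y) t))"

text \<open>
  The quotient by \<open>1 + j\<close>, for central \<open>j\<close>, of a \<open>\<int>\<^sub>p[G]\<close>-module, as a module over \<open>\<int>\<^sub>p[\<Gamma>]\<close>.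
\<close>

definition minus_part ::
    "nat \<Rightarrow> 'g monoid \<Rightarrow> 'g set \<Rightarrow> 'g \<Rightarrow> ('g \<Rightarrow> nat \<Rightarrow> int, 'm) module \<Rightarrow>
     ('g \<Rightarrow> nat \<Rightarrow> int, 'm set) module" where
  "minus_part p G \<Gamma> j N =
     (let R = group_ring (padic_int p) G
      in restrict_scalars (gr_map (padic_int p) (G\<lparr>carrier := \<Gamma>\<rparr>) G id)
           (quot_mod N {(\<one>\<^bsub>R\<^esub> \<oplus>\<^bsub>R\<^esub> gr_of (padic_int p) G j) \<odot>\<^bsub>N\<^esub> x | x. x \<in> carrier N}))"

definition A_minus ::
    "nat \<Rightarrow> 'g monoid \<Rightarrow> 'g set \<Rightarrow> 'g \<Rightarrow> 'g set \<Rightarrow> 'g set \<Rightarrow> 'g set \<Rightarrow>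
     ('g \<Rightarrow> nat \<Rightarrow> int,
      (((nat \<Rightarrow> int) \<times> ((('g \<Rightarrow> int) \<times> ('g set \<Rightarrow> int) set) \<Rightarrow>\<^sub>0 int) set) \<Rightarrow>\<^sub>0 int) set set) module"
  where
  "A_minus p G \<Gamma> j D I \<phi> = minus_part p G \<Gamma> j (padic_tensor p G (A_mod G D I \<phi>))"

end

theory Submission
 imports Defs "HOL-Algebra.Sylow"
begin

text \<open>
 Dividing by \<open>1 + j\<close> turns \<open>\<int>\<^sub>p[G]\<close> into \<open>\<Lambda> = \<int>\<^sub>p[\<Gamma>]\<close>, an element \<open>g\<close> outside \<open>\<Gamma>\<close> becoming
 \<open>u(g) = - g j\<close>, and \<open>A\<close> into the cyclic module \<open>\<Lambda>/L\<close>, where the left ideal \<open>L\<close> is generated by the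
 \<open>u(i) - 1\<close> for \<open>i \<in> I\<close> and by \<open>\<beta> = 1 - u(\<psi>) + #I\<close> for a lift \<open>\<psi>\<close> of the inverse of \<open>\<phi>\<close>.  By Schanuel's
 lemma \<open>\<Phi>\<close> is the class of \<open>L\<close>.

 If \<open>p\<close> does not divide \<open>#I\<close>, the averaging idempotent \<open>e\<close> of \<open>I\<close> gives \<open>L = \<Lambda> (1 - e + e \<beta>)\<close>, which is free.
 Otherwise \<open>\<sigma> \<in> I\<close>, and since \<open>\<psi>\<close> to the power \<open>2 r\<close> is a power of \<open>\<sigma>\<close>, \<open>L\<close> contains \<open>(1 + #I)\<^sup>2\<^sup>r - 1\<close>, hence \<open>p\<close>,
 hence \<open>u(d) - 1\<close> for all \<open>d \<in> D\<close>.  For \<open>j \<in> D\<close> this contains the unit \<open>-2\<close>.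

 If \<open>j \<notin> D\<close>, then \<open>D\<close> is generated by \<open>\<sigma>\<close> and an element \<open>\<delta>\<close>, and \<open>L\<close> consists of the \<open>a\<close> with
 \<open>\<chi>\<^sub>i(a) \<equiv> 0\<close> modulo \<open>p\<close> for all \<open>i\<close> with \<open>\<chi>\<^sub>i(\<delta>) = 1\<close>, where \<open>\<chi>\<^sub>i\<close> sends \<open>\<sigma>\<close> to \<open>1\<close> and \<open>\<tau>\<close> to the \<open>i\<close>-th power of \<open>\<rho>\<close>.
 The \<open>\<chi>\<^sub>i\<close>-component \<open>\<Lambda> e\<^sub>i\<close> is the fibre product of \<open>\<int>\<^sub>p\<close> and \<open>\<int>\<^sub>p[\<zeta>]\<close> over \<open>\<int>/p\<close>; the kernel of its map to \<open>\<int>/p\<close> is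
 \<open>p \<int>\<^sub>p \<oplus> (1 - \<zeta>) \<int>\<^sub>p[\<zeta>]\<close>, and \<open>a \<mapsto> (\<chi>\<^sub>i(a)/p, a w\<^sup>i)\<close> identifies it with the sum of the \<open>i\<close>-th and the \<open>(i+1)\<close>-st
 lattice, \<open>w\<close> being an eigenvector of \<open>\<tau>\<close> that generates the ideal of \<open>1 - \<zeta>\<close>.
\<close>

\<comment> \<open>The tensor products that define A^- are never computed. Only their universal
  properties are used: \<open>LL\<close>, the annihilator of a generator, contains the relations and
  lies in every left ideal that contains them. Each case is then settled by a candidate ideal as
  upper bound and by explicit elements as lower bound. As these are only left ideals, factors must
  be moved to the proper side before a relation applies. The eigenvector w is e_1 (1 - \<zeta>).
  Modulo 1 - \<zeta> each of the r summands of w / (1 - \<zeta>) is \<rho>^{-l} s^l / r = 1/r, so w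
  is a unit times 1 - \<zeta>. Multiplication by w^i absorbs the twist of \<tau> by \<rho>^i and
  shifts the ideal by i; the congruence modulo p gives one more factor 1 - \<zeta>, hence i + 1.
  That p is odd enters chiefly through the fact that 1 is the only root of unity congruent to 1
  modulo p, and through the invertibility of 2. No fraction field and no limit in Z_p[\<zeta>]
  occurs: torsion-freeness and Nakayama's lemma take their place.\<close>
syntax (input) "_index" :: "logic => index"  ("$_" [1000] 1000)

abbreviation (input) in_carrier ("_ \<in>$_" [51, 1000] 50) where "x \<in>$R == x \<in> carrier R"
abbreviation (input) ring_mult ("_ *$_ _" [70, 1000, 71] 70) where "x *$R y == x \<otimes>\<^bsub>R\<^esub> y"
abbreviation (input) ring_add ("_ +$_ _" [65, 1000, 66] 65) where "x +$R y == x \<oplus>\<^bsub>R\<^esub> y"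
abbreviation (input) ring_minus ("_ -$_ _" [65, 1000, 66] 65) where "x -$R y == x \<ominus>\<^bsub>R\<^esub> y"
abbreviation (input) ring_pow ("_ ^$_ _" [76, 1000, 75] 75) where "x ^$R n == x [^]\<^bsub>R\<^esub> n"
abbreviation (input) ring_one ("1$_" [1000] 1000) where "1$R == \<one>\<^bsub>R\<^esub>"
abbreviation (input) ring_zero ("0$_" [1000] 1000) where "0$R == \<zero>\<^bsub>R\<^esub>"

section \<open>Generalities on modules\<close>

lemma mk_mod_simps [simp]:
 "carrier (mk_mod S z pl sm) = S" "ring.zero (mk_mod S z pl sm) = z"
 "ring.add (mk_mod S z pl sm) = pl" "smult (mk_mod S z pl sm) = sm"
 by (simp_all add: mk_mod_def)

lemma left_moduleI:
 assumes "ring R" "abelian_group M"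
  and "!!a x. [|a \<in>$R; x \<in>$M|] ==> a \<odot>$M x \<in>$M"
  and "!!a b x. [|a \<in>$R; b \<in>$R; x \<in>$M|] ==>
   (a +$R b) \<odot>$M x = a \<odot>$M x +$M b \<odot>$M x"
  and "!!a x y. [|a \<in>$R; x \<in>$M; y \<in>$M|] ==>
   a \<odot>$M (x +$M y) = a \<odot>$M x +$M a \<odot>$M y"
  and "!!a b x. [|a \<in>$R; b \<in>$R; x \<in>$M|] ==>
   (a *$R b) \<odot>$M x = a \<odot>$M (b \<odot>$M x)"
  and "!!x. x \<in>$M ==> 1$R \<odot>$M x = x"
 shows "left_module R M"
 using assms by (auto simp: left_module_def left_module_axioms_def)

lemma left_moduleD:
 assumes "left_module R M"
 shows "ring R" "abelian_group M"
 using assms by (auto simp: left_module_def)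

lemma lmod_homI:
 assumes "!!x. x \<in>$M ==> h x \<in>$N"
  and "!!x y. [|x \<in>$M; y \<in>$M|] ==> h (x +$M y) = h x +$N h y"
  and "!!a x. [|a \<in>$R; x \<in>$M|] ==> h (a \<odot>$M x) = a \<odot>$N h x"
 shows "h \<in> lmod_hom R M N"
 using assms by (auto simp: lmod_hom_def)

lemma lmod_homD:
 assumes "h \<in> lmod_hom R M N"
 shows "x \<in>$M ==> h x \<in>$N"
  and "[|x \<in>$M; y \<in>$M|] ==> h (x +$M y) = h x +$N h y"
  and "[|a \<in>$R; x \<in>$M|] ==> h (a \<odot>$M x) = a \<odot>$N h x"
 using assms by (auto simp: lmod_hom_def)

lemma additive_zero:
 assumes "abelian_group M" "abelian_group N"
  and "!!x. x \<in>$M ==> h x \<in>$N"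
  and "!!x y. [|x \<in>$M; y \<in>$M|] ==> h (x +$M y) = h x +$N h y"
 shows "h 0$M = 0$N"
proof -
 interpret M: abelian_group M by fact
 interpret N: abelian_group N by fact
 have "h 0$M +$N h 0$M = h 0$M"
  using assms(4)[of "0$M" "0$M"] by simp
 thus ?thesis using assms(3)[of "0$M"] N.add.l_cancel_one' by simp
qed

lemma additive_neg:
 assumes "abelian_group M" "abelian_group N"
  and "!!x. x \<in>$M ==> h x \<in>$N"
  and "!!x y. [|x \<in>$M; y \<in>$M|] ==> h (x +$M y) = h x +$N h y"
  and "x \<in>$M"
 shows "h (\<ominus>$M x) = \<ominus>$N h x"
proof -
 interpret M: abelian_group M by fact
 interpret N: abelian_group N by fact
 have "h (\<ominus>$M x) +$N h x = h 0$M"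
  using assms(4)[of "\<ominus>$M x" x] assms(5) by (simp add: M.l_neg)
 also have "\<dots> = 0$N" by (rule additive_zero[OF assms(1-4)])
 finally show ?thesis using assms(3,5) by (simp add: N.minus_equality)
qed

lemma additive_finsum:
 assumes "abelian_group M" "abelian_group N"
  and "!!x. x \<in>$M ==> h x \<in>$N"
  and "!!x y. [|x \<in>$M; y \<in>$M|] ==> h (x +$M y) = h x +$N h y"
  and "f \<in> A \<rightarrow> carrier M"
 shows "h (\<Oplus>$M i\<in>A. f i) = (\<Oplus>$N i\<in>A. h (f i))"
proof -
 interpret M: abelian_group M by fact
 interpret N: abelian_group N by fact
 have z: "h 0$M = 0$N" by (rule additive_zero[OF assms(1-4)])
 show ?thesis
 proof (cases "finite A")
  case True
  thus ?thesis using assms(5)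
  proof (induction A rule: finite_induct)
   case (insert a A)
   thus ?case using assms(3,4) by (simp add: Pi_iff)
  qed (simp add: z)
 qed (simp add: z)
qed

lemma lmod_hom_zero:
 assumes "left_module R M" "left_module R N" "h \<in> lmod_hom R M N"
 shows "h 0$M = 0$N"
 by (rule additive_zero) (use assms in "auto dest: left_moduleD lmod_homD")

lemma lmod_hom_neg:
 assumes "left_module R M" "left_module R N" "h \<in> lmod_hom R M N" "x \<in>$M"
 shows "h (\<ominus>$M x) = \<ominus>$N h x"
 by (rule additive_neg) (use assms in "auto dest: left_moduleD lmod_homD")

lemma lmod_hom_minus:
 assumes "left_module R M" "left_module R N" "h \<in> lmod_hom R M N" "x \<in>$M" "y \<in>$M"
 shows "h (x -$M y) = h x -$N h y"
proof -
 interpret M: abelian_group M using assms(1) by (rule left_moduleD)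
 show ?thesis using assms by (simp add: a_minus_def lmod_homD lmod_hom_neg)
qed

lemma lmod_hom_comp:
 assumes "h \<in> lmod_hom R M N" "g \<in> lmod_hom R N P"
 shows "(%x. g (h x)) \<in> lmod_hom R M P"
 using assms by (auto simp: lmod_hom_def Pi_iff)

lemma (in left_module) smult_zero_right:
 assumes "a \<in>$R" shows "a \<odot>$M 0$M = 0$M"
 by (rule additive_zero[of M M "%x. a \<odot>$M x"])
  (use assms smult_closed smult_r_distr in "auto intro: M.abelian_group_axioms")

lemma (in left_module) smult_zero_left:
 assumes "x \<in>$M" shows "\<zero> \<odot>$M x = 0$M"
 by (rule additive_zero[of R M "%a. a \<odot>$M x"])
  (use assms smult_closed smult_l_distr in "auto intro: M.abelian_group_axioms R.abelian_group_axioms")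

lemma (in left_module) smult_neg_right:
 assumes "a \<in>$R" "x \<in>$M" shows "a \<odot>$M (\<ominus>$M x) = \<ominus>$M (a \<odot>$M x)"
 by (rule additive_neg[of M M "%x. a \<odot>$M x"])
  (use assms smult_closed smult_r_distr in "auto intro: M.abelian_group_axioms")

lemma (in left_module) smult_neg_left:
 assumes "a \<in>$R" "x \<in>$M" shows "(\<ominus> a) \<odot>$M x = \<ominus>$M (a \<odot>$M x)"
 by (rule additive_neg[of R M "%a. a \<odot>$M x"])
  (use assms smult_closed smult_l_distr in "auto intro: M.abelian_group_axioms R.abelian_group_axioms")

lemma (in left_module) smult_finsum_right:
 assumes "a \<in>$R" "f \<in> A \<rightarrow> carrier M"
 shows "a \<odot>$M (\<Oplus>$M i\<in>A. f i) = (\<Oplus>$M i\<in>A. a \<odot>$M f i)"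
 by (rule additive_finsum[of M M "%x. a \<odot>$M x"])
  (use assms smult_closed smult_r_distr in "auto intro: M.abelian_group_axioms")

lemma (in left_module) smult_finsum_left:
 assumes "x \<in>$M" "f \<in> A \<rightarrow> carrier R"
 shows "(\<Oplus>i\<in>A. f i) \<odot>$M x = (\<Oplus>$M i\<in>A. f i \<odot>$M x)"
 by (rule additive_finsum[of R M "%a. a \<odot>$M x"])
  (use assms smult_closed smult_l_distr in "auto intro: M.abelian_group_axioms R.abelian_group_axioms")

text \<open>All axioms are transported along a surjection. The zero needs a hypothesis of its own:
  \<open>zero\<close> is a separate record field, and before N is known to be a group, additivity of
  \<open>h\<close> says nothing about it.\<close>

lemma left_module_image:
 assumes M: "left_module R M" and h: "h \<in> lmod_hom R M N"
  and surj: "h ` carrier M = carrier N" and z: "h 0$M = 0$N"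
 shows "left_module R N"
proof -
 interpret M: left_module R M by fact
 note hD = lmod_homD[OF h]
 have ex: "\<exists>x\<in>carrier M. y = h x" if "y \<in>$N" for y using that surj by blast
 have "abelian_group N"
 proof (rule abelian_groupI)
  fix x y assume "x \<in>$N" "y \<in>$N"
  then obtain u v where *: "u \<in>$M" "v \<in>$M" and eq: "x = h u" "y = h v"
   using ex by metis
  show "x +$N y \<in>$N" "x +$N y = y +$N x"
   using * by (simp_all add: eq hD(1) hD(2)[symmetric] M.M.a_comm)
  fix t assume "t \<in>$N"
  then obtain w where **: "w \<in>$M" and eqw: "t = h w" using ex by metis
  show "x +$N y +$N t = x +$N (y +$N t)"
   using * ** by (simp add: eq eqw hD(1) hD(2)[symmetric] M.M.a_assoc)
 next
  show "0$N \<in>$N" using z hD(1)[of "0$M"] by simp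
 next
  fix x assume "x \<in>$N"
  then obtain u where *: "u \<in>$M" "x = h u" using ex by metis
  show "0$N +$N x = x" using * hD(2)[of "0$M" u] z by simp
  show "\<exists>y\<in>carrier N. y +$N x = 0$N"
   using * hD(2)[of "\<ominus>$M u" u] hD(1)[of "\<ominus>$M u"] z by (auto simp: M.M.l_neg)
 qed
 thus ?thesis
 proof (rule left_moduleI[OF M.R.ring_axioms])
  fix a x assume a: "a \<in>$R" and "x \<in>$N"
  then obtain u where u: "u \<in>$M" "x = h u" using ex by metis
  show "a \<odot>$N x \<in>$N" using a u hD(1,3) M.smult_closed by metis
  fix y assume "y \<in>$N"
  then obtain v where v: "v \<in>$M" "y = h v" using ex by metis
  show "a \<odot>$N (x +$N y) = a \<odot>$N x +$N a \<odot>$N y"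
   using a u v by (simp add: hD(2,3)[symmetric] M.smult_closed M.smult_r_distr)
 next
  fix a b x assume ab: "a \<in>$R" "b \<in>$R" and "x \<in>$N"
  then obtain u where u: "u \<in>$M" "x = h u" using ex by metis
  show "(a +$R b) \<odot>$N x = a \<odot>$N x +$N b \<odot>$N x"
   using ab u by (simp add: hD(2,3)[symmetric] M.smult_closed M.smult_l_distr)
  show "(a *$R b) \<odot>$N x = a \<odot>$N (b \<odot>$N x)"
   using ab u by (simp add: hD(2,3)[symmetric] M.smult_closed M.smult_assoc)
 next
  fix x assume "x \<in>$N"
  then obtain u where u: "u \<in>$M" "x = h u" using ex by metis
  show "1$R \<odot>$N x = x" using u by (simp add: hD(3)[symmetric] M.smult_one)
 qed
qed

lemma lmod_isoI:
 assumes "h \<in> lmod_hom R M N" "!!x. x \<in>$M ==> g (h x) = x"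
  "!!y. y \<in>$N ==> g y \<in>$M" "!!y. y \<in>$N ==> h (g y) = y"
 shows "lmod_iso R M N"
 unfolding lmod_iso_def
 by (rule bexI[OF _ assms(1)], rule bij_betw_byWitness[where f' = g])
  (use assms lmod_homD[OF assms(1)] in auto)

lemma lmod_iso_refl: "lmod_iso R M M"
 by (rule lmod_isoI[where h = id and g = id]) (auto simp: lmod_hom_def)

lemma lmod_iso_trans [trans]: "lmod_iso R M N ==> lmod_iso R N P ==> lmod_iso R M P"
 unfolding lmod_iso_def by (metis (no_types, lifting) lmod_hom_comp bij_betw_trans comp_def ext)

lemma lmod_iso_sym:
 assumes M: "left_module R M" and "lmod_iso R M N"
 shows "lmod_iso R N M"
proof -
 interpret M: left_module R M by fact
 obtain h where h: "h \<in> lmod_hom R M N" and b: "bij_betw h (carrier M) (carrier N)"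
  using assms(2) by (auto simp: lmod_iso_def)
 note hD = lmod_homD[OF h]
 let ?g = "inv_into (carrier M) h"
 have g: "?g y \<in>$M" "h (?g y) = y" if "y \<in>$N" for y
  using b that by (auto simp: bij_betw_def inv_into_into f_inv_into_f)
 have gh: "?g (h x) = x" if "x \<in>$M" for x
  using b that by (simp add: bij_betw_def)
 show ?thesis
 proof (rule lmod_isoI[where h = ?g and g = h])
  show "?g \<in> lmod_hom R N M"
  proof (rule lmod_homI)
   fix x y assume xy: "x \<in>$N" "y \<in>$N"
   have "?g (h (?g x +$M ?g y)) = ?g x +$M ?g y" using xy g by (intro gh) simp
   thus "?g (x +$N y) = ?g x +$M ?g y" using xy g by (simp add: hD)
  next
   fix a y assume ay: "a \<in>$R" "y \<in>$N"
   have "?g (h (a \<odot>$M ?g y)) = a \<odot>$M ?g y" using ay g by (intro gh M.smult_closed)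
   thus "?g (a \<odot>$N y) = a \<odot>$M ?g y" using ay g by (simp add: hD)
  qed (use g in auto)
 qed (use g gh hD in auto)
qed

text \<open>The quantifiers in the definitions of projectivity and of projective equivalence range
  over modules with elements in one fixed type. Any module whose carrier injects into that type can
  be replaced by a copy there.\<close>

lemma lmod_iso_transport:
 fixes M :: "('r, 'm) module" and f :: "'m => 'b"
 assumes M: "left_module R M" and f: "inj_on f (carrier M)"
 shows "\<exists>N :: ('r, 'b) module. left_module R N \<and> lmod_iso R M N"
proof -
 let ?g = "inv_into (carrier M) f"
 define N where "N = mk_mod (f ` carrier M) (f 0$M) (%x y. f (?g x +$M ?g y)) (%a x. f (a \<odot>$M ?g x))"
 have h: "f \<in> lmod_hom R M N"
  using f by (intro lmod_homI) (auto simp: N_def)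
 have "left_module R N"
  by (rule left_module_image[OF M h]) (auto simp: N_def)
 moreover have "lmod_iso R M N"
  using h f by (auto simp: lmod_iso_def N_def bij_betw_def)
 ultimately show ?thesis by blast
qed

lemma oplus_mod_simps [simp]:
 "carrier (oplus_mod M N) = carrier M \<times> carrier N"
 "0$(oplus_mod M N) = (0$M, 0$N)"
 "u +$(oplus_mod M N) v = (fst u +$M fst v, snd u +$N snd v)"
 "a \<odot>$(oplus_mod M N) u = (a \<odot>$M fst u, a \<odot>$N snd u)"
 by (simp_all add: oplus_mod_def)

lemma left_module_oplus:
 assumes "left_module R M" "left_module R N"
 shows "left_module R (oplus_mod M N)"
proof -
 interpret M: left_module R M by fact
 interpret N: left_module R N by fact
 have "abelian_group (oplus_mod M N)"
 proof (rule abelian_groupI)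
  fix x assume "x \<in>$(oplus_mod M N)"
  thus "\<exists>y\<in>carrier (oplus_mod M N). y +$(oplus_mod M N) x = 0$(oplus_mod M N)"
   by (intro bexI[of _ "(\<ominus>$M fst x, \<ominus>$N snd x)"]) (auto simp: M.M.l_neg N.M.l_neg)
 qed (auto simp: M.M.a_ac N.M.a_ac)
 thus ?thesis
  by (intro left_moduleI M.R.ring_axioms)
   (auto simp: M.smult_closed N.smult_closed M.smult_l_distr N.smult_l_distr M.smult_r_distr
    N.smult_r_distr M.smult_assoc N.smult_assoc M.smult_one N.smult_one)
qed

lemma dsum_mod_simps [simp]:
 "carrier (dsum_mod I M) = (\<Pi>\<^sub>E i\<in>I. carrier (M i))"
 "0$(dsum_mod I M) = (\<lambda>i\<in>I. 0$(M i))"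
 "u +$(dsum_mod I M) v = (\<lambda>i\<in>I. u i +$(M i) v i)"
 "a \<odot>$(dsum_mod I M) u = (\<lambda>i\<in>I. a \<odot>$(M i) u i)"
 by (simp_all add: dsum_mod_def)

lemma left_module_dsum:
 assumes R: "ring R" and M: "!!i. i \<in> I ==> left_module R (M i)"
 shows "left_module R (dsum_mod I M)"
proof -
 note A = left_moduleD(2)[OF M]
 note AE = abelian_groupE[OF A]
 have neg: "\<ominus>$(M i) x \<in>$(M i)" "\<ominus>$(M i) x +$(M i) x = 0$(M i)"
  if "i \<in> I" "x \<in>$(M i)" for i x
  using that A[OF that(1)] by (auto intro!: abelian_group.l_neg abelian_group.a_inv_closed)
 let ?D = "dsum_mod I M"
 have mem: "x i \<in>$(M i)" if "x \<in>$?D" "i \<in> I" for x i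
  using that by (simp add: PiE_iff)
 have eq: "x = y" if "x \<in>$?D" "y \<in>$?D" "!!i. i \<in> I ==> x i = y i" for x y
  by (rule PiE_ext[OF that(1,2)[unfolded dsum_mod_simps] that(3)])
 have plus: "x +$?D y \<in>$?D" if "x \<in>$?D" "y \<in>$?D" for x y
  using that AE(1) by (simp add: PiE_iff)
 have zero: "0$?D \<in>$?D" using AE(2) by (simp add: PiE_iff)
 have sm: "a \<odot>$?D x \<in>$?D" if "a \<in>$R" "x \<in>$?D" for a x
  using that left_module.smult_closed[OF M] by (simp add: PiE_iff)
 have "abelian_group ?D"
 proof (rule abelian_groupI)
  fix x assume x: "x \<in>$?D"
  show "\<exists>y\<in>carrier ?D. y +$?D x = 0$?D"
  proof (rule bexI)
   show n: "(\<lambda>i\<in>I. \<ominus>$(M i) x i) \<in>$?D" using x neg by (simp add: PiE_iff)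
   show "(\<lambda>i\<in>I. \<ominus>$(M i) x i) +$?D x = 0$?D"
    by (rule eq[OF plus[OF n x] zero]) (use neg mem[OF x] in simp)
  qed
  show "0$?D +$?D x = x"
   by (rule eq[OF plus[OF zero x] x]) (use AE(5) mem[OF x] in simp)
  fix y assume y: "y \<in>$?D"
  show "x +$?D y = y +$?D x"
   by (rule eq[OF plus[OF x y] plus[OF y x]]) (use AE(4) mem[OF x] mem[OF y] in simp)
  fix z assume z: "z \<in>$?D"
  show "x +$?D y +$?D z = x +$?D (y +$?D z)"
   by (rule eq[OF plus[OF plus[OF x y] z] plus[OF x plus[OF y z]]])
    (use AE(3) mem[OF x] mem[OF y] mem[OF z] in simp)
 qed (fact plus zero)+
 thus ?thesis
 proof (rule left_moduleI[OF R])
  fix a b x assume a: "a \<in>$R" and b: "b \<in>$R" and x: "x \<in>$?D"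
  interpret R: ring R by fact
  show "(a +$R b) \<odot>$?D x = a \<odot>$?D x +$?D b \<odot>$?D x"
   by (rule eq[OF sm[OF R.a_closed[OF a b] x] plus[OF sm[OF a x] sm[OF b x]]])
    (use left_module.smult_l_distr[OF M a b] mem[OF x] in simp)
  show "(a *$R b) \<odot>$?D x = a \<odot>$?D (b \<odot>$?D x)"
   by (rule eq[OF sm[OF R.m_closed[OF a b] x] sm[OF a sm[OF b x]]])
    (use left_module.smult_assoc[OF M a b] mem[OF x] in simp)
 next
  fix a x y assume a: "a \<in>$R" and x: "x \<in>$?D" and y: "y \<in>$?D"
  show "a \<odot>$?D (x +$?D y) = a \<odot>$?D x +$?D a \<odot>$?D y"
   by (rule eq[OF sm[OF a plus[OF x y]] plus[OF sm[OF a x] sm[OF a y]]])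
    (use left_module.smult_r_distr[OF M a] mem[OF x] mem[OF y] in simp)
 next
  fix x assume x: "x \<in>$?D"
  interpret R: ring R by fact
  show "1$R \<odot>$?D x = x"
   by (rule eq[OF sm[OF R.one_closed x] x]) (use left_module.smult_one[OF M] mem[OF x] in simp)
 qed (fact sm)
qed

lemma reg_mod_simps [simp]:
 "carrier (reg_mod R) = carrier R" "0$(reg_mod R) = 0$R"
 "x +$(reg_mod R) y = x +$R y" "a \<odot>$(reg_mod R) x = a *$R x"
 by (simp_all add: reg_mod_def)

lemma left_module_reg: assumes "ring R" shows "left_module R (reg_mod R)"
proof -
 interpret ring R by fact
 have "abelian_group (reg_mod R)"
  by (rule abelian_groupI) (auto simp: a_ac intro!: bexI[of _ "\<ominus>$R _"] l_neg)
 thus ?thesis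
  by (intro left_moduleI assms) (auto simp: l_distr r_distr m_assoc)
qed

lemma oplus_iso_cong:
 assumes "lmod_iso R M M'" "lmod_iso R N N'"
 shows "lmod_iso R (oplus_mod M N) (oplus_mod M' N')"
proof -
 obtain f g where f: "f \<in> lmod_hom R M M'" "bij_betw f (carrier M) (carrier M')"
  and g: "g \<in> lmod_hom R N N'" "bij_betw g (carrier N) (carrier N')"
  using assms by (auto simp: lmod_iso_def)
 have "map_prod f g \<in> lmod_hom R (oplus_mod M N) (oplus_mod M' N')"
  by (rule lmod_homI) (auto simp: lmod_homD[OF f(1)] lmod_homD[OF g(1)])
 moreover have "bij_betw (map_prod f g) (carrier M \<times> carrier N) (carrier M' \<times> carrier N')"
  by (rule bij_betw_map_prod[OF f(2) g(2)])
 ultimately show ?thesis by (auto simp: lmod_iso_def)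
qed

lemma oplus_comm: "lmod_iso R (oplus_mod M N) (oplus_mod N M)"
 by (rule lmod_isoI[where h = prod.swap and g = prod.swap]) (auto intro!: lmod_homI)

lemma oplus_assoc: "lmod_iso R (oplus_mod (oplus_mod M N) P) (oplus_mod M (oplus_mod N P))"
 by (rule lmod_isoI[where h = "%((x, y), z). (x, y, z)" and g = "%(x, y, z). ((x, y), z)"])
  (auto intro!: lmod_homI)

lemma oplus_assoc': "lmod_iso R (oplus_mod M (oplus_mod N P)) (oplus_mod (oplus_mod M N) P)"
 by (rule lmod_isoI[where g = "%((x, y), z). (x, y, z)" and h = "%(x, y, z). ((x, y), z)"])
  (auto intro!: lmod_homI)

lemma oplus_trivial:
 assumes "left_module R M" "left_module R N" "carrier N = {0$N}"
 shows "lmod_iso R M (oplus_mod M N)"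
proof -
 interpret M: left_module R M by fact
 interpret N: left_module R N by fact
 show ?thesis
 proof (rule lmod_isoI[where h = "%x. (x, 0$N)" and g = fst])
  show "(%x. (x, 0$N)) \<in> lmod_hom R M (oplus_mod M N)"
   by (rule lmod_homI) (simp_all add: N.smult_zero_right)
 next
  fix y assume "y \<in>$(oplus_mod M N)"
  hence "fst y \<in>$M" "snd y \<in>$N" by auto
  moreover from this(2) have "snd y = 0$N" unfolding assms(3) by simp
  ultimately show "fst y \<in>$M" "(fst y, 0$N) = y" by (simp_all add: prod_eq_iff)
 qed simp
qed

lemma dsum_Suc: "lmod_iso R (dsum_mod {..<Suc n} M) (oplus_mod (dsum_mod {..<n} M) (M n))"
proof (rule lmod_isoI[where h = "%u. (restrict u {..<n}, u n)" and g = "%(v, x). v(n := x)"])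
 show "(%u. (restrict u {..<n}, u n)) \<in> lmod_hom R (dsum_mod {..<Suc n} M) (oplus_mod (dsum_mod {..<n} M) (M n))"
 proof (rule lmod_homI)
  fix x assume "x \<in>$(dsum_mod {..<Suc n} M)"
  thus "(restrict x {..<n}, x n) \<in> carrier (oplus_mod (dsum_mod {..<n} M) (M n))"
   by (simp add: PiE_iff)
 qed (simp_all add: fun_eq_iff restrict_def)
next
 fix x assume "x \<in>$(dsum_mod {..<Suc n} M)"
 thus "(case (restrict x {..<n}, x n) of (v, y) => v(n := y)) = x"
  by (simp add: fun_eq_iff PiE_iff extensional_def restrict_def less_Suc_eq)
next
 fix y assume y: "y \<in> carrier (oplus_mod (dsum_mod {..<n} M) (M n))"
 thus "(case y of (v, x) => v(n := x)) \<in>$(dsum_mod {..<Suc n} M)"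
  by (cases y) (auto simp: PiE_iff extensional_def less_Suc_eq)
 show "(restrict (case y of (v, x) => v(n := x)) {..<n}, (case y of (v, x) => v(n := x)) n) = y"
  using y by (cases y) (simp add: fun_eq_iff PiE_iff extensional_def restrict_def)
qed

abbreviation free_mod :: "('r, 'a) ring_scheme => nat => ('r, nat => 'r) module" where
 "free_mod R n \<equiv> dsum_mod {..<n} (%_. reg_mod R)"

lemma left_module_free: "ring R ==> left_module R (free_mod R n)"
 by (intro left_module_dsum left_module_reg)

lemma free_mod_0: assumes "ring R" shows "carrier (free_mod R 0) = {0$(free_mod R 0)}"
 by auto

lemma free_mod_1: assumes "ring R" shows "lmod_iso R (free_mod R 1) (reg_mod R)"
proof -
 interpret ring R by fact
 show ?thesis
 proof (rule lmod_isoI[where h = "%u. u 0" and g = "%x. \<lambda>i\<in>{..<1}. x"])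
  show "(%u. u 0) \<in> lmod_hom R (free_mod R 1) (reg_mod R)"
   by (rule lmod_homI) (simp_all add: PiE_iff)
 next
  fix x assume "x \<in>$(free_mod R 1)"
  thus "(\<lambda>i\<in>{..<1}. x 0) = x"
   by (simp add: fun_eq_iff PiE_iff extensional_def restrict_def)
 qed simp_all
qed

lemma free_mod_add:
 assumes "ring R"
 shows "lmod_iso R (oplus_mod (free_mod R m) (free_mod R n)) (free_mod R (m + n))"
proof (induction n)
 case 0
 show ?case
  unfolding add_0_right
  by (rule lmod_iso_sym[OF left_module_free[OF assms] oplus_trivial[OF left_module_free[OF assms]
     left_module_free[OF assms] free_mod_0[OF assms]]])
next
 case (Suc n)
 have "lmod_iso R (oplus_mod (free_mod R m) (free_mod R (Suc n)))
   (oplus_mod (free_mod R m) (oplus_mod (free_mod R n) (reg_mod R)))"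
  by (intro oplus_iso_cong lmod_iso_refl dsum_Suc)
 also have "lmod_iso R \<dots> (oplus_mod (oplus_mod (free_mod R m) (free_mod R n)) (reg_mod R))"
  by (rule oplus_assoc')
 also have "lmod_iso R \<dots> (oplus_mod (free_mod R (m + n)) (reg_mod R))"
  by (intro oplus_iso_cong lmod_iso_refl Suc)
 also have "lmod_iso R \<dots> (free_mod R (m + Suc n))"
  unfolding add_Suc_right by (intro lmod_iso_sym[OF left_module_free[OF assms]] dsum_Suc)
 finally show ?case .
qed

section \<open>Finitely generated projective modules\<close>

lemma fg_projectiveD: "fg_projective R P ==> left_module R P"
 by (simp add: fg_projective_def)

lemma fg_projective_iso:
 assumes P: "fg_projective R P" and iso: "lmod_iso R P P'" and P': "left_module R P'"
 shows "fg_projective R P'"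
proof -
 obtain n and Q :: "('a, nat => 'a) module" where Q: "left_module R Q"
  "lmod_iso R (oplus_mod P Q) (free_mod R n)"
  using P by (auto simp: fg_projective_def)
 have "lmod_iso R (oplus_mod P' Q) (free_mod R n)"
  by (rule lmod_iso_trans[OF oplus_iso_cong[OF lmod_iso_sym[OF fg_projectiveD[OF P] iso] lmod_iso_refl] Q(2)])
 thus ?thesis using P' Q(1) by (auto simp: fg_projective_def)
qed

text \<open>The complement may live in any type, provided that its elements can be coded by
  sequences; \<open>c\<close> is the coding.\<close>

lemma fg_projectiveI:
 fixes Q :: "('r, 'n) module" and c :: "'n => nat => 'r"
 assumes P: "left_module R P" and Q: "left_module R Q" and c: "inj_on c (carrier Q)"
  and iso: "lmod_iso R (oplus_mod P Q) (free_mod R n)"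
 shows "fg_projective R P"
proof -
 obtain Q' :: "('r, nat => 'r) module" where Q': "left_module R Q'" "lmod_iso R Q Q'"
  using lmod_iso_transport[OF Q c] by blast
 have "lmod_iso R (oplus_mod P Q') (free_mod R n)"
  by (rule lmod_iso_trans[OF oplus_iso_cong[OF lmod_iso_refl lmod_iso_sym[OF Q Q'(2)]] iso])
 thus ?thesis using P Q'(1) by (auto simp: fg_projective_def)
qed

text \<open>By x \<mapsto> (x, 0) the module is contained in its sum with the complement, that is,
  in R^n, whose elements are sequences already.\<close>

lemma fg_projective_embed:
 fixes R :: "('r, 'a) ring_scheme" and P :: "('r, 'm) module"
 assumes "fg_projective R P"
 obtains c :: "'m => nat => 'r" where "inj_on c (carrier P)"
proof -
 obtain n and Q :: "('r, nat => 'r) module" where Q: "left_module R Q"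
  "lmod_iso R (oplus_mod P Q) (free_mod R n)"
  using assms by (auto simp: fg_projective_def)
 obtain h where h: "bij_betw h (carrier P \<times> carrier Q) (carrier (free_mod R n))"
  using Q(2) by (auto simp: lmod_iso_def)
 interpret Q: left_module R Q by fact
 have "inj_on (%x. h (x, 0$Q)) (carrier P)"
  by (rule inj_onI) (use inj_onD[OF bij_betw_imp_inj_on[OF h]] in fastforce)
 thus thesis by (rule that)
qed

lemma fg_projective_nat:
 fixes R :: "('r, 'a) ring_scheme" and P :: "('r, 'm) module"
 assumes "fg_projective R P"
 obtains P' :: "('r, nat => 'r) module" where "fg_projective R P'" "lmod_iso R P P'"
proof -
 obtain c :: "'m => nat => 'r" where c: "inj_on c (carrier P)" using fg_projective_embed[OF assms] .
 show thesis
  using lmod_iso_transport[OF fg_projectiveD[OF assms] c] fg_projective_iso[OF assms] that by blast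
qed

text \<open>Interleaving codes two sequences by one. It keeps the direct sum of two complements
  within the type of sequences.\<close>

definition merge_seq :: "(nat => 'r) \<times> (nat => 'r) => nat => 'r" where
 "merge_seq u n = (if even n then fst u (n div 2) else snd u (n div 2))"

lemma inj_merge_seq: "inj merge_seq"
proof (rule injI)
 fix u v :: "(nat => 'r) \<times> (nat => 'r)" assume eq: "merge_seq u = merge_seq v"
 have "fst u n = fst v n" "snd u n = snd v n" for n
  using fun_cong[OF eq, of "2 * n"] fun_cong[OF eq, of "Suc (2 * n)"] by (simp_all add: merge_seq_def)
 thus "u = v" by (simp add: prod_eq_iff fun_eq_iff)
qed

lemma fg_projective_oplus:
 fixes R :: "('r, 'a) ring_scheme" and P :: "('r, 'm) module" and P' :: "('r, 'n) module"
 assumes "fg_projective R P" "fg_projective R P'"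
 shows "fg_projective R (oplus_mod P P')"
proof -
 obtain n and Q :: "('r, nat => 'r) module" where Q: "left_module R Q"
  "lmod_iso R (oplus_mod P Q) (free_mod R n)"
  using assms by (auto simp: fg_projective_def)
 obtain n' and Q' :: "('r, nat => 'r) module" where Q': "left_module R Q'"
  "lmod_iso R (oplus_mod P' Q') (free_mod R n')"
  using assms by (auto simp: fg_projective_def)
 have R: "ring R" using Q(1) by (rule left_moduleD)
 have "lmod_iso R (oplus_mod (oplus_mod P P') (oplus_mod Q Q')) (oplus_mod (oplus_mod P Q) (oplus_mod P' Q'))"
  by (rule lmod_isoI[where h = "%((x, y), z, w). ((x, z), y, w)" and g = "%((x, y), z, w). ((x, z), y, w)"])
   (auto intro!: lmod_homI)
 also have "lmod_iso R \<dots> (oplus_mod (free_mod R n) (free_mod R n'))"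
  by (rule oplus_iso_cong[OF Q(2) Q'(2)])
 also have "lmod_iso R \<dots> (free_mod R (n + n'))" by (rule free_mod_add[OF R])
 finally show ?thesis
  by (rule fg_projectiveI[OF left_module_oplus[OF fg_projectiveD[OF assms(1)] fg_projectiveD[OF assms(2)]]
    left_module_oplus[OF Q(1) Q'(1)] inj_on_subset[OF inj_merge_seq subset_UNIV]])
qed

lemma fg_projective_summand:
 fixes R :: "('r, 'a) ring_scheme" and Q :: "('r, 'n) module" and c :: "'n => nat => 'r"
 assumes "fg_projective R (oplus_mod P Q)" "left_module R P" "left_module R Q" "inj_on c (carrier Q)"
 shows "fg_projective R P"
proof -
 obtain n and Q' :: "('r, nat => 'r) module" where Q': "left_module R Q'"
  "lmod_iso R (oplus_mod (oplus_mod P Q) Q') (free_mod R n)"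
  using assms by (auto simp: fg_projective_def)
 have "inj_on (%(x, y). merge_seq (c x, y)) (carrier (oplus_mod Q Q'))"
 proof (rule inj_onI)
  fix u v assume uv: "u \<in>$(oplus_mod Q Q')" "v \<in>$(oplus_mod Q Q')"
   and "(case u of (x, y) => merge_seq (c x, y)) = (case v of (x, y) => merge_seq (c x, y))"
  hence "c (fst u) = c (fst v)" "snd u = snd v"
   using injD[OF inj_merge_seq, of "(c (fst u), snd u)" "(c (fst v), snd v)"] by (auto simp: case_prod_beta)
  thus "u = v" using uv inj_onD[OF assms(4)] by (auto simp: prod_eq_iff mem_Times_iff)
 qed
 thus ?thesis
  using left_module_oplus[OF assms(3) Q'(1)] lmod_iso_trans[OF oplus_assoc' Q'(2)] assms(2)
  by (intro fg_projectiveI[where Q = "oplus_mod Q Q'"])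
qed

lemma fg_projective_reg: assumes "ring R" shows "fg_projective R (reg_mod R)"
proof -
 have "lmod_iso R (reg_mod R) (free_mod R 1)"
  by (rule lmod_iso_sym[OF left_module_free[OF assms] free_mod_1[OF assms]])
 hence "lmod_iso R (oplus_mod (reg_mod R) (free_mod R 0)) (free_mod R (1 + 0))"
  by (intro lmod_iso_trans[OF oplus_iso_cong[OF _ lmod_iso_refl] free_mod_add[OF assms]])
 thus ?thesis
  using left_module_reg[OF assms] left_module_free[OF assms] unfolding fg_projective_def by blast
qed

lemma fg_projective_trivial:
 assumes "left_module R M" "carrier M = {0$M}" shows "fg_projective R M"
proof -
 have R: "ring R" using assms(1) by (rule left_moduleD)
 have "lmod_iso R (oplus_mod M (free_mod R 0)) (oplus_mod (free_mod R 0) M)" by (rule oplus_comm)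
 also have "lmod_iso R \<dots> (free_mod R 0)"
  by (rule lmod_iso_sym[OF left_module_free[OF R] oplus_trivial[OF left_module_free[OF R] assms]])
 finally show ?thesis
  using assms(1) left_module_free[OF R] unfolding fg_projective_def by blast
qed

text \<open>The lifting property of P against one map g, with M and N as parameters so that their
  elements may have any type.\<close>

definition lifts :: "('r, 'a) ring_scheme => ('r, 'x) module => ('r, 'm) module => ('r, 'n) module => ('m => 'n) => bool" where
 "lifts R P M N g \<longleftrightarrow>
   (\<forall>f\<in>lmod_hom R P N. \<exists>h\<in>lmod_hom R P M. \<forall>x\<in>carrier P. g (h x) = f x)"

lemma lifts_reg:
 assumes M: "left_module R M" and N: "left_module R N" and g: "g \<in> lmod_hom R M N" "g ` carrier M = carrier N"
 shows "lifts R (reg_mod R) M N g"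
 unfolding lifts_def
proof
 interpret M: left_module R M by fact
 fix f assume f: "f \<in> lmod_hom R (reg_mod R) N"
 have "f 1$R \<in>$N" using lmod_homD(1)[OF f] by simp
 then obtain y where y: "y \<in>$M" "g y = f 1$R" using g(2) by (metis imageE)
 have "(%a. a \<odot>$M y) \<in> lmod_hom R (reg_mod R) M"
  using y by (intro lmod_homI) (auto simp: M.smult_closed M.smult_l_distr M.smult_assoc)
 moreover have "g (x \<odot>$M y) = f x" if "x \<in>$R" for x
  using lmod_homD(3)[OF f, of x "1$R"] that y by (simp add: lmod_homD[OF g(1)])
 ultimately show "\<exists>h\<in>lmod_hom R (reg_mod R) M. \<forall>x\<in>carrier (reg_mod R). g (h x) = f x"
  by (intro bexI[of _ "%a. a \<odot>$M y"]) simp_all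
qed

lemma lifts_iso:
 assumes "lmod_iso R P P'" "left_module R P" "lifts R P M N g"
 shows "lifts R P' M N g"
 unfolding lifts_def
proof
 fix f assume f: "f \<in> lmod_hom R P' N"
 obtain k where k: "k \<in> lmod_hom R P P'" "bij_betw k (carrier P) (carrier P')"
  using assms(1) by (auto simp: lmod_iso_def)
 obtain l where l: "l \<in> lmod_hom R P' P" "bij_betw l (carrier P') (carrier P)"
  using lmod_iso_sym[OF assms(2,1)] by (auto simp: lmod_iso_def)
 define k' where "k' = inv_into (carrier P) k"
 have k': "k' y \<in>$P" "k (k' y) = y" if "y \<in>$P'" for y
  using k(2) that by (auto simp: k'_def bij_betw_def inv_into_into f_inv_into_f)
 have k'h: "k' \<in> lmod_hom R P' P"
 proof (rule lmod_homI)
  interpret P: left_module R P by fact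
  have inj: "x = y" if "x \<in>$P" "y \<in>$P" "k x = k y" for x y
   using that k(2) by (auto simp: bij_betw_def inj_on_def)
  note kD = lmod_homD[OF k(1)]
  have cl: "x +$P' y \<in>$P'" if "x \<in>$P'" "y \<in>$P'" for x y
   using kD(1)[of "k' x +$P k' y"] kD(2)[of "k' x" "k' y"] that k' by simp
  have cl': "a \<odot>$P' y \<in>$P'" if "a \<in>$R" "y \<in>$P'" for a y
   using kD(1)[of "a \<odot>$P k' y"] kD(3)[of a "k' y"] that k' by (simp add: P.smult_closed)
  fix x y assume "x \<in>$P'" "y \<in>$P'"
  thus "k' (x +$P' y) = k' x +$P k' y" using k' cl by (intro inj) (simp_all add: kD)
 next
  interpret P: left_module R P by fact
  have inj: "x = y" if "x \<in>$P" "y \<in>$P" "k x = k y" for x y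
   using that k(2) by (auto simp: bij_betw_def inj_on_def)
  note kD = lmod_homD[OF k(1)]
  have cl': "a \<odot>$P' y \<in>$P'" if "a \<in>$R" "y \<in>$P'" for a y
   using kD(1)[of "a \<odot>$P k' y"] kD(3)[of a "k' y"] that k' by (simp add: P.smult_closed)
  fix a y assume "a \<in>$R" "y \<in>$P'"
  thus "k' (a \<odot>$P' y) = a \<odot>$P k' y" using k' cl' by (intro inj) (simp_all add: kD P.smult_closed)
 qed (use k' in auto)
 obtain h where h: "h \<in> lmod_hom R P M" "\<forall>x\<in>carrier P. g (h x) = f (k x)"
  using assms(3) lmod_hom_comp[OF k(1) f] by (auto simp: lifts_def)
 show "\<exists>h\<in>lmod_hom R P' M. \<forall>x\<in>carrier P'. g (h x) = f x"
  by (rule bexI[OF _ lmod_hom_comp[OF k'h h(1)]]) (use h(2) k' in auto)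
qed

lemma lifts_oplus:
 assumes M: "left_module R M" and N: "left_module R N" and P: "left_module R P" and Q: "left_module R Q"
  and g: "g \<in> lmod_hom R M N" and lP: "lifts R P M N g" and lQ: "lifts R Q M N g"
 shows "lifts R (oplus_mod P Q) M N g"
 unfolding lifts_def
proof
 interpret P: left_module R P by fact
 interpret Q: left_module R Q by fact
 interpret M: left_module R M by fact
 fix f assume f: "f \<in> lmod_hom R (oplus_mod P Q) N"
 note fD = lmod_homD[OF f, simplified]
 have "(%x. f (x, 0$Q)) \<in> lmod_hom R P N"
  using fD(2)[of "(_, 0$Q)" "(_, 0$Q)"] fD(3)[of _ "(_, 0$Q)"] fD(1)[of "(_, 0$Q)"]
  by (intro lmod_homI) (auto simp: Q.smult_zero_right)
 then obtain h where h: "h \<in> lmod_hom R P M" "\<forall>x\<in>carrier P. g (h x) = f (x, 0$Q)"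
  using lP by (auto simp: lifts_def)
 have "(%x. f (0$P, x)) \<in> lmod_hom R Q N"
  using fD(2)[of "(0$P, _)" "(0$P, _)"] fD(3)[of _ "(0$P, _)"] fD(1)[of "(0$P, _)"]
  by (intro lmod_homI) (auto simp: P.smult_zero_right)
 then obtain k where k: "k \<in> lmod_hom R Q M" "\<forall>x\<in>carrier Q. g (k x) = f (0$P, x)"
  using lQ by (auto simp: lifts_def)
 note hD = lmod_homD[OF h(1)] and kD = lmod_homD[OF k(1)] and gD = lmod_homD[OF g]
 have "(%u. h (fst u) +$M k (snd u)) \<in> lmod_hom R (oplus_mod P Q) M"
  by (rule lmod_homI) (auto simp: hD kD M.M.a_ac M.smult_r_distr)
 moreover have "g (h x +$M k y) = f (x, y)" if "x \<in>$P" "y \<in>$Q" for x y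
  using that fD(2)[of "(x, 0$Q)" "(0$P, y)"] h(2) k(2) by (simp add: gD hD kD)
 ultimately show "\<exists>h\<in>lmod_hom R (oplus_mod P Q) M. \<forall>x\<in>carrier (oplus_mod P Q). g (h x) = f x"
  by (intro bexI[of _ "%u. h (fst u) +$M k (snd u)"]) auto
qed

lemma lifts_summand:
 assumes P: "left_module R P" and Q: "left_module R Q" and N: "left_module R N" and l: "lifts R (oplus_mod P Q) M N g"
 shows "lifts R P M N g"
 unfolding lifts_def
proof
 interpret Q: left_module R Q by fact
 fix f assume f: "f \<in> lmod_hom R P N"
 have "(%u. f (fst u)) \<in> lmod_hom R (oplus_mod P Q) N"
  by (rule lmod_homI) (auto simp: lmod_homD[OF f])
 then obtain h where h: "h \<in> lmod_hom R (oplus_mod P Q) M" "\<forall>u\<in>carrier (oplus_mod P Q). g (h u) = f (fst u)"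
  using l by (auto simp: lifts_def)
 note hD = lmod_homD[OF h(1), simplified]
 have "(%x. h (x, 0$Q)) \<in> lmod_hom R P M"
  using hD(2)[of "(_, 0$Q)" "(_, 0$Q)"] hD(3)[of _ "(_, 0$Q)"] hD(1)[of "(_, 0$Q)"]
  by (intro lmod_homI) (auto simp: Q.smult_zero_right)
 thus "\<exists>h\<in>lmod_hom R P M. \<forall>x\<in>carrier P. g (h x) = f x"
  using h(2) by (intro bexI[of _ "%x. h (x, 0$Q)"]) auto
qed

text \<open>R itself has the property (lift the image of 1). It passes to finite sums, hence to R^n,
  and descends to summands.\<close>

lemma fg_projective_lifts:
 assumes P: "fg_projective R P" and M: "left_module R M" and N: "left_module R N"
  and g: "g \<in> lmod_hom R M N" "g ` carrier M = carrier N"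
 shows "lifts R P M N g"
proof -
 obtain n and Q :: "('a, nat => 'a) module" where Q: "left_module R Q"
  "lmod_iso R (oplus_mod P Q) (free_mod R n)"
  using P by (auto simp: fg_projective_def)
 have R: "ring R" using Q(1) by (rule left_moduleD)
 note F = left_module_free[OF R]
 have "lifts R (free_mod R n) M N g" for n
 proof (induction n)
  case 0
  interpret M: left_module R M by fact
  interpret N: left_module R N by fact
  show ?case unfolding lifts_def
  proof
   fix f assume f: "f \<in> lmod_hom R (free_mod R 0) N"
   have "(%_. 0$M) \<in> lmod_hom R (free_mod R 0) M"
    by (rule lmod_homI) (auto simp: M.smult_zero_right)
   thus "\<exists>h\<in>lmod_hom R (free_mod R 0) M. \<forall>x\<in>carrier (free_mod R 0). g (h x) = f x"
    using lmod_hom_zero[OF F N f] lmod_hom_zero[OF M N g(1)] free_mod_0[OF R]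
    by (intro bexI[of _ "%_. 0$M"]) (auto simp del: dsum_mod_simps)
  qed
 next
  case (Suc n)
  have "lifts R (oplus_mod (free_mod R n) (reg_mod R)) M N g"
   by (rule lifts_oplus[OF M N F left_module_reg[OF R] g(1) Suc lifts_reg[OF M N g]])
  thus ?case
   by (rule lifts_iso[OF lmod_iso_sym[OF F dsum_Suc] left_module_oplus[OF F left_module_reg[OF R]]])
 qed
 hence "lifts R (oplus_mod P Q) M N g"
  by (intro lifts_iso[OF lmod_iso_sym[OF left_module_oplus[OF fg_projectiveD[OF P] Q(1)] Q(2)] F])
 thus ?thesis by (rule lifts_summand[OF fg_projectiveD[OF P] Q(1) N])
qed

section \<open>Projective equivalence\<close>

text \<open>Replaces the two auxiliary projectives by copies in the type over which the definition
  quantifies.\<close>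

lemma proj_equivI:
 fixes R :: "('r, 'a) ring_scheme"
  and L :: "('r, 'm) module" and L' :: "('r, 'n) module"
  and F :: "('r, 'f) module" and F' :: "('r, 'g) module"
 assumes "left_module R L" "left_module R L'" and F: "fg_projective R F" and F': "fg_projective R F'"
  and iso: "lmod_iso R (oplus_mod L F') (oplus_mod L' F)"
 shows "proj_equiv R L L'"
proof -
 obtain F1 :: "('r, nat => 'r) module" where F1: "fg_projective R F1" "lmod_iso R F F1"
  using fg_projective_nat[OF F] .
 obtain F2 :: "('r, nat => 'r) module" where F2: "fg_projective R F2" "lmod_iso R F' F2"
  using fg_projective_nat[OF F'] .
 have "lmod_iso R (oplus_mod L F2) (oplus_mod L F')"
  by (intro oplus_iso_cong lmod_iso_refl lmod_iso_sym[OF fg_projectiveD[OF F'] F2(2)])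
 also note iso
 also have "lmod_iso R (oplus_mod L' F) (oplus_mod L' F1)"
  by (intro oplus_iso_cong lmod_iso_refl F1)
 finally show ?thesis using F1(1) F2(1) unfolding proj_equiv_def by blast
qed

lemma proj_equiv_sym:
 assumes "left_module R L" "proj_equiv R L L'"
 shows "proj_equiv R L' L"
proof -
 obtain F F' :: "('a, nat => 'a) module" where F: "fg_projective R F" "fg_projective R F'"
  "lmod_iso R (oplus_mod L F') (oplus_mod L' F)"
  using assms(2) by (auto simp: proj_equiv_def)
 have "lmod_iso R (oplus_mod L' F) (oplus_mod L F')"
  by (rule lmod_iso_sym[OF left_module_oplus[OF assms(1) fg_projectiveD[OF F(2)]] F(3)])
 thus ?thesis using F(1,2) unfolding proj_equiv_def by blast
qed

lemma proj_equiv_trans: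
 assumes "left_module R L" "left_module R L''" "proj_equiv R L L'" "proj_equiv R L' L''"
 shows "proj_equiv R L L''"
proof -
 obtain F F' :: "('a, nat => 'a) module" where F: "fg_projective R F" "fg_projective R F'"
  "lmod_iso R (oplus_mod L F') (oplus_mod L' F)"
  using assms(3) by (auto simp: proj_equiv_def)
 obtain E E' :: "('a, nat => 'a) module" where E: "fg_projective R E" "fg_projective R E'"
  "lmod_iso R (oplus_mod L' E') (oplus_mod L'' E)"
  using assms(4) by (auto simp: proj_equiv_def)
 have "lmod_iso R (oplus_mod L (oplus_mod F' E')) (oplus_mod (oplus_mod L F') E')" by (rule oplus_assoc')
 also have "lmod_iso R \<dots> (oplus_mod (oplus_mod L' F) E')"
  by (intro oplus_iso_cong lmod_iso_refl F)
 also have "lmod_iso R \<dots> (oplus_mod L' (oplus_mod F E'))" by (rule oplus_assoc)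
 also have "lmod_iso R \<dots> (oplus_mod L' (oplus_mod E' F))"
  by (intro oplus_iso_cong lmod_iso_refl oplus_comm)
 also have "lmod_iso R \<dots> (oplus_mod (oplus_mod L' E') F)" by (rule oplus_assoc')
 also have "lmod_iso R \<dots> (oplus_mod (oplus_mod L'' E) F)"
  by (intro oplus_iso_cong lmod_iso_refl E)
 also have "lmod_iso R \<dots> (oplus_mod L'' (oplus_mod E F))" by (rule oplus_assoc)
 finally show ?thesis
  by (rule proj_equivI[OF assms(1,2) fg_projective_oplus[OF E(1) F(1)] fg_projective_oplus[OF F(2) E(2)]])
qed

lemma proj_class_cong:
 assumes "left_module R M" "left_module R M'" "proj_equiv R M M'"
 shows "proj_class R M = proj_class R M'"
proof -
 have "proj_equiv R L M \<longleftrightarrow> proj_equiv R L M'" if "left_module R L" for L :: "('a, nat => 'a) module"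
  using proj_equiv_trans[OF that assms(2) _ assms(3)]
   proj_equiv_trans[OF that assms(1) _ proj_equiv_sym[OF assms(1,3)]] by blast
 thus ?thesis unfolding proj_class_def by blast
qed

text \<open>A module that becomes projective after adding a projective is a summand of a projective.
  Conversely, for projective L and M the isomorphism of L + M with M + L is an equivalence of the
  required shape.\<close>

lemma proj_class_projective:
 assumes "fg_projective R M"
 shows "proj_class R M = fg_projective_class R"
proof (intro Set.set_eqI iffI)
 note M = fg_projectiveD[OF assms]
 have R: "ring R" using M by (rule left_moduleD)
 fix L :: "('a, nat => 'a) module"
 {
  assume "L \<in> proj_class R M"
  then obtain F F' :: "('a, nat => 'a) module" where L: "left_module R L"
   and F: "fg_projective R F" "fg_projective R F'" "lmod_iso R (oplus_mod L F') (oplus_mod M F)"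
   by (auto simp: proj_class_def proj_equiv_def)
  note LF = left_module_oplus[OF L fg_projectiveD[OF F(2)]]
  have "fg_projective R (oplus_mod L F')"
   by (rule fg_projective_iso[OF fg_projective_oplus[OF assms F(1)] lmod_iso_sym[OF LF F(3)] LF])
  hence "fg_projective R L"
   by (rule fg_projective_summand[OF _ L fg_projectiveD[OF F(2)] inj_on_id])
  thus "L \<in> fg_projective_class R" by (simp add: fg_projective_class_def)
 next
  assume "L \<in> fg_projective_class R"
  hence L: "fg_projective R L" by (simp add: fg_projective_class_def)
  show "L \<in> proj_class R M"
   unfolding proj_class_def
   using fg_projectiveD[OF L] proj_equivI[OF fg_projectiveD[OF L] M L assms oplus_comm] by blast
 }
qed

lemma left_module_ker:
 assumes M: "left_module R M" and N: "left_module R N" and f: "f \<in> lmod_hom R M N"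
 shows "left_module R (ker_mod M N f)"
proof -
 interpret M: left_module R M by fact
 interpret N: left_module R N by fact
 have sel: "carrier (ker_mod M N f) = {x \<in> carrier M. f x = 0$N}" "0$(ker_mod M N f) = 0$M"
  "ring.add (ker_mod M N f) = ring.add M" "smult (ker_mod M N f) = smult M"
  by (simp_all add: ker_mod_def)
 note fD = lmod_homD[OF f]
 have "abelian_group (ker_mod M N f)"
 proof (rule abelian_groupI, unfold sel)
  fix x assume "x \<in> {x \<in> carrier M. f x = 0$N}"
  thus "\<exists>y\<in>{x \<in> carrier M. f x = 0$N}. y +$M x = 0$M"
   by (intro bexI[of _ "\<ominus>$M x"]) (auto simp: M.M.l_neg lmod_hom_neg[OF M N f])
 qed (auto simp: fD lmod_hom_zero[OF M N f] M.M.a_ac)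
 thus ?thesis
  by (rule left_moduleI[OF M.R.ring_axioms], unfold sel)
   (auto simp: fD M.smult_closed M.smult_l_distr M.smult_r_distr M.smult_assoc M.smult_one N.smult_zero_right)
qed

text \<open>Schanuel's lemma\<close>

lemma ker_proj_equiv:
 assumes N: "left_module R N"
  and F: "fg_projective R F" and f: "f \<in> lmod_hom R F N" "f ` carrier F = carrier N"
  and E: "fg_projective R E" and g: "g \<in> lmod_hom R E N" "g ` carrier E = carrier N"
 shows "proj_equiv R (ker_mod F N f) (ker_mod E N g)"
proof -
 note F' = fg_projectiveD[OF F] and E' = fg_projectiveD[OF E]
 interpret F: left_module R F by fact
 interpret E: left_module R E by fact
 interpret N: left_module R N by fact
 obtain h where h: "h \<in> lmod_hom R F E" "\<forall>x\<in>carrier F. g (h x) = f x"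
  using fg_projective_lifts[OF F E' N g] f(1) by (auto simp: lifts_def)
 obtain k where k: "k \<in> lmod_hom R E F" "\<forall>y\<in>carrier E. f (k y) = g y"
  using fg_projective_lifts[OF E F' N f] g(1) by (auto simp: lifts_def)
 note fD = lmod_homD[OF f(1)] and gD = lmod_homD[OF g(1)] and hD = lmod_homD[OF h(1)] and kD = lmod_homD[OF k(1)]
 note minus = lmod_hom_minus[OF F' N f(1)] lmod_hom_minus[OF E' N g(1)]
  lmod_hom_minus[OF F' E' h(1)] lmod_hom_minus[OF E' F' k(1)]
 let ?K = "ker_mod F N f" and ?L = "ker_mod E N g"
 have sel: "carrier ?K = {x \<in> carrier F. f x = 0$N}" "ring.add ?K = ring.add F" "smult ?K = smult F"
  "carrier ?L = {x \<in> carrier E. g x = 0$N}" "ring.add ?L = ring.add E" "smult ?L = smult E"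
  by (simp_all add: ker_mod_def)
 \<comment> \<open>With x = a + k y the first entry y - h x is killed by g, since g (h x) = f x = f
   (k y) = g y. \<open>Q\<close> recovers y as b + h x and then a as x - k y. This is the
   isomorphism of both sums with the fibre product over N, which therefore need not be
   built.\<close>
 define P where "P = (%(a, y). (y -$E h (a +$F k y), a +$F k y))"
 define Q where "Q = (%(b, x). (x -$F k (b +$E h x), b +$E h x))"
 have cF: "x -$F y +$F y = x" if "x \<in>$F" "y \<in>$F" for x y
  using that by (simp add: a_minus_def F.M.a_assoc F.M.l_neg)
 have cE: "x -$E y +$E y = x" if "x \<in>$E" "y \<in>$E" for x y
  using that by (simp add: a_minus_def E.M.a_assoc E.M.l_neg)
 have cF': "x +$F y -$F y = x" if "x \<in>$F" "y \<in>$F" for x y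
  using that by (simp add: a_minus_def F.M.a_assoc F.M.r_neg)
 have cE': "x +$E y -$E y = x" if "x \<in>$E" "y \<in>$E" for x y
  using that by (simp add: a_minus_def E.M.a_assoc E.M.r_neg)
 have "lmod_iso R (oplus_mod ?K E) (oplus_mod ?L F)"
 proof (rule lmod_isoI[where h = P and g = Q])
  show "P \<in> lmod_hom R (oplus_mod ?K E) (oplus_mod ?L F)"
  proof (rule lmod_homI)
   fix u assume "u \<in>$(oplus_mod ?K E)"
   thus "P u \<in>$(oplus_mod ?L F)"
    using h(2) k(2) by (auto simp: P_def sel fD gD hD kD minus N.M.r_neg a_minus_def[of N])
  next
   fix u v assume "u \<in>$(oplus_mod ?K E)" "v \<in>$(oplus_mod ?K E)"
   thus "P (u +$(oplus_mod ?K E) v) = P u +$(oplus_mod ?L F) P v"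
    by (auto simp: P_def sel hD kD a_minus_def F.M.a_ac E.M.a_ac E.M.minus_add)
  next
   fix a u assume "a \<in>$R" "u \<in>$(oplus_mod ?K E)"
   thus "P (a \<odot>$(oplus_mod ?K E) u) = a \<odot>$(oplus_mod ?L F) P u"
    by (auto simp: P_def sel hD kD a_minus_def F.smult_closed E.smult_closed
     F.smult_r_distr E.smult_r_distr E.smult_neg_right)
  qed
  fix u assume "u \<in>$(oplus_mod ?K E)"
  thus "Q (P u) = u" by (auto simp: P_def Q_def sel hD kD cE cF')
 next
  fix u assume u: "u \<in>$(oplus_mod ?L F)"
  thus "Q u \<in>$(oplus_mod ?K E)"
   using h(2) k(2) by (auto simp: Q_def sel fD gD hD kD minus N.M.r_neg a_minus_def[of N])
  show "P (Q u) = u" using u by (auto simp: P_def Q_def sel hD kD cF cE')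
 qed
 thus ?thesis
  by (rule proj_equivI[OF left_module_ker[OF F' N f(1)] left_module_ker[OF E' N g(1)] F E])
qed

text \<open>\<open>Phi\<close> refers to projectives whose elements are sequences, so the given E is
  first replaced by such a copy. Schanuel's lemma then compares all kernels.\<close>

lemma Phi_eq:
 fixes R :: "('r, 'a) ring_scheme" and E :: "('r, 'e) module"
 assumes N: "left_module R N" and E: "fg_projective R E"
  and g: "g \<in> lmod_hom R E N" "g ` carrier E = carrier N"
 shows "Phi R N = proj_class R (ker_mod E N g)"
proof (intro Set.set_eqI iffI)
 note K = left_module_ker[OF fg_projectiveD[OF E] N g(1)]
 fix L :: "('r, nat => 'r) module"
 {
  assume "L \<in> Phi R N"
  then obtain F :: "('r, nat => 'r) module" and f where L: "left_module R L"
   and F: "fg_projective R F" "f \<in> lmod_hom R F N" "f ` carrier F = carrier N"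
   and pe: "proj_equiv R L (ker_mod F N f)"
   by (auto simp: Phi_def)
  show "L \<in> proj_class R (ker_mod E N g)"
   using L proj_equiv_trans[OF L K pe ker_proj_equiv[OF N F E g]] by (simp add: proj_class_def)
 next
  assume "L \<in> proj_class R (ker_mod E N g)"
  hence L: "left_module R L" "proj_equiv R L (ker_mod E N g)" by (auto simp: proj_class_def)
  obtain F :: "('r, nat => 'r) module" where F: "fg_projective R F" "lmod_iso R E F"
   using fg_projective_nat[OF E] .
  obtain h where h: "h \<in> lmod_hom R F E" "bij_betw h (carrier F) (carrier E)"
   using lmod_iso_sym[OF fg_projectiveD[OF E] F(2)] by (auto simp: lmod_iso_def)
  let ?f = "%x. g (h x)"
  have f: "?f \<in> lmod_hom R F N" "?f ` carrier F = carrier N"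
   using lmod_hom_comp[OF h(1) g(1)] h(2) g(2) by (auto simp: bij_betw_def image_image[symmetric])
  show "L \<in> Phi R N"
   unfolding Phi_def
   using L(1) F(1) f proj_equiv_trans[OF L(1) left_module_ker[OF fg_projectiveD[OF F(1)] N f(1)] L(2)
     ker_proj_equiv[OF N E g F(1) f]] by blast
 }
qed

section \<open>Submodules, quotients and restriction of scalars\<close>

text \<open>Closure under negation follows, as - x = (- 1) x; see \<open>submod_neg\<close>.\<close>

definition submod :: "('r, 'a) ring_scheme => ('r, 'm, 'c) module_scheme => 'm set => bool" where
 "submod R M N \<longleftrightarrow> N \<subseteq> carrier M \<and> 0$M \<in> N \<and> (\<forall>x\<in>N. \<forall>y\<in>N. x +$M y \<in> N) \<and>
   (\<forall>a\<in>carrier R. \<forall>x\<in>N. a \<odot>$M x \<in> N)"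

lemma submodD:
 assumes "submod R M N"
 shows "N \<subseteq> carrier M" "x \<in> N ==> x \<in>$M" "0$M \<in> N"
  "[|x \<in> N; y \<in> N|] ==> x +$M y \<in> N" "[|a \<in>$R; x \<in> N|] ==> a \<odot>$M x \<in> N"
 using assms by (auto simp: submod_def)

lemma submodI:
 assumes "N \<subseteq> carrier M" "0$M \<in> N" "!!x y. [|x \<in> N; y \<in> N|] ==> x +$M y \<in> N"
  "!!a x. [|a \<in>$R; x \<in> N|] ==> a \<odot>$M x \<in> N"
 shows "submod R M N"
 using assms by (auto simp: submod_def)

lemma (in abelian_group) neg_zero: "\<ominus> \<zero> = \<zero>"
 by (rule minus_equality) simp_all

context left_module
begin

lemma smult_minus_one: "x \<in>$M ==> (\<ominus> \<one>) \<odot>$M x = \<ominus>$M x"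
 by (simp add: smult_neg_left smult_one)

lemma submod_neg: "submod R M N ==> x \<in> N ==> \<ominus>$M x \<in> N"
 using submodD(2)[of R M N x] submodD(5)[of R M N "\<ominus> \<one>" x] smult_minus_one[of x] by simp

lemma submod_finsum:
 assumes "submod R M N" "f \<in> A \<rightarrow> N" shows "(\<Oplus>$M i\<in>A. f i) \<in> N"
proof (cases "finite A")
 case True
 thus ?thesis using assms(2)
 proof (induction A rule: finite_induct)
  case (insert a A)
  hence "f a \<in>$M" "f \<in> A \<rightarrow> carrier M" using submodD(2)[OF assms(1)] by auto
  with insert show ?case by (simp add: submodD[OF assms(1)])
 qed (simp add: submodD[OF assms(1)])
qed (simp add: submodD[OF assms(1)])

lemma submod_abelian_subgroup:
 assumes "submod R M N" shows "abelian_subgroup N M"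
proof (intro abelian_subgroupI3 additive_subgroupI M.abelian_group_axioms)
 show "subgroup N (add_monoid M)"
  by (rule M.add.subgroupI)
   (use submodD[OF assms] submod_neg[OF assms] in "auto simp: a_inv_def[symmetric]")
qed

lemma left_module_submod:
 assumes "submod R M N" shows "left_module R (M\<lparr>carrier := N\<rparr>)"
proof -
 note s = submodD[OF assms]
 have "abelian_group (M\<lparr>carrier := N\<rparr>)"
 proof (rule abelian_groupI)
  fix x assume "x \<in>$(M\<lparr>carrier := N\<rparr>)"
  thus "\<exists>y\<in>carrier (M\<lparr>carrier := N\<rparr>). y +$(M\<lparr>carrier := N\<rparr>) x = 0$(M\<lparr>carrier := N\<rparr>)"
   using submod_neg[OF assms] s(2) by (auto simp: M.l_neg intro!: bexI[of _ "\<ominus>$M x"])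
 qed (use s in "auto simp: M.a_ac")
 thus ?thesis
  by (intro left_moduleI R.ring_axioms)
   (use s in "auto simp: smult_l_distr smult_r_distr smult_assoc smult_one")
qed

end

definition proj_mod :: "('r, 'm, 'c) module_scheme => 'm set => 'm => 'm set" where
 "proj_mod M N x = N +>$M x"

locale left_mod = left_module R M
 for R :: "('r, 'a) ring_scheme" (structure) and M :: "('r, 'm) module" (structure)

lemma quot_mod_sel:
 "carrier (quot_mod M N) = a_rcosets\<^bsub>M\<^esub> N" "0$(quot_mod M N) = N"
 "C +$(quot_mod M N) C' = C <+>$M C'" "a \<odot>$(quot_mod M N) C = (\<Union>x\<in>C. N +>$M (a \<odot>$M x))"
 by (simp_all add: quot_mod_def)

lemma (in left_module) proj_mod_eq_iff:
 assumes "submod R M N" "x \<in>$M" "y \<in>$M"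
 shows "proj_mod M N x = proj_mod M N y \<longleftrightarrow> x -$M y \<in> N"
proof -
 interpret N: abelian_subgroup N M by (rule submod_abelian_subgroup[OF assms(1)])
 have "x \<in> N +>$M y \<longleftrightarrow> x -$M y \<in> N"
  using N.a_rcos_module[OF assms(3,2)] by (simp add: a_minus_def)
 moreover have "x \<in> N +>$M y \<longleftrightarrow> N +>$M x = N +>$M y"
  using N.a_rcos_self[OF assms(2)] M.a_repr_independence[OF _ assms(3) N.a_subgroup] by blast
 ultimately show ?thesis by (simp add: proj_mod_def)
qed

lemma (in left_mod) quot_mod:
 assumes "submod R M N"
 shows "proj_mod M N \<in> lmod_hom R M (quot_mod M N)"
  and "proj_mod M N ` carrier M = carrier (quot_mod M N)"
  and "proj_mod M N 0$M = 0$(quot_mod M N)"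
  and "left_module R (quot_mod M N)"
proof -
 interpret N: abelian_subgroup N M by (rule submod_abelian_subgroup[OF assms])
 note s = submodD[OF assms]
 show h: "proj_mod M N \<in> lmod_hom R M (quot_mod M N)"
 proof (rule lmod_homI)
  fix x assume "x \<in>$M"
  thus "proj_mod M N x \<in>$(quot_mod M N)"
   using s by (auto simp: quot_mod_sel proj_mod_def intro!: M.a_rcosetsI)
 next
  fix x y assume "x \<in>$M" "y \<in>$M"
  thus "proj_mod M N (x +$M y) = proj_mod M N x +$(quot_mod M N) proj_mod M N y"
   by (simp add: quot_mod_sel proj_mod_def N.a_rcos_sum)
 next
  fix a x assume a: "a \<in>$R" and x: "x \<in>$M"
  have "proj_mod M N (a \<odot>$M y) = proj_mod M N (a \<odot>$M x)" if "y \<in> N +>$M x" for y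
  proof -
   have y: "y \<in>$M" using that M.a_r_coset_subset_G[OF s(1) x] by blast
   have "y -$M x \<in> N" using that N.a_rcos_module[OF x y] by (simp add: a_minus_def)
   hence "a \<odot>$M (y -$M x) \<in> N" using s(5)[OF a] by blast
   thus ?thesis
    using a x y by (simp add: proj_mod_eq_iff[OF assms] smult_closed a_minus_def smult_r_distr smult_neg_right)
  qed
  hence "(\<Union>y\<in>N +>$M x. N +>$M (a \<odot>$M y)) = (\<Union>y\<in>N +>$M x. proj_mod M N (a \<odot>$M x))"
   unfolding proj_mod_def by (rule SUP_cong[OF refl])
  also have "\<dots> = proj_mod M N (a \<odot>$M x)" using N.a_rcos_self[OF x] by blast
  finally show "proj_mod M N (a \<odot>$M x) = a \<odot>$(quot_mod M N) proj_mod M N x"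
   by (simp add: quot_mod_sel proj_mod_def)
 qed
 show im: "proj_mod M N ` carrier M = carrier (quot_mod M N)"
  by (auto simp: quot_mod_sel proj_mod_def A_RCOSETS_def')
 show z: "proj_mod M N 0$M = 0$(quot_mod M N)"
  using s by (simp add: proj_mod_def quot_mod_sel)
 show "left_module R (quot_mod M N)"
  by (rule left_module_image[OF left_module_axioms h im z])
qed

lemma (in left_mod) proj_mod_eq_zero_iff:
 assumes "submod R M N" "x \<in>$M"
 shows "proj_mod M N x = 0$(quot_mod M N) \<longleftrightarrow> x \<in> N"
 using proj_mod_eq_iff[OF assms M.zero_closed] quot_mod(3)[OF assms(1)] assms(2) M.neg_zero
 by (simp add: a_minus_def)

text \<open>The target is just an abelian group, because the maps to which this is applied change
  the ring of scalars. Compatibility with scalars is proved in each application.\<close>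

lemma (in left_mod) quot_mod_universal:
 assumes N: "submod R M N" and B: "abelian_group B"
  and h: "!!x. x \<in>$M ==> h x \<in>$B"
  and add: "!!x y. [|x \<in>$M; y \<in>$M|] ==> h (x +$M y) = h x +$B h y"
  and zero: "!!x. x \<in> N ==> h x = 0$B"
 obtains k where "!!x. x \<in>$M ==> k (proj_mod M N x) = h x"
  "!!u. u \<in>$(quot_mod M N) ==> k u \<in>$B"
  "!!u v. [|u \<in>$(quot_mod M N); v \<in>$(quot_mod M N)|] ==> k (u +$(quot_mod M N) v) = k u +$B k v"
proof -
 interpret B: abelian_group B by fact
 note q = quot_mod[OF N]
 have eq: "h x = h y" if "x \<in>$M" "y \<in>$M" "proj_mod M N x = proj_mod M N y" for x y
 proof -
  have "x -$M y \<in> N" using that by (simp add: proj_mod_eq_iff[OF N])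
  hence "h ((x -$M y) +$M y) = 0$B +$B h y" using that by (simp add: add zero)
  thus ?thesis using that h by (simp add: a_minus_def M.a_assoc M.l_neg)
 qed
 define k where "k u = h (SOME x. x \<in>$M \<and> proj_mod M N x = u)" for u
 have k: "k (proj_mod M N x) = h x" if "x \<in>$M" for x
  unfolding k_def by (rule someI2[of _ x], simp add: that, rule eq) (simp_all add: that)
 show thesis
 proof (rule that[of k])
  fix u v assume "u \<in>$(quot_mod M N)" "v \<in>$(quot_mod M N)"
  then obtain x y where *: "x \<in>$M" "u = proj_mod M N x" "y \<in>$M" "v = proj_mod M N y"
   using q(2) by (metis imageE)
  show "k u \<in>$B" using * k h by simp
  show "k (u +$(quot_mod M N) v) = k u +$B k v"
   using * k add lmod_homD(2)[OF q(1), symmetric] by simp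
 qed (rule k)
qed

lemma restrict_scalars_simps [simp]:
 "carrier (restrict_scalars f M) = carrier M" "0$(restrict_scalars f M) = 0$M"
 "x +$(restrict_scalars f M) y = x +$M y" "a \<odot>$(restrict_scalars f M) x = f a \<odot>$M x"
 by (simp_all add: restrict_scalars_def)

lemma left_module_restrict_scalars:
 assumes R: "ring R" and f: "f \<in> ring_hom R S" and M: "left_module S M"
 shows "left_module R (restrict_scalars f M)"
proof -
 interpret M: left_module S M by fact
 have "abelian_group (restrict_scalars f M)"
  by (rule abelian_groupI) (auto simp: M.M.a_ac intro!: bexI[of _ "\<ominus>$M _"] M.M.l_neg)
 thus ?thesis
  by (intro left_moduleI R)
   (auto simp: ring_hom_closed[OF f] ring_hom_add[OF f] ring_hom_mult[OF f] ring_hom_one[OF f]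
    M.smult_closed M.smult_l_distr M.smult_r_distr M.smult_assoc M.smult_one)
qed

section \<open>Tensor products\<close>

text \<open>There are two instances: over Z[D], to form A, and over the integers, to extend scalars
  to Z_p.\<close>

locale tensor_setup =
 fixes R :: "('r, 'a) ring_scheme" and M :: "('s, 'm) module" and act :: "'m => 'r => 'm"
  and N :: "('r, 'n) module"
 assumes abelian_M: "abelian_group M" and abelian_N: "abelian_group N"
  and act_closed: "[|x \<in>$M; a \<in>$R|] ==> act x a \<in>$M"
  and scal_closed: "[|a \<in>$R; y \<in>$N|] ==> a \<odot>$N y \<in>$N"
begin

interpretation AM: abelian_group M by (rule abelian_M)
interpretation AN: abelian_group N by (rule abelian_N)

abbreviation "FG \<equiv> free_Abelian_group (carrier M \<times> carrier N)"
abbreviation "K \<equiv> tensor_rel R M act N"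
abbreviation "TT \<equiv> tensor R M act N"

definition cls :: "(('m \<times> 'n) \<Rightarrow>\<^sub>0 int) => (('m \<times> 'n) \<Rightarrow>\<^sub>0 int) set" where
 "cls c = K #>$FG c"

text \<open>The pure tensor x \<otimes> y.\<close>

definition pt :: "'m => 'n => (('m \<times> 'n) \<Rightarrow>\<^sub>0 int) set" where
 "pt x y = cls (frag_of (x, y))"

interpretation F: comm_group FG by (rule abelian_free_Abelian_group)

definition gens :: "(('m \<times> 'n) \<Rightarrow>\<^sub>0 int) set" where
 "gens = {frag_of (x +$M x', y) - frag_of (x, y) - frag_of (x', y) | x x' y.
     x \<in>$M \<and> x' \<in>$M \<and> y \<in>$N} \<union>
   {frag_of (x, y +$N y') - frag_of (x, y) - frag_of (x, y') | x y y'.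
     x \<in>$M \<and> y \<in>$N \<and> y' \<in>$N} \<union>
   {frag_of (act x a, y) - frag_of (x, a \<odot>$N y) | x a y.
     x \<in>$M \<and> a \<in>$R \<and> y \<in>$N}"

lemma K_eq: "K = generate FG gens"
 by (simp add: tensor_rel_def gens_def)

lemma gens_sub: "gens \<subseteq> carrier FG"
proof -
 have d: "a - b \<in>$FG" if "a \<in>$FG" "b \<in>$FG" for a b
  using that keys_diff[of a b] by auto
 show ?thesis unfolding gens_def
  by (auto intro!: d simp del: carrier_free_Abelian_group_iff
    simp: act_closed scal_closed)
qed

lemma K_subgroup: "subgroup K FG"
 unfolding K_eq by (rule F.generate_is_subgroup[OF gens_sub])

lemma K_normal: "K \<lhd> FG"
 using K_subgroup F.normal_iff_subgroup by simp

lemma tensor_sel: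
 "carrier TT = carrier (FG Mod K)" "0$TT = K" "u +$TT v = u <#>$FG v"
 "a \<odot>$TT u = tensor_map R M act N (%x. a \<odot>$M x) id u"
 by (simp_all add: tensor_def Let_def)

lemma tensor_abelian: "abelian_group TT"
proof -
 interpret Q: comm_group "FG Mod K" by (rule F.abelian_FactGroup[OF K_subgroup])
 show ?thesis
 proof (rule abelian_groupI, unfold tensor_sel)
  fix u assume u: "u \<in>$(FG Mod K)"
  show "\<exists>v\<in>carrier (FG Mod K). v <#>$FG u = K"
   by (rule bexI[OF _ Q.inv_closed[OF u]]) (use Q.l_inv[OF u] in simp)
  show "K <#>$FG u = u" using Q.l_one[OF u] by simp
  fix v assume v: "v \<in>$(FG Mod K)"
  show "u <#>$FG v \<in>$(FG Mod K)" using Q.m_closed[OF u v] by simp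
  show "u <#>$FG v = v <#>$FG u" using Q.m_comm[OF u v] by simp
  fix w assume w: "w \<in>$(FG Mod K)"
  show "u <#>$FG v <#>$FG w = u <#>$FG (v <#>$FG w)" using Q.m_assoc[OF u v w] by simp
 qed (use Q.one_closed in simp)
qed

lemma cls_closed: "c \<in>$FG ==> cls c \<in>$TT"
 unfolding tensor_sel carrier_FactGroup cls_def by blast

lemma cls_surj: "u \<in>$TT ==> \<exists>c\<in>carrier FG. u = cls c"
 unfolding tensor_sel carrier_FactGroup cls_def by blast

lemma cls_add: "c \<in>$FG ==> d \<in>$FG ==> cls (c + d) = cls c +$TT cls d"
 unfolding tensor_sel cls_def using normal.rcos_sum[OF K_normal, of c d] by simp

lemma cls_eq_iff:
 assumes "c \<in>$FG" "d \<in>$FG"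
 shows "cls c = cls d \<longleftrightarrow> c - d \<in> K"
proof -
 have "c \<in> cls d \<longleftrightarrow> c - d \<in> K"
  using subgroup.rcos_module[OF K_subgroup F.is_group assms(2,1)] assms by (simp add: cls_def)
 moreover have "c \<in> cls d \<longleftrightarrow> cls c = cls d"
  using F.rcos_self[OF assms(1) K_subgroup] F.repr_independence[OF _ assms(2) K_subgroup, of c]
  unfolding cls_def by blast
 ultimately show ?thesis by simp
qed

lemma cls_minus:
 assumes "c \<in>$FG" "d \<in>$FG" shows "cls (c - d) = cls c -$TT cls d"
proof -
 interpret T: abelian_group TT by (rule tensor_abelian)
 have cd: "c - d \<in>$FG" using assms keys_diff[of c d] by auto
 have "cls c = cls (c - d) +$TT cls d" using cls_add[OF cd assms(2)] by simp
 thus ?thesis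
  using cls_closed[OF cd] cls_closed[OF assms(2)] by (simp add: a_minus_def T.a_assoc T.r_neg)
qed

lemma frag_in: "x \<in>$M ==> y \<in>$N ==> frag_of (x, y) \<in>$FG"
 by simp

lemma pt_closed: "x \<in>$M ==> y \<in>$N ==> pt x y \<in>$TT"
 unfolding pt_def by (intro cls_closed frag_in)

lemma gens_in_K: "c \<in> gens ==> c \<in> K"
 unfolding K_eq by (rule generate.incl)

lemma pt_add_left:
 assumes "x \<in>$M" "x' \<in>$M" "y \<in>$N"
 shows "pt (x +$M x') y = pt x y +$TT pt x' y"
proof -
 have c: "frag_of (x, y) + frag_of (x', y) \<in>$FG"
  using F.m_closed[OF frag_in frag_in] assms by simp
 have "frag_of (x +$M x', y) - (frag_of (x, y) + frag_of (x', y)) \<in> K"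
  by (rule gens_in_K) (use assms in "auto simp: gens_def diff_diff_eq")
 thus ?thesis
  unfolding pt_def using assms c by (simp add: cls_add[symmetric] cls_eq_iff del: carrier_free_Abelian_group_iff)
qed

lemma pt_add_right:
 assumes "x \<in>$M" "y \<in>$N" "y' \<in>$N"
 shows "pt x (y +$N y') = pt x y +$TT pt x y'"
proof -
 have c: "frag_of (x, y) + frag_of (x, y') \<in>$FG"
  using F.m_closed[OF frag_in frag_in] assms by simp
 have "frag_of (x, y +$N y') - (frag_of (x, y) + frag_of (x, y')) \<in> K"
  by (rule gens_in_K) (use assms in "auto simp: gens_def diff_diff_eq")
 thus ?thesis
  unfolding pt_def using assms c by (simp add: cls_add[symmetric] cls_eq_iff del: carrier_free_Abelian_group_iff)
qed

lemma pt_balanced: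
 assumes "x \<in>$M" "a \<in>$R" "y \<in>$N"
 shows "pt (act x a) y = pt x (a \<odot>$N y)"
proof -
 have "frag_of (act x a, y) - frag_of (x, a \<odot>$N y) \<in> K"
  by (rule gens_in_K) (use assms in "auto simp: gens_def")
 thus ?thesis
  unfolding pt_def using assms
  by (simp add: cls_eq_iff act_closed scal_closed del: carrier_free_Abelian_group_iff)
qed

text \<open>Pure tensors generate the group. With differences as the only induction step, sums,
  negatives and zero (a difference of equal tensors) need no cases of their own.\<close>

lemma tensor_induct [consumes 1, case_names pt minus]:
 assumes "u \<in>$TT"
  and "!!x y. [|x \<in>$M; y \<in>$N|] ==> P (pt x y)"
  and "!!u v. [|u \<in>$TT; v \<in>$TT; P u; P v|] ==> P (u -$TT v)"
 shows "P u"
proof -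
 interpret T: abelian_group TT by (rule tensor_abelian)
 obtain c where c: "c \<in>$FG" "u = cls c" using cls_surj[OF assms(1)] by blast
 have "Poly_Mapping.keys c \<subseteq> carrier M \<times> carrier N" using c(1) by simp
 hence "P (cls c)"
 proof (rule free_Abelian_group_induct)
  have p: "pt 0$M 0$N \<in>$TT" "P (pt 0$M 0$N)"
   by (simp_all add: pt_closed assms(2))
  have "cls (frag_of (0$M, 0$N) - frag_of (0$M, 0$N)) = pt 0$M 0$N -$TT pt 0$M 0$N"
   unfolding pt_def by (rule cls_minus) simp_all
  thus "P (cls 0)" using assms(3)[OF p(1) p(1) p(2) p(2)] by simp
 next
  fix x y assume "Poly_Mapping.keys x \<subseteq> carrier M \<times> carrier N" "Poly_Mapping.keys y \<subseteq> carrier M \<times> carrier N"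
   "P (cls x)" "P (cls y)"
  thus "P (cls (x - y))" using assms(3)[of "cls x" "cls y"] cls_minus[of x y] cls_closed[of x] cls_closed[of y] by simp
 next
  fix a assume "a \<in> carrier M \<times> carrier N"
  thus "P (cls (frag_of a))" using assms(2) by (cases a) (simp add: pt_def)
 qed
 thus ?thesis by (simp add: c)
qed

lemma additive_minus:
 assumes "abelian_group A" "abelian_group B"
  and "!!x. x \<in>$A ==> h x \<in>$B"
  and "!!x y. [|x \<in>$A; y \<in>$A|] ==> h (x +$A y) = h x +$B h y"
  and "x \<in>$A" "y \<in>$A"
 shows "h (x -$A y) = h x -$B h y"
 using assms(5,6) abelian_group.a_inv_closed[OF assms(1)] additive_neg[OF assms(1-4)]
 by (simp add: a_minus_def assms(4))

lemma tensor_hom_eq: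
 assumes B: "abelian_group B"
  and f: "!!u. u \<in>$TT ==> f u \<in>$B"
   "!!u v. [|u \<in>$TT; v \<in>$TT|] ==> f (u +$TT v) = f u +$B f v"
  and g: "!!u. u \<in>$TT ==> g u \<in>$B"
   "!!u v. [|u \<in>$TT; v \<in>$TT|] ==> g (u +$TT v) = g u +$B g v"
  and pt: "!!x y. [|x \<in>$M; y \<in>$N|] ==> f (pt x y) = g (pt x y)"
  and u: "u \<in>$TT"
 shows "f u = g u"
 using u
proof (induction u rule: tensor_induct)
 case (minus u v)
 thus ?case
  using additive_minus[OF tensor_abelian B f minus(1,2)] additive_minus[OF tensor_abelian B g minus(1,2)] by simp
qed (rule pt)

text \<open>The biadditive map extends to the free abelian group and kills each generating relation,
  hence the subgroup that they generate; so it is constant on cosets.\<close>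

lemma tensor_universal:
 assumes B: "abelian_group B"
  and closed: "!!x y. [|x \<in>$M; y \<in>$N|] ==> \<beta> x y \<in>$B"
  and left: "!!x x' y. [|x \<in>$M; x' \<in>$M; y \<in>$N|] ==> \<beta> (x +$M x') y = \<beta> x y +$B \<beta> x' y"
  and right: "!!x y y'. [|x \<in>$M; y \<in>$N; y' \<in>$N|] ==> \<beta> x (y +$N y') = \<beta> x y +$B \<beta> x y'"
  and balanced: "!!x a y. [|x \<in>$M; a \<in>$R; y \<in>$N|] ==> \<beta> (act x a) y = \<beta> x (a \<odot>$N y)"
 obtains \<theta> where "!!u. u \<in>$TT ==> \<theta> u \<in>$B"
  "!!u v. [|u \<in>$TT; v \<in>$TT|] ==> \<theta> (u +$TT v) = \<theta> u +$B \<theta> v"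
  "!!x y. [|x \<in>$M; y \<in>$N|] ==> \<theta> (pt x y) = \<beta> x y"
proof -
 interpret B: abelian_group B by fact
 have "(%(x, y). \<beta> x y) ` (carrier M \<times> carrier N) \<subseteq> carrier (add_monoid B)" using closed by auto
 then obtain h where h: "h \<in> hom FG (add_monoid B)"
  and hf: "!!z. z \<in> carrier M \<times> carrier N ==> h (frag_of z) = (%(x, y). \<beta> x y) z"
  using comm_group.free_Abelian_group_universal[OF B.a_comm_group] by metis
 have hadd: "h (c + d) = h c +$B h d" if "c \<in>$FG" "d \<in>$FG" for c d
  using hom_mult[OF h that] by simp
 have hcl: "h c \<in>$B" if "c \<in>$FG" for c
  using hom_in_carrier[OF h that] by simp
 have hminus: "h (c - d) = h c -$B h d" if "c \<in>$FG" "d \<in>$FG" for c d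
 proof -
  have "c - d \<in>$FG" using that keys_diff[of c d] by auto
  hence "h c = h (c - d) +$B h d" using hadd[of "c - d" d] that by simp
  thus ?thesis using hcl[OF \<open>c - d \<in>$FG\<close>] hcl[OF that(2)] by (simp add: a_minus_def B.a_assoc B.r_neg)
 qed
 have cdiff: "c - d \<in>$FG" if "c \<in>$FG" "d \<in>$FG" for c d
  using that keys_diff[of c d] by auto
 have canc: "((a +$B b) -$B a) -$B b = 0$B" if "a \<in>$B" "b \<in>$B" for a b
  using that B.r_neg[of "a +$B b"]
  by (simp add: a_minus_def B.a_assoc[of "a +$B b"] B.minus_add del: B.a_assoc)
 have hgen: "h c = 0$B" if "c \<in> gens" for c
  using that unfolding gens_def
  by (elim UnE CollectE exE conjE)
   (simp_all add: hminus cdiff frag_in hf left right balanced[symmetric] closed canc act_closed scal_closed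
    B.r_neg a_minus_def[of B "\<beta> (act _ _) _"] del: carrier_free_Abelian_group_iff)
 interpret hG: group_hom FG "add_monoid B" h
  using h B.a_group by (simp add: group_hom_def group_hom_axioms_def)
 have hK: "h c = 0$B" if "c \<in> K" for c
 proof -
  have "gens \<subseteq> kernel FG (add_monoid B) h"
   using hgen gens_sub by (auto simp: kernel_def simp del: carrier_free_Abelian_group_iff)
  hence "K \<subseteq> kernel FG (add_monoid B) h"
   unfolding K_eq by (rule F.generate_subgroup_incl[OF _ hG.subgroup_kernel])
  thus ?thesis using that by (auto simp: kernel_def)
 qed
 have heq: "h c = h d" if "c \<in>$FG" "d \<in>$FG" "cls c = cls d" for c d
 proof -
  have k: "c - d \<in> K" using that cls_eq_iff by simp
  have "h ((c - d) + d) = h (c - d) +$B h d" by (rule hadd[OF cdiff[OF that(1,2)] that(2)])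
  thus ?thesis using hK[OF k] hcl[OF that(2)] by simp
 qed
 define \<theta> where "\<theta> u = h (SOME c. c \<in>$FG \<and> cls c = u)" for u
 have \<theta>: "\<theta> (cls c) = h c" if "c \<in>$FG" for c
  unfolding \<theta>_def by (rule someI2[of _ c]) (use that heq in blast)+
 show thesis
 proof (rule that[of \<theta>])
  fix u v assume "u \<in>$TT" "v \<in>$TT"
  then obtain c d where *: "c \<in>$FG" "u = cls c" "d \<in>$FG" "v = cls d"
   using cls_surj by metis
  have "c + d \<in>$FG" using F.m_closed[OF *(1,3)] by simp
  thus "\<theta> (u +$TT v) = \<theta> u +$B \<theta> v"
   unfolding *(2,4) cls_add[OF *(1,3), symmetric] using * by (simp only: \<theta> hadd)
 next
  fix u assume "u \<in>$TT"
  thus "\<theta> u \<in>$B" using cls_surj[of u] \<theta> hcl by auto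
 next
  fix x y assume "x \<in>$M" "y \<in>$N"
  thus "\<theta> (pt x y) = \<beta> x y"
   unfolding pt_def using \<theta>[OF frag_in] hf[of "(x, y)"] by simp
 qed
qed

text \<open>The induced endomorphism of the free abelian group sends generating relations to
  generating relations, hence \<open>K\<close> into \<open>K\<close>. The union in the definition is
  therefore a union of equal cosets.\<close>

lemma tensor_map:
 assumes f: "!!x. x \<in>$M ==> f x \<in>$M"
   "!!x x'. [|x \<in>$M; x' \<in>$M|] ==> f (x +$M x') = f x +$M f x'"
   "!!x a. [|x \<in>$M; a \<in>$R|] ==> f (act x a) = act (f x) a"
  and h: "!!y. y \<in>$N ==> h y \<in>$N"
   "!!y y'. [|y \<in>$N; y' \<in>$N|] ==> h (y +$N y') = h y +$N h y'"
   "!!a y. [|a \<in>$R; y \<in>$N|] ==> h (a \<odot>$N y) = a \<odot>$N h y"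
 shows "u \<in>$TT ==> tensor_map R M act N f h u \<in>$TT"
  and "[|u \<in>$TT; v \<in>$TT|] ==>
   tensor_map R M act N f h (u +$TT v) = tensor_map R M act N f h u +$TT tensor_map R M act N f h v"
  and "[|x \<in>$M; y \<in>$N|] ==> tensor_map R M act N f h (pt x y) = pt (f x) (h y)"
proof -
 let ?E = "frag_extend (%(x, y). frag_of (f x, h y))"
 let ?t = "tensor_map R M act N f h"
 have Ecl: "?E c \<in>$FG" if "c \<in>$FG" for c
 proof -
  have "Poly_Mapping.keys (?E c) \<subseteq> (\<Union>x \<in> Poly_Mapping.keys c. Poly_Mapping.keys (case x of (x, y) => frag_of (f x, h y)))"
   by (rule keys_frag_extend)
  also have "\<dots> \<subseteq> carrier M \<times> carrier N" using that f(1) h(1) by auto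
  finally show ?thesis by simp
 qed
 have Ehom: "?E \<in> hom FG FG" using Ecl by (intro homI) (simp_all add: frag_extend_add del: carrier_free_Abelian_group_iff)
 interpret E: group_hom FG FG ?E
  using Ehom F.is_group by (simp add: group_hom_def group_hom_axioms_def)
 have "?E c \<in> K" if "c \<in> gens" for c
  using that unfolding gens_def
 proof (elim UnE CollectE exE conjE)
  fix x x' y assume *: "c = frag_of (x +$M x', y) - frag_of (x, y) - frag_of (x', y)"
   "x \<in>$M" "x' \<in>$M" "y \<in>$N"
  hence "?E c = frag_of (f x +$M f x', h y) - frag_of (f x, h y) - frag_of (f x', h y)"
   by (simp add: frag_extend_diff f)
  hence "?E c \<in> gens" using f(1)[OF *(2)] f(1)[OF *(3)] h(1)[OF *(4)] unfolding gens_def by blast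
  thus ?thesis by (rule gens_in_K)
 next
  fix x y y' assume *: "c = frag_of (x, y +$N y') - frag_of (x, y) - frag_of (x, y')"
   "x \<in>$M" "y \<in>$N" "y' \<in>$N"
  hence "?E c = frag_of (f x, h y +$N h y') - frag_of (f x, h y) - frag_of (f x, h y')"
   by (simp add: frag_extend_diff h)
  hence "?E c \<in> gens" using f(1)[OF *(2)] h(1)[OF *(3)] h(1)[OF *(4)] unfolding gens_def by blast
  thus ?thesis by (rule gens_in_K)
 next
  fix x a y assume *: "c = frag_of (act x a, y) - frag_of (x, a \<odot>$N y)"
   "x \<in>$M" "a \<in>$R" "y \<in>$N"
  hence "?E c = frag_of (act (f x) a, h y) - frag_of (f x, a \<odot>$N h y)"
   by (simp add: frag_extend_diff f h)
  hence "?E c \<in> gens" using f(1)[OF *(2)] *(3) h(1)[OF *(4)] unfolding gens_def by blast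
  thus ?thesis by (rule gens_in_K)
 qed
 hence g: "?E ` gens \<subseteq> K" by blast
 have EK: "?E c \<in> K" if "c \<in> K" for c
 proof -
  have "?E ` K = generate FG (?E ` gens)" unfolding K_eq by (rule E.generate_img[OF gens_sub, symmetric])
  also have "\<dots> \<subseteq> K" by (rule F.generate_subgroup_incl[OF g K_subgroup])
  finally show ?thesis using that by blast
 qed
 have t: "?t (cls c) = cls (?E c)" if "c \<in>$FG" for c
 proof -
  have "cls (?E d) = cls (?E c)" if d: "d \<in> cls c" for d
  proof -
   have dF: "d \<in>$FG"
    using d F.r_coset_subset_G[OF subgroup.subset[OF K_subgroup] \<open>c \<in>$FG\<close>] unfolding cls_def by blast
   have "cls d = cls c" using d F.repr_independence[OF _ \<open>c \<in>$FG\<close> K_subgroup, of d] unfolding cls_def by blast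
   hence "d - c \<in> K" using cls_eq_iff[OF dF \<open>c \<in>$FG\<close>] by simp
   hence "?E d - ?E c \<in> K" using EK[of "d - c"] by (simp add: frag_extend_diff)
   thus ?thesis using cls_eq_iff[OF Ecl[OF dF] Ecl[OF \<open>c \<in>$FG\<close>]] by simp
  qed
  moreover have "c \<in> cls c" unfolding cls_def by (rule F.rcos_self[OF that K_subgroup])
  ultimately show ?thesis unfolding tensor_map_def cls_def[symmetric] by blast
 qed
 show "?t u \<in>$TT" if u: "u \<in>$TT" for u
 proof -
  obtain c where c: "c \<in>$FG" "u = cls c" using cls_surj[OF u] by blast
  show ?thesis unfolding c(2) t[OF c(1)] by (rule cls_closed[OF Ecl[OF c(1)]])
 qed
 show "?t (u +$TT v) = ?t u +$TT ?t v" if u: "u \<in>$TT" and v: "v \<in>$TT" for u v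
 proof -
  obtain c d where *: "c \<in>$FG" "u = cls c" "d \<in>$FG" "v = cls d"
   using cls_surj[OF u] cls_surj[OF v] by blast
  have "c + d \<in>$FG" using F.m_closed[OF *(1,3)] by simp
  from t[OF this] show ?thesis
   unfolding *(2,4) cls_add[OF *(1,3), symmetric] t[OF *(1)] t[OF *(3)] frag_extend_add
    cls_add[OF Ecl[OF *(1)] Ecl[OF *(3)], symmetric] .
 qed
 show "?t (pt x y) = pt (f x) (h y)" if "x \<in>$M" "y \<in>$N"
  unfolding pt_def using t[OF frag_in[OF that]] by simp
qed

end

text \<open>Both sides of each module axiom are additive in the tensor, so it is enough to compare
  them on pure tensors.\<close>

lemma tensor_left_module:
 assumes ts: "tensor_setup R M act N" and M: "left_module S M"
  and act: "!!s x a. [|s \<in>$S; x \<in>$M; a \<in>$R|] ==> s \<odot>$M act x a = act (s \<odot>$M x) a"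
 shows "left_module S (tensor R M act N)"
  and "[|s \<in>$S; x \<in>$M; y \<in>$N|] ==>
   s \<odot>$(tensor R M act N) tensor_setup.pt R M act N x y = tensor_setup.pt R M act N (s \<odot>$M x) y"
proof -
 interpret tensor_setup R M act N by fact
 interpret M: left_module S M by fact
 interpret T: abelian_group TT by (rule tensor_abelian)
 have tm: "(u \<in>$TT \<longrightarrow> s \<odot>$TT u \<in>$TT) \<and>
   (u \<in>$TT \<longrightarrow> v \<in>$TT \<longrightarrow> s \<odot>$TT (u +$TT v) = s \<odot>$TT u +$TT s \<odot>$TT v) \<and>
   (x \<in>$M \<longrightarrow> y \<in>$N \<longrightarrow> s \<odot>$TT pt x y = pt (s \<odot>$M x) y)"
  if s: "s \<in>$S" for s u v x y
  unfolding tensor_sel(4)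
  using tensor_map[of "%x. s \<odot>$M x" id] s
  by (simp add: M.smult_closed M.smult_r_distr act)
 thus "[|s \<in>$S; x \<in>$M; y \<in>$N|] ==> s \<odot>$TT pt x y = pt (s \<odot>$M x) y" by blast
 have cl: "s \<odot>$TT u \<in>$TT" if "s \<in>$S" "u \<in>$TT" for s u
  using tm that by blast
 have ad: "s \<odot>$TT (u +$TT v) = s \<odot>$TT u +$TT s \<odot>$TT v"
  if "s \<in>$S" "u \<in>$TT" "v \<in>$TT" for s u v
  using tm that by blast
 have sp: "s \<odot>$TT pt x y = pt (s \<odot>$M x) y" if "s \<in>$S" "x \<in>$M" "y \<in>$N" for s x y
  using tm that by blast
 show "left_module S TT"
 proof (rule left_moduleI[OF M.R.ring_axioms tensor_abelian])
  fix a b u assume a: "a \<in>$S" and b: "b \<in>$S" and u: "u \<in>$TT"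
  show "(a +$S b) \<odot>$TT u = a \<odot>$TT u +$TT b \<odot>$TT u"
   by (rule tensor_hom_eq[where f = "%u. (a +$S b) \<odot>$TT u"
      and g = "%u. a \<odot>$TT u +$TT b \<odot>$TT u", OF tensor_abelian _ _ _ _ _ u])
    (use a b in "simp_all add: cl ad sp T.a_ac M.smult_closed M.smult_l_distr pt_add_left pt_closed")
  show "(a *$S b) \<odot>$TT u = a \<odot>$TT (b \<odot>$TT u)"
   by (rule tensor_hom_eq[where f = "%u. (a *$S b) \<odot>$TT u"
      and g = "%u. a \<odot>$TT (b \<odot>$TT u)", OF tensor_abelian _ _ _ _ _ u])
    (use a b in "simp_all add: cl ad sp M.smult_closed M.smult_assoc")
 next
  fix u assume u: "u \<in>$TT"
  show "1$S \<odot>$TT u = u"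
   by (rule tensor_hom_eq[where f = "%u. 1$S \<odot>$TT u" and g = "%u. u", OF tensor_abelian _ _ _ _ _ u])
    (simp_all add: cl ad sp M.smult_one)
 qed (fact cl ad)+
qed

section \<open>Finite sums\<close>

context abelian_group
begin

lemma finsum_swap:
 assumes "finite A" "finite B" "!!i k. [|i \<in> A; k \<in> B|] ==> f i k \<in>$G"
 shows "(\<Oplus>i\<in>A. \<Oplus>k\<in>B. f i k) = (\<Oplus>k\<in>B. \<Oplus>i\<in>A. f i k)"
 using assms(1,3)
proof (induction A rule: finite_induct)
 case (insert a A)
 have 1: "(\<Oplus>i\<in>insert a A. \<Oplus>k\<in>B. f i k) = (\<Oplus>k\<in>B. f a k) \<oplus> (\<Oplus>i\<in>A. \<Oplus>k\<in>B. f i k)"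
  using insert by (intro finsum_insert) (auto intro!: finsum_closed)
 have 2: "(\<Oplus>k\<in>B. \<Oplus>i\<in>insert a A. f i k) = (\<Oplus>k\<in>B. f a k \<oplus> (\<Oplus>i\<in>A. f i k))"
  using insert by (intro finsum_cong' refl finsum_insert) (auto intro!: finsum_closed)
 have 3: "(\<Oplus>k\<in>B. f a k \<oplus> (\<Oplus>i\<in>A. f i k)) = (\<Oplus>k\<in>B. f a k) \<oplus> (\<Oplus>k\<in>B. \<Oplus>i\<in>A. f i k)"
  using insert by (intro finsum_addf) (auto intro!: finsum_closed)
 have "(\<Oplus>i\<in>A. \<Oplus>k\<in>B. f i k) = (\<Oplus>k\<in>B. \<Oplus>i\<in>A. f i k)"
  using insert by blast
 thus ?case unfolding 1 2 3 by simp
qed simp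

lemma finsum_bij:
 assumes "bij_betw h A B" "!!x. x \<in> B ==> f x \<in>$G"
 shows "(\<Oplus>x\<in>B. f x) = (\<Oplus>x\<in>A. f (h x))"
 using finsum_reindex[of f h A] assms by (auto simp: bij_betw_def)

lemma finsum_delta:
 assumes "finite A" "a \<in> A" "x \<in>$G"
 shows "(\<Oplus>i\<in>A. if i = a then x else \<zero>) = x"
 using add.finprod_singleton_swap[OF assms(2,1), of "%_. x"] assms(3) by simp

lemma finsum_filter:
 assumes "finite A" "!!x. x \<in> A ==> f x \<in>$G"
 shows "(\<Oplus>x\<in>{x\<in>A. P x}. f x) = (\<Oplus>x\<in>A. if P x then f x else \<zero>)"
 by (rule add.finprod_mono_neutral_cong_left) (use assms in auto)

lemma finsum_product:
 assumes "finite A" "finite B" "!!i k. [|i \<in> A; k \<in> B|] ==> f i k \<in>$G"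
 shows "(\<Oplus>i\<in>A. \<Oplus>k\<in>B. f i k) = (\<Oplus>z\<in>A \<times> B. f (fst z) (snd z))"
 using assms(1,3)
proof (induction A rule: finite_induct)
 case (insert a A)
 have 1: "(\<Oplus>i\<in>insert a A. \<Oplus>k\<in>B. f i k) = (\<Oplus>k\<in>B. f a k) \<oplus> (\<Oplus>i\<in>A. \<Oplus>k\<in>B. f i k)"
  using insert by (intro finsum_insert) (auto intro!: finsum_closed)
 have 2: "(\<Oplus>z\<in>{a} \<times> B. f (fst z) (snd z)) = (\<Oplus>k\<in>B. f a k)"
 proof -
  have "bij_betw (Pair a) B ({a} \<times> B)" by (auto simp: bij_betw_def inj_on_def)
  from finsum_bij[OF this, of "%z. f (fst z) (snd z)"] show ?thesis using insert by auto
 qed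
 have 3: "insert a A \<times> B = {a} \<times> B \<union> A \<times> B" by auto
 have 4: "(\<Oplus>z\<in>insert a A \<times> B. f (fst z) (snd z))
   = (\<Oplus>z\<in>{a} \<times> B. f (fst z) (snd z)) \<oplus> (\<Oplus>z\<in>A \<times> B. f (fst z) (snd z))"
  unfolding 3 using insert assms(2) by (intro finsum_Un_disjoint) auto
 have "(\<Oplus>i\<in>A. \<Oplus>k\<in>B. f i k) = (\<Oplus>z\<in>A \<times> B. f (fst z) (snd z))"
  using insert by blast
 thus ?case unfolding 1 2 4 by simp
qed simp

end

lemma dsum_finsum:
 assumes R: "ring R" and M: "!!i. i \<in> I ==> left_module R (M i)"
  and f: "!!k. k \<in> A ==> f k \<in>$(dsum_mod I M)" and i: "i \<in> I"
 shows "(\<Oplus>$(dsum_mod I M) k\<in>A. f k) i = (\<Oplus>$(M i) k\<in>A. f k i)"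
 by (rule additive_finsum[where h = "%u. u i", OF left_moduleD(2)[OF left_module_dsum[OF R M]] left_moduleD(2)[OF M[OF i]]])
  (use f i in "auto simp del: dsum_mod_simps(2)")

section \<open>Group rings\<close>

locale fin_group_cring = R: cring R + G: group G
 for R :: "('k, 'a) ring_scheme" and G :: "('g, 'b) monoid_scheme" +
 assumes fin: "finite (carrier G)"
begin

abbreviation "RG \<equiv> group_ring R G"

end

text \<open>A representation of \<open>G\<close> on an \<open>R\<close>-module makes it a module over \<open>R[G]\<close>; the axioms of the
 group ring itself are obtained from the regular representation.\<close>

definition gr_act :: "('k, 'a) ring_scheme => ('g, 'b) monoid_scheme => ('k, 'm) module => ('g => 'm => 'm)
  => ('g => 'k) => 'm => 'm" where
 "gr_act R G M \<psi> a x = (\<Oplus>$M g\<in>carrier G. a g \<odot>$M \<psi> g x)"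

text \<open>The monomial c g.\<close>

definition gr_mono :: "('k, 'a) ring_scheme => ('g, 'b) monoid_scheme => 'k => 'g => 'g => 'k" where
 "gr_mono R G c g = (\<lambda>h\<in>carrier G. if h = g then c else 0$R)"

lemma gr_of_mono: "gr_of R G g = gr_mono R G 1$R g"
 by (simp add: gr_of_def gr_mono_def)

lemma group_ring_sel:
 "carrier (group_ring R G) = carrier G \<rightarrow>\<^sub>E carrier R"
 "a *$(group_ring R G) b =
  (\<lambda>g\<in>carrier G. \<Oplus>$R h\<in>carrier G. a h *$R b (inv\<^bsub>G\<^esub> h *$G g))"
 "1$(group_ring R G) = gr_mono R G 1$R 1$G"
 "0$(group_ring R G) = (\<lambda>g\<in>carrier G. 0$R)"
 "a +$(group_ring R G) b = (\<lambda>g\<in>carrier G. a g +$R b g)"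
 by (simp_all add: group_ring_def gr_mono_def)

locale group_rep = fin_group_cring R G + M: left_module R M
 for R :: "('k, 'a) ring_scheme" and G :: "('g, 'b) monoid_scheme" and M :: "('k, 'm) module" +
 fixes \<psi> :: "'g => 'm => 'm"
 assumes psi_closed: "[|g \<in>$G; x \<in>$M|] ==> \<psi> g x \<in>$M"
  and psi_add: "[|g \<in>$G; x \<in>$M; y \<in>$M|] ==> \<psi> g (x +$M y) = \<psi> g x +$M \<psi> g y"
  and psi_smult: "[|g \<in>$G; c \<in>$R; x \<in>$M|] ==> \<psi> g (c \<odot>$M x) = c \<odot>$M \<psi> g x"
  and psi_one: "x \<in>$M ==> \<psi> 1$G x = x"
  and psi_mult: "[|g \<in>$G; h \<in>$G; x \<in>$M|] ==> \<psi> (g *$G h) x = \<psi> g (\<psi> h x)"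
begin

abbreviation "act \<equiv> gr_act R G M \<psi>"

lemma coeff_closed: "a \<in>$RG ==> g \<in>$G ==> a g \<in>$R"
 by (auto simp: group_ring_sel)

lemma term_closed: "a \<in>$RG ==> x \<in>$M ==> g \<in>$G ==> a g \<odot>$M \<psi> g x \<in>$M"
 by (intro M.smult_closed coeff_closed psi_closed)

lemma act_closed: "a \<in>$RG ==> x \<in>$M ==> act a x \<in>$M"
 unfolding gr_act_def by (intro M.M.finsum_closed) (simp add: term_closed)

lemma act_add_right:
 assumes "a \<in>$RG" "x \<in>$M" "y \<in>$M"
 shows "act a (x +$M y) = act a x +$M act a y"
proof -
 have "act a (x +$M y) = (\<Oplus>$M g\<in>carrier G. a g \<odot>$M \<psi> g x +$M a g \<odot>$M \<psi> g y)"
  unfolding gr_act_def using assms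
  by (intro M.M.finsum_cong' refl)
   (auto simp: psi_add M.smult_r_distr coeff_closed psi_closed M.smult_closed)
 also have "\<dots> = act a x +$M act a y"
  unfolding gr_act_def using assms by (intro M.M.finsum_addf) (auto simp: term_closed)
 finally show ?thesis .
qed

lemma act_add_left:
 assumes "a \<in>$RG" "b \<in>$RG" "x \<in>$M"
 shows "act (a +$RG b) x = act a x +$M act b x"
proof -
 have "act (a +$RG b) x = (\<Oplus>$M g\<in>carrier G. a g \<odot>$M \<psi> g x +$M b g \<odot>$M \<psi> g x)"
  unfolding gr_act_def using assms
  by (intro M.M.finsum_cong' refl)
   (auto simp: group_ring_sel(5) M.smult_l_distr coeff_closed psi_closed M.smult_closed)
 also have "\<dots> = act a x +$M act b x"
  unfolding gr_act_def using assms by (intro M.M.finsum_addf) (auto simp: term_closed)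
 finally show ?thesis .
qed

lemma mono_closed: "c \<in>$R ==> gr_mono R G c g \<in>$RG"
 by (auto simp: group_ring_sel gr_mono_def)

lemma act_mono:
 assumes "c \<in>$R" "g \<in>$G" "x \<in>$M"
 shows "act (gr_mono R G c g) x = c \<odot>$M \<psi> g x"
proof -
 have "act (gr_mono R G c g) x = (\<Oplus>$M h\<in>carrier G. if h = g then c \<odot>$M \<psi> g x else 0$M)"
  unfolding gr_act_def using assms
  by (intro M.M.finsum_cong' refl) (auto simp: gr_mono_def psi_closed M.smult_closed M.smult_zero_left)
 also have "\<dots> = c \<odot>$M \<psi> g x"
  using assms fin by (intro M.M.finsum_delta) (auto simp: psi_closed M.smult_closed)
 finally show ?thesis .
qed

lemma act_one: "x \<in>$M ==> act 1$RG x = x"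
 by (simp add: group_ring_sel(3) act_mono psi_one M.smult_one)

lemma psi_finsum:
 assumes "g \<in>$G" "f \<in> A \<rightarrow> carrier M"
 shows "\<psi> g (\<Oplus>$M i\<in>A. f i) = (\<Oplus>$M i\<in>A. \<psi> g (f i))"
 by (rule additive_finsum[where h = "\<psi> g", OF M.M.abelian_group_axioms M.M.abelian_group_axioms])
  (use assms in "auto simp: psi_closed psi_add")

lemma conv_closed: 
 assumes "a \<in>$RG" "b \<in>$RG" "g \<in>$G" "h \<in>$G"
 shows "a h *$R b (inv\<^bsub>G\<^esub> h *$G g) \<in>$R"
 using assms by (intro R.m_closed coeff_closed[of a] coeff_closed[of b]) auto

lemma mult_closed: "a \<in>$RG ==> b \<in>$RG ==> a *$RG b \<in>$RG"
 using conv_closed unfolding group_ring_sel(1,2) by (auto intro!: R.finsum_closed)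

text \<open>Convolution becomes composition: after the two sums are interchanged, k = h^{-1} g runs
  over the group when g does.\<close>

lemma act_mult:
 assumes a: "a \<in>$RG" and b: "b \<in>$RG" and x: "x \<in>$M"
 shows "act (a *$RG b) x = act a (act b x)"
proof -
 have cl: "a h *$R b k \<in>$R" "a h \<odot>$M (b k \<odot>$M \<psi> h (\<psi> k x)) \<in>$M" 
  if "h \<in>$G" "k \<in>$G" for h k
  using R.m_closed[OF coeff_closed[OF a that(1)] coeff_closed[OF b that(2)]]
   M.smult_closed[OF coeff_closed[OF a that(1)] M.smult_closed[OF coeff_closed[OF b that(2)]
    psi_closed[OF that(1) psi_closed[OF that(2) x]]]] by simp_all
 have "act (a *$RG b) x =
   (\<Oplus>$M g\<in>carrier G. \<Oplus>$M h\<in>carrier G. a h \<odot>$M (b (inv\<^bsub>G\<^esub> h *$G g) \<odot>$M \<psi> h (\<psi> (inv\<^bsub>G\<^esub> h *$G g) x)))"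
  unfolding gr_act_def
 proof (intro M.M.finsum_cong' refl)
  fix g assume g: "g \<in>$G"
  have "(a *$RG b) g \<odot>$M \<psi> g x = (\<Oplus>$M h\<in>carrier G. (a h *$R b (inv\<^bsub>G\<^esub> h *$G g)) \<odot>$M \<psi> g x)"
   using g x a b by (simp add: group_ring_sel(2) M.smult_finsum_left psi_closed conv_closed Pi_iff)
  also have "\<dots> = (\<Oplus>$M h\<in>carrier G. a h \<odot>$M (b (inv\<^bsub>G\<^esub> h *$G g) \<odot>$M \<psi> h (\<psi> (inv\<^bsub>G\<^esub> h *$G g) x)))"
  proof (intro M.M.finsum_cong' refl)
   fix h assume h: "h \<in>$G"
   have "\<psi> g x = \<psi> (h *$G (inv\<^bsub>G\<^esub> h *$G g)) x"
    using g h by (simp add: G.m_assoc[symmetric])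
   also have "\<dots> = \<psi> h (\<psi> (inv\<^bsub>G\<^esub> h *$G g) x)"
    using g h x by (intro psi_mult) auto
   finally show "(a h *$R b (inv\<^bsub>G\<^esub> h *$G g)) \<odot>$M \<psi> g x =
     a h \<odot>$M (b (inv\<^bsub>G\<^esub> h *$G g) \<odot>$M \<psi> h (\<psi> (inv\<^bsub>G\<^esub> h *$G g) x))"
    using g h a b x by (simp add: M.smult_assoc coeff_closed psi_closed)
  qed (use g cl in auto)
  finally show "(a *$RG b) g \<odot>$M \<psi> g x = \<dots>" .
 qed (auto intro!: M.M.finsum_closed cl)
 also have "\<dots> = (\<Oplus>$M h\<in>carrier G. \<Oplus>$M g\<in>carrier G. a h \<odot>$M (b (inv\<^bsub>G\<^esub> h *$G g) \<odot>$M \<psi> h (\<psi> (inv\<^bsub>G\<^esub> h *$G g) x)))"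
  by (rule M.M.finsum_swap) (auto simp: fin cl)
 also have "\<dots> = act a (act b x)"
  unfolding gr_act_def
 proof (intro M.M.finsum_cong' refl)
  fix h assume h: "h \<in>$G"
  have "bij_betw (%g. inv\<^bsub>G\<^esub> h *$G g) (carrier G) (carrier G)"
   using h by (intro bij_betw_byWitness[where f' = "%k. h *$G k"]) (auto simp: G.m_assoc[symmetric])
  hence "(\<Oplus>$M g\<in>carrier G. a h \<odot>$M (b (inv\<^bsub>G\<^esub> h *$G g) \<odot>$M \<psi> h (\<psi> (inv\<^bsub>G\<^esub> h *$G g) x)))
    = (\<Oplus>$M k\<in>carrier G. a h \<odot>$M (b k \<odot>$M \<psi> h (\<psi> k x)))"
   by (rule M.M.finsum_bij[where f = "%k. a h \<odot>$M (b k \<odot>$M \<psi> h (\<psi> k x))", symmetric]) (use h cl in auto)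
  also have "\<dots> = a h \<odot>$M (\<Oplus>$M k\<in>carrier G. \<psi> h (b k \<odot>$M \<psi> k x))"
   using h a b x by (subst M.smult_finsum_right)
    (auto simp: coeff_closed psi_smult psi_closed M.smult_closed intro!: M.M.finsum_cong')
  also have "\<dots> = a h \<odot>$M \<psi> h (\<Oplus>$M k\<in>carrier G. b k \<odot>$M \<psi> k x)"
   using h b x by (subst psi_finsum) (auto simp: term_closed)
  finally show "(\<Oplus>$M g\<in>carrier G. a h \<odot>$M (b (inv\<^bsub>G\<^esub> h *$G g) \<odot>$M \<psi> h (\<psi> (inv\<^bsub>G\<^esub> h *$G g) x)))
    = a h \<odot>$M \<psi> h (\<Oplus>$M g\<in>carrier G. b g \<odot>$M \<psi> g x)" .
 next
  show "(%g. a g \<odot>$M \<psi> g (\<Oplus>$M g\<in>carrier G. b g \<odot>$M \<psi> g x)) \<in> carrier G \<rightarrow> carrier M"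
   using term_closed[OF a act_closed[OF b x]] by (auto simp: gr_act_def)
 qed
 finally show ?thesis .
qed

end

context fin_group_cring
begin

definition reg_rep :: "'g => ('g => 'k) => 'g => 'k" where
 "reg_rep h b = (\<lambda>g\<in>carrier G. b (inv\<^bsub>G\<^esub> h *$G g))"

abbreviation "PG \<equiv> dsum_mod (carrier G) (%_. reg_mod R)"

lemma reg_rep: "group_rep R G PG reg_rep"
proof -
 interpret P: left_module R PG by (intro left_module_dsum left_module_reg R.ring_axioms)
 show ?thesis
 proof (unfold_locales)
  fix x assume "x \<in>$PG"
  thus "reg_rep 1$G x = x"
   by (auto simp: reg_rep_def PiE_iff extensional_def fun_eq_iff)
 next
  fix g h x assume "g \<in>$G" "h \<in>$G" "x \<in>$PG"
  thus "reg_rep (g *$G h) x = reg_rep g (reg_rep h x)"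
   by (auto simp: reg_rep_def G.inv_mult_group G.m_assoc intro!: restrict_ext)
 qed (auto simp: reg_rep_def intro!: restrict_ext)
qed

lemma mult_eq_act:
 assumes a: "a \<in>$RG" and b: "b \<in>$RG"
 shows "a *$RG b = gr_act R G PG reg_rep a b"
proof -
 interpret group_rep R G PG reg_rep by (rule reg_rep)
 have b': "b \<in>$PG" using b by (simp add: group_ring_sel)
 show ?thesis
 proof (rule PiE_ext)
  show "a *$RG b \<in> carrier G \<rightarrow>\<^sub>E carrier R" using mult_closed[OF a b] by (simp add: group_ring_sel)
  show "gr_act R G PG reg_rep a b \<in> carrier G \<rightarrow>\<^sub>E carrier R" using act_closed[OF a b'] by simp
  fix g assume g: "g \<in>$G"
  have "gr_act R G PG reg_rep a b g = (\<Oplus>$(reg_mod R) h\<in>carrier G. (a h \<odot>$PG reg_rep h b) g)"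
   unfolding gr_act_def
   by (rule dsum_finsum[OF R.ring_axioms left_module_reg[OF R.ring_axioms] _ g])
    (rule term_closed[OF a b'])
  also have "\<dots> = (a *$RG b) g"
  proof -
   have "finsum (reg_mod R) f A = finsum R f A" for f and A :: "'g set"
    by (simp add: finsum_def reg_mod_def mk_mod_def finprod_def)
   thus ?thesis
    using g conv_closed[OF a b g] by (simp add: group_ring_sel(2) reg_rep_def cong: R.finsum_cong')
  qed
  finally show "(a *$RG b) g = gr_act R G PG reg_rep a b g" ..
 qed
qed

lemma group_ring_ring: "ring RG"
proof -
 interpret group_rep R G PG reg_rep by (rule reg_rep)
 have car: "carrier RG = carrier PG" by (simp add: group_ring_sel)
 have add: "a +$RG b = a +$PG b" for a b by (simp add: group_ring_sel)
 have zero: "0$RG = 0$PG" by (simp add: group_ring_sel)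
 have ag: "abelian_group RG"
  by (rule abelian_groupI, unfold car add zero)
   (rule abelian_groupE[OF M.M.abelian_group_axioms]; assumption)+
 have one: "1$RG \<in>$RG" unfolding group_ring_sel(3) by (rule mono_closed) simp
 show ?thesis
 proof (intro ringI ag monoidI)
  fix a b c assume abc: "a \<in>$RG" "b \<in>$RG" "c \<in>$RG"
  thus "a *$RG b *$RG c = a *$RG (b *$RG c)"
   using act_mult[of a b c] mult_closed[of a b] mult_closed[of b c] car by (simp add: mult_eq_act)
  show "(a +$RG b) *$RG c = a *$RG c +$RG b *$RG c"
   using abc act_add_left[of a b c] abelian_groupE(1)[OF ag, of a b] car by (simp add: mult_eq_act add del: dsum_mod_simps)
  show "c *$RG (a +$RG b) = c *$RG a +$RG c *$RG b"
   using abc act_add_right[of c a b] abelian_groupE(1)[OF ag, of a b] car by (simp add: mult_eq_act add del: dsum_mod_simps)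
 next
  fix a assume a: "a \<in>$RG"
  show "1$RG *$RG a = a"
   using a act_one[of a] one car by (simp add: mult_eq_act)
  \<comment> \<open>A left action yields associativity, both distributive laws and the left unit.
    The right unit is beyond its reach and is computed coefficient by coefficient.\<close>
  show "a *$RG 1$RG = a"
  proof (rule PiE_ext)
   show "a *$RG 1$RG \<in> carrier G \<rightarrow>\<^sub>E carrier R" using mult_closed[OF a one] by (simp add: group_ring_sel)
   show "a \<in> carrier G \<rightarrow>\<^sub>E carrier R" using a by (simp add: group_ring_sel)
   fix g assume g: "g \<in>$G"
   have "(a *$RG 1$RG) g = (\<Oplus>$R h\<in>carrier G. if h = g then a g else 0$R)"
    unfolding group_ring_sel(2,3) using g coeff_closed[OF a]
    by (auto intro!: R.finsum_cong' simp: gr_mono_def G.inv_solve_left')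
   also have "\<dots> = a g" using g coeff_closed[OF a] fin by (intro R.finsum_delta) auto
   finally show "(a *$RG 1$RG) g = a g" .
  qed
 qed (use mult_closed one in auto)
qed

end

sublocale fin_group_cring \<subseteq> RG: ring RG by (rule group_ring_ring)

lemma (in group_rep) rep_left_module:
 "left_module RG (mk_mod (carrier M) 0$M (\<oplus>$M) act)"
proof (rule left_moduleI[OF group_ring_ring])
 show "abelian_group (mk_mod (carrier M) 0$M (\<oplus>$M) act)"
  by (rule abelian_groupI) (auto simp: M.M.a_ac intro!: bexI[of _ "\<ominus>$M _"] M.M.l_neg)
qed (auto simp: act_closed act_add_left act_add_right act_mult act_one)

context fin_group_cring
begin

lemma gr_coeff_closed: "a \<in>$RG ==> g \<in>$G ==> a g \<in>$R"
 by (auto simp: group_ring_sel)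

lemma gr_mono_closed: "c \<in>$R ==> gr_mono R G c g \<in>$RG"
 by (auto simp: group_ring_sel gr_mono_def)

lemma gr_of_closed: "gr_of R G g \<in>$RG"
 unfolding gr_of_mono by (rule gr_mono_closed) simp

lemma gr_eqI:
 assumes "a \<in>$RG" "b \<in>$RG" "!!g. g \<in>$G ==> a g = b g"
 shows "a = b"
 using assms unfolding group_ring_sel(1) by (rule PiE_ext)

lemma gr_mono_add:
 assumes "c \<in>$R" "d \<in>$R"
 shows "gr_mono R G (c +$R d) g = gr_mono R G c g +$RG gr_mono R G d g"
 using assms by (auto simp: group_ring_sel gr_mono_def intro!: restrict_ext)

lemma gr_mono_mult:
 assumes c: "c \<in>$R" and d: "d \<in>$R" and g: "g \<in>$G" and h: "h \<in>$G"
 shows "gr_mono R G c g *$RG gr_mono R G d h = gr_mono R G (c *$R d) (g *$G h)"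
proof -
 interpret group_rep R G PG reg_rep by (rule reg_rep)
 have "gr_mono R G c g *$RG gr_mono R G d h = c \<odot>$PG reg_rep g (gr_mono R G d h)"
  using act_mono[OF c g, of "gr_mono R G d h"] gr_mono_closed[OF d, of h] gr_mono_closed[OF c, of g]
  by (simp add: mult_eq_act group_ring_sel(1))
 also have "\<dots> = gr_mono R G (c *$R d) (g *$G h)"
  using c g h by (auto simp: reg_rep_def gr_mono_def G.inv_solve_left' intro!: restrict_ext)
 finally show ?thesis .
qed

lemma gr_finsum_apply:
 assumes "f \<in> A \<rightarrow> carrier RG" "g \<in>$G"
 shows "(\<Oplus>$RG i\<in>A. f i) g = (\<Oplus>$R i\<in>A. f i g)"
 by (rule additive_finsum[where h = "%u. u g", OF RG.abelian_group_axioms R.abelian_group_axioms])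
  (use assms in "auto simp: group_ring_sel(1,5)")

lemma gr_expand:
 assumes a: "a \<in>$RG"
 shows "a = (\<Oplus>$RG g\<in>carrier G. gr_mono R G (a g) g)"
proof (rule gr_eqI[OF a])
 have cl: "(%g. gr_mono R G (a g) g) \<in> carrier G \<rightarrow> carrier RG"
  using gr_coeff_closed[OF a] gr_mono_closed by auto
 thus "(\<Oplus>$RG g\<in>carrier G. gr_mono R G (a g) g) \<in>$RG" by (rule RG.finsum_closed)
 fix x assume x: "x \<in>$G"
 have "(\<Oplus>$RG g\<in>carrier G. gr_mono R G (a g) g) x = (\<Oplus>$R g\<in>carrier G. gr_mono R G (a g) g x)"
  by (rule gr_finsum_apply[OF cl x])
 also have "\<dots> = (\<Oplus>$R g\<in>carrier G. if g = x then a x else 0$R)"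
  using x gr_coeff_closed[OF a] by (intro R.finsum_cong' refl) (auto simp: gr_mono_def)
 also have "\<dots> = a x" using x gr_coeff_closed[OF a] fin by (intro R.finsum_delta) auto
 finally show "a x = (\<Oplus>$RG g\<in>carrier G. gr_mono R G (a g) g) x" ..
qed

text \<open>The monomials c g generate the group ring additively. Many identities below, such as
  centrality of an element or agreement of two homomorphisms, are reduced to monomials in this
  way.\<close>

lemma gr_additive_eq:
 assumes B: "abelian_group B"
  and f: "!!a. a \<in>$RG ==> f a \<in>$B"
   "!!a b. [|a \<in>$RG; b \<in>$RG|] ==> f (a +$RG b) = f a +$B f b"
  and h: "!!a. a \<in>$RG ==> h a \<in>$B"
   "!!a b. [|a \<in>$RG; b \<in>$RG|] ==> h (a +$RG b) = h a +$B h b"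
  and eq: "!!c g. [|c \<in>$R; g \<in>$G|] ==> f (gr_mono R G c g) = h (gr_mono R G c g)"
  and a: "a \<in>$RG"
 shows "f a = h a"
proof -
 interpret B: abelian_group B by fact
 have cl: "(%g. gr_mono R G (a g) g) \<in> carrier G \<rightarrow> carrier RG"
  using gr_coeff_closed[OF a] gr_mono_closed by auto
 have "f (\<Oplus>$RG g\<in>carrier G. gr_mono R G (a g) g) = (\<Oplus>$B g\<in>carrier G. f (gr_mono R G (a g) g))"
  by (rule additive_finsum[where h = f, OF RG.abelian_group_axioms B f cl])
 also have "\<dots> = (\<Oplus>$B g\<in>carrier G. h (gr_mono R G (a g) g))"
  using cl h(1) eq gr_coeff_closed[OF a] by (intro B.finsum_cong' refl) auto
 also have "\<dots> = h (\<Oplus>$RG g\<in>carrier G. gr_mono R G (a g) g)"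
  by (rule additive_finsum[where h = h, OF RG.abelian_group_axioms B h cl, symmetric])
 finally show ?thesis by (simp only: gr_expand[OF a, symmetric])
qed

end

section \<open>Ring homomorphisms out of a group ring\<close>

definition gr_lift :: "('g, 'b) monoid_scheme => ('s, 'd) ring_scheme => ('k => 's) => ('g => 's) => ('g => 'k) => 's" where
 "gr_lift G B c u a = (\<Oplus>$B g\<in>carrier G. c (a g) *$B u g)"

text \<open>Through c the ring B is an R-module, and G acts on it by left multiplication with u;
  \<open>comm\<close> makes this action linear. Thus B is a module over the group ring, and the
  homomorphism is the orbit map of 1.\<close>

lemma (in fin_group_cring) gr_lift:
 fixes B :: "('s, 'd) ring_scheme"
 assumes B: "ring B" and c: "c \<in> ring_hom R B"
  and u: "!!g. g \<in>$G ==> u g \<in>$B" "u 1$G = 1$B"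
   "!!g h. [|g \<in>$G; h \<in>$G|] ==> u (g *$G h) = u g *$B u h"
  and comm: "!!r g. [|r \<in>$R; g \<in>$G|] ==> c r *$B u g = u g *$B c r"
 shows "gr_lift G B c u \<in> ring_hom RG B"
  and "[|r \<in>$R; g \<in>$G|] ==> gr_lift G B c u (gr_mono R G r g) = c r *$B u g"
proof -
 interpret B: ring B by fact
 let ?M = "restrict_scalars c (reg_mod B)"
 have M: "left_module R ?M" by (rule left_module_restrict_scalars[OF R.ring_axioms c left_module_reg[OF B]])
 note cc = ring_hom_closed[OF c]
 have finsum_eq: "finsum ?M f A = finsum B f A" for f and A :: "'g set"
  by (simp add: finsum_def restrict_scalars_def reg_mod_def mk_mod_def finprod_def)
 interpret group_rep R G ?M "%g x. u g *$B x"
 proof (intro group_rep.intro group_rep_axioms.intro M fin_group_cring_axioms)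
  fix g r x assume "g \<in>$G" "r \<in>$R" "x \<in>$?M"
  thus "u g *$B (r \<odot>$?M x) = r \<odot>$?M (u g *$B x)"
   using u cc comm[of r g] by (simp add: B.m_assoc[symmetric])
 qed (use u in "auto simp: B.r_distr B.m_assoc")
 have key: "gr_act R G ?M (%g x. u g *$B x) a x = gr_lift G B c u a *$B x"
  if "a \<in>$RG" "x \<in>$B" for a x
 proof -
  have "gr_lift G B c u a *$B x = (\<Oplus>$B g\<in>carrier G. c (a g) *$B u g *$B x)"
   unfolding gr_lift_def using that u cc gr_coeff_closed fin by (intro B.finsum_ldistr) auto
  also have "\<dots> = (\<Oplus>$B g\<in>carrier G. c (a g) *$B (u g *$B x))"
   using that u cc gr_coeff_closed by (intro B.finsum_cong' refl) (auto simp: B.m_assoc)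
  finally show ?thesis by (simp add: gr_act_def finsum_eq)
 qed
 have closed: "gr_lift G B c u a \<in>$B" if "a \<in>$RG" for a
  unfolding gr_lift_def using that u cc gr_coeff_closed by (intro B.finsum_closed) auto
 have one: "gr_lift G B c u a = gr_act R G ?M (%g x. u g *$B x) a 1$B" if "a \<in>$RG" for a
  using key[OF that B.one_closed] closed[OF that] by simp
 show "gr_lift G B c u \<in> ring_hom RG B"
 proof (rule ring_hom_memI)
  fix a b assume ab: "a \<in>$RG" "b \<in>$RG"
  show "gr_lift G B c u (a +$RG b) = gr_lift G B c u a +$B gr_lift G B c u b"
   using act_add_left[OF ab, of "1$B"] ab RG.a_closed[OF ab] by (simp add: one)
  have "gr_lift G B c u (a *$RG b) = gr_act R G ?M (%g x. u g *$B x) a (gr_lift G B c u b)"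
   using act_mult[OF ab, of "1$B"] ab RG.m_closed[OF ab] by (simp add: one)
  thus "gr_lift G B c u (a *$RG b) = gr_lift G B c u a *$B gr_lift G B c u b"
   using key[OF ab(1) closed[OF ab(2)]] by simp
 next
  show "gr_lift G B c u 1$RG = 1$B"
   using act_one[of "1$B"] by (simp add: one)
 qed (rule closed)
 show "gr_lift G B c u (gr_mono R G r g) = c r *$B u g" if "r \<in>$R" "g \<in>$G"
  using act_mono[OF that, of "1$B"] that gr_mono_closed u by (simp add: one)
qed

definition gr_const :: "('k, 'a) ring_scheme => ('g, 'b) monoid_scheme => 'k => 'g => 'k" where
 "gr_const R G c = gr_mono R G c 1$G"

context fin_group_cring
begin

lemma gr_const_hom: "gr_const R G \<in> ring_hom R RG"
 by (rule ring_hom_memI)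
  (auto simp: gr_const_def gr_mono_closed gr_mono_mult gr_mono_add group_ring_sel(3))

lemma gr_const_closed: "c \<in>$R ==> gr_const R G c \<in>$RG"
 by (simp add: gr_const_def gr_mono_closed)

lemma gr_mono_const: "c \<in>$R ==> g \<in>$G ==> gr_mono R G c g = gr_const R G c *$RG gr_of R G g"
 by (simp add: gr_const_def gr_of_mono gr_mono_mult)

lemma gr_of_mult: "g \<in>$G ==> h \<in>$G ==> gr_of R G g *$RG gr_of R G h = gr_of R G (g *$G h)"
 by (simp add: gr_of_mono gr_mono_mult)

lemma gr_of_one: "gr_of R G 1$G = 1$RG"
 by (simp add: gr_of_mono group_ring_sel(3))

lemma gr_const_of_comm:
 "c \<in>$R ==> g \<in>$G ==> gr_const R G c *$RG gr_of R G g = gr_of R G g *$RG gr_const R G c"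
 by (simp add: gr_const_def gr_of_mono gr_mono_mult)

lemma gr_const_central:
 assumes c: "c \<in>$R" and a: "a \<in>$RG"
 shows "gr_const R G c *$RG a = a *$RG gr_const R G c"
 by (rule gr_additive_eq[where f = "%a. gr_const R G c *$RG a" and h = "%a. a *$RG gr_const R G c",
    OF RG.abelian_group_axioms _ _ _ _ _ a])
  (use c in "simp_all add: gr_const_closed RG.r_distr RG.l_distr gr_const_def gr_mono_mult gr_mono_closed R.m_comm")

text \<open>The fibre sums defining \<open>gr_map\<close> are the coefficients of a
  \<open>gr_lift\<close> into the group ring of H, from which multiplicativity is inherited.\<close>

lemma gr_map_hom:
 fixes H :: "('h, 'c) monoid_scheme"
 assumes H: "group H" "finite (carrier H)" and f: "f \<in> hom G H"
 shows "gr_map R G H f \<in> ring_hom RG (group_ring R H)"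
  and "[|c \<in>$R; g \<in>$G|] ==> gr_map R G H f (gr_mono R G c g) = gr_mono R H c (f g)"
proof -
 interpret H: fin_group_cring R H
  using H by (simp add: fin_group_cring_def fin_group_cring_axioms_def R.cring_axioms)
 note fc = hom_in_carrier[OF f]
 have f1: "f 1$G = 1$H" by (rule hom_one[OF f G.is_group H(1)])
 note L = gr_lift[OF H.group_ring_ring H.gr_const_hom, of "%g. gr_of R H (f g)"]
 have L1: "gr_lift G (group_ring R H) (gr_const R H) (%g. gr_of R H (f g)) \<in> ring_hom RG (group_ring R H)"
  and L2: "[|c \<in>$R; g \<in>$G|] ==>
   gr_lift G (group_ring R H) (gr_const R H) (%g. gr_of R H (f g)) (gr_mono R G c g) = gr_const R H c *$(group_ring R H) gr_of R H (f g)"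
  for c g
  by (rule L; simp add: H.gr_of_closed f1 H.gr_of_one hom_mult[OF f] H.gr_of_mult fc H.gr_const_of_comm)+
 have eq: "gr_map R G H f a = gr_lift G (group_ring R H) (gr_const R H) (%g. gr_of R H (f g)) a" (is "_ = ?l a")
  if a: "a \<in>$RG" for a
 proof (rule H.gr_eqI)
  show "?l a \<in>$(group_ring R H)" using ring_hom_closed[OF L1 a] .
  have fin': "finite {x \<in> carrier G. f x = y}" for y using fin by simp
  show "gr_map R G H f a \<in>$(group_ring R H)"
   unfolding gr_map_def group_ring_sel(1) using gr_coeff_closed[OF a] by (auto intro!: R.finsum_closed)
  fix y assume y: "y \<in>$H"
  have "gr_map R G H f a y = (\<Oplus>$R x\<in>carrier G. if f x = y then a x else 0$R)"
   using y gr_coeff_closed[OF a] fin by (simp add: gr_map_def R.finsum_filter)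
  also have "\<dots> = (\<Oplus>$R x\<in>carrier G. gr_mono R H (a x) (f x) y)"
   using y gr_coeff_closed[OF a] by (intro R.finsum_cong' refl) (auto simp: gr_mono_def)
  also have "\<dots> = (\<Oplus>$R x\<in>carrier G. (gr_const R H (a x) *$(group_ring R H) gr_of R H (f x)) y)"
   using gr_coeff_closed[OF a] fc y H.gr_coeff_closed
   by (intro R.finsum_cong' refl)
    (auto simp: H.gr_mono_const[symmetric] H.gr_mono_closed intro!: H.gr_coeff_closed H.gr_mono_closed)
  also have "\<dots> = ?l a y"
   unfolding gr_lift_def using gr_coeff_closed[OF a] y
   by (intro H.gr_finsum_apply[symmetric]) (auto intro!: H.RG.m_closed H.gr_const_closed H.gr_of_closed)
  finally show "gr_map R G H f a y = ?l a y" .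
 qed
 show "gr_map R G H f \<in> ring_hom RG (group_ring R H)"
  by (rule ring_hom_memI)
   (simp_all add: eq ring_hom_closed[OF L1] ring_hom_add[OF L1] ring_hom_mult[OF L1] ring_hom_one[OF L1])
 show "gr_map R G H f (gr_mono R G c g) = gr_mono R H c (f g)" if "c \<in>$R" "g \<in>$G"
  using that fc by (simp add: eq gr_mono_closed L2 H.gr_mono_const)
qed

end

section \<open>The \<open>p\<close>-adic integers\<close>

lemma padic_sel:
 "carrier (padic_int p) = {x. \<forall>n. x n \<in> {0..<int p ^ n} \<and> x (Suc n) mod int p ^ n = x n}"
 "x *$(padic_int p) y = (%n. (x n * y n) mod int p ^ n)"
 "1$(padic_int p) = (%n. 1 mod int p ^ n)"
 "0$(padic_int p) = (%n. 0)"
 "x +$(padic_int p) y = (%n. (x n + y n) mod int p ^ n)"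
 by (simp_all add: padic_int_def)

locale padic =
 fixes p :: nat
 assumes prime: "prime p" and odd: "odd p"
begin

abbreviation "Zp \<equiv> padic_int p"

lemma p_pos: "int p ^ n > 0" using prime_gt_0_nat[OF prime] by simp

lemma p_gt_1: "int p > 1" using prime_gt_1_nat[OF prime] by simp

lemma mod_Suc_mod: "a mod int p ^ Suc n mod int p ^ n = a mod int p ^ n"
 by (rule mod_mod_cancel) simp

lemma padic_mem:
 "x \<in>$Zp \<longleftrightarrow> (\<forall>n. 0 \<le> x n \<and> x n < int p ^ n \<and> x (Suc n) mod int p ^ n = x n)"
 by (auto simp: padic_sel)

lemma padic_range: "x \<in>$Zp ==> 0 \<le> x n \<and> x n < int p ^ n"
 by (auto simp: padic_sel)

lemma padic_mod: "x \<in>$Zp ==> x n mod int p ^ n = x n"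
 using padic_range[of x n] by simp

lemma padic_mod_le: "x \<in>$Zp ==> m \<le> n ==> x n mod int p ^ m = x m"
proof (induction n)
 case (Suc n)
 show ?case
 proof (cases "m = Suc n")
  case False
  hence "m \<le> n" using Suc by simp
  hence "x (Suc n) mod int p ^ m = x (Suc n) mod int p ^ n mod int p ^ m"
   by (intro mod_mod_cancel[symmetric] le_imp_power_dvd)
  also have "\<dots> = x m" using Suc \<open>m \<le> n\<close> by (simp add: padic_mem)
  finally show ?thesis .
 qed (use padic_mod[OF Suc.prems(1), of "Suc n"] in simp)
qed (use padic_mod[of x 0] in simp)

lemma seq_closed:
 assumes "!!n. f (Suc n) mod int p ^ n = f n mod int p ^ n"
 shows "(%n. f n mod int p ^ n) \<in>$Zp"
 unfolding padic_mem mod_Suc_mod using assms pos_mod_bound[OF p_pos] pos_mod_sign[OF p_pos] by blast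

lemma const_closed: "(%n. k mod int p ^ n) \<in>$Zp"
 by (rule seq_closed) simp

lemma padic_Suc: "x \<in>$Zp ==> x (Suc n) mod int p ^ n = x n mod int p ^ n"
 by (simp add: padic_mem)

lemma padic_cring: "cring Zp"
proof (rule cringI)
 show "abelian_group Zp"
 proof (rule abelian_groupI)
  fix x y assume xy: "x \<in>$Zp" "y \<in>$Zp"
  show "x +$Zp y \<in>$Zp"
   unfolding padic_sel(5)
   by (rule seq_closed) (intro mod_add_cong padic_Suc xy)
  show "x +$Zp y = y +$Zp x" by (simp add: padic_sel add.commute)
  fix z assume "z \<in>$Zp"
  show "x +$Zp y +$Zp z = x +$Zp (y +$Zp z)"
   by (simp add: padic_sel mod_simps add.assoc)
 next
  fix x assume x: "x \<in>$Zp"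
  show "0$Zp +$Zp x = x" using padic_mod[OF x] by (simp add: padic_sel)
  have "(%n. (- x n) mod int p ^ n) \<in>$Zp"
   by (rule seq_closed) (intro mod_minus_cong padic_Suc x)
  moreover have "(%n. (- x n) mod int p ^ n) +$Zp x = 0$Zp"
   by (simp add: padic_sel mod_simps)
  ultimately show "\<exists>y\<in>carrier Zp. y +$Zp x = 0$Zp" by blast
 qed (simp add: padic_mem p_pos, use p_pos in "auto simp: padic_sel")
next
 show "comm_monoid Zp"
 proof (rule comm_monoidI)
  fix x y assume xy: "x \<in>$Zp" "y \<in>$Zp"
  show "x *$Zp y \<in>$Zp"
   unfolding padic_sel(2)
   by (rule seq_closed) (intro mod_mult_cong padic_Suc xy)
  show "x *$Zp y = y *$Zp x" by (simp add: padic_sel mult.commute)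
  fix z assume "z \<in>$Zp"
  show "x *$Zp y *$Zp z = x *$Zp (y *$Zp z)"
   by (simp add: padic_sel mod_simps mult.assoc)
 next
  fix x assume x: "x \<in>$Zp"
  show "1$Zp *$Zp x = x" using padic_mod[OF x] by (simp add: padic_sel mod_simps)
 qed (unfold padic_sel(3), rule const_closed)
next
 fix x y z
 show "(x +$Zp y) *$Zp z = x *$Zp z +$Zp y *$Zp z"
  by (simp add: padic_sel mod_simps distrib_right)
qed

end

sublocale padic \<subseteq> Zp: cring Zp by (rule padic_cring)

context padic
begin

lemma padic_neg:
 assumes "x \<in>$Zp" shows "\<ominus>$Zp x = (%n. (- x n) mod int p ^ n)"
proof (rule Zp.minus_equality)
 show "(%n. (- x n) mod int p ^ n) \<in>$Zp"
  by (rule seq_closed) (intro mod_minus_cong padic_Suc assms)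
qed (simp_all add: padic_sel(4,5) mod_simps assms)

lemma padic_minus:
 assumes "x \<in>$Zp" "y \<in>$Zp" shows "x -$Zp y = (%n. (x n - y n) mod int p ^ n)"
 using assms by (simp add: a_minus_def padic_neg padic_sel(5) mod_simps)

lemma padic_smult:
 assumes "x \<in>$Zp" shows "[(k::nat)] \<cdot>$Zp x = (%n. (int k * x n) mod int p ^ n)"
proof (induction k)
 case (Suc k)
 thus ?case using assms by (simp add: padic_sel(5) mod_simps algebra_simps)
qed (simp add: padic_sel(4))

lemma padic_smult_int:
 assumes "x \<in>$Zp" shows "[(k::int)] \<cdot>$Zp x = (%n. (k * x n) mod int p ^ n)"
proof (cases "k \<ge> 0")
 case True
 thus ?thesis using padic_smult[OF assms, of "nat k"] by (simp add: add_pow_int_ge)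
next
 case False
 thus ?thesis
  using padic_smult[OF assms, of "nat (- k)"] padic_neg[OF Zp.add.nat_pow_closed[OF assms, of "nat (- k)"]]
  by (simp add: add_pow_int_lt mod_simps)
qed

lemma padic_of_nat: "[(k::nat)] \<cdot>$Zp 1$Zp = (%n. int k mod int p ^ n)"
 by (simp add: padic_smult) (simp add: padic_sel mod_simps)

lemma padic_of_int: "[(k::int)] \<cdot>$Zp 1$Zp = (%n. k mod int p ^ n)"
 by (simp add: padic_smult_int) (simp add: padic_sel mod_simps)

lemma padic_pow:
 assumes "x \<in>$Zp" shows "x ^$Zp (k::nat) = (%n. (x n ^ k) mod int p ^ n)"
 by (induction k) (simp_all add: padic_sel mod_simps mult.commute)

lemma padic_smult_mult:
 assumes "x \<in>$Zp" shows "[(k::nat)] \<cdot>$Zp x = ([k] \<cdot>$Zp 1$Zp) *$Zp x"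
 using assms by (simp add: Zp.add_pow_ldistr)

text \<open>The residue of a \<open>p\<close>-adic integer \<open>x\<close> is \<open>x 1\<close>.\<close>

lemma residue_simps:
 "[|x \<in>$Zp; y \<in>$Zp|] ==> (x *$Zp y) 1 = (x 1 * y 1) mod int p"
 "[|x \<in>$Zp; y \<in>$Zp|] ==> (x +$Zp y) 1 = (x 1 + y 1) mod int p"
 "[|x \<in>$Zp; y \<in>$Zp|] ==> (x -$Zp y) 1 = (x 1 - y 1) mod int p"
 "x \<in>$Zp ==> (\<ominus>$Zp x) 1 = (- x 1) mod int p"
 "x \<in>$Zp ==> (x ^$Zp k) 1 = (x 1 ^ k) mod int p"
 "([(k::nat)] \<cdot>$Zp 1$Zp) 1 = int k mod int p" "1$Zp 1 = 1" "0$Zp 1 = 0"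
 using p_gt_1
 by (simp_all add: padic_sel(2,5) padic_minus padic_neg padic_pow padic_of_nat) (simp_all add: padic_sel)

text \<open>A nonzero residue makes every component prime to p, so there is an inverse modulo each
  p^n. Inverses modulo p^n are unique, hence the chosen ones are compatible.\<close>

lemma padic_unit:
 assumes x: "x \<in>$Zp" and r: "x 1 \<noteq> 0" shows "x \<in> Units Zp"
proof -
 have cop: "coprime (x n) (int p ^ n)" for n
 proof (cases "n = 0")
  case False
  have "x n mod int p = x 1" using padic_mod_le[OF x, of 1 n] False by simp
  hence "\<not> int p dvd x n" using r by (auto simp: dvd_eq_mod_eq_0)
  hence "coprime (int p) (x n)" using prime by (intro prime_imp_coprime) simp_all
  thus ?thesis by (simp add: coprime_commute)
 qed simp
 have "\<exists>z. 0 \<le> z \<and> z < int p ^ n \<and> (x n * z) mod int p ^ n = 1 mod int p ^ n" for n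
 proof -
  obtain z where "[x n * z = 1] (mod int p ^ n)" using cong_solve_coprime_int[OF cop] by blast
  thus ?thesis
   using p_pos[of n] by (intro exI[of _ "z mod int p ^ n"]) (simp add: cong_def mod_simps)
 qed
 then obtain y where y: "!!n. 0 \<le> y n" "!!n. y n < int p ^ n"
  "!!n. (x n * y n) mod int p ^ n = 1 mod int p ^ n" by metis
 have "y (Suc n) mod int p ^ n = y n" for n
 proof -
  have "(x n * y (Suc n)) mod int p ^ n = (x (Suc n) * y (Suc n)) mod int p ^ Suc n mod int p ^ n"
   unfolding mod_Suc_mod by (intro mod_mult_cong refl padic_Suc[OF x, symmetric])
  also have "\<dots> = 1 mod int p ^ n" unfolding y(3) mod_Suc_mod ..
  finally have "[x n * y (Suc n) = x n * y n] (mod int p ^ n)" using y(3)[of n] by (simp add: cong_def)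
  hence "[y (Suc n) = y n] (mod int p ^ n)" using cop cong_mult_lcancel by blast
  thus ?thesis using y(1,2)[of n] by (simp add: cong_def)
 qed
 hence yc: "y \<in>$Zp" using y by (simp add: padic_mem)
 moreover have "x *$Zp y = 1$Zp" using y(3) by (simp add: padic_sel)
 ultimately show ?thesis using x Zp.m_comm[OF x yc] by (auto simp: Units_def)
qed

lemma padic_divide_p:
 assumes x: "x \<in>$Zp" and r: "x 1 = 0"
 obtains y where "y \<in>$Zp" "x = [p] \<cdot>$Zp 1$Zp *$Zp y"
proof -
 have dvd: "int p dvd x (Suc n)" for n
  using padic_mod_le[OF x, of 1 "Suc n"] r by (simp add: dvd_eq_mod_eq_0)
 \<comment> \<open>The index is shifted because x modulo p^(n+1) determines x / p only modulo
   p^n.\<close>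
 define y where "y n = x (Suc n) div int p" for n
 have xy: "x (Suc n) = int p * y n" for n using dvd[of n] by (simp add: y_def)
 have "y \<in>$Zp" unfolding padic_mem
 proof (intro allI)
  fix n
  have "0 \<le> int p * y n" "int p * y n < int p * int p ^ n" using padic_range[OF x, of "Suc n"] xy[of n] by auto
  hence 1: "0 \<le> y n" "y n < int p ^ n" using p_gt_1 by (simp_all add: zero_le_mult_iff)
  have "x (Suc (Suc n)) mod int p ^ Suc n = x (Suc n)" using x unfolding padic_mem by blast
  hence "int p * (y (Suc n) mod int p ^ n) = int p * y n" by (simp add: xy mod_mult_mult1)
  thus "0 \<le> y n \<and> y n < int p ^ n \<and> y (Suc n) mod int p ^ n = y n" using 1 p_gt_1 by simp
 qed
 moreover have "x = [p] \<cdot>$Zp 1$Zp *$Zp y"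
 proof
  fix n
  show "x n = ([p] \<cdot>$Zp 1$Zp *$Zp y) n"
   using xy[of n] padic_mod_le[OF x, of n "Suc n"] by (simp add: padic_of_nat padic_sel(2) mod_simps)
 qed
 ultimately show thesis by (rule that)
qed

text \<open>Write k = p^a m with m prime to p. Cancelling p^a from the equation modulo p^(n+a)
  leaves m x = 0 modulo p^n, and m is invertible there.\<close>

lemma padic_torsion_free:
 assumes x: "x \<in>$Zp" and k: "k > 0" and z: "[(k::nat)] \<cdot>$Zp x = 0$Zp"
 shows "x = 0$Zp"
proof -
 obtain a m where am: "k = p ^ a * m" "\<not> p dvd m"
  using multiplicity_decompose'[of k p] k not_prime_unit prime by blast
 have "coprime p m" by (rule prime_imp_coprime[OF prime am(2)])
 hence cop: "coprime (int p ^ n) (int m)" for n by simp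
 have "x n = 0" for n
 proof -
  have "int p ^ (n + a) dvd int k * x (n + a)"
   using fun_cong[OF z, of "n + a"] unfolding padic_smult[OF x] padic_sel(4)
   by (rule dvd_eq_mod_eq_0[THEN iffD2])
  hence "int p ^ a * int p ^ n dvd int p ^ a * (int m * x (n + a))"
   by (simp add: am(1) power_add mult_ac)
  hence "int p ^ n dvd int m * x (n + a)" using p_gt_1 by simp
  hence "int p ^ n dvd x (n + a)" using cop coprime_dvd_mult_right_iff by blast
  thus ?thesis using padic_mod_le[OF x, of n "n + a"] by (simp add: dvd_eq_mod_eq_0)
 qed
 thus ?thesis by (auto simp: padic_sel(4))
qed

text \<open>The sum is the cofactor of a - 1 in a^n - 1. For n = p and a = 1 + p t it is p + t p^2
  (p - 1) / 2 modulo p^2, and as p is odd the second summand is a multiple of p^2.\<close>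

lemma geometric_cofactor:
 fixes a :: int
 assumes "int p dvd a - 1"
 shows "[(\<Sum>k<n. a ^ k) = int n] (mod int p)"
  and "[(\<Sum>k<p. a ^ k) = int p] (mod (int p)\<^sup>2)"
proof -
 have a1: "[a = 1] (mod int p)" using assms by (simp add: cong_iff_dvd_diff)
 have "[(\<Sum>k<n. a ^ k) = (\<Sum>k<n. 1)] (mod int p)"
  using cong_pow[OF a1] by (intro cong_sum) simp
 thus "[(\<Sum>k<n. a ^ k) = int n] (mod int p)" by simp
 obtain t where t: "a = 1 + int p * t" using assms by (auto simp: dvd_def algebra_simps)
 have pw: "[a ^ k = 1 + int k * (int p * t)] (mod (int p)\<^sup>2)" for k
 proof (induction k)
  case (Suc k)
  have "[a * a ^ k = a * (1 + int k * (int p * t))] (mod (int p)\<^sup>2)" by (rule cong_mult[OF cong_refl Suc])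
  also have "a * (1 + int k * (int p * t)) = 1 + int (Suc k) * (int p * t) + (int p)\<^sup>2 * (int k * t * t)"
   by (simp add: t algebra_simps power2_eq_square)
  also have "[\<dots> = 1 + int (Suc k) * (int p * t)] (mod (int p)\<^sup>2)" by (simp add: cong_def)
  finally show ?case by simp
 qed simp
 have "[(\<Sum>k<p. a ^ k) = (\<Sum>k<p. 1 + int k * (int p * t))] (mod (int p)\<^sup>2)" by (intro cong_sum pw)
 also have "(\<Sum>k<p. 1 + int k * (int p * t)) = int p + int (\<Sum>k<p. k) * (int p * t)"
  by (simp add: sum.distrib sum_distrib_right)
 also have "(\<Sum>k<p. k) = p * ((p - 1) div 2)"
 proof -
  have "even (p - 1)" using odd by simp
  moreover have "2 * (\<Sum>k<n. k) = n * (n - 1)" for n :: nat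
  proof (induction n)
   case (Suc n)
   thus ?case by (cases n) auto
  qed simp
  ultimately have "2 * (\<Sum>k<p. k) = 2 * (p * ((p - 1) div 2))" by simp
  thus ?thesis by simp
 qed
 also have "int p + int (p * ((p - 1) div 2)) * (int p * t) = int p + (int p)\<^sup>2 * (int ((p - 1) div 2) * t)"
  by (simp only: of_nat_mult power2_eq_square mult_ac)
 also have "[\<dots> = int p] (mod (int p)\<^sup>2)" by (simp add: cong_def)
 finally show "[(\<Sum>k<p. a ^ k) = int p] (mod (int p)\<^sup>2)" .
qed

text \<open>Factor x^n - 1 into x - 1 and its cofactor. If p does not divide n, the cofactor is
  congruent to n, hence invertible. If n = p m, then z = x^m satisfies z^p = 1, and its cofactor is
  p times a unit; cancelling it gives z = 1, and the induction continues with m.\<close>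

lemma padic_root_of_unity:
 assumes "x \<in>$Zp" "x 1 = 1" "n > 0" "x ^$Zp (n::nat) = 1$Zp"
 shows "x = 1$Zp"
 using assms
proof (induction n arbitrary: x rule: less_induct)
 case (less n)
 note x = less.prems(1)
 have a: "int p dvd x j - 1" if "j > 0" for j
  using padic_mod_le[OF x, of 1 j] less.prems(2) that p_gt_1 by (simp add: mod_eq_dvd_iff[symmetric])
 have eq1: "y = 1$Zp" if y: "y \<in>$Zp" and d: "!!j. int p ^ j dvd y j - 1" for y
 proof
  fix j show "y j = 1$Zp j"
   using d[of j] padic_mod[OF y, of j] by (simp add: padic_sel(3) mod_eq_dvd_iff[symmetric])
 qed
 have fac: "y ^ k - 1 = (y - 1) * (\<Sum>i<k. y ^ i)" for y :: int and k
  by (rule power_diff_1_eq)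
 have pw: "int p ^ j dvd y j ^ k - 1" if "y \<in>$Zp" "y ^$Zp k = 1$Zp" for y and k :: nat and j
  using fun_cong[OF that(2), of j] that(1) by (simp add: padic_pow padic_sel(3) mod_eq_dvd_iff)
 show ?case
 proof (cases "p dvd n")
  case False
  show ?thesis
  proof (rule eq1[OF x])
   fix j show "int p ^ j dvd x j - 1"
   proof (cases "j = 0")
    case j: False
    have "[(\<Sum>k<n. x j ^ k) = int n] (mod int p)" using geometric_cofactor(1) a j by blast
    hence "\<not> int p dvd (\<Sum>k<n. x j ^ k)" using False by (simp add: cong_dvd_iff)
    hence "coprime (int p) (\<Sum>k<n. x j ^ k)" using prime by (intro prime_imp_coprime) simp_all
    hence "coprime (int p ^ j) (\<Sum>k<n. x j ^ k)" by simp
    moreover have "int p ^ j dvd (x j - 1) * (\<Sum>k<n. x j ^ k)"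
     using pw[OF x less.prems(4), of j] by (simp add: fac)
    ultimately show ?thesis using coprime_dvd_mult_left_iff by blast
   qed simp
  qed
 next
  case True
  then obtain m where m: "n = p * m" by (auto simp: dvd_def)
  have m0: "m > 0" "m < n" using less.prems(3) m prime_gt_1_nat[OF prime] by auto
  define z where "z = x ^$Zp m"
  have z: "z \<in>$Zp" using x by (simp add: z_def)
  have z1: "z 1 = 1" using x less.prems(2) p_gt_1 by (simp add: z_def residue_simps[unfolded One_nat_def])
  have zp: "z ^$Zp p = 1$Zp" using less.prems(4) x m by (simp add: z_def Zp.nat_pow_pow mult.commute)
  have "z = 1$Zp"
  proof (rule eq1[OF z])
   fix j
   \<comment> \<open>One level above the target, because cancelling the cofactor costs one factor
     p.\<close>
   let ?a = "z (Suc j)"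
   have az: "int p dvd ?a - 1"
    using padic_mod_le[OF z, of 1 "Suc j"] z1 p_gt_1 by (simp add: mod_eq_dvd_iff[symmetric])
   have "[(\<Sum>k<p. ?a ^ k) = int p] (mod (int p)\<^sup>2)" by (rule geometric_cofactor(2)[OF az])
   then obtain q where "(\<Sum>k<p. ?a ^ k) - int p = (int p)\<^sup>2 * q" unfolding cong_iff_dvd_diff by (auto simp: dvd_def)
   hence S: "(\<Sum>k<p. ?a ^ k) = int p * (1 + int p * q)" by (simp add: algebra_simps power2_eq_square)
   have "int p ^ Suc j dvd (?a - 1) * (\<Sum>k<p. ?a ^ k)" using pw[OF z zp, of "Suc j"] by (simp only: fac)
   hence "int p * int p ^ j dvd int p * ((?a - 1) * (1 + int p * q))" by (simp add: S mult_ac)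
   hence d: "int p ^ j dvd (?a - 1) * (1 + int p * q)" using p_gt_1 by (simp only: dvd_mult_cancel_left) auto
   have "coprime (int p) (1 + int p * q)"
   proof (rule prime_imp_coprime)
    show "prime (int p)" using prime by simp
    show "\<not> int p dvd 1 + int p * q" using p_gt_1 by (simp add: dvd_add_left_iff)
   qed
   hence "coprime (int p ^ j) (1 + int p * q)" by simp
   hence "int p ^ j dvd ?a - 1" using d coprime_dvd_mult_left_iff by blast
   hence "?a mod int p ^ j = 1 mod int p ^ j" by (simp add: mod_eq_dvd_iff)
   moreover have "?a mod int p ^ j = z j mod int p ^ j" by (rule padic_Suc[OF z])
   ultimately show "int p ^ j dvd z j - 1" by (simp add: mod_eq_dvd_iff[symmetric])
  qed
  thus ?thesis using less.IH[OF m0(2) x less.prems(2) m0(1)] by (simp add: z_def)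
 qed
qed

text \<open>The residue of x cannot be 1, as this would force x = 1; so x - 1 has nonzero
  residue.\<close>

lemma root_of_unity_minus_one:
 assumes x: "x \<in>$Zp" and n: "n > 0" "x ^$Zp (n::nat) = 1$Zp" and "x \<noteq> 1$Zp"
 shows "x -$Zp 1$Zp \<in> Units Zp"
proof (rule padic_unit)
 have "x 1 \<noteq> 1" using assms padic_root_of_unity by blast
 moreover have "0 \<le> x 1" "x 1 < int p" using padic_range[OF x, of 1] by auto
 ultimately have "(x 1 - 1) mod int p \<noteq> 0"
  using p_gt_1 by (metis mod_eq_dvd_iff dvd_eq_mod_eq_0 mod_pos_pos_trivial zero_le_one)
 thus "(x -$Zp 1$Zp) 1 \<noteq> 0" using x by (simp add: residue_simps[unfolded One_nat_def])
qed (use x in simp)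

lemma of_nat_unit: "\<not> p dvd k ==> [(k::nat)] \<cdot>$Zp 1$Zp \<in> Units Zp"
 by (rule padic_unit) (simp_all only: residue_simps, auto simp: dvd_eq_mod_eq_0 simp flip: of_nat_mod)

end

section \<open>The ring \<open>\<int>\<^sub>p[\<zeta>]\<close>\<close>

text \<open>Multiplying the sum for n by y shifts its index by one; adding both sums is Pascal's
  rule.\<close>

lemma (in cring) binomial_one_plus:
 assumes y: "y \<in>$R"
 shows "(\<one> \<oplus> y) [^] n = (\<Oplus>k\<in>{..n}. [(n choose k)] \<cdot> (y [^] k))"
proof (induction n)
 case 0
 thus ?case using y by simp
next
 case (Suc n)
 define f where "f k = [(n choose k)] \<cdot> (y [^] k)" for k
 define g where "g k = (if k = 0 then \<zero> else [(n choose (k - 1))] \<cdot> (y [^] k))" for k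
 have f: "f k \<in>$R" and g: "g k \<in>$R" for k using y by (simp_all add: f_def g_def)
 have f2: "finsum R f {..Suc n} = finsum R f {..n}"
  using f finsum_Suc[of f n] by (simp add: f_def binomial_eq_0)
 have "y \<otimes> finsum R f {..n} = (\<Oplus>k\<in>{..n}. y \<otimes> f k)" using f y by (intro finsum_rdistr) auto
 also have "\<dots> = (\<Oplus>k\<in>{..n}. g (Suc k))"
  using y f by (intro finsum_cong' refl) (auto simp: f_def g_def add_pow_rdistr m_comm)
 also have "\<dots> = (\<Oplus>k\<in>{..n}. g (Suc k)) \<oplus> g 0"
  using g finsum_closed[of "%k. g (Suc k)" "{..n}"] by (simp add: g_def[of 0])
 also have "\<dots> = finsum R g {..Suc n}" by (rule finsum_Suc2[symmetric]) (use g in auto)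
 finally have g2: "y \<otimes> finsum R f {..n} = finsum R g {..Suc n}" .
 have fs: "finsum R f A \<in>$R" for A using f by (intro finsum_closed) auto
 have fn: "(\<one> \<oplus> y) [^] n = finsum R f {..n}" using Suc by (simp add: f_def[abs_def])
 have "(\<one> \<oplus> y) [^] Suc n = (\<one> \<oplus> y) \<otimes> finsum R f {..n}"
  using y fs by (simp add: fn m_comm)
 also have "\<dots> = finsum R f {..Suc n} \<oplus> finsum R g {..Suc n}"
  unfolding f2 g2[symmetric] using y fs by (simp add: l_distr)
 also have "\<dots> = (\<Oplus>k\<in>{..Suc n}. f k \<oplus> g k)" using f g by (intro finsum_addf[symmetric]) auto
 also have "\<dots> = (\<Oplus>k\<in>{..Suc n}. [(Suc n choose k)] \<cdot> (y [^] k))"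
 proof (intro finsum_cong' refl)
  fix k
  show "f k \<oplus> g k = [(Suc n choose k)] \<cdot> (y [^] k)"
   using y by (cases k) (simp_all add: f_def g_def add.nat_pow_mult add.commute)
 qed (use y in auto)
 finally show ?case .
qed

context padic
begin

abbreviation "P \<equiv> UP Zp"

lemma UP_cring_Zp: "UP_cring Zp"
 by (simp add: UP_cring_def padic_cring)

interpretation U: UP_cring Zp "UP Zp"
 by (rule UP_cring_Zp) simp

definition PHI :: "nat => nat => int" where
 "PHI = (\<Oplus>$P k\<in>{..<p}. monom P 1$Zp k)"

abbreviation "IP \<equiv> cyclo_ideal p"
abbreviation "Z \<equiv> Zp_zeta p"
abbreviation "\<kappa> \<equiv> zeta_const p"
abbreviation "\<zeta> \<equiv> zeta p"

definition qmap :: "(nat => nat => int) => (nat => nat => int) set" where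
 "qmap f = IP +>$P f"

lemma PHI_closed: "PHI \<in>$P"
 unfolding PHI_def by (rule U.P.finsum_closed) simp

lemma IP_eq: "IP = {x *$P PHI | x. x \<in>$P}"
 by (simp add: cyclo_ideal_def Let_def PHI_def cgenideal_def)

lemma IP_ideal: "ideal IP P"
 using U.P.cgenideal_ideal[OF PHI_closed] by (simp add: IP_eq cgenideal_def)

interpretation I: ideal IP P by (rule IP_ideal)

lemma Z_cring: "cring Z"
 unfolding Zp_zeta_def by (rule I.quotient_is_cring[OF U.P.cring_axioms])

interpretation Z: cring Z by (rule Z_cring)

lemma qmap_hom: "qmap \<in> ring_hom P Z"
 using I.rcos_ring_hom by (simp add: Zp_zeta_def qmap_def[abs_def])

lemma qmap_surj: "x \<in>$Z ==> \<exists>f\<in>carrier P. x = qmap f"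
 by (auto simp: Zp_zeta_def FactRing_def A_RCOSETS_def' qmap_def)

lemma qmap_zero_iff: "f \<in>$P ==> qmap f = 0$Z \<longleftrightarrow> f \<in> IP"
 using U.P.a_coset_join1[of IP f] U.P.a_coset_join2[of f IP] I.a_subgroup
 by (auto simp: qmap_def Zp_zeta_def FactRing_def)

lemma kappa_eq: "\<kappa> c = qmap (monom P c 0)"
 by (simp add: zeta_const_def qmap_def)

lemma zeta_eq: "\<zeta> = qmap (monom P 1$Zp 1)"
 by (simp add: zeta_def qmap_def)

lemma kappa_hom: "\<kappa> \<in> ring_hom Zp Z"
 using ring_hom_trans[OF U.const_ring_hom qmap_hom] by (simp add: kappa_eq[abs_def] comp_def)

lemma kappa_closed [simp]: "c \<in>$Zp ==> \<kappa> c \<in>$Z"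
 by (rule ring_hom_closed[OF kappa_hom])

lemma kappa_simps:
 "[|c \<in>$Zp; d \<in>$Zp|] ==> \<kappa> (c +$Zp d) = \<kappa> c +$Z \<kappa> d"
 "[|c \<in>$Zp; d \<in>$Zp|] ==> \<kappa> (c *$Zp d) = \<kappa> c *$Z \<kappa> d"
 "\<kappa> 1$Zp = 1$Z" "\<kappa> 0$Zp = 0$Z"
 using kappa_hom ring_hom_zero[OF kappa_hom] Zp.ring_axioms Z.ring_axioms
 by (simp_all add: ring_hom_add ring_hom_mult ring_hom_one)

lemma zeta_closed [simp]: "\<zeta> \<in>$Z"
 unfolding zeta_eq by (rule ring_hom_closed[OF qmap_hom]) simp

lemma qmap_monom: "c \<in>$Zp ==> qmap (monom P c k) = \<kappa> c *$Z \<zeta> ^$Z k"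
proof -
 assume c: "c \<in>$Zp"
 interpret q: ring_hom_cring P Z qmap
  using U.P.cring_axioms Z_cring qmap_hom by (simp add: ring_hom_cring_def ring_hom_cring_axioms_def)
 have "monom P c k = monom P c 0 *$P (monom P 1$Zp 1) ^$P k"
  using c U.monom_pow[of "1$Zp" 1 k] U.monom_mult[of c "1$Zp" 0 k] by simp
 thus ?thesis
  using c U.monom_closed[of c 0] U.monom_closed[of "1$Zp" 1] by (simp add: kappa_eq zeta_eq del: U.monom_mult)
qed

text \<open>Coordinates with respect to all p powers of \<zeta> rather than a basis of p - 1 of
  them. Exponents then reduce modulo p, and c is at the same time a coordinate vector in the group
  ring of the group generated by \<sigma>. The price is that constant vectors represent
  zero.\<close>

definition zsum :: "(nat => nat => int) => (nat => nat => int) set" where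
 "zsum c = (\<Oplus>$Z k\<in>{..<p}. \<kappa> (c k) *$Z \<zeta> ^$Z k)"

lemma qmap_finsum: "f \<in> A \<rightarrow> carrier P ==> qmap (\<Oplus>$P i\<in>A. f i) = (\<Oplus>$Z i\<in>A. qmap (f i))"
 by (rule additive_finsum[OF U.P.abelian_group_axioms Z.abelian_group_axioms])
  (use qmap_hom in "auto simp: ring_hom_closed ring_hom_add")

lemma zsum_qmap:
 assumes "!!k. c k \<in>$Zp" shows "zsum c = qmap (\<Oplus>$P k\<in>{..<p}. monom P (c k) k)"
 using assms by (subst qmap_finsum) (auto simp: zsum_def qmap_monom)

lemma zeta_sum: "(\<Oplus>$Z k\<in>{..<p}. \<zeta> ^$Z k) = 0$Z"
proof -
 have "PHI \<in> IP" unfolding IP_eq using PHI_closed U.P.l_one[OF PHI_closed] by (metis (mono_tags, lifting) U.P.one_closed mem_Collect_eq)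
 hence "qmap PHI = 0$Z" using qmap_zero_iff[OF PHI_closed] by simp
 moreover have "qmap PHI = zsum (%_. 1$Zp)" by (subst zsum_qmap) (simp_all add: PHI_def)
 moreover have "zsum (%_. 1$Zp) = (\<Oplus>$Z k\<in>{..<p}. \<zeta> ^$Z k)"
  unfolding zsum_def by (intro Z.finsum_cong' refl) (auto simp: kappa_simps)
 ultimately show ?thesis by simp
qed

text \<open>From the sum of \<zeta>^k over 0 \<le> k \<le> p split off the last term or the first:
  the rest is zero both times, so \<zeta>^p and 1 agree.\<close>

lemma zeta_pow_p: "\<zeta> ^$Z p = 1$Z"
proof -
 obtain n where n: "p = Suc n" using prime_gt_0_nat[OF prime] gr0_implies_Suc by blast
 have c: "(%k. \<zeta> ^$Z k) \<in> A \<rightarrow> carrier Z" for A :: "nat set" by auto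
 have s: "(\<Oplus>$Z k\<in>{..n}. \<zeta> ^$Z k) = 0$Z"
  using zeta_sum by (simp add: n lessThan_Suc_atMost)
 have s1: "(\<Oplus>$Z k\<in>{..Suc n}. \<zeta> ^$Z k) = \<zeta> ^$Z Suc n"
  by (subst Z.finsum_Suc) (simp_all add: s del: Z.nat_pow_Suc)
 have "(\<Oplus>$Z k\<in>{..n}. \<zeta> ^$Z Suc k) = (\<Oplus>$Z k\<in>{..n}. \<zeta> ^$Z k) *$Z \<zeta>"
  by (subst Z.finsum_ldistr) simp_all
 hence s2: "(\<Oplus>$Z k\<in>{..Suc n}. \<zeta> ^$Z k) = 1$Z"
  by (subst Z.finsum_Suc2) (simp_all add: s)
 show ?thesis using s1 s2 by (simp add: n)
qed

lemma zeta_pow_mod: "\<zeta> ^$Z (k mod p) = \<zeta> ^$Z k"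
proof -
 have "\<zeta> ^$Z (p * (k div p) + k mod p) = \<zeta> ^$Z (k mod p)"
  by (subst Z.nat_pow_mult[symmetric]) (simp_all add: Z.nat_pow_pow[symmetric] zeta_pow_p)
 thus ?thesis by simp
qed

lemma zeta_pow_cong: "[k = l] (mod p) ==> \<zeta> ^$Z k = \<zeta> ^$Z l"
 using zeta_pow_mod[of k] zeta_pow_mod[of l] by (simp add: cong_def)

lemma zsum_closed: "(!!k. c k \<in>$Zp) ==> zsum c \<in>$Z"
 unfolding zsum_def by (intro Z.finsum_closed) auto

lemma zsum_add:
 assumes "!!k. c k \<in>$Zp" "!!k. d k \<in>$Zp"
 shows "zsum (%k. c k +$Zp d k) = zsum c +$Z zsum d"
proof -
 have "zsum (%k. c k +$Zp d k) = (\<Oplus>$Z k\<in>{..<p}. \<kappa> (c k) *$Z \<zeta> ^$Z k +$Z \<kappa> (d k) *$Z \<zeta> ^$Z k)"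
  unfolding zsum_def using assms by (intro Z.finsum_cong' refl) (auto simp: kappa_simps Z.l_distr)
 also have "\<dots> = zsum c +$Z zsum d"
  unfolding zsum_def using assms by (intro Z.finsum_addf) auto
 finally show ?thesis .
qed

lemma zsum_single:
 assumes "a \<in>$Zp"
 shows "\<kappa> a *$Z \<zeta> ^$Z i = zsum (%k. if k = i mod p then a else 0$Zp)"
proof -
 have "zsum (%k. if k = i mod p then a else 0$Zp)
   = (\<Oplus>$Z k\<in>{..<p}. if k = i mod p then \<kappa> a *$Z \<zeta> ^$Z i else 0$Z)"
  unfolding zsum_def using assms by (intro Z.finsum_cong' refl) (auto simp: kappa_simps zeta_pow_mod)
 also have "\<dots> = \<kappa> a *$Z \<zeta> ^$Z i"
  using assms prime_gt_0_nat[OF prime] by (intro Z.finsum_delta) auto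
 finally show ?thesis ..
qed

lemma zsum_span:
 assumes "x \<in>$Z"
 obtains c where "!!k. c k \<in>$Zp" "x = zsum c"
proof -
 let ?W = "{zsum c | c. \<forall>k. c k \<in>$Zp}"
 have W0: "0$Z \<in> ?W"
 proof -
  have "zsum (%_. 0$Zp) = (\<Oplus>$Z k\<in>{..<p}. 0$Z)"
   unfolding zsum_def by (intro Z.finsum_cong' refl) (auto simp: kappa_simps)
  thus ?thesis by (intro CollectI exI[of _ "%_. 0$Zp"]) simp
 qed
 have Wadd: "u +$Z v \<in> ?W" if "u \<in> ?W" "v \<in> ?W" for u v
 proof -
  obtain c d where cd: "u = zsum c" "v = zsum d" "!!k. c k \<in>$Zp" "!!k. d k \<in>$Zp"
   using \<open>u \<in> ?W\<close> \<open>v \<in> ?W\<close> by blast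
  show ?thesis
   unfolding cd(1,2) using zsum_add[of c d] cd(3,4)
   by (intro CollectI exI[of _ "%k. c k +$Zp d k"]) simp
 qed
 have Wsingle: "\<kappa> a *$Z \<zeta> ^$Z i \<in> ?W" if "a \<in>$Zp" for a and i :: nat
  unfolding zsum_single[OF that] using that
  by (intro CollectI exI[of _ "%k. if k = i mod p then a else 0$Zp"]) simp
 obtain f where f: "f \<in>$P" "x = qmap f" using qmap_surj[OF assms] by blast
 have "x = qmap (\<Oplus>$P i\<in>{..deg Zp f}. monom P (coeff P f i) i)"
  using U.up_repr[OF f(1)] f(2) by simp
 also have "\<dots> = (\<Oplus>$Z i\<in>{..deg Zp f}. \<kappa> (coeff P f i) *$Z \<zeta> ^$Z i)"
  using f(1) by (subst qmap_finsum) (auto simp: qmap_monom)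
 also have "\<dots> \<in> ?W"
 proof -
  have "(\<Oplus>$Z i\<in>A. \<kappa> (coeff P f i) *$Z \<zeta> ^$Z i) \<in> ?W" if "finite A" for A
   using that
  proof (induction A rule: finite_induct)
   case (insert a A)
   have "(\<Oplus>$Z i\<in>insert a A. \<kappa> (coeff P f i) *$Z \<zeta> ^$Z i) =
     \<kappa> (coeff P f a) *$Z \<zeta> ^$Z a +$Z (\<Oplus>$Z i\<in>A. \<kappa> (coeff P f i) *$Z \<zeta> ^$Z i)"
    using insert.hyps f(1) by (intro Z.finsum_insert) auto
   also have "\<dots> \<in> ?W" by (intro Wadd Wsingle insert.IH U.coeff_closed f(1))
   finally show ?case .
  qed (use W0 in simp)
  thus ?thesis by simp
 qed
 finally show thesis using that by blast
qed

text \<open>The polynomial with coefficients c is a product g \<open>PHI\<close>. By descending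
  induction on m \<ge> 1 the coefficient m of g is the only contribution in degree m + p - 1, where
  the polynomial has no term. So g is constant, and every c n equals this constant.\<close>

lemma zsum_eq_zero:
 assumes c: "!!k. c k \<in>$Zp" and z: "zsum c = 0$Z" and n: "n < p"
 shows "c n = c 0"
proof -
 define f where "f = (\<Oplus>$P k\<in>{..<p}. monom P (c k) k)"
 have f: "f \<in>$P" unfolding f_def using c by (intro U.P.finsum_closed) auto
 have coeff_sum: "coeff P (\<Oplus>$P k\<in>{..<p}. monom P (d k) k) m = (if m < p then d m else 0$Zp)"
  if d: "!!k. d k \<in>$Zp" for d m
 proof -
  have "coeff P (\<Oplus>$P k\<in>{..<p}. monom P (d k) k) m = (\<Oplus>$Zp k\<in>{..<p}. if k = m then d m else 0$Zp)"
   using d by (subst U.coeff_finsum) (auto intro!: Zp.finsum_cong')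
  also have "\<dots> = (if m < p then d m else 0$Zp)"
  proof (cases "m < p")
   case True
   thus ?thesis using d Zp.finsum_delta[of "{..<p}" m "d m"] by simp
  next
   case False
   hence "(\<Oplus>$Zp k\<in>{..<p}. if k = m then d m else 0$Zp) = (\<Oplus>$Zp k\<in>{..<p}. 0$Zp)"
    by (intro Zp.finsum_cong' refl) auto
   thus ?thesis using False by simp
  qed
  finally show ?thesis .
 qed
 have "f \<in> IP" using z zsum_qmap[OF c] qmap_zero_iff[OF f] by (simp add: f_def)
 then obtain g where g: "g \<in>$P" "f = g *$P PHI" unfolding IP_eq by blast
 let ?g = "coeff P g"
 have gc: "?g i \<in>$Zp" for i using g(1) by simp
 have cf: "(if m < p then c m else 0$Zp) = (\<Oplus>$Zp i\<in>{..m}. if m - i < p then ?g i else 0$Zp)" for m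
 proof -
  have "(if m < p then c m else 0$Zp) = coeff P f m" by (simp add: f_def coeff_sum c)
  also have "\<dots> = (\<Oplus>$Zp i\<in>{..m}. ?g i *$Zp coeff P PHI (m - i))"
   unfolding g(2) by (rule U.coeff_mult[OF g(1) PHI_closed])
  also have "\<dots> = (\<Oplus>$Zp i\<in>{..m}. if m - i < p then ?g i else 0$Zp)"
   using gc coeff_sum[of "%_. 1$Zp"] by (intro Zp.finsum_cong' refl) (auto simp: PHI_def)
  finally show ?thesis .
 qed
 have delta: "(\<Oplus>$Zp i\<in>{..m}. if m - i < p then ?g i else 0$Zp) = ?g l"
  if "l \<le> m" "m - l < p" "!!i. i \<le> m ==> i < l ==> \<not> m - i < p" "!!i. i > l ==> ?g i = 0$Zp" for m l
 proof -
  have "(\<Oplus>$Zp i\<in>{..m}. if m - i < p then ?g i else 0$Zp) = (\<Oplus>$Zp i\<in>{..m}. if i = l then ?g l else 0$Zp)"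
  proof (intro Zp.finsum_cong' refl)
   fix i assume "i \<in> {..m}"
   thus "(if m - i < p then ?g i else 0$Zp) = (if i = l then ?g l else 0$Zp)"
    using that(2) that(3)[of i] that(4)[of i] by (cases i l rule: linorder_cases) auto
  qed (use gc in auto)
  also have "\<dots> = ?g l" using that(1) gc by (intro Zp.finsum_delta) auto
  finally show ?thesis .
 qed
 have "?g m = 0$Zp" if "m \<ge> 1" for m
  using that
 proof (induction "deg Zp g - m" arbitrary: m rule: less_induct)
  case (less m)
  have hi: "?g i = 0$Zp" if "i > m" for i
  proof (cases "i \<le> deg Zp g")
   case True
   thus ?thesis using less.hyps[of i] that less.prems by simp
  next
   case False
   thus ?thesis using U.deg_aboveD[of g i] g(1) by simp
  qed
  have "p > 0" "\<not> m + p - 1 < p" using prime_gt_0_nat[OF prime] less.prems by simp_all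
  hence "0$Zp = ?g m"
   using cf[of "m + p - 1"] delta[of m "m + p - 1"] hi less.prems by simp
  thus ?case by simp
 qed
 hence hi: "?g i = 0$Zp" if "i > 0" for i using that by simp
 have "c m = ?g 0" if "m < p" for m
  using cf[of m] delta[of 0 m] hi that by simp
 thus ?thesis using n by auto
qed

subsection \<open>The uniformiser \<open>1 - \<zeta>\<close> and units\<close>

definition pi_zeta :: "(nat => nat => int) set" where
 "pi_zeta = 1$Z -$Z \<zeta>"

abbreviation "\<pi> \<equiv> pi_zeta"
abbreviation "pp \<equiv> [p] \<cdot>$Zp 1$Zp"

lemma pi_closed [simp]: "\<pi> \<in>$Z"
 by (simp add: pi_zeta_def)

lemma kappa_add_pow:
 assumes "c \<in>$Zp" shows "\<kappa> ([(k::nat)] \<cdot>$Zp c) = [k] \<cdot>$Z \<kappa> c"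
 using assms by (induction k) (simp_all add: kappa_simps)

lemma smult_kappa:
 assumes "x \<in>$Z" shows "[(k::nat)] \<cdot>$Z x = \<kappa> ([k] \<cdot>$Zp 1$Zp) *$Z x"
 using assms by (simp add: kappa_add_pow kappa_simps Z.add_pow_ldistr)

text \<open>\<open>1 - \<zeta>\<^sup>k = (1 - \<zeta>) (1 + \<zeta> + \<dots> + \<zeta>\<^sup>k\<^sup>-\<^sup>1)\<close>, and the cofactor is \<open>k\<close> modulo \<open>1 - \<zeta>\<close>.\<close>

lemma one_minus_zeta_pow:
 obtains y where "y \<in>$Z" "1$Z -$Z \<zeta> ^$Z (k::nat) = \<pi> *$Z (\<kappa> ([k] \<cdot>$Zp 1$Zp) +$Z \<pi> *$Z y)"
proof -
 have "\<exists>y\<in>carrier Z. 1$Z -$Z \<zeta> ^$Z k = \<pi> *$Z (\<kappa> ([k] \<cdot>$Zp 1$Zp) +$Z \<pi> *$Z y)"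
 proof (induction k)
  case 0
  show ?case by (intro bexI[of _ "0$Z"]) (simp_all add: kappa_simps Z.r_neg a_minus_def)
 next
  case (Suc k)
  then obtain y where y: "y \<in>$Z"
   "1$Z -$Z \<zeta> ^$Z k = \<pi> *$Z (\<kappa> ([k] \<cdot>$Zp 1$Zp) +$Z \<pi> *$Z y)" by blast
  define m where "m = \<kappa> ([k] \<cdot>$Zp 1$Zp)"
  define z where "z = \<zeta> ^$Z k"
  have mz: "m \<in>$Z" "z \<in>$Z" by (simp_all add: m_def z_def)
  have zm: "z = 1$Z -$Z \<pi> *$Z (m +$Z \<pi> *$Z y)"
   unfolding m_def y(2)[symmetric] z_def[symmetric] using mz by algebra
  have zeta: "\<zeta> = 1$Z -$Z \<pi>" unfolding pi_zeta_def using zeta_closed Z.one_closed by algebra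
  have "1$Z -$Z z *$Z \<zeta> = \<pi> *$Z ((1$Z +$Z m) +$Z \<pi> *$Z (y -$Z (m +$Z \<pi> *$Z y)))"
   unfolding zm zeta using mz(1) y(1) pi_closed Z.one_closed by algebra
  moreover have "\<kappa> ([Suc k] \<cdot>$Zp 1$Zp) = 1$Z +$Z m"
   using mz by (simp add: m_def kappa_simps Z.a_comm)
  ultimately show ?case
   using mz y(1) by (intro bexI[of _ "y -$Z (m +$Z \<pi> *$Z y)"]) (simp_all add: z_def)
 qed
 thus thesis using that by blast
qed

text \<open>Sum 1 = (1 - \<zeta>^k) + \<zeta>^k over k < p: the powers of \<zeta> add up to zero,
  and \<pi> divides the other terms.\<close>

lemma p_in_pi: "\<exists>w\<in>carrier Z. \<kappa> pp = \<pi> *$Z w"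
proof -
 have "\<exists>y. y \<in>$Z \<and> 1$Z -$Z \<zeta> ^$Z (k::nat) = \<pi> *$Z y" for k
  using one_minus_zeta_pow[of k] by (metis Z.a_closed Z.m_closed kappa_closed pi_closed Zp.add.nat_pow_closed Zp.one_closed)
 then obtain y where y: "!!k. y k \<in>$Z" "!!k::nat. 1$Z -$Z \<zeta> ^$Z k = \<pi> *$Z y k" by metis
 have "(\<Oplus>$Z k\<in>{..<p}. 1$Z) = (\<Oplus>$Z k\<in>{..<p}. \<pi> *$Z y k +$Z \<zeta> ^$Z k)"
  by (intro Z.finsum_cong' refl)
   (use y(1) in "auto simp: y(2)[symmetric] a_minus_def Z.a_assoc Z.l_neg")
 also have "\<dots> = (\<Oplus>$Z k\<in>{..<p}. \<pi> *$Z y k) +$Z 0$Z"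
  unfolding zeta_sum[symmetric] using y(1) by (intro Z.finsum_addf) auto
 also have "\<dots> = \<pi> *$Z (\<Oplus>$Z k\<in>{..<p}. y k)"
  using y(1) by (subst Z.finsum_rdistr) (auto intro!: Z.r_zero Z.finsum_closed)
 finally have "(\<Oplus>$Z k\<in>{..<p}. 1$Z) = \<pi> *$Z (\<Oplus>$Z k\<in>{..<p}. y k)" .
 moreover have "(\<Oplus>$Z k\<in>{..<p}. 1$Z) = \<kappa> pp"
  using Z.add.finprod_const[of "1$Z" "{..<p}"] by (simp add: kappa_add_pow kappa_simps)
 ultimately show ?thesis using y(1) by (intro bexI[of _ "\<Oplus>$Z k\<in>{..<p}. y k"]) auto
qed

text \<open>In the binomial expansion of (1 - \<zeta>)^p the inner coefficients are divisible by p,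
  and the outer terms 1 and (- \<zeta>)^p = - 1 cancel since p is odd.\<close>

lemma pi_pow_p: "\<exists>w\<in>carrier Z. \<pi> ^$Z p = \<kappa> pp *$Z w"
proof -
 define y where "y = \<ominus>$Z \<zeta>"
 have y: "y \<in>$Z" by (simp add: y_def)
 define f where "f k = [(p choose k)] \<cdot>$Z (y ^$Z k)" for k
 have f: "f k \<in>$Z" for k using y by (simp add: f_def)
 have yp: "y ^$Z p = \<ominus>$Z 1$Z"
 proof -
  have "y ^$Z n = (if even n then \<zeta> ^$Z n else \<ominus>$Z (\<zeta> ^$Z n))" for n :: nat
   by (induction n) (auto simp: y_def Z.l_minus Z.r_minus)
  thus ?thesis using odd by (simp add: zeta_pow_p)
 qed
 have mid: "\<exists>w\<in>carrier Z. f k = \<kappa> pp *$Z w" if "k \<in> {1..<p}" for k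
 proof -
  have "p dvd p choose k" using that prime by (intro dvd_choose_prime) auto
  then obtain m where m: "p choose k = p * m" by (auto simp: dvd_def)
  have "f k = [p] \<cdot>$Z ([m] \<cdot>$Z (y ^$Z k))"
   using y by (simp add: f_def m Z.add.nat_pow_pow mult.commute)
  thus ?thesis using y smult_kappa[of "[m] \<cdot>$Z (y ^$Z k)" p] by auto
 qed
 then obtain w where w: "!!k. k \<in> {1..<p} ==> w k \<in>$Z \<and> f k = \<kappa> pp *$Z w k" by metis
 have p1: "p > 1" using prime_gt_1_nat[OF prime] .
 have set: "{..p} = insert 0 (insert p {1..<p})" using p1 by auto
 have "\<pi> ^$Z p = finsum Z f {..p}"
  using Z.binomial_one_plus[OF y, of p] by (simp add: pi_zeta_def y_def f_def[abs_def] a_minus_def)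
 also have "\<dots> = f 0 +$Z (f p +$Z finsum Z f {1..<p})"
  unfolding set using f p1 by (subst Z.finsum_insert; simp)+
 also have "f 0 = 1$Z" by (simp add: f_def)
 also have "f p = \<ominus>$Z 1$Z" by (simp add: f_def yp)
 also have "finsum Z f {1..<p} = (\<Oplus>$Z k\<in>{1..<p}. \<kappa> pp *$Z w k)"
  using w by (intro Z.finsum_cong' refl) auto
 also have "\<dots> = \<kappa> pp *$Z (\<Oplus>$Z k\<in>{1..<p}. w k)"
  using w by (intro Z.finsum_rdistr[symmetric]) auto
 finally have "\<pi> ^$Z p = \<kappa> pp *$Z (\<Oplus>$Z k\<in>{1..<p}. w k)"
  using w Z.r_neg1[of "\<ominus>$Z 1$Z"] by (simp add: Z.a_assoc[symmetric] Z.r_neg Pi_iff)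
 moreover have "(\<Oplus>$Z k\<in>{1..<p}. w k) \<in>$Z" using w by (intro Z.finsum_closed) auto
 ultimately show ?thesis by blast
qed

text \<open>As \<zeta> is congruent to 1 modulo \<pi>, an element is congruent to the sum of its
  coordinates; so Z_p maps onto the quotient by \<pi>.\<close>

lemma residue_decomp:
 assumes "x \<in>$Z"
 obtains a y where "a \<in>$Zp" "y \<in>$Z" "x = \<kappa> a +$Z \<pi> *$Z y"
proof -
 let ?W = "{\<kappa> a +$Z \<pi> *$Z y | a y. a \<in>$Zp \<and> y \<in>$Z}"
 have Wadd: "u +$Z v \<in> ?W" if u: "u \<in> ?W" and v: "v \<in> ?W" for u v
 proof -
  obtain a y b z where *: "a \<in>$Zp" "y \<in>$Z" "u = \<kappa> a +$Z \<pi> *$Z y"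
   "b \<in>$Zp" "z \<in>$Z" "v = \<kappa> b +$Z \<pi> *$Z z"
   using u v by blast
  have "u +$Z v = \<kappa> (a +$Zp b) +$Z \<pi> *$Z (y +$Z z)"
   unfolding *(3,6) kappa_simps(1)[OF *(1,4)]
   using kappa_closed[OF *(1)] kappa_closed[OF *(4)] *(2,5) pi_closed by algebra
  thus ?thesis using *(1,2,4,5) by blast
 qed
 have W0: "0$Z \<in> ?W"
  by (intro CollectI exI[of _ "0$Zp"] exI[of _ "0$Z"]) (simp add: kappa_simps)
 have W1: "\<kappa> a *$Z \<zeta> ^$Z (k::nat) \<in> ?W" if a: "a \<in>$Zp" for a k
 proof -
  obtain y where y: "y \<in>$Z"
   "1$Z -$Z \<zeta> ^$Z k = \<pi> *$Z (\<kappa> ([k] \<cdot>$Zp 1$Zp) +$Z \<pi> *$Z y)"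
   by (rule one_minus_zeta_pow)
  define w where "w = \<kappa> ([k] \<cdot>$Zp 1$Zp) +$Z \<pi> *$Z y"
  have w: "w \<in>$Z" using y(1) by (simp add: w_def)
  have zk: "\<zeta> ^$Z k \<in>$Z" by simp
  have "\<zeta> ^$Z k = 1$Z -$Z (1$Z -$Z \<zeta> ^$Z k)" using zk Z.one_closed by algebra
  also have "\<dots> = 1$Z -$Z \<pi> *$Z w" using y(2) by (simp add: w_def)
  finally have "\<kappa> a *$Z \<zeta> ^$Z k = \<kappa> a *$Z (1$Z -$Z \<pi> *$Z w)" by simp
  also have "\<dots> = \<kappa> a +$Z \<pi> *$Z (\<ominus>$Z (\<kappa> a *$Z w))"
   using kappa_closed[OF a] w pi_closed Z.one_closed by algebra
  finally show ?thesis using a w by (intro CollectI exI conjI) (assumption | simp)+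
 qed
 obtain c where c: "!!k. c k \<in>$Zp" "x = zsum c" using zsum_span[OF assms] by blast
 have "(\<Oplus>$Z k\<in>A. \<kappa> (c k) *$Z \<zeta> ^$Z k) \<in> ?W" if "finite A" for A
  using that
 proof (induction A rule: finite_induct)
  case (insert a A)
  have "(\<Oplus>$Z k\<in>insert a A. \<kappa> (c k) *$Z \<zeta> ^$Z k)
    = \<kappa> (c a) *$Z \<zeta> ^$Z a +$Z (\<Oplus>$Z k\<in>A. \<kappa> (c k) *$Z \<zeta> ^$Z k)"
   using insert.hyps c(1) by (intro Z.finsum_insert) auto
  also have "\<dots> \<in> ?W" by (intro Wadd W1 insert.IH c(1))
  finally show ?case .
 qed (use W0 in simp)
 from this[of "{..<p}"] have "x \<in> ?W" by (simp add: c(2) zsum_def)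
 thus thesis using that by blast
qed

section \<open>Nakayama's lemma and units of Z_p[\<zeta>]\<close>

primrec add_span :: "(nat => nat => int) set set => nat => (nat => nat => int) set set" where
 "add_span J 0 = J"
| "add_span J (Suc k) = {w +$Z \<kappa> c *$Z \<zeta> ^$Z k | w c. w \<in> add_span J k \<and> c \<in>$Zp}"

text \<open>\<open>add_span J k\<close> is J enlarged by \<zeta>^0, ..., \<zeta>^(k-1), which is
  everything for k = p. Then the generators are removed one by one: substituting v = w + c \<zeta>^k
  in \<zeta>^k = u + p v puts (1 - p c) \<zeta>^k into the smaller span, and 1 - p c is a unit of
  Z_p.\<close>

lemma nakayama:
 assumes sub: "J \<subseteq> carrier Z" and zero: "0$Z \<in> J"
  and add: "!!x y. [|x \<in> J; y \<in> J|] ==> x +$Z y \<in> J"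
  and scal: "!!c x. [|c \<in>$Zp; x \<in> J|] ==> \<kappa> c *$Z x \<in> J"
  and gen: "!!x. x \<in>$Z ==> \<exists>u\<in>J. \<exists>v\<in>carrier Z. x = u +$Z \<kappa> pp *$Z v"
 shows "J = carrier Z"
proof -
 let ?W = "add_span J"
 have props: "?W k \<subseteq> carrier Z \<and> J \<subseteq> ?W k \<and> (\<forall>x\<in>?W k. \<forall>y\<in>?W k. x +$Z y \<in> ?W k) \<and>
   (\<forall>c\<in>carrier Zp. \<forall>x\<in>?W k. \<kappa> c *$Z x \<in> ?W k)" for k
 proof (induction k)
  case 0
  thus ?case using sub add scal by simp
 next
  case (Suc k)
  hence W: "?W k \<subseteq> carrier Z" "J \<subseteq> ?W k" "!!x y. x \<in> ?W k ==> y \<in> ?W k ==> x +$Z y \<in> ?W k"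
   "!!c x. c \<in>$Zp ==> x \<in> ?W k ==> \<kappa> c *$Z x \<in> ?W k" by blast+
  have zk: "\<zeta> ^$Z k \<in>$Z" by simp
  show ?case
  proof (intro conjI ballI)
   show "?W (Suc k) \<subseteq> carrier Z" using W(1) by auto
   show "J \<subseteq> ?W (Suc k)"
   proof
    fix x assume x: "x \<in> J"
    hence "x = x +$Z \<kappa> 0$Zp *$Z \<zeta> ^$Z k" using sub by (auto simp: kappa_simps)
    thus "x \<in> ?W (Suc k)" using x W(2) by auto
   qed
  next
   fix x y assume "x \<in> ?W (Suc k)" "y \<in> ?W (Suc k)"
   then obtain w c w' c' where *: "w \<in> ?W k" "c \<in>$Zp" "x = w +$Z \<kappa> c *$Z \<zeta> ^$Z k"
    "w' \<in> ?W k" "c' \<in>$Zp" "y = w' +$Z \<kappa> c' *$Z \<zeta> ^$Z k" by auto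
   have w: "w \<in>$Z" "w' \<in>$Z" using * W(1) by auto
   have "x +$Z y = (w +$Z w') +$Z \<kappa> (c +$Zp c') *$Z \<zeta> ^$Z k"
    unfolding *(3,6) kappa_simps(1)[OF *(2,5)]
    using w kappa_closed[OF *(2)] kappa_closed[OF *(5)] zk by algebra
   thus "x +$Z y \<in> ?W (Suc k)" using W(3)[OF *(1,4)] *(2,5) by auto
  next
   fix c x assume c: "c \<in>$Zp" and "x \<in> ?W (Suc k)"
   then obtain w d where *: "w \<in> ?W k" "d \<in>$Zp" "x = w +$Z \<kappa> d *$Z \<zeta> ^$Z k" by auto
   have w: "w \<in>$Z" using * W(1) by auto
   have "\<kappa> c *$Z x = \<kappa> c *$Z w +$Z \<kappa> (c *$Zp d) *$Z \<zeta> ^$Z k"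
    unfolding *(3) kappa_simps(2)[OF c *(2)]
    using w kappa_closed[OF *(2)] kappa_closed[OF c] zk by algebra
   thus "\<kappa> c *$Z x \<in> ?W (Suc k)" using W(4)[OF c *(1)] c *(2) by auto
  qed
 qed
 have W: "?W k \<subseteq> carrier Z" "J \<subseteq> ?W k" "!!x y. x \<in> ?W k ==> y \<in> ?W k ==> x +$Z y \<in> ?W k"
  "!!c x. c \<in>$Zp ==> x \<in> ?W k ==> \<kappa> c *$Z x \<in> ?W k" for k
  using props[of k] by blast+
 have top: "carrier Z \<subseteq> ?W p"
 proof
  fix x assume "x \<in>$Z"
  then obtain c where c: "!!k. c k \<in>$Zp" "x = zsum c" using zsum_span by blast
  have "(\<Oplus>$Z k\<in>{..<n}. \<kappa> (c k) *$Z \<zeta> ^$Z k) \<in> ?W n" for n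
  proof (induction n)
   case (Suc n)
   have "(\<Oplus>$Z k\<in>{..<Suc n}. \<kappa> (c k) *$Z \<zeta> ^$Z k)
     = (\<Oplus>$Z k\<in>{..<n}. \<kappa> (c k) *$Z \<zeta> ^$Z k) +$Z \<kappa> (c n) *$Z \<zeta> ^$Z n"
    unfolding lessThan_Suc using c(1) by (subst Z.finsum_insert) (auto intro!: Z.a_comm)
   thus ?case using Suc c(1)[of n] unfolding add_span.simps by blast
  qed (use zero in simp)
  thus "x \<in> ?W p" unfolding c(2) zsum_def .
 qed
 have step: "carrier Z \<subseteq> ?W k" if IH: "carrier Z \<subseteq> ?W (Suc k)" for k
 proof -
  have zk: "\<zeta> ^$Z k \<in>$Z" by simp
  obtain u v where uv: "u \<in> J" "v \<in>$Z" "\<zeta> ^$Z k = u +$Z \<kappa> pp *$Z v"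
   using gen[OF zk] by blast
  obtain w c where wc: "w \<in> ?W k" "c \<in>$Zp" "v = w +$Z \<kappa> c *$Z \<zeta> ^$Z k"
   using IH uv(2) by auto
  define e where "e = 1$Zp -$Zp pp *$Zp c"
  have e: "e \<in> Units Zp"
  proof (rule padic_unit)
   show "e \<in>$Zp" using wc(2) by (simp add: e_def)
   show "e 1 \<noteq> 0"
    using wc(2) p_gt_1 by (simp add: e_def residue_simps[unfolded One_nat_def])
  qed
  have ec: "e \<in>$Zp" using e by auto
  define t where "t = u +$Z \<kappa> pp *$Z w"
  have cl: "u \<in>$Z" "w \<in>$Z" "\<kappa> c \<in>$Z" "\<kappa> pp \<in>$Z"
   using uv(1) wc sub W(1) by auto
  have t: "t \<in> ?W k"
   unfolding t_def using uv(1) wc(1) W(2) by (intro W(3) W(4)) auto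
  have ke: "\<kappa> e = 1$Z -$Z \<kappa> pp *$Z \<kappa> c"
  proof -
   have "\<kappa> e +$Z \<kappa> pp *$Z \<kappa> c = \<kappa> (e +$Zp pp *$Zp c)"
    using ec wc(2) by (simp add: kappa_simps)
   also have "e +$Zp pp *$Zp c = 1$Zp"
    using wc(2) by (simp add: e_def a_minus_def Zp.a_assoc Zp.l_neg)
   finally have "\<kappa> e +$Z \<kappa> pp *$Z \<kappa> c = 1$Z" by (simp add: kappa_simps)
   thus ?thesis using cl kappa_closed[OF ec] by (metis Z.add.inv_solve_right Z.m_closed Z.one_closed a_minus_def)
  qed
  have "\<kappa> e *$Z \<zeta> ^$Z k = \<zeta> ^$Z k -$Z \<kappa> pp *$Z (\<kappa> c *$Z \<zeta> ^$Z k)"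
   unfolding ke using cl zk Z.one_closed by algebra
  also have "\<dots> = u +$Z \<kappa> pp *$Z v -$Z \<kappa> pp *$Z (\<kappa> c *$Z \<zeta> ^$Z k)"
   using uv(3) by simp
  also have "\<dots> = t" unfolding wc(3) t_def using cl zk by algebra
  finally have et: "\<kappa> e *$Z \<zeta> ^$Z k = t" .
  obtain e' where e': "e' \<in>$Zp" "e' *$Zp e = 1$Zp" using e by (auto simp: Units_def)
  have "\<zeta> ^$Z k = \<kappa> (e' *$Zp e) *$Z \<zeta> ^$Z k" unfolding e'(2) using zk by (simp add: kappa_simps)
  also have "\<dots> = \<kappa> e' *$Z t" unfolding et[symmetric] using e'(1) ec zk by (simp add: kappa_simps Z.m_assoc)
  also have "\<dots> \<in> ?W k" by (rule W(4)[OF e'(1) t])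
  finally have zW: "\<zeta> ^$Z k \<in> ?W k" .
  show ?thesis
  proof
   fix x assume "x \<in>$Z"
   then obtain w' c' where *: "w' \<in> ?W k" "c' \<in>$Zp" "x = w' +$Z \<kappa> c' *$Z \<zeta> ^$Z k"
    using IH by auto
   show "x \<in> ?W k" unfolding *(3) by (intro W(3) W(4) *(1,2) zW)
  qed
 qed
 have "carrier Z \<subseteq> ?W (p - n)" if "n \<le> p" for n
  using that
 proof (induction n)
  case (Suc n)
  hence "p - n = Suc (p - Suc n)" by simp
  thus ?case using Suc step[of "p - Suc n"] by simp
 qed (use top in simp)
 from this[of p] show ?thesis using sub by auto
qed

text \<open>Let v be the element and Z = Z_p[\<zeta>]. Every x lies in v Z + \<pi> Z because v has
  invertible residue, by iteration in v Z + \<pi>^p Z, hence in v Z + p Z. Nakayama's lemma then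
  gives v Z = Z.\<close>

lemma zeta_unit:
 assumes c: "c \<in>$Zp" "c 1 \<noteq> 0" and y: "y \<in>$Z"
 shows "\<kappa> c +$Z \<pi> *$Z y \<in> Units Z"
proof -
 define v where "v = \<kappa> c +$Z \<pi> *$Z y"
 have kc: "\<kappa> c \<in>$Z" using c(1) by simp
 have v: "v \<in>$Z" using kc y by (simp add: v_def)
 define J where "J = {v *$Z x | x. x \<in>$Z}"
 obtain c' where c': "c' \<in>$Zp" "c' *$Zp c = 1$Zp"
  using padic_unit[OF c] by (auto simp: Units_def)
 have kc': "\<kappa> c' *$Z \<kappa> c = 1$Z" using c' c(1) by (simp add: kappa_simps(2,3)[symmetric])
 have step1: "\<exists>u\<in>carrier Z. \<exists>w\<in>carrier Z. x = v *$Z u +$Z \<pi> *$Z w" if x: "x \<in>$Z" for x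
 proof -
  obtain a z where az: "a \<in>$Zp" "z \<in>$Z" "x = \<kappa> a +$Z \<pi> *$Z z" using residue_decomp[OF x] .
  have ka: "\<kappa> a \<in>$Z" and kc1: "\<kappa> c' \<in>$Z" using az(1) c'(1) by simp_all
  define u where "u = \<kappa> a *$Z \<kappa> c'"
  have u: "u \<in>$Z" using ka kc1 by (simp add: u_def)
  have "u *$Z \<kappa> c = \<kappa> a" using ka kc1 kc kc' by (simp add: u_def Z.m_assoc)
  hence "x = u *$Z \<kappa> c +$Z \<pi> *$Z z" using az(3) by simp
  also have "\<dots> = v *$Z u +$Z \<pi> *$Z (z -$Z y *$Z u)"
   unfolding v_def using kc u y az(2) pi_closed by algebra
  finally show ?thesis using u y az(2) by blast
 qed
 have stepn: "\<exists>u\<in>carrier Z. \<exists>w\<in>carrier Z. x = v *$Z u +$Z \<pi> ^$Z n *$Z w" if x: "x \<in>$Z" for x and n :: nat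
 proof (induction n)
  case 0
  show ?case using x v by (intro bexI[of _ "0$Z"] bexI[of _ x]) simp_all
 next
  case (Suc n)
  then obtain u w where uw: "u \<in>$Z" "w \<in>$Z" "x = v *$Z u +$Z \<pi> ^$Z n *$Z w" by blast
  obtain u' w' where uw': "u' \<in>$Z" "w' \<in>$Z" "w = v *$Z u' +$Z \<pi> *$Z w'" using step1[OF uw(2)] by blast
  define q where "q = \<pi> ^$Z n"
  have q: "q \<in>$Z" by (simp add: q_def)
  have "x = v *$Z (u +$Z q *$Z u') +$Z (q *$Z \<pi>) *$Z w'"
   unfolding uw(3) uw'(3) q_def[symmetric] using uw(1) uw' v q pi_closed by algebra
  thus ?case using uw(1) uw' q by (intro bexI[of _ "u +$Z q *$Z u'"] bexI[of _ w']) (simp_all add: q_def)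
 qed
 obtain w0 where w0: "w0 \<in>$Z" "\<pi> ^$Z p = \<kappa> pp *$Z w0" using pi_pow_p by blast
 have "J = carrier Z"
 proof (rule nakayama)
  show "J \<subseteq> carrier Z" using v by (auto simp: J_def)
  show "0$Z \<in> J" using v unfolding J_def by (intro CollectI exI[of _ "0$Z"]) simp
  show "x +$Z y \<in> J" if "x \<in> J" "y \<in> J" for x y
   using that v unfolding J_def by (auto simp: Z.r_distr[symmetric])
  show "\<kappa> c *$Z x \<in> J" if "c \<in>$Zp" "x \<in> J" for c x
   using that v unfolding J_def by (auto simp: Z.m_lcomm)
  show "\<exists>u\<in>J. \<exists>w\<in>carrier Z. x = u +$Z \<kappa> pp *$Z w" if x: "x \<in>$Z" for x
  proof -
   obtain u w where uw: "u \<in>$Z" "w \<in>$Z" "x = v *$Z u +$Z \<pi> ^$Z p *$Z w"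
    using stepn[OF x] by blast
   thus ?thesis using w0 v
    by (intro bexI[of _ "v *$Z u"] bexI[of _ "w0 *$Z w"]) (auto simp: J_def Z.m_assoc)
  qed
 qed
 hence "1$Z \<in> J" by simp
 then obtain x where "x \<in>$Z" "v *$Z x = 1$Z" by (auto simp: J_def)
 thus ?thesis unfolding v_def[symmetric] using v Z.m_comm[of v x] by (auto simp: Units_def)
qed

text \<open>As \<pi> divides p, the hypothesis gives p x = 0. So the coordinates of p x are all
  equal, those of x too by torsion-freeness, and a constant vector represents zero.\<close>

lemma pi_nonzero_divisor:
 assumes x: "x \<in>$Z" and z: "\<pi> *$Z x = 0$Z" shows "x = 0$Z"
proof -
 obtain w where w: "w \<in>$Z" "\<kappa> pp = \<pi> *$Z w" using p_in_pi by blast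
 obtain c where c: "!!k. c k \<in>$Zp" "x = zsum c" using zsum_span[OF x] by blast
 have "\<kappa> pp *$Z x = w *$Z (\<pi> *$Z x)" unfolding w(2) using w(1) x pi_closed by (simp add: Z.m_ac)
 hence "\<kappa> pp *$Z x = 0$Z" using z w(1) by simp
 moreover have "\<kappa> pp *$Z zsum c = zsum (%k. pp *$Zp c k)"
  unfolding zsum_def using c(1)
  by (subst Z.finsum_rdistr) (auto intro!: Z.finsum_cong' simp: kappa_simps Z.m_assoc)
 ultimately have z2: "zsum (%k. pp *$Zp c k) = 0$Z" using c(2) by simp
 have eq: "c k = c 0" if "k < p" for k
 proof -
  have "pp *$Zp c k = pp *$Zp c 0" by (rule zsum_eq_zero[OF _ z2 that]) (use c(1) in simp)
  hence "pp *$Zp (c k -$Zp c 0) = 0$Zp"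
   using c(1) by (simp add: a_minus_def Zp.r_distr Zp.r_minus Zp.r_neg)
  hence "[p] \<cdot>$Zp (c k -$Zp c 0) = 0$Zp" using c(1) padic_smult_mult[of "c k -$Zp c 0" p] by simp
  hence "c k -$Zp c 0 = 0$Zp"
   by (rule padic_torsion_free[OF _ prime_gt_0_nat[OF prime], rotated]) (use c(1) in simp)
  thus ?thesis using c(1) by (simp add: Zp.r_right_minus_eq)
 qed
 have "x = (\<Oplus>$Z k\<in>{..<p}. \<kappa> (c 0) *$Z \<zeta> ^$Z k)"
  unfolding c(2) zsum_def
 proof (rule Z.finsum_cong'[OF refl])
  fix k assume "k \<in> {..<p}"
  thus "\<kappa> (c k) *$Z \<zeta> ^$Z k = \<kappa> (c 0) *$Z \<zeta> ^$Z k" using eq[of k] by simp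
 qed (use c(1) in auto)
 also have "\<dots> = \<kappa> (c 0) *$Z 0$Z" unfolding zeta_sum[symmetric] using c(1) by (intro Z.finsum_rdistr[symmetric]) auto
 finally show ?thesis using c(1) by simp
qed

subsection \<open>The automorphism \<open>\<zeta> \<mapsto> \<zeta>\<^sup>s\<close>\<close>

text \<open>Evaluation at \<zeta>^s kills \<open>PHI\<close>, since multiplication by s permutes the
  residues modulo p. It is therefore constant on each coset, and \<open>the_elem\<close> picks that
  value.\<close>

lemma zeta_aut:
 assumes s: "coprime s p"
 shows "zeta_aut p s \<in> ring_hom Z Z" and "c \<in>$Zp ==> zeta_aut p s (\<kappa> c) = \<kappa> c"
  and "zeta_aut p s \<zeta> = \<zeta> ^$Z s"
proof -
 let ?E = "eval Zp Z \<kappa> (\<zeta> ^$Z s)"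
 interpret E: UP_pre_univ_prop Zp Z \<kappa> "UP Zp"
  using padic_cring Z_cring kappa_hom
  by (simp_all add: UP_pre_univ_prop_def ring_hom_cring_def ring_hom_cring_axioms_def UP_cring_def)
 have zs: "\<zeta> ^$Z s \<in>$Z" by simp
 have E: "?E \<in> ring_hom P Z" by (rule E.eval_ring_hom[OF zs])
 have Em: "?E (monom P c k) = \<kappa> c *$Z (\<zeta> ^$Z s) ^$Z k" if "c \<in>$Zp" for c k
  by (rule E.eval_monom[OF that zs])
 have "?E PHI = (\<Oplus>$Z k\<in>{..<p}. ?E (monom P 1$Zp k))"
  unfolding PHI_def
  by (rule additive_finsum[OF U.P.abelian_group_axioms Z.abelian_group_axioms])
   (use E in "auto simp: ring_hom_closed ring_hom_add")
 also have "\<dots> = (\<Oplus>$Z k\<in>{..<p}. \<zeta> ^$Z (s * k mod p))"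
  by (intro Z.finsum_cong' refl) (auto simp: Em kappa_simps Z.nat_pow_pow zeta_pow_mod)
 also have "\<dots> = (\<Oplus>$Z k\<in>{..<p}. \<zeta> ^$Z k)"
 proof (rule Z.finsum_bij[symmetric])
  have p0: "p > 0" using prime_gt_0_nat[OF prime] .
  have inj: "inj_on (%k. s * k mod p) {..<p}"
  proof (rule inj_onI)
   fix a b assume ab: "a \<in> {..<p}" "b \<in> {..<p}" "s * a mod p = s * b mod p"
   hence "[s * a = s * b] (mod p)" by (simp add: cong_def)
   hence "[a = b] (mod p)" using s cong_mult_lcancel_nat by blast
   thus "a = b" using ab by (simp add: cong_def)
  qed
  moreover have "(%k. s * k mod p) ` {..<p} = {..<p}"
   by (rule endo_inj_surj[OF _ _ inj]) (use p0 in auto)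
  ultimately show "bij_betw (%k. s * k mod p) {..<p} {..<p}" by (simp add: bij_betw_def)
 qed simp
 finally have EPHI: "?E PHI = 0$Z" by (simp add: zeta_sum)
 have EI: "?E f = 0$Z" if "f \<in> IP" for f
 proof -
  obtain x where x: "x \<in>$P" "f = x *$P PHI" using \<open>f \<in> IP\<close> unfolding IP_eq by blast
  show ?thesis
   unfolding x(2) ring_hom_mult[OF E x(1) PHI_closed] EPHI by (rule Z.r_null[OF ring_hom_closed[OF E x(1)]])
 qed
 have aut: "zeta_aut p s (qmap f) = ?E f" if f: "f \<in>$P" for f
 proof -
  have "?E h = ?E f" if h: "h \<in> qmap f" for h
  proof -
   obtain i where i: "i \<in> IP" "h = i +$P f" using h by (auto simp: qmap_def a_r_coset_def')
   thus ?thesis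
    using EI[OF i(1)] f I.a_Hcarr[OF i(1)] ring_hom_closed[OF E f] by (simp add: ring_hom_add[OF E])
  qed
  moreover have "f \<in> qmap f" unfolding qmap_def by (rule I.a_rcos_self[OF f])
  ultimately have "?E ` qmap f = {?E f}" by blast
  thus ?thesis by (simp add: zeta_aut_def)
 qed
 show "zeta_aut p s \<in> ring_hom Z Z"
 proof (rule ring_hom_memI)
  fix x y assume "x \<in>$Z" "y \<in>$Z"
  then obtain f g where fg: "f \<in>$P" "x = qmap f" "g \<in>$P" "y = qmap g" using qmap_surj by metis
  show "zeta_aut p s x \<in>$Z" using fg ring_hom_closed[OF E] by (simp add: aut)
  show "zeta_aut p s (x *$Z y) = zeta_aut p s x *$Z zeta_aut p s y"
   using fg aut[of "f *$P g"] ring_hom_mult[OF E fg(1,3)] ring_hom_mult[OF qmap_hom fg(1,3)] by (simp add: aut)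
  show "zeta_aut p s (x +$Z y) = zeta_aut p s x +$Z zeta_aut p s y"
   using fg aut[of "f +$P g"] ring_hom_add[OF E fg(1,3)] ring_hom_add[OF qmap_hom fg(1,3)] by (simp add: aut)
 next
  show "zeta_aut p s 1$Z = 1$Z"
   using aut[OF U.P.one_closed] ring_hom_one[OF E] ring_hom_one[OF qmap_hom] by simp
 qed
 show "zeta_aut p s (\<kappa> c) = \<kappa> c" if "c \<in>$Zp"
  using aut[of "monom P c 0"] Em[OF that, of 0] that by (simp add: kappa_eq[symmetric])
 show "zeta_aut p s \<zeta> = \<zeta> ^$Z s"
  using aut[of "monom P 1$Zp 1"] Em[of "1$Zp" 1]
  by (simp add: zeta_eq[symmetric, unfolded One_nat_def] kappa_simps)
qed

end

section \<open>The module \<open>A\<close> as a cyclic module\<close>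

lemma int_additive:
 fixes f :: "int => 'b"
 assumes B: "abelian_group B" and cl: "!!k. f k \<in>$B"
  and add: "!!k l. f (k + l) = f k +$B f l"
 shows "f k = [k] \<cdot>$B f 1"
proof -
 interpret B: abelian_group B by fact
 have z: "f 0 = 0$B" using add[of 0 0] cl[of 0] B.add.l_cancel_one' by simp
 have n: "f (int n) = [n] \<cdot>$B f 1" for n
 proof (induction n)
  case (Suc n)
  have "f (int (Suc n)) = f (int n) +$B f 1" using add[of "int n" 1] by (simp add: add.commute)
  thus ?case using Suc by simp
 qed (simp add: z)
 show ?thesis
 proof (cases "k \<ge> 0")
  case True
  thus ?thesis using n[of "nat k"] by (simp add: add_pow_int_ge)
 next
  case False
  have "f k +$B f (- k) = 0$B" using add[of k "- k"] z by simp
  hence "f k = \<ominus>$B f (- k)" using cl by (metis B.minus_equality)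
  thus ?thesis using n[of "nat (- k)"] False by (simp add: add_pow_int_lt)
 qed
qed

lemma int_sel:
 "carrier \<Z> = UNIV" "k +$\<Z> l = k + l" "k *$\<Z> l = k * l" "1$\<Z> = 1" "0$\<Z> = 0"
 by simp_all

lemma ring_hom_add_pow:
 assumes "ring R" "ring S" "h \<in> ring_hom R S" "x \<in>$R"
 shows "h ([(n::nat)] \<cdot>$R x) = [n] \<cdot>$S h x"
proof -
 interpret R: ring R by fact
 interpret S: ring S by fact
 show ?thesis
  using ring_hom_zero[OF assms(3,1,2)] assms(4) by (induction n) (simp_all add: ring_hom_add[OF assms(3)])
qed

lemma ring_hom_minus:
 assumes "ring R" "ring S" "h \<in> ring_hom R S" "x \<in>$R" "y \<in>$R"
 shows "h (x -$R y) = h x -$S h y"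
proof -
 interpret R: ring R by fact
 interpret S: ring S by fact
 have "h (\<ominus>$R y) = \<ominus>$S h y"
  by (rule additive_neg[OF R.abelian_group_axioms S.abelian_group_axioms])
   (use assms in "auto simp: ring_hom_closed ring_hom_add")
 thus ?thesis using assms by (simp add: a_minus_def ring_hom_add)
qed

locale decomp_setup = padic p + G: group G
 for p and G :: "'g monoid" +
 fixes \<Gamma> :: "'g set" and j :: 'g and D I :: "'g set" and \<phi> :: "'g set"
 assumes finG: "finite (carrier G)" and sgGamma: "subgroup \<Gamma> G" and jG: "j \<in>$G" and jn: "j \<notin> \<Gamma>"
  and jj: "j *$G j = 1$G" and jc: "g \<in>$G ==> g *$G j = j *$G g"
  and cover: "g \<in>$G ==> g \<in> \<Gamma> \<or> g *$G j \<in> \<Gamma>"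
  and sgD: "subgroup D G" and nI: "I \<lhd> G\<lparr>carrier := D\<rparr>"
  and phi: "\<phi> \<in>$(G\<lparr>carrier := D\<rparr> Mod I)"
begin

abbreviation "HD \<equiv> G\<lparr>carrier := D\<rparr>"
abbreviation "GG \<equiv> G\<lparr>carrier := \<Gamma>\<rparr>"
abbreviation "Q \<equiv> HD Mod I"
abbreviation "ZG \<equiv> group_ring \<Z> G"
abbreviation "ZH \<equiv> group_ring \<Z> HD"
abbreviation "ZQ \<equiv> group_ring \<Z> Q"
abbreviation "pG \<equiv> group_ring Zp G"
abbreviation "Lam \<equiv> group_ring Zp GG"

lemma D_sub: "d \<in> D ==> d \<in>$G" using subgroup.subset[OF sgD] by blast
lemma Gamma_sub: "g \<in> \<Gamma> ==> g \<in>$G" using subgroup.subset[OF sgGamma] by blast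

lemma group_HD: "group HD" by (rule G.subgroup_imp_group[OF sgD])
lemma group_GG: "group GG" by (rule G.subgroup_imp_group[OF sgGamma])
lemma group_Q: "group Q" by (rule normal.factorgroup_is_group[OF nI])

lemma I_sub: "I \<subseteq> D" using normal_imp_subgroup[OF nI] subgroup.subset by force

lemma carrier_Q: "carrier Q = (%d. I #>$G d) ` D"
 by (simp add: carrier_FactGroup r_coset_def)

sublocale zg: fin_group_cring \<Z> G
 by (intro fin_group_cring.intro fin_group_cring_axioms.intro int_is_cring G.is_group finG)

sublocale zh: fin_group_cring \<Z> HD
 by (intro fin_group_cring.intro fin_group_cring_axioms.intro int_is_cring group_HD)
  (use subgroup.subset[OF sgD] finG finite_subset in auto)

sublocale zq: fin_group_cring \<Z> Q
 by (intro fin_group_cring.intro fin_group_cring_axioms.intro int_is_cring group_Q)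
  (use zh.fin in "simp add: carrier_Q")

sublocale pg: fin_group_cring Zp G
 by (intro fin_group_cring.intro fin_group_cring_axioms.intro padic_cring G.is_group finG)

sublocale lam: fin_group_cring Zp GG
 by (intro fin_group_cring.intro fin_group_cring_axioms.intro padic_cring group_GG)
  (use subgroup.subset[OF sgGamma] finG finite_subset in auto)

definition u :: "'g => 'g => nat => int" where
 "u g = (if g \<in> \<Gamma> then gr_of Zp GG g else \<ominus>$Lam gr_of Zp GG (g *$G j))"

lemma u_closed: "u g \<in>$Lam"
 by (simp add: u_def lam.gr_of_closed)

lemma u_one: "u 1$G = 1$Lam"
 using subgroup.one_closed[OF sgGamma] lam.gr_of_one by (simp add: u_def)

lemma mult_j_j: "g \<in>$G ==> g *$G j *$G j = g"
 by (simp add: G.m_assoc jG jj)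

lemma Gamma_j: "g \<in>$G ==> g *$G j \<in> \<Gamma> \<longleftrightarrow> g \<notin> \<Gamma>"
proof
 assume g: "g \<in>$G" and gj: "g *$G j \<in> \<Gamma>"
 show "g \<notin> \<Gamma>"
 proof
  assume "g \<in> \<Gamma>"
  hence "inv\<^bsub>G\<^esub> g *$G (g *$G j) \<in> \<Gamma>"
   using gj subgroup.m_closed[OF sgGamma] subgroup.m_inv_closed[OF sgGamma] by blast
  thus False using g jG jn by (simp add: G.m_assoc[symmetric])
 qed
qed (use cover in blast)

lemma u_mult:
 assumes g: "g \<in>$G" and h: "h \<in>$G"
 shows "u (g *$G h) = u g *$Lam u h"
proof -
 note mc = subgroup.m_closed[OF sgGamma]
 note of_mult = lam.gr_of_mult[simplified]
 have ghj: "g *$G h *$G j = g *$G (h *$G j)" using g h jG by (simp add: G.m_assoc)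
 have gjh: "g *$G h *$G j = (g *$G j) *$G h" using g h jG jc[OF h] by (simp add: G.m_assoc)
 have gjhj: "(g *$G j) *$G (h *$G j) = g *$G h"
  using g h jG by (metis G.m_assoc G.m_closed gjh mult_j_j ghj)
 consider "g \<in> \<Gamma>" "h \<in> \<Gamma>" | "g \<in> \<Gamma>" "h *$G j \<in> \<Gamma>" "h \<notin> \<Gamma>" | "g *$G j \<in> \<Gamma>" "g \<notin> \<Gamma>" "h \<in> \<Gamma>"
  | "g *$G j \<in> \<Gamma>" "g \<notin> \<Gamma>" "h *$G j \<in> \<Gamma>" "h \<notin> \<Gamma>"
  using cover[OF g] cover[OF h] Gamma_j[OF g] Gamma_j[OF h] by blast
 thus ?thesis
 proof cases
  case 1
  thus ?thesis using mc[of g h] of_mult[of g h] by (simp add: u_def)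
 next
  case 2
  have m: "g *$G h *$G j \<in> \<Gamma>" unfolding ghj by (rule mc[OF 2(1,2)])
  hence "g *$G h \<notin> \<Gamma>" using Gamma_j[of "g *$G h"] g h by simp
  thus ?thesis using 2 of_mult[of g "h *$G j"] lam.gr_of_closed ghj
   by (simp add: u_def lam.RG.r_minus)
 next
  case 3
  have m: "g *$G h *$G j \<in> \<Gamma>" unfolding gjh by (rule mc[OF 3(1,3)])
  hence "g *$G h \<notin> \<Gamma>" using Gamma_j[of "g *$G h"] g h by simp
  thus ?thesis using 3 of_mult[of "g *$G j" h] lam.gr_of_closed gjh
   by (simp add: u_def lam.RG.l_minus)
 next
  case 4
  have m: "g *$G h \<in> \<Gamma>" using mc[OF 4(1,3)] gjhj by simp
  thus ?thesis using 4 of_mult[of "g *$G j" "h *$G j"] lam.gr_of_closed gjhj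
   by (simp add: u_def lam.RG.l_minus lam.RG.r_minus)
 qed
qed

lemma u_const_comm:
 assumes c: "c \<in>$Zp"
 shows "gr_const Zp GG c *$Lam u g = u g *$Lam gr_const Zp GG c"
 by (rule lam.gr_const_central[OF c u_closed])

text \<open>Reduction modulo 1 + j, from Z_p[G] to Z_p[\<Gamma>]; the inclusion \<open>iG\<close> is
  a section of it.\<close>

definition red :: "('g => nat => int) => 'g => nat => int" where
 "red = gr_lift G Lam (gr_const Zp GG) u"

lemma red_hom: "red \<in> ring_hom pG Lam"
 and red_mono: "[|c \<in>$Zp; g \<in>$G|] ==> red (gr_mono Zp G c g) = gr_const Zp GG c *$Lam u g"
 unfolding red_def
 by (rule pg.gr_lift[OF lam.group_ring_ring lam.gr_const_hom]; simp add: u_closed u_one u_mult u_const_comm)+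

definition kZ :: "int => nat => int" where
 "kZ k = [k] \<cdot>$Zp 1$Zp"

lemma kZ_closed: "kZ k \<in>$Zp"
 by (simp add: kZ_def)

lemma kZ_hom: "kZ \<in> ring_hom \<Z> Zp"
 by (rule ring_hom_memI, simp add: kZ_closed)
  (simp_all add: kZ_def padic_of_int, simp_all add: padic_sel mod_simps)

text \<open>The composite of Z[G] \<rightarrow> Z_p[G] with \<open>red\<close>; see
  \<open>red_conv\<close>.\<close>

definition redZ :: "('g => int) => 'g => nat => int" where
 "redZ = gr_lift G Lam (%k. gr_const Zp GG (kZ k)) u"

lemma redZ_hom: "redZ \<in> ring_hom ZG Lam"
 and redZ_mono: "g \<in>$G ==> redZ (gr_mono \<Z> G k g) = gr_const Zp GG (kZ k) *$Lam u g"
proof -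
 have c: "(%k. gr_const Zp GG (kZ k)) \<in> ring_hom \<Z> Lam"
  using ring_hom_trans[OF kZ_hom lam.gr_const_hom] by (simp add: comp_def)
 show "redZ \<in> ring_hom ZG Lam"
  unfolding redZ_def
  by (rule zg.gr_lift(1)[OF lam.group_ring_ring c]; simp add: u_closed u_one u_mult u_const_comm kZ_closed)
 show "g \<in>$G ==> redZ (gr_mono \<Z> G k g) = gr_const Zp GG (kZ k) *$Lam u g"
  unfolding redZ_def
  by (rule zg.gr_lift(2)[OF lam.group_ring_ring c]; simp add: u_closed u_one u_mult u_const_comm kZ_closed int_sel)
qed

definition iH :: "('g => int) => 'g => int" where
 "iH = gr_map \<Z> HD G id"

definition qH :: "('g => int) => 'g set => int" where
 "qH = gr_map \<Z> HD Q (%d. I #>$G d)"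

lemma coset_hom: "(%d. I #>$G d) \<in> hom HD Q"
 using normal.r_coset_hom_Mod[OF nI] by (simp add: r_coset_def)

lemma id_hom: "id \<in> hom HD G"
 using subgroup.subset[OF sgD] by (auto simp: hom_def)

lemma iH_hom: "iH \<in> ring_hom ZH ZG"
 and iH_mono: "d \<in> D ==> iH (gr_mono \<Z> HD k d) = gr_mono \<Z> G k d"
 unfolding iH_def using zh.gr_map_hom[OF G.is_group finG id_hom] by (simp_all add: int_sel)

lemma qH_hom: "qH \<in> ring_hom ZH ZQ"
 and qH_mono: "d \<in> D ==> qH (gr_mono \<Z> HD k d) = gr_mono \<Z> Q k (I #>$G d)"
 unfolding qH_def using zh.gr_map_hom[OF group_Q zq.fin coset_hom] by (simp_all add: int_sel)

lemma qH_surj: "z \<in>$ZQ ==> \<exists>w\<in>carrier ZH. z = qH w"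
proof -
 assume z: "z \<in>$ZQ"
 have "\<forall>q\<in>carrier Q. \<exists>d\<in>D. q = I #>$G d" by (auto simp: carrier_Q)
 then obtain rep where rep: "!!q. q \<in>$Q ==> rep q \<in> D \<and> q = I #>$G rep q" by metis
 let ?f = "%q. gr_mono \<Z> HD (z q) (rep q)"
 have f: "?f \<in> carrier Q \<rightarrow> carrier ZH" using zh.gr_mono_closed by (auto simp: int_sel)
 have "qH (\<Oplus>$ZH q\<in>carrier Q. ?f q) = (\<Oplus>$ZQ q\<in>carrier Q. qH (?f q))"
  by (rule additive_finsum[OF zh.RG.abelian_group_axioms zq.RG.abelian_group_axioms _ _ f])
   (use qH_hom in "auto simp: ring_hom_closed ring_hom_add")
 also have "\<dots> = (\<Oplus>$ZQ q\<in>carrier Q. gr_mono \<Z> Q (z q) q)"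
 proof (rule zq.RG.finsum_cong'[OF refl])
  show "(%q. gr_mono \<Z> Q (z q) q) \<in> carrier Q \<rightarrow> carrier ZQ"
   using zq.gr_mono_closed by (auto simp: int_sel)
  fix q assume q: "q \<in>$Q"
  show "qH (?f q) = gr_mono \<Z> Q (z q) q"
   using qH_mono[of "rep q" "z q"] rep[OF q] by auto
 qed
 also have "\<dots> = z" by (rule zq.gr_expand[OF z, symmetric])
 finally have "qH (\<Oplus>$ZH q\<in>carrier Q. ?f q) = z" .
 thus ?thesis by (rule bexI[OF sym zh.RG.finsum_closed[OF f]])
qed

definition redH :: "('g => int) => 'g => nat => int" where
 "redH w = redZ (iH w)"

lemma redH_hom: "redH \<in> ring_hom ZH Lam"
 using ring_hom_trans[OF iH_hom redZ_hom] by (simp add: comp_def redH_def[abs_def])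

lemma redH_mono: "d \<in> D ==> redH (gr_mono \<Z> HD k d) = gr_const Zp GG (kZ k) *$Lam u d"
 by (simp add: redH_def iH_mono redZ_mono D_sub)

definition alpha :: "'g set => int" where
 "alpha = (1$ZQ -$ZQ gr_of \<Z> Q (inv\<^bsub>Q\<^esub> \<phi>)) +$ZQ [card I] \<cdot>$ZQ 1$ZQ"

definition psi :: 'g where
 "psi = (SOME d. d \<in> D \<and> I #>$G d = inv\<^bsub>Q\<^esub> \<phi>)"

lemma psi: "psi \<in> D" "I #>$G psi = inv\<^bsub>Q\<^esub> \<phi>"
proof -
 have "inv\<^bsub>Q\<^esub> \<phi> \<in>$Q" by (rule group.inv_closed[OF group_Q phi])
 hence "\<exists>d. d \<in> D \<and> I #>$G d = inv\<^bsub>Q\<^esub> \<phi>" by (auto simp: carrier_Q)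
 from someI_ex[OF this] show "psi \<in> D" "I #>$G psi = inv\<^bsub>Q\<^esub> \<phi>" by (simp_all add: psi_def)
qed

text \<open>A lift of \<open>alpha\<close> to Z[D], from where it can be sent to Z_p[\<Gamma>]; its
  image there is \<open>beta\<close>.\<close>

definition alphaH :: "'g => int" where
 "alphaH = (1$ZH -$ZH gr_of \<Z> HD psi) +$ZH [card I] \<cdot>$ZH 1$ZH"

definition beta :: "'g => nat => int" where
 "beta = (1$Lam -$Lam u psi) +$Lam [card I] \<cdot>$Lam 1$Lam"

lemma alphaH_closed: "alphaH \<in>$ZH"
 by (simp add: alphaH_def zh.gr_of_closed)

lemma beta_closed: "beta \<in>$Lam"
 by (simp add: beta_def u_closed)

lemma redH_of: "d \<in> D ==> redH (gr_of \<Z> HD d) = u d"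
 using redH_mono[of d 1] ring_hom_one[OF kZ_hom] ring_hom_one[OF lam.gr_const_hom] u_closed
 by (simp add: gr_of_mono int_sel)

lemma qH_of: "d \<in> D ==> qH (gr_of \<Z> HD d) = gr_of \<Z> Q (I #>$G d)"
 using qH_mono[of d 1] by (simp add: gr_of_mono int_sel)

lemma qH_alphaH: "qH alphaH = alpha"
 unfolding alphaH_def alpha_def
 using psi zh.gr_of_closed
 by (simp add: ring_hom_add[OF qH_hom] ring_hom_minus[OF zh.group_ring_ring zq.group_ring_ring qH_hom]
   ring_hom_add_pow[OF zh.group_ring_ring zq.group_ring_ring qH_hom] ring_hom_one[OF qH_hom] qH_of)

lemma redH_alphaH: "redH alphaH = beta"
 unfolding alphaH_def beta_def
 using psi zh.gr_of_closed
 by (simp add: ring_hom_add[OF redH_hom] ring_hom_minus[OF zh.group_ring_ring lam.group_ring_ring redH_hom]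
   ring_hom_add_pow[OF zh.group_ring_ring lam.group_ring_ring redH_hom] ring_hom_one[OF redH_hom] redH_of)

lemma alpha_closed: "alpha \<in>$ZQ"
 using ring_hom_closed[OF qH_hom alphaH_closed] by (simp add: qH_alphaH)

text \<open>The left ideals through which \<open>A\<^sup>-\<close> is presented.\<close>

definition rel_ideal :: "('g => nat => int) set => bool" where
 "rel_ideal L \<longleftrightarrow> submod Lam (reg_mod Lam) L \<and> (\<forall>i\<in>I. u i -$Lam 1$Lam \<in> L) \<and> beta \<in> L"

subsection \<open>The tensor product over \<open>\<int>[D]\<close>\<close>

abbreviation "JJ \<equiv> PIdl\<^bsub>ZQ\<^esub> alpha"
abbreviation "N1 \<equiv> quot_mod (reg_mod ZQ) JJ"
abbreviation "NN \<equiv> restrict_scalars qH N1"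
abbreviation "act1 \<equiv> (%x a. x *$ZG iH a)"
abbreviation "AA \<equiv> A_mod G D I \<phi>"

lemma A_mod_eq: "AA = tensor ZH (reg_mod ZG) act1 NN"
 by (simp add: A_mod_def Let_def alpha_def iH_def qH_def)

sublocale rzq: left_mod ZQ "reg_mod ZQ"
 by (intro left_mod.intro left_module_reg zq.group_ring_ring)

lemma JJ_submod: "submod ZQ (reg_mod ZQ) JJ"
proof (rule submodI)
 show "JJ \<subseteq> carrier (reg_mod ZQ)" using alpha_closed by (auto simp: cgenideal_def)
 show "0$(reg_mod ZQ) \<in> JJ"
  unfolding cgenideal_def using alpha_closed by (intro CollectI exI[of _ "0$ZQ"]) simp
 show "x +$(reg_mod ZQ) y \<in> JJ" if "x \<in> JJ" "y \<in> JJ" for x y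
  using that alpha_closed by (auto simp: cgenideal_def zq.RG.l_distr[symmetric])
 show "a \<odot>$(reg_mod ZQ) x \<in> JJ" if "a \<in>$ZQ" "x \<in> JJ" for a x
  using that alpha_closed by (auto simp: cgenideal_def zq.RG.m_assoc[symmetric])
qed

lemma N1_module: "left_module ZQ N1"
 by (rule rzq.quot_mod(4)[OF JJ_submod])

lemma NN_module: "left_module ZH NN"
 by (rule left_module_restrict_scalars[OF zh.group_ring_ring qH_hom N1_module])

abbreviation "pr1 \<equiv> proj_mod (reg_mod ZQ) JJ"

lemma pr1_closed: "z \<in>$ZQ ==> pr1 z \<in>$NN"
 using lmod_homD(1)[OF rzq.quot_mod(1)[OF JJ_submod]] by simp

lemma pr1_smult: "w \<in>$ZH ==> z \<in>$ZQ ==> w \<odot>$NN pr1 z = pr1 (qH w *$ZQ z)"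
 using lmod_homD(3)[OF rzq.quot_mod(1)[OF JJ_submod], of "qH w" z] ring_hom_closed[OF qH_hom, of w] by simp

lemma NN_elem: "n \<in>$NN ==> \<exists>w\<in>carrier ZH. n = pr1 (qH w)"
proof -
 assume "n \<in>$NN"
 hence "n \<in>$N1" by simp
 hence "n \<in> pr1 ` carrier (reg_mod ZQ)" using rzq.quot_mod(2)[OF JJ_submod] by simp
 thus ?thesis using qH_surj by auto
qed

lemma ts1: "tensor_setup ZH (reg_mod ZG) act1 NN"
proof (rule tensor_setup.intro)
 show "abelian_group (reg_mod ZG)" by (rule left_moduleD(2)[OF left_module_reg[OF zg.group_ring_ring]])
 show "abelian_group NN" by (rule left_moduleD(2)[OF NN_module])
 show "!!x a. [|x \<in>$(reg_mod ZG); a \<in>$ZH|] ==> x *$ZG iH a \<in>$(reg_mod ZG)"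
  using ring_hom_closed[OF iH_hom] by simp
 show "!!a y. [|a \<in>$ZH; y \<in>$NN|] ==> a \<odot>$NN y \<in>$NN"
  by (rule left_module.smult_closed[OF NN_module])
qed

sublocale t1: tensor_setup ZH "reg_mod ZG" act1 NN by (rule ts1)

lemma AA_module: "left_module ZG AA"
 and AA_pt: "[|s \<in>$ZG; x \<in>$ZG; y \<in>$NN|] ==> s \<odot>$AA t1.pt x y = t1.pt (s *$ZG x) y"
 using tensor_left_module[OF ts1 left_module_reg[OF zg.group_ring_ring]] ring_hom_closed[OF iH_hom]
 by (simp_all add: A_mod_eq zg.RG.m_assoc)

sublocale aa: left_mod ZG AA by (rule left_mod.intro[OF AA_module])

definition e1 where "e1 = pr1 1$ZQ"
text \<open>The generator 1 \<otimes> 1 of A.\<close>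

definition v1 where "v1 = t1.pt 1$ZG e1"

lemma e1_closed: "e1 \<in>$NN" unfolding e1_def by (rule pr1_closed) simp

lemma v1_closed: "v1 \<in>$AA"
 unfolding v1_def A_mod_eq by (rule t1.pt_closed) (use e1_closed in simp_all)

lemma smult_e1: "w \<in>$ZH ==> w \<odot>$NN e1 = pr1 (qH w)"
 unfolding e1_def using pr1_smult[of w "1$ZQ"] ring_hom_closed[OF qH_hom, of w] by simp

lemma pt_v1:
 assumes x: "x \<in>$ZG" and w: "w \<in>$ZH"
 shows "t1.pt x (pr1 (qH w)) = (x *$ZG iH w) \<odot>$AA v1"
proof -
 have c: "x *$ZG iH w \<in>$ZG" using x ring_hom_closed[OF iH_hom w] by simp
 have "t1.pt x (pr1 (qH w)) = t1.pt (x *$ZG iH w) e1"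
  using t1.pt_balanced[of x w e1] x w e1_closed by (simp only: reg_mod_simps smult_e1)
 also have "\<dots> = (x *$ZG iH w) \<odot>$AA v1"
  unfolding v1_def using AA_pt[OF c zg.RG.one_closed e1_closed] c by (simp only: zg.RG.r_one)
 finally show ?thesis .
qed

lemma AA_generated: "a \<in>$AA ==> \<exists>w\<in>carrier ZG. a = w \<odot>$AA v1"
 unfolding A_mod_eq
proof (induction a rule: t1.tensor_induct)
 case (pt x y)
 then obtain w where w: "w \<in>$ZH" "y = pr1 (qH w)" using NN_elem by blast
 have x: "x \<in>$ZG" using pt by simp
 show ?case
  using pt_v1[OF x w(1)] w x ring_hom_closed[OF iH_hom w(1)] unfolding A_mod_eq[symmetric]
  by (intro bexI[of _ "x *$ZG iH w"]) simp_all
next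
 case (minus a b)
 then obtain w w' where w: "w \<in>$ZG" "a = w \<odot>$AA v1" "w' \<in>$ZG" "b = w' \<odot>$AA v1"
  unfolding A_mod_eq[symmetric] by blast
 have "a -$AA b = (w -$ZG w') \<odot>$AA v1"
  using w v1_closed by (simp add: a_minus_def aa.smult_l_distr aa.smult_neg_left)
 thus ?case unfolding A_mod_eq[symmetric] using w by blast
qed

text \<open>An element of Z[D] can be moved across the tensor sign, where it acts on 1 in the
  quotient of Z[D/I] by \<open>alpha\<close> and gives zero.\<close>

lemma v1_rel:
 assumes w: "w \<in>$ZH" and q: "qH w \<in> JJ" shows "iH w \<odot>$AA v1 = 0$AA"
proof -
 have "pr1 (qH w) = 0$NN"
  using rzq.proj_mod_eq_zero_iff[OF JJ_submod, of "qH w"] ring_hom_closed[OF qH_hom w] q by simp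
 hence "iH w \<odot>$AA v1 = t1.pt 1$ZG 0$NN"
  using pt_v1[OF zg.RG.one_closed w] ring_hom_closed[OF iH_hom w] by simp
 also have "t1.pt 1$ZG 0$NN = 0$AA"
  unfolding A_mod_eq
  by (rule additive_zero[OF t1.abelian_N t1.tensor_abelian])
   (use t1.pt_closed t1.pt_add_right in "simp_all del: restrict_scalars_simps")
 finally show ?thesis .
qed

end

text \<open>For a left ideal \<open>L\<close> containing the relations, the map \<open>A\<^sup>- \<rightarrow> \<int>\<^sub>p[\<Gamma>]/L\<close>.\<close>

locale rel_setup = decomp_setup +
 fixes L assumes L: "rel_ideal L"
begin

lemma L_submod: "submod Lam (reg_mod Lam) L" using L by (simp add: rel_ideal_def)

sublocale rl: left_mod Lam "reg_mod Lam"
 by (intro left_mod.intro left_module_reg lam.group_ring_ring)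

abbreviation "BB \<equiv> quot_mod (reg_mod Lam) L"
abbreviation "prL \<equiv> proj_mod (reg_mod Lam) L"

sublocale bb: left_mod Lam BB
 by (rule left_mod.intro[OF rl.quot_mod(4)[OF L_submod]])

lemmas prL = lmod_homD[OF rl.quot_mod(1)[OF L_submod], simplified]
lemmas prL_zero_iff = rl.proj_mod_eq_zero_iff[OF L_submod, simplified]

definition rep :: "'a set => 'a" where
 "rep q = (SOME d. d \<in> D \<and> I #>$G d = q)"

lemma rep: assumes "q \<in>$Q" shows "rep q \<in> D" "I #>$G rep q = q"
proof -
 have "\<exists>d. d \<in> D \<and> I #>$G d = q" using assms by (auto simp: carrier_Q)
 from someI_ex[OF this] show "rep q \<in> D" "I #>$G rep q = q" by (simp_all add: rep_def)
qed

text \<open>The map Z[D/I] \<rightarrow> Z_p[\<Gamma>] / L induced by u. On D/I itself u is defined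
  only modulo L, so coset representatives are chosen; by \<open>theta0_qH\<close> the choice does
  not affect the result.\<close>

definition theta0 :: "('a set => int) => ('a => nat => int) set" where
 "theta0 z = (\<Oplus>$BB q\<in>carrier Q. prL (gr_const Zp GG (kZ (z q)) *$Lam u (rep q)))"

lemma cu_closed: "gr_const Zp GG (kZ k) *$Lam u g \<in>$Lam"
 by (simp add: kZ_closed lam.gr_const_closed u_closed)

lemma theta0_closed: "theta0 z \<in>$BB"
 unfolding theta0_def by (intro bb.M.finsum_closed) (simp add: prL(1) cu_closed)

lemma theta0_add:
 assumes z: "z \<in>$ZQ" and z': "z' \<in>$ZQ"
 shows "theta0 (z +$ZQ z') = theta0 z +$BB theta0 z'"
proof -
 have "theta0 (z +$ZQ z') = (\<Oplus>$BB q\<in>carrier Q. prL (gr_const Zp GG (kZ (z q)) *$Lam u (rep q)) +$BB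
   prL (gr_const Zp GG (kZ (z' q)) *$Lam u (rep q)))"
  unfolding theta0_def
 proof (rule bb.M.finsum_cong'[OF refl])
  fix q assume q: "q \<in>$Q"
  have k: "gr_const Zp GG (kZ ((z +$ZQ z') q)) = gr_const Zp GG (kZ (z q)) +$Lam gr_const Zp GG (kZ (z' q))"
   using q ring_hom_add[OF kZ_hom, of "z q" "z' q"] ring_hom_add[OF lam.gr_const_hom kZ_closed kZ_closed]
   by (simp add: group_ring_sel(5) int_sel)
  show "prL (gr_const Zp GG (kZ ((z +$ZQ z') q)) *$Lam u (rep q)) =
    prL (gr_const Zp GG (kZ (z q)) *$Lam u (rep q)) +$BB prL (gr_const Zp GG (kZ (z' q)) *$Lam u (rep q))"
   unfolding k using cu_closed
   by (simp add: lam.RG.l_distr lam.gr_const_closed kZ_closed u_closed prL(2))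
 qed (auto simp: prL(1) cu_closed)
 also have "\<dots> = theta0 z +$BB theta0 z'"
  unfolding theta0_def by (rule bb.M.finsum_addf) (auto simp: prL(1) cu_closed)
 finally show ?thesis .
qed

text \<open>\<open>I d = d I\<close> for \<open>d \<in> D\<close> turns the relations \<open>u i - 1\<close> into relations between the elements of a coset.\<close>

lemma u_coset:
 assumes d: "d \<in> D" and d': "d' \<in> D" and eq: "I #>$G d = I #>$G d'"
 shows "u d -$Lam u d' \<in> L"
proof -
 have G': "d \<in>$G" "d' \<in>$G" using d d' D_sub by auto
 have "inv\<^bsub>G\<^esub> d' *$G d \<in> I"
 proof -
  have "d \<in> I #>$HD d" using group.rcos_self[OF group_HD, of d I] d normal_imp_subgroup[OF nI] by simp
  hence "d \<in> d' <#\<^bsub>HD\<^esub> I" using eq normal.coset_eq[OF nI] d' by (auto simp: r_coset_def)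
  then obtain i where "i \<in> I" "d = d' *$G i" by (auto simp: l_coset_def)
  moreover have "i \<in>$G" using \<open>i \<in> I\<close> I_sub D_sub by auto
  ultimately show ?thesis using G' by (simp add: G.m_assoc[symmetric])
 qed
 hence "u d' *$Lam (u (inv\<^bsub>G\<^esub> d' *$G d) -$Lam 1$Lam) \<in> L"
  using L submodD(5)[OF L_submod u_closed[of d']] by (simp add: rel_ideal_def)
 moreover have "u d' *$Lam u (inv\<^bsub>G\<^esub> d' *$G d) = u d"
  using G' by (simp add: u_mult[symmetric] G.m_assoc[symmetric])
 ultimately show ?thesis
  using u_closed by (simp add: a_minus_def lam.RG.r_distr lam.RG.r_minus)
qed

lemma theta0_qH:
 assumes w: "w \<in>$ZH" shows "theta0 (qH w) = prL (redH w)"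
proof (rule zh.gr_additive_eq[OF bb.M.abelian_group_axioms _ _ _ _ _ w])
 show "theta0 (qH (a +$ZH b)) = theta0 (qH a) +$BB theta0 (qH b)" if "a \<in>$ZH" "b \<in>$ZH" for a b
  using that by (simp add: ring_hom_add[OF qH_hom] theta0_add ring_hom_closed[OF qH_hom])
 show "prL (redH (a +$ZH b)) = prL (redH a) +$BB prL (redH b)" if "a \<in>$ZH" "b \<in>$ZH" for a b
  using that by (simp add: ring_hom_add[OF redH_hom] prL(2) ring_hom_closed[OF redH_hom])
 fix k d assume "d \<in>$HD"
 hence d: "d \<in> D" by simp
 hence qd: "I #>$G d \<in>$Q" by (auto simp: carrier_Q)
 have "theta0 (qH (gr_mono \<Z> HD k d)) = (\<Oplus>$BB q\<in>carrier Q. if q = I #>$G d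
   then prL (gr_const Zp GG (kZ k) *$Lam u (rep (I #>$G d))) else 0$BB)"
  unfolding theta0_def qH_mono[OF d]
 proof (rule bb.M.finsum_cong'[OF refl])
  fix q assume q: "q \<in>$Q"
  have z: "prL 0$Lam = 0$BB" using rl.quot_mod(3)[OF L_submod] by simp
  have k0: "gr_const Zp GG (kZ 0) = 0$Lam"
   using ring_hom_zero[OF kZ_hom zg.R.ring_axioms Zp.ring_axioms] ring_hom_zero[OF lam.gr_const_hom Zp.ring_axioms lam.group_ring_ring]
   by (simp add: int_sel)
  show "prL (gr_const Zp GG (kZ (gr_mono \<Z> Q k (I #>$G d) q)) *$Lam u (rep q)) =
    (if q = I #>$G d then prL (gr_const Zp GG (kZ k) *$Lam u (rep (I #>$G d))) else 0$BB)"
   using q by (simp add: gr_mono_def int_sel k0 u_closed z)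
 qed (auto simp: prL(1) cu_closed)
 also have "\<dots> = prL (gr_const Zp GG (kZ k) *$Lam u (rep (I #>$G d)))"
  by (rule bb.M.finsum_delta[OF zq.fin qd prL(1)[OF cu_closed]])
 also have "\<dots> = prL (gr_const Zp GG (kZ k) *$Lam u d)"
 proof -
  have "gr_const Zp GG (kZ k) *$Lam (u (rep (I #>$G d)) -$Lam u d) \<in> L"
   using submodD(5)[OF L_submod lam.gr_const_closed[OF kZ_closed] u_coset[OF rep(1)[OF qd] d rep(2)[OF qd]]] by simp
  hence "gr_const Zp GG (kZ k) *$Lam u (rep (I #>$G d)) -$Lam gr_const Zp GG (kZ k) *$Lam u d \<in> L"
   using u_closed lam.gr_const_closed[OF kZ_closed] by (simp add: a_minus_def lam.RG.r_distr lam.RG.r_minus)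
  moreover have "x -$(reg_mod Lam) y = x -$Lam y" for x y
   by (simp add: a_minus_def a_inv_def reg_mod_def mk_mod_def m_inv_def)
  ultimately show ?thesis
   using rl.proj_mod_eq_iff[OF L_submod, of "gr_const Zp GG (kZ k) *$Lam u (rep (I #>$G d))" "gr_const Zp GG (kZ k) *$Lam u d"]
    cu_closed by simp
 qed
 finally show "theta0 (qH (gr_mono \<Z> HD k d)) = prL (redH (gr_mono \<Z> HD k d))" by (simp add: redH_mono[OF d])
qed (use theta0_closed ring_hom_closed[OF redH_hom] prL(1) in auto)

text \<open>Lifted to Z[D], a multiple of \<open>alpha\<close> becomes a left multiple of
  \<open>alphaH\<close>, whose image is a left multiple of \<open>beta\<close>; and L is a left
  ideal.\<close>

lemma theta0_JJ: assumes "z \<in> JJ" shows "theta0 z = 0$BB"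
proof -
 obtain x where x: "x \<in>$ZQ" "z = x *$ZQ alpha" using assms by (auto simp: cgenideal_def)
 obtain w where w: "w \<in>$ZH" "x = qH w" using qH_surj[OF x(1)] by blast
 have "z = qH (w *$ZH alphaH)" using w by (simp add: x ring_hom_mult[OF qH_hom] alphaH_closed qH_alphaH)
 hence "theta0 z = prL (redH w *$Lam beta)"
  using theta0_qH[of "w *$ZH alphaH"] w by (simp add: alphaH_closed ring_hom_mult[OF redH_hom] redH_alphaH)
 moreover have "redH w *$Lam beta \<in> L"
  using L submodD(5)[OF L_submod ring_hom_closed[OF redH_hom w(1)]] by (simp add: rel_ideal_def)
 moreover have "redH w *$Lam beta \<in>$Lam" using ring_hom_closed[OF redH_hom w(1)] beta_closed by simp
 ultimately show ?thesis using prL_zero_iff by simp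
qed

text \<open>A pair of x and n is sent to \<open>redZ x\<close> acting on the image of n under the
  factored \<open>theta0\<close>. This is balanced over Z[D] because \<open>redZ\<close> is
  multiplicative and \<open>theta0\<close> agrees with \<open>redH\<close> on lifts to Z[D].\<close>

lemma theta1:
 obtains th where "!!a. a \<in>$AA ==> th a \<in>$BB"
  "!!a b. [|a \<in>$AA; b \<in>$AA|] ==> th (a +$AA b) = th a +$BB th b"
  "!!w a. [|w \<in>$ZG; a \<in>$AA|] ==> th (w \<odot>$AA a) = redZ w \<odot>$BB th a"
  "th v1 = prL 1$Lam"
proof -
 obtain tN where tN: "!!z. z \<in>$ZQ ==> tN (pr1 z) = theta0 z"
  "!!n. n \<in>$N1 ==> tN n \<in>$BB"
  "!!n m. [|n \<in>$N1; m \<in>$N1|] ==> tN (n +$N1 m) = tN n +$BB tN m"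
  using rzq.quot_mod_universal[OF JJ_submod bb.M.abelian_group_axioms, of theta0] theta0_closed theta0_add theta0_JJ
  by (auto simp: reg_mod_simps)
 note rc = ring_hom_closed[OF redZ_hom]
 have tNw: "tN (pr1 (qH w)) = prL (redH w)" if "w \<in>$ZH" for w
  using tN(1)[OF ring_hom_closed[OF qH_hom that]] theta0_qH[OF that] by simp
 have bal: "tN (a \<odot>$NN n) = redH a \<odot>$BB tN n" if a: "a \<in>$ZH" and n: "n \<in>$NN" for a n
 proof -
  obtain w where w: "w \<in>$ZH" "n = pr1 (qH w)" using NN_elem[OF n] by blast
  have "tN (a \<odot>$NN n) = tN (pr1 (qH (a *$ZH w)))"
   unfolding w(2) pr1_smult[OF a ring_hom_closed[OF qH_hom w(1)]] ring_hom_mult[OF qH_hom a w(1)] ..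
  also have "\<dots> = prL (redH a *$Lam redH w)"
   using a w by (simp add: tNw ring_hom_mult[OF redH_hom])
  also have "\<dots> = redH a \<odot>$BB tN n"
   using a w by (simp add: tNw prL(3) ring_hom_closed[OF redH_hom])
  finally show ?thesis .
 qed
 obtain th where th: "!!a. a \<in>$AA ==> th a \<in>$BB"
  "!!a b. [|a \<in>$AA; b \<in>$AA|] ==> th (a +$AA b) = th a +$BB th b"
  "!!x y. [|x \<in>$ZG; y \<in>$NN|] ==> th (t1.pt x y) = redZ x \<odot>$BB tN y"
 proof (rule t1.tensor_universal[OF bb.M.abelian_group_axioms, of "%x n. redZ x \<odot>$BB tN n"])
  fix x x' y y' a assume *: "x \<in>$(reg_mod ZG)" "y \<in>$NN"
  show "redZ x \<odot>$BB tN y \<in>$BB" using * tN(2) rc by (simp add: bb.smult_closed)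
  show "redZ (x +$(reg_mod ZG) x') \<odot>$BB tN y = redZ x \<odot>$BB tN y +$BB redZ x' \<odot>$BB tN y"
   if "x' \<in>$(reg_mod ZG)"
   using * that tN(2) rc by (simp add: ring_hom_add[OF redZ_hom] bb.smult_l_distr)
  show "redZ x \<odot>$BB tN (y +$NN y') = redZ x \<odot>$BB tN y +$BB redZ x \<odot>$BB tN y'"
   if "y' \<in>$NN"
   using * that tN(2,3) rc by (simp add: bb.smult_r_distr)
  show "redZ (x *$ZG iH a) \<odot>$BB tN y = redZ x \<odot>$BB tN (a \<odot>$NN y)" if a: "a \<in>$ZH"
   unfolding bal[OF a *(2)] redH_def
   using * a tN(2) rc ring_hom_closed[OF iH_hom a]
   by (simp add: ring_hom_mult[OF redZ_hom] bb.smult_assoc)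
 qed (auto simp: A_mod_eq)
 show thesis
 proof (rule that[of th])
  fix w a assume w: "w \<in>$ZG" and a: "a \<in>$AA"
  show "th (w \<odot>$AA a) = redZ w \<odot>$BB th a"
  proof (rule t1.tensor_hom_eq[where f = "%a. th (w \<odot>$AA a)" and g = "%a. redZ w \<odot>$BB th a", OF bb.M.abelian_group_axioms],
    unfold A_mod_eq[symmetric])
   show "th (w \<odot>$AA t1.pt x y) = redZ w \<odot>$BB th (t1.pt x y)"
    if "x \<in>$(reg_mod ZG)" "y \<in>$NN" for x y
    using that w tN(2) rc by (simp add: AA_pt th(3) ring_hom_mult[OF redZ_hom] bb.smult_assoc)
  qed (use w a th(1,2) rc in "simp_all add: aa.smult_closed aa.smult_r_distr bb.smult_closed bb.smult_r_distr")
 next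
  have q1: "qH 1$ZH = 1$ZQ" by (rule ring_hom_one[OF qH_hom])
  have "tN e1 = prL 1$Lam" using tNw[OF zh.RG.one_closed] ring_hom_one[OF redH_hom] by (simp add: e1_def q1)
  thus "th v1 = prL 1$Lam"
   unfolding v1_def using th(3)[OF zg.RG.one_closed e1_closed] ring_hom_one[OF redZ_hom]
   by (simp add: bb.smult_one prL(1))
 qed (fact th)+
qed

end

section \<open>Integer multiples in abelian groups\<close>

lemma abelian_mk_mod:
 assumes "abelian_group M" shows "abelian_group (mk_mod (carrier M) 0$M (\<oplus>$M) sm)"
proof -
 interpret M: abelian_group M by fact
 show ?thesis by (rule abelian_groupI) (auto simp: M.a_ac intro!: bexI[of _ "\<ominus>$M _"] M.l_neg)
qed

context abelian_group
begin

lemma int_smult_closed: "x \<in>$G ==> [(k::int)] \<cdot> x \<in>$G"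
 using group.int_pow_closed[OF a_group, of x k] by (simp add: add_pow_def)

lemma int_smult_add: "x \<in>$G ==> [(k + l::int)] \<cdot> x = [k] \<cdot> x \<oplus> [l] \<cdot> x"
 using group.int_pow_mult[OF a_group, of x k l] by (simp add: add_pow_def)

lemma int_smult_one: "x \<in>$G ==> [(1::int)] \<cdot> x = x"
 using group.int_pow_1[OF a_group, of x] by (simp add: add_pow_def)

lemma int_smult_zero: "x \<in>$G ==> [(0::int)] \<cdot> x = \<zero>"
 by (simp add: add_pow_int_ge)

end

lemma additive_int_smult:
 assumes M: "abelian_group M" and N: "abelian_group N"
  and cl: "!!x. x \<in>$M ==> h x \<in>$N"
  and add: "!!x y. [|x \<in>$M; y \<in>$M|] ==> h (x +$M y) = h x +$N h y"
  and x: "x \<in>$M"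
 shows "h ([(k::int)] \<cdot>$M x) = [k] \<cdot>$N h x"
proof -
 interpret M: abelian_group M by fact
 have "h ([k] \<cdot>$M x) = [k] \<cdot>$N h ([(1::int)] \<cdot>$M x)"
  by (rule int_additive[OF N]) (use x in "simp_all add: cl add M.int_smult_closed M.int_smult_add")
 thus ?thesis by (simp only: M.int_smult_one[OF x])
qed

section \<open>The minus part\<close>

context decomp_setup
begin

abbreviation "act2 \<equiv> (%x (k::int). [k] \<cdot>$Zp x)"
abbreviation "AZ \<equiv> mk_mod (carrier AA) 0$AA (\<oplus>$AA) (%(k::int) y. [k] \<cdot>$AA y)"
abbreviation "T2 \<equiv> tensor \<Z> (reg_mod Zp) act2 AZ"
abbreviation "PT \<equiv> padic_tensor p G AA"

lemma ts2: "tensor_setup \<Z> (reg_mod Zp) act2 AZ"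
proof (rule tensor_setup.intro)
 show "abelian_group (reg_mod Zp)" by (rule left_moduleD(2)[OF left_module_reg[OF Zp.ring_axioms]])
 show "abelian_group AZ" by (rule abelian_mk_mod[OF aa.M.abelian_group_axioms])
qed (simp_all add: Zp.int_smult_closed aa.M.int_smult_closed)

sublocale t2: tensor_setup \<Z> "reg_mod Zp" act2 AZ by (rule ts2)

lemma T2_module: "left_module Zp T2"
 and T2_pt: "[|s \<in>$Zp; x \<in>$Zp; y \<in>$AA|] ==> s \<odot>$T2 t2.pt x y = t2.pt (s *$Zp x) y"
 using tensor_left_module[OF ts2 left_module_reg[OF Zp.ring_axioms]] by (simp_all add: Zp.add_pow_rdistr_int)

sublocale tt: left_mod Zp T2 by (rule left_mod.intro[OF T2_module])

definition psi2 where
 "psi2 g = tensor_map \<Z> (reg_mod Zp) act2 AZ id (%y. gr_of \<Z> G g \<odot>$AA y)"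

lemma psi2:
 shows "t \<in>$T2 ==> psi2 g t \<in>$T2"
  and "[|t \<in>$T2; t' \<in>$T2|] ==> psi2 g (t +$T2 t') = psi2 g t +$T2 psi2 g t'"
  and "[|x \<in>$Zp; y \<in>$AA|] ==> psi2 g (t2.pt x y) = t2.pt x (gr_of \<Z> G g \<odot>$AA y)"
proof -
 have lin: "gr_of \<Z> G g \<odot>$AA ([k] \<cdot>$AA y) = [k] \<cdot>$AA (gr_of \<Z> G g \<odot>$AA y)" if "y \<in>$AA" for k :: int and y
  by (rule additive_int_smult[OF aa.M.abelian_group_axioms aa.M.abelian_group_axioms _ _ that])
   (simp_all add: aa.smult_closed aa.smult_r_distr zg.gr_of_closed)
 note tm = t2.tensor_map[of id "%y. gr_of \<Z> G g \<odot>$AA y", folded psi2_def]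
 show "t \<in>$T2 ==> psi2 g t \<in>$T2"
  by (rule tm(1)) (simp_all add: aa.smult_closed aa.smult_r_distr zg.gr_of_closed lin)
 show "[|t \<in>$T2; t' \<in>$T2|] ==> psi2 g (t +$T2 t') = psi2 g t +$T2 psi2 g t'"
  by (rule tm(2)) (simp_all add: aa.smult_closed aa.smult_r_distr zg.gr_of_closed lin)
 show "psi2 g (t2.pt x y) = t2.pt x (gr_of \<Z> G g \<odot>$AA y)" if "x \<in>$Zp" "y \<in>$AA"
  using tm(3)[of x y] that by (simp add: aa.smult_closed aa.smult_r_distr zg.gr_of_closed lin)
qed

lemma pt2_closed: "x \<in>$Zp ==> y \<in>$AA ==> t2.pt x y \<in>$T2"
 by (rule t2.pt_closed) simp_all

sublocale g2: group_rep Zp G T2 psi2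
proof (intro group_rep.intro group_rep_axioms.intro pg.fin_group_cring_axioms T2_module)
 note ab = tt.M.abelian_group_axioms
 fix g c t assume g: "g \<in>$G" and c: "c \<in>$Zp" and t: "t \<in>$T2"
 show "psi2 g (c \<odot>$T2 t) = c \<odot>$T2 psi2 g t"
  by (rule t2.tensor_hom_eq[where f = "%t. psi2 g (c \<odot>$T2 t)" and g = "%t. c \<odot>$T2 psi2 g t", OF ab _ _ _ _ _ t])
   (use c in "simp_all add: psi2 tt.smult_closed tt.smult_r_distr T2_pt aa.smult_closed zg.gr_of_closed")
next
 note ab = tt.M.abelian_group_axioms
 fix t assume t: "t \<in>$T2"
 show "psi2 1$G t = t"
  by (rule t2.tensor_hom_eq[where f = "%t. psi2 1$G t" and g = "%t. t", OF ab _ _ _ _ _ t])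
   (simp_all add: psi2 zg.gr_of_one aa.smult_one)
next
 note ab = tt.M.abelian_group_axioms
 fix g h t assume g: "g \<in>$G" and h: "h \<in>$G" and t: "t \<in>$T2"
 show "psi2 (g *$G h) t = psi2 g (psi2 h t)"
  by (rule t2.tensor_hom_eq[where f = "%t. psi2 (g *$G h) t" and g = "%t. psi2 g (psi2 h t)", OF ab _ _ _ _ _ t])
   (use g h in "simp_all add: psi2 zg.gr_of_mult[symmetric] aa.smult_assoc aa.smult_closed zg.gr_of_closed")
qed (rule psi2; assumption)+

lemma PT_eq: "PT = mk_mod (carrier T2) 0$T2 (\<oplus>$T2) (gr_act Zp G T2 psi2)"
 unfolding padic_tensor_def Let_def gr_act_def psi2_def ..

lemma PT_sel: "carrier PT = carrier T2" "0$PT = 0$T2" "t +$PT t' = t +$T2 t'"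
 "b \<odot>$PT t = gr_act Zp G T2 psi2 b t"
 by (simp_all add: PT_eq)

lemma PT_module: "left_module pG PT"
 unfolding PT_eq by (rule g2.rep_left_module)

sublocale ptm: left_mod pG PT by (rule left_mod.intro[OF PT_module])

lemma PT_mono:
 assumes "c \<in>$Zp" "g \<in>$G" "x \<in>$Zp" "y \<in>$AA"
 shows "gr_mono Zp G c g \<odot>$PT t2.pt x y = t2.pt (c *$Zp x) (gr_of \<Z> G g \<odot>$AA y)"
 using assms by (simp add: PT_sel g2.act_mono pt2_closed psi2 T2_pt aa.smult_closed zg.gr_of_closed)

definition v2 where "v2 = t2.pt 1$Zp v1"

lemma v2_closed: "v2 \<in>$PT"
 unfolding v2_def PT_sel by (rule pt2_closed) (use v1_closed in simp_all)

text \<open>The element x w of Z_p[G] for a p-adic integer x and w in Z[G]. It expresses the tensor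
  of x and w \<open>v1\<close> as a multiple of \<open>v2\<close>.\<close>

definition conv :: "(nat => int) => ('g => int) => 'g => nat => int" where
 "conv x w = (\<lambda>g\<in>carrier G. [w g] \<cdot>$Zp x)"

lemma conv_closed: "x \<in>$Zp ==> conv x w \<in>$pG"
 by (auto simp: conv_def group_ring_sel Zp.int_smult_closed)

lemma conv_add:
 assumes "x \<in>$Zp" shows "conv x (w +$ZG w') = conv x w +$pG conv x w'"
 using assms by (auto simp: conv_def group_ring_sel Zp.int_smult_add intro!: restrict_ext)

lemma conv_mono:
 assumes "x \<in>$Zp" shows "conv x (gr_mono \<Z> G k g) = gr_mono Zp G ([k] \<cdot>$Zp x) g"
 using assms by (auto simp: conv_def gr_mono_def Zp.int_smult_zero intro!: restrict_ext)

lemma AA_mono: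
 assumes "a \<in>$AA" shows "gr_mono \<Z> G k g \<odot>$AA a = [k] \<cdot>$AA (gr_of \<Z> G g \<odot>$AA a)"
proof -
 have m: "gr_mono \<Z> G k g \<in>$ZG" for k by (rule zg.gr_mono_closed) simp
 have a: "gr_mono \<Z> G (k + l) g = gr_mono \<Z> G k g +$ZG gr_mono \<Z> G l g" for k l
  using zg.gr_mono_add[of k l g] by simp
 show ?thesis
  unfolding gr_of_mono int_sel
  by (rule int_additive[where f = "%k. gr_mono \<Z> G k g \<odot>$AA a", OF aa.M.abelian_group_axioms])
   (simp_all only: a aa.smult_l_distr[OF m m assms] aa.smult_closed[OF m assms])
qed

text \<open>Both sides are additive in w, and for a monomial k g the integer k crosses the tensor
  sign.\<close>

lemma pt2_v1:
 assumes x: "x \<in>$Zp" and w: "w \<in>$ZG"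
 shows "t2.pt x (w \<odot>$AA v1) = conv x w \<odot>$PT v2"
proof (rule zg.gr_additive_eq[where f = "%w. t2.pt x (w \<odot>$AA v1)" and h = "%w. conv x w \<odot>$PT v2",
   OF ptm.M.abelian_group_axioms _ _ _ _ _ w])
 fix a b assume ab: "a \<in>$ZG" "b \<in>$ZG"
 show "t2.pt x (a \<odot>$AA v1) \<in>$PT"
  unfolding PT_sel using ab x v1_closed by (intro pt2_closed aa.smult_closed)
 show "conv x a \<odot>$PT v2 \<in>$PT" by (intro ptm.smult_closed conv_closed x v2_closed)
 have s: "a \<odot>$AA v1 \<in>$AA" "b \<odot>$AA v1 \<in>$AA" using ab v1_closed by (auto intro: aa.smult_closed)
 show "t2.pt x ((a +$ZG b) \<odot>$AA v1) = t2.pt x (a \<odot>$AA v1) +$PT t2.pt x (b \<odot>$AA v1)"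
  unfolding PT_sel aa.smult_l_distr[OF ab v1_closed]
  using t2.pt_add_right[of x "a \<odot>$AA v1" "b \<odot>$AA v1"] x s by simp
 show "conv x (a +$ZG b) \<odot>$PT v2 = conv x a \<odot>$PT v2 +$PT conv x b \<odot>$PT v2"
  unfolding conv_add[OF x] by (rule ptm.smult_l_distr[OF conv_closed[OF x] conv_closed[OF x] v2_closed])
next
 fix k g assume g: "g \<in>$G"
 have s: "gr_of \<Z> G g \<odot>$AA v1 \<in>$AA" using v1_closed zg.gr_of_closed by (auto intro: aa.smult_closed)
 have "t2.pt x (gr_mono \<Z> G k g \<odot>$AA v1) = t2.pt ([k] \<cdot>$Zp x) (gr_of \<Z> G g \<odot>$AA v1)"
  unfolding AA_mono[OF v1_closed]
  using t2.pt_balanced[of x k "gr_of \<Z> G g \<odot>$AA v1"] x s by simp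
 also have "\<dots> = conv x (gr_mono \<Z> G k g) \<odot>$PT v2"
  unfolding conv_mono[OF x] v2_def
  using PT_mono[OF Zp.int_smult_closed[OF x, of k] g Zp.one_closed v1_closed] Zp.int_smult_closed[OF x, of k] by simp
 finally show "t2.pt x (gr_mono \<Z> G k g \<odot>$AA v1) = conv x (gr_mono \<Z> G k g) \<odot>$PT v2" .
qed

lemma PT_generated: "t \<in>$PT ==> \<exists>b\<in>carrier pG. t = b \<odot>$PT v2"
 unfolding PT_sel(1)
proof (induction t rule: t2.tensor_induct)
 case (pt x y)
 hence xy: "x \<in>$Zp" "y \<in>$AA" by simp_all
 obtain w where w: "w \<in>$ZG" "y = w \<odot>$AA v1" using AA_generated[OF xy(2)] by blast
 show ?case unfolding w(2) pt2_v1[OF xy(1) w(1)] by (rule bexI[OF refl conv_closed[OF xy(1)]])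
next
 case (minus a b)
 then obtain w w' where w: "w \<in>$pG" "a = w \<odot>$PT v2" "w' \<in>$pG" "b = w' \<odot>$PT v2" by blast
 have m: "a -$T2 b = a -$PT b"
  by (simp add: a_minus_def a_inv_def m_inv_def PT_sel)
 have "a -$T2 b = (w -$pG w') \<odot>$PT v2"
  unfolding m using w v2_closed by (simp add: a_minus_def ptm.smult_l_distr ptm.smult_neg_left)
 thus ?case using w by blast
qed

lemma red_conv: assumes w: "w \<in>$ZG" shows "red (conv 1$Zp w) = redZ w"
 by (rule zg.gr_additive_eq[where f = "%w. red (conv 1$Zp w)" and h = redZ, OF lam.RG.abelian_group_axioms _ _ _ _ _ w])
  (simp_all add: ring_hom_closed[OF red_hom] conv_closed conv_add ring_hom_add[OF red_hom]
   ring_hom_closed[OF redZ_hom] ring_hom_add[OF redZ_hom] conv_mono red_mono redZ_mono kZ_closed[unfolded kZ_def] kZ_def)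

definition jplus where "jplus = 1$pG +$pG gr_of Zp G j"

abbreviation "N3 \<equiv> {jplus \<odot>$PT x | x. x \<in>$PT}"
abbreviation "XX \<equiv> quot_mod PT N3"
abbreviation "pr3 \<equiv> proj_mod PT N3"
abbreviation "AM \<equiv> A_minus p G \<Gamma> j D I \<phi>"

definition iG where "iG = gr_map Zp GG G id"

lemma AM_eq: "AM = restrict_scalars iG XX"
 by (simp add: A_minus_def minus_part_def Let_def iG_def jplus_def)

lemma jplus_closed: "jplus \<in>$pG" by (simp add: jplus_def pg.gr_of_closed)

text \<open>Centrality makes the image of 1 + j on a left module a submodule, as the quotient
  \<open>XX\<close> requires.\<close>

lemma jplus_central: assumes b: "b \<in>$pG" shows "b *$pG jplus = jplus *$pG b"
proof -
 have "b *$pG gr_of Zp G j = gr_of Zp G j *$pG b"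
  by (rule pg.gr_additive_eq[where f = "%b. b *$pG gr_of Zp G j" and h = "%b. gr_of Zp G j *$pG b",
     OF pg.RG.abelian_group_axioms _ _ _ _ _ b])
   (simp_all add: pg.gr_of_closed pg.RG.l_distr pg.RG.r_distr gr_of_mono pg.gr_mono_mult pg.gr_mono_closed jG jc)
 thus ?thesis using b by (simp add: jplus_def pg.gr_of_closed pg.RG.l_distr pg.RG.r_distr)
qed

lemma N3_submod: "submod pG PT N3"
proof (rule submodI)
 show "N3 \<subseteq> carrier PT" using jplus_closed by (auto intro: ptm.smult_closed)
 show "0$PT \<in> N3" using ptm.smult_zero_right[OF jplus_closed] by (intro CollectI exI[of _ "0$PT"]) simp
 show "x +$PT y \<in> N3" if "x \<in> N3" "y \<in> N3" for x y
 proof -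
  from \<open>x \<in> N3\<close> \<open>y \<in> N3\<close> obtain x' y' where *: "x' \<in>$PT" "x = jplus \<odot>$PT x'" "y' \<in>$PT" "y = jplus \<odot>$PT y'" by blast
  thus ?thesis using ptm.smult_r_distr[OF jplus_closed *(1,3)] by (intro CollectI exI[of _ "x' +$PT y'"]) simp
 qed
 show "a \<odot>$PT x \<in> N3" if a: "a \<in>$pG" and x: "x \<in> N3" for a x
 proof -
  obtain x' where *: "x' \<in>$PT" "x = jplus \<odot>$PT x'" using x by blast
  have "a \<odot>$PT x = jplus \<odot>$PT (a \<odot>$PT x')"
   unfolding *(2) ptm.smult_assoc[OF a jplus_closed *(1), symmetric]
    ptm.smult_assoc[OF jplus_closed a *(1), symmetric] jplus_central[OF a] ..
  thus ?thesis using ptm.smult_closed[OF a *(1)] by blast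
 qed
qed

lemma XX_module: "left_module pG XX" by (rule ptm.quot_mod(4)[OF N3_submod])

sublocale xx: left_mod pG XX by (rule left_mod.intro[OF XX_module])

lemmas pr3 = lmod_homD[OF ptm.quot_mod(1)[OF N3_submod]]

lemma id_hom_Gamma: "id \<in> hom GG G" using subgroup.subset[OF sgGamma] by (auto simp: hom_def)

lemma iG_hom: "iG \<in> ring_hom Lam pG"
 and iG_mono: "[|c \<in>$Zp; g \<in> \<Gamma>|] ==> iG (gr_mono Zp GG c g) = gr_mono Zp G c g"
 unfolding iG_def using lam.gr_map_hom[OF G.is_group finG id_hom_Gamma] by simp_all

lemma AM_module: "left_module Lam AM"
 unfolding AM_eq by (rule left_module_restrict_scalars[OF lam.group_ring_ring iG_hom XX_module])

text \<open>The class of 1 \<otimes> (1 \<otimes> 1), a generator of A^-.\<close>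

definition eps where "eps = pr3 v2"

lemma eps_closed: "eps \<in>$XX" unfolding eps_def by (rule pr3(1)[OF v2_closed])

lemma smult_eps: "b \<in>$pG ==> b \<odot>$XX eps = pr3 (b \<odot>$PT v2)"
 unfolding eps_def by (rule pr3(3)[OF _ v2_closed, symmetric])

lemma jplus_eps:
 assumes "b \<in>$pG" shows "(jplus *$pG b) \<odot>$XX eps = 0$XX"
proof -
 have "(jplus *$pG b) \<odot>$PT v2 \<in> N3"
  using ptm.smult_assoc[OF jplus_closed assms v2_closed] ptm.smult_closed[OF assms v2_closed] by blast
 moreover have c: "jplus *$pG b \<in>$pG" using assms jplus_closed by simp
 ultimately show ?thesis
  using ptm.proj_mod_eq_zero_iff[OF N3_submod ptm.smult_closed[OF c v2_closed]] by (simp add: smult_eps[OF c])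
qed

text \<open>On the cyclic module generated by \<open>eps\<close> the central element j acts as - 1,
  so g may be replaced by u(g).\<close>

lemma iG_red_eps:
 assumes b: "b \<in>$pG" shows "iG (red b) \<odot>$XX eps = b \<odot>$XX eps"
proof (rule pg.gr_additive_eq[where f = "%b. iG (red b) \<odot>$XX eps" and h = "%b. b \<odot>$XX eps",
   OF xx.M.abelian_group_axioms _ _ _ _ _ b])
 note cl = ring_hom_closed[OF iG_hom] ring_hom_closed[OF red_hom]
 show "iG (red a) \<odot>$XX eps \<in>$XX" if "a \<in>$pG" for a
  using that eps_closed cl by (intro xx.smult_closed) auto
 show "iG (red (a +$pG c)) \<odot>$XX eps = iG (red a) \<odot>$XX eps +$XX iG (red c) \<odot>$XX eps"
  if "a \<in>$pG" "c \<in>$pG" for a c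
  using that eps_closed cl by (simp add: ring_hom_add[OF red_hom] ring_hom_add[OF iG_hom] xx.smult_l_distr)
 fix c g assume c: "c \<in>$Zp" and g: "g \<in>$G"
 show "iG (red (gr_mono Zp G c g)) \<odot>$XX eps = gr_mono Zp G c g \<odot>$XX eps"
 proof (cases "g \<in> \<Gamma>")
  case True
  hence "red (gr_mono Zp G c g) = gr_mono Zp GG c g"
   using lam.gr_mono_const[OF c, of g] by (simp add: red_mono[OF c g] u_def)
  thus ?thesis using iG_mono[OF c True] by simp
 next
  case False
  hence gj: "g *$G j \<in> \<Gamma>" using cover[OF g] by blast
  have gjG: "g *$G j \<in>$G" using g jG by simp
  have m: "gr_mono Zp GG c (g *$G j) \<in>$Lam" by (rule lam.gr_mono_closed[OF c])
  have m1: "gr_mono Zp G c g \<in>$pG" "gr_mono Zp G c (g *$G j) \<in>$pG"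
   by (rule pg.gr_mono_closed[OF c])+
  have "red (gr_mono Zp G c g) = \<ominus>$Lam gr_mono Zp GG c (g *$G j)"
   using False gj lam.gr_mono_const[OF c, of "g *$G j"] lam.gr_of_closed lam.gr_const_closed[OF c]
   by (simp add: red_mono[OF c g] u_def lam.RG.r_minus)
  moreover have "iG (\<ominus>$Lam gr_mono Zp GG c (g *$G j)) = \<ominus>$pG gr_mono Zp G c (g *$G j)"
   unfolding iG_mono[OF c gj, symmetric]
   by (rule additive_neg[OF lam.RG.abelian_group_axioms pg.RG.abelian_group_axioms _ _ m])
    (use iG_hom in "auto simp: ring_hom_closed ring_hom_add")
  ultimately have 1: "iG (red (gr_mono Zp G c g)) \<odot>$XX eps = \<ominus>$XX (gr_mono Zp G c (g *$G j) \<odot>$XX eps)"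
   using m1 eps_closed by (simp add: xx.smult_neg_left)
  have "jplus *$pG gr_mono Zp G c g = gr_mono Zp G c g +$pG gr_mono Zp G c (g *$G j)"
   using m1 c g jG jc[OF g] by (simp add: jplus_def pg.gr_of_closed pg.RG.l_distr gr_of_mono pg.gr_mono_mult pg.gr_mono_closed)
  hence "gr_mono Zp G c g \<odot>$XX eps +$XX gr_mono Zp G c (g *$G j) \<odot>$XX eps = 0$XX"
   using jplus_eps[OF m1(1)] xx.smult_l_distr[OF m1 eps_closed] by simp
  hence "\<ominus>$XX (gr_mono Zp G c (g *$G j) \<odot>$XX eps) = gr_mono Zp G c g \<odot>$XX eps"
   using m1 eps_closed by (intro xx.M.minus_equality) (auto intro: xx.smult_closed)
  thus ?thesis using 1 by simp
 qed
qed (use eps_closed in "auto simp: xx.smult_closed xx.smult_l_distr")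

text \<open>The annihilator of the generator, so that A^- is Z_p[\<Gamma>] / \<open>LL\<close>.
  Together \<open>LL_rel_ideal\<close> and \<open>LL_least\<close> identify it as the least left
  ideal containing the relations.\<close>

definition LL where "LL = {a \<in> carrier Lam. a \<odot>$AM eps = 0$AM}"

lemma AM_smult: "a \<odot>$AM x = iG a \<odot>$XX x" and AM_zero: "0$AM = 0$XX" and AM_carrier: "carrier AM = carrier XX"
 by (simp_all add: AM_eq)

lemma redH_LL:
 assumes w: "w \<in>$ZH" and q: "qH w \<in> JJ" shows "redH w \<in> LL"
proof -
 have iw: "iH w \<in>$ZG" by (rule ring_hom_closed[OF iH_hom w])
 have c: "conv 1$Zp (iH w) \<in>$pG" by (rule conv_closed) simp
 have "conv 1$Zp (iH w) \<odot>$PT v2 = t2.pt 1$Zp 0$AA"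
  using pt2_v1[OF Zp.one_closed iw] by (simp add: v1_rel[OF w q])
 also have "\<dots> = 0$PT"
 proof -
  have "t2.pt 1$Zp 0$AZ = 0$T2"
   by (rule additive_zero[OF t2.abelian_N t2.tensor_abelian])
    (use t2.pt_closed[of "1$Zp"] t2.pt_add_right[of "1$Zp"] in simp_all)
  thus ?thesis by (simp add: PT_sel)
 qed
 finally have "conv 1$Zp (iH w) \<odot>$XX eps = 0$XX"
  unfolding smult_eps[OF c] using ptm.quot_mod(3)[OF N3_submod] by simp
 hence "iG (redH w) \<odot>$XX eps = 0$XX"
  using iG_red_eps[OF c] by (simp add: red_conv[OF iw] redH_def)
 thus ?thesis using ring_hom_closed[OF redH_hom w] by (simp add: LL_def AM_smult AM_zero)
qed

lemma eval_eps_hom: "(%a. a \<odot>$AM eps) \<in> lmod_hom Lam (reg_mod Lam) AM"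
proof -
 interpret am: left_module Lam AM by (rule AM_module)
 have e: "eps \<in>$AM" using eps_closed by (simp add: AM_carrier)
 show ?thesis
  by (rule lmod_homI) (use am.smult_closed[OF _ e] am.smult_l_distr[OF _ _ e] am.smult_assoc[OF _ _ e] in simp_all)
qed

lemma eval_eps_surj: "(%a. a \<odot>$AM eps) ` carrier (reg_mod Lam) = carrier AM"
proof
 show "(%a. a \<odot>$AM eps) ` carrier (reg_mod Lam) \<subseteq> carrier AM"
  using lmod_homD(1)[OF eval_eps_hom] by blast
 show "carrier AM \<subseteq> (%a. a \<odot>$AM eps) ` carrier (reg_mod Lam)"
 proof
  fix x assume "x \<in>$AM"
  hence "x \<in> pr3 ` carrier PT" using ptm.quot_mod(2)[OF N3_submod] by (simp add: AM_carrier)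
  then obtain t where t: "t \<in>$PT" "x = pr3 t" by blast
  obtain b where b: "b \<in>$pG" "t = b \<odot>$PT v2" using PT_generated[OF t(1)] by blast
  have "x = red b \<odot>$AM eps"
   unfolding AM_smult iG_red_eps[OF b(1)] smult_eps[OF b(1)] t(2) b(2) ..
  thus "x \<in> (%a. a \<odot>$AM eps) ` carrier (reg_mod Lam)"
   using ring_hom_closed[OF red_hom b(1)] by auto
 qed
qed

lemma LL_rel_ideal: "rel_ideal LL"
 unfolding rel_ideal_def
proof (intro conjI ballI)
 interpret am: left_module Lam AM by (rule AM_module)
 have e: "eps \<in>$AM" using eps_closed by (simp add: AM_carrier)
 show "submod Lam (reg_mod Lam) LL"
  by (rule submodI)
   (use am.smult_l_distr[OF _ _ e] am.smult_assoc[OF _ _ e] am.smult_zero_left[OF e] am.smult_zero_right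
    in "auto simp: LL_def")
 fix i assume i: "i \<in> I"
 hence iD: "i \<in> D" using I_sub by blast
 have c: "gr_of \<Z> HD i -$ZH 1$ZH \<in>$ZH" using zh.gr_of_closed by simp
 have "I #>$G i = 1$Q"
  using group.coset_join2[OF group_HD, of i I] normal_imp_subgroup[OF nI] iD i by (simp add: r_coset_def)
 hence "qH (gr_of \<Z> HD i -$ZH 1$ZH) = 1$ZQ -$ZQ 1$ZQ"
  using zh.gr_of_closed zq.gr_of_one
  by (simp add: ring_hom_minus[OF zh.group_ring_ring zq.group_ring_ring qH_hom] qH_of[OF iD] ring_hom_one[OF qH_hom])
 also have "\<dots> = 0$ZQ" by (simp add: a_minus_def zq.RG.r_neg)
 finally have "qH (gr_of \<Z> HD i -$ZH 1$ZH) = 0$ZQ" .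
 hence "qH (gr_of \<Z> HD i -$ZH 1$ZH) \<in> JJ" using submodD(3)[OF JJ_submod] by simp
 from redH_LL[OF c this] show "u i -$Lam 1$Lam \<in> LL"
  using zh.gr_of_closed
  by (simp add: ring_hom_minus[OF zh.group_ring_ring lam.group_ring_ring redH_hom] redH_of[OF iD] ring_hom_one[OF redH_hom])
next
 have "qH alphaH \<in> JJ" unfolding qH_alphaH cgenideal_def
  using alpha_closed by (intro CollectI exI[of _ "1$ZQ"]) simp
 from redH_LL[OF alphaH_closed this] show "beta \<in> LL" by (simp add: redH_alphaH)
qed

theorem Phi_A_minus: "Phi Lam AM = proj_class Lam ((reg_mod Lam)\<lparr>carrier := LL\<rparr>)"
 using Phi_eq[OF AM_module fg_projective_reg[OF lam.group_ring_ring] eval_eps_hom eval_eps_surj]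
 by (simp add: ker_mod_def LL_def)

text \<open>The universal properties of the two tensor products and of the quotient by 1 + j combine
  to a map A^- \<rightarrow> Z_p[\<Gamma>] / L sending \<open>eps\<close> to the class of 1.
  Whatever kills \<open>eps\<close> therefore lies in L.\<close>

lemma LL_least: assumes "rel_ideal L" shows "LL \<subseteq> L"
proof -
 interpret rel_setup p G \<Gamma> j D I \<phi> L
  using assms by (simp add: rel_setup_def rel_setup_axioms_def decomp_setup_axioms)
 obtain th where th: "!!a. a \<in>$AA ==> th a \<in>$BB"
  "!!a b. [|a \<in>$AA; b \<in>$AA|] ==> th (a +$AA b) = th a +$BB th b"
  "!!w a. [|w \<in>$ZG; a \<in>$AA|] ==> th (w \<odot>$AA a) = redZ w \<odot>$BB th a"
  "th v1 = prL 1$Lam"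
  by (rule theta1) blast
 note cc = lam.gr_const_closed
 have bal: "gr_const Zp GG ([k] \<cdot>$Zp x) \<odot>$BB th y = gr_const Zp GG x \<odot>$BB th ([k] \<cdot>$AA y)"
  if x: "x \<in>$Zp" and y: "y \<in>$AA" for x y and k :: int
 proof -
  have "gr_const Zp GG ([k] \<cdot>$Zp x) \<odot>$BB th y = [k] \<cdot>$BB (gr_const Zp GG x \<odot>$BB th y)"
   by (rule additive_int_smult[where h = "%x. gr_const Zp GG x \<odot>$BB th y", OF Zp.abelian_group_axioms bb.M.abelian_group_axioms _ _ x])
    (use th(1)[OF y] cc in "simp_all add: bb.smult_closed ring_hom_add[OF lam.gr_const_hom] bb.smult_l_distr")
  also have "\<dots> = gr_const Zp GG x \<odot>$BB th ([k] \<cdot>$AA y)"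
   by (rule additive_int_smult[where h = "%y. gr_const Zp GG x \<odot>$BB th y", OF aa.M.abelian_group_axioms bb.M.abelian_group_axioms _ _ y, symmetric])
    (use th(1,2) cc[OF x] in "simp_all add: bb.smult_closed bb.smult_r_distr")
  finally show ?thesis .
 qed
 obtain t2h where t2h: "!!t. t \<in>$PT ==> t2h t \<in>$BB"
  "!!t t'. [|t \<in>$PT; t' \<in>$PT|] ==> t2h (t +$PT t') = t2h t +$BB t2h t'"
  "!!x y. [|x \<in>$Zp; y \<in>$AA|] ==> t2h (t2.pt x y) = gr_const Zp GG x \<odot>$BB th y"
 proof (rule t2.tensor_universal[OF bb.M.abelian_group_axioms, of "%x y. gr_const Zp GG x \<odot>$BB th y"])
  fix x y assume *: "x \<in>$(reg_mod Zp)" "y \<in>$AZ"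
  show "gr_const Zp GG x \<odot>$BB th y \<in>$BB" using * th(1) cc by (simp add: bb.smult_closed)
  show "gr_const Zp GG (x +$(reg_mod Zp) x') \<odot>$BB th y = gr_const Zp GG x \<odot>$BB th y +$BB gr_const Zp GG x' \<odot>$BB th y"
   if "x' \<in>$(reg_mod Zp)" for x'
   using * that th(1) cc by (simp add: ring_hom_add[OF lam.gr_const_hom] bb.smult_l_distr)
  show "gr_const Zp GG x \<odot>$BB th (y +$AZ y') = gr_const Zp GG x \<odot>$BB th y +$BB gr_const Zp GG x \<odot>$BB th y'"
   if "y' \<in>$AZ" for y'
   using * that th(1,2) cc by (simp add: bb.smult_r_distr)
  show "gr_const Zp GG ([a] \<cdot>$Zp x) \<odot>$BB th y = gr_const Zp GG x \<odot>$BB th (a \<odot>$AZ y)" for a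
   using * bal by simp
 qed (auto simp: PT_sel)
 note rc = ring_hom_closed[OF red_hom]
 have mono_lin: "t2h (gr_mono Zp G c g \<odot>$PT t) = red (gr_mono Zp G c g) \<odot>$BB t2h t"
  if c: "c \<in>$Zp" and g: "g \<in>$G" and t: "t \<in>$PT" for c g t
 proof (rule t2.tensor_hom_eq[where f = "%t. t2h (gr_mono Zp G c g \<odot>$PT t)" and g = "%t. red (gr_mono Zp G c g) \<odot>$BB t2h t",
    OF bb.M.abelian_group_axioms], unfold PT_sel(1,3)[symmetric])
  note m = pg.gr_mono_closed[OF c, of g]
  show "t2h (gr_mono Zp G c g \<odot>$PT t2.pt x y) = red (gr_mono Zp G c g) \<odot>$BB t2h (t2.pt x y)"
   if "x \<in>$(reg_mod Zp)" "y \<in>$AZ" for x y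
  proof -
   have x: "x \<in>$Zp" and y: "y \<in>$AA" using that by simp_all
   have gy: "gr_of \<Z> G g \<odot>$AA y \<in>$AA" by (rule aa.smult_closed[OF zg.gr_of_closed y])
   have rg: "redZ (gr_of \<Z> G g) = u g"
    using redZ_mono[OF g, of 1] ring_hom_one[OF kZ_hom] ring_hom_one[OF lam.gr_const_hom] u_closed
    by (simp add: gr_of_mono)
   have "t2h (gr_mono Zp G c g \<odot>$PT t2.pt x y) = gr_const Zp GG (c *$Zp x) \<odot>$BB (u g \<odot>$BB th y)"
    unfolding PT_mono[OF c g x y] using t2h(3)[OF Zp.m_closed[OF c x] gy] th(3)[OF zg.gr_of_closed y] by (simp add: rg)
   also have "\<dots> = (gr_const Zp GG c *$Lam (gr_const Zp GG x *$Lam u g)) \<odot>$BB th y"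
    using c x cc u_closed th(1)[OF y]
    by (simp add: bb.smult_assoc[symmetric] ring_hom_mult[OF lam.gr_const_hom] lam.RG.m_assoc)
   also have "\<dots> = red (gr_mono Zp G c g) \<odot>$BB t2h (t2.pt x y)"
    unfolding u_const_comm[OF x] red_mono[OF c g] t2h(3)[OF x y]
    using c x cc u_closed th(1)[OF y] by (simp add: bb.smult_assoc[symmetric] lam.RG.m_assoc)
   finally show ?thesis .
  qed
 qed (use c t t2h(1,2) rc[OF pg.gr_mono_closed[OF c]] pg.gr_mono_closed[OF c] in
   "simp_all add: ptm.smult_closed ptm.smult_r_distr bb.smult_closed bb.smult_r_distr")
 have lin: "t2h (b \<odot>$PT t) = red b \<odot>$BB t2h t" if b: "b \<in>$pG" and t: "t \<in>$PT" for b t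
  by (rule pg.gr_additive_eq[where f = "%b. t2h (b \<odot>$PT t)" and h = "%b. red b \<odot>$BB t2h t", OF bb.M.abelian_group_axioms _ _ _ _ _ b])
   (use t t2h(1,2) rc mono_lin[OF _ _ t] in
    "simp_all add: ptm.smult_closed ptm.smult_l_distr bb.smult_closed bb.smult_l_distr ring_hom_add[OF red_hom]")
 have tv2: "t2h v2 = prL 1$Lam"
  unfolding v2_def using t2h(3)[OF Zp.one_closed v1_closed] th(4) ring_hom_one[OF lam.gr_const_hom]
  by (simp add: bb.smult_one prL(1))
 \<comment> \<open>Since u(j) = - 1, the map descends to the quotient by 1 + j.\<close>
 have rj: "red jplus = 0$Lam"
 proof -
  have "red (gr_of Zp G j) = u j"
   using red_mono[OF Zp.one_closed jG] ring_hom_one[OF lam.gr_const_hom] u_closed by (simp add: gr_of_mono)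
  moreover have "u j = \<ominus>$Lam 1$Lam" using jn jj lam.gr_of_one by (simp add: u_def)
  ultimately show ?thesis
   by (simp add: jplus_def ring_hom_add[OF red_hom] pg.gr_of_closed ring_hom_one[OF red_hom] lam.RG.r_neg)
 qed
 have zero: "t2h t = 0$BB" if "t \<in> N3" for t
 proof -
  obtain x where x: "x \<in>$PT" "t = jplus \<odot>$PT x" using \<open>t \<in> N3\<close> by blast
  show ?thesis unfolding x(2) lin[OF jplus_closed x(1)] rj by (rule bb.smult_zero_left[OF t2h(1)[OF x(1)]])
 qed
 obtain t3 where t3: "!!t. t \<in>$PT ==> t3 (pr3 t) = t2h t"
  by (rule ptm.quot_mod_universal[OF N3_submod bb.M.abelian_group_axioms t2h(1,2) zero]) blast+
 have red_iG: "red (iG a) = a" if a: "a \<in>$Lam" for a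
 proof (rule lam.gr_additive_eq[where f = "%a. red (iG a)" and h = "%a. a", OF lam.RG.abelian_group_axioms _ _ _ _ _ a])
  fix c g assume c: "c \<in>$Zp" and "g \<in>$GG"
  hence g: "g \<in> \<Gamma>" by simp
  show "red (iG (gr_mono Zp GG c g)) = gr_mono Zp GG c g"
   unfolding iG_mono[OF c g] red_mono[OF c Gamma_sub[OF g]] using g lam.gr_mono_const[OF c, of g] by (simp add: u_def)
 qed (simp_all add: ring_hom_closed[OF red_hom] ring_hom_closed[OF iG_hom] ring_hom_add[OF red_hom] ring_hom_add[OF iG_hom])
 show ?thesis
 proof
  fix a assume a: "a \<in> LL"
  hence aL: "a \<in>$Lam" and "iG a \<odot>$XX eps = 0$XX" by (simp_all add: LL_def AM_smult AM_zero)
  note ia = ring_hom_closed[OF iG_hom aL]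
  have "pr3 (iG a \<odot>$PT v2) = pr3 0$PT"
   using \<open>iG a \<odot>$XX eps = 0$XX \<close> smult_eps[OF ia] ptm.quot_mod(3)[OF N3_submod] by simp
  hence "t2h (iG a \<odot>$PT v2) = t2h 0$PT"
   using t3[OF ptm.smult_closed[OF ia v2_closed]] t3[OF ptm.M.zero_closed] by simp
  hence "a \<odot>$BB prL 1$Lam = 0$BB"
   using zero[OF submodD(3)[OF N3_submod]] by (simp add: lin[OF ia v2_closed] red_iG[OF aL] tv2)
  hence "prL a = 0$BB" using prL(3)[OF aL lam.RG.one_closed] aL by simp
  thus "a \<in> L" using prL_zero_iff[OF aL] by simp
 qed
qed

end

section \<open>The metacyclic group \<open>\<Gamma>\<close>\<close>

locale metacyclic_group = padic p + G: group G
 for p and G :: "'g monoid" +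
 fixes \<Gamma> :: "'g set" and r s :: nat and \<sigma> \<tau> :: 'g
 assumes cop: "coprime s p" and r: "r = ord p s"
  and sG: "\<sigma> \<in>$G" and tG: "\<tau> \<in>$G"
  and ord_s: "G.ord \<sigma> = p" and ord_t: "G.ord \<tau> = r"
  and conj: "\<tau> *$G \<sigma> *$G inv\<^bsub>G\<^esub> \<tau> = \<sigma> ^$G s"
  and Gamma: "\<Gamma> = generate G {\<sigma>, \<tau>}"
begin

lemma r_pos: "r > 0"
 using cop by (simp add: r ord_eq_0 coprime_commute)

lemma p0: "p > 0" using prime_gt_0_nat[OF prime] .

lemma coprime_p_s: "coprime p s" using cop by (simp add: coprime_commute)

lemma r_dvd: "r dvd p - 1"
proof -
 have "ord p s dvd totient p" by (rule order_divides_totient[OF coprime_p_s])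
 thus ?thesis using prime by (simp add: r totient_prime)
qed

lemma r_less: "r < p"
 using dvd_imp_le[OF r_dvd] prime_gt_1_nat[OF prime] by linarith

lemma p_not_dvd_r: "\<not> p dvd r"
 using r_pos r_less by (auto dest: dvd_imp_le)

lemma s_pow_r: "[s ^ r = 1] (mod p)"
 unfolding r using ord[of s p] by simp

definition el :: "nat => nat => 'g" where
 "el k l = \<sigma> ^$G k *$G \<tau> ^$G l"

lemma spow: "\<sigma> ^$G (k::nat) \<in>$G" and tpow: "\<tau> ^$G (l::nat) \<in>$G"
 using sG tG by auto

lemma el_closed: "el k l \<in>$G"
 by (simp add: el_def spow tpow)

lemma spow_eq_iff: "\<sigma> ^$G (k::nat) = 1$G \<longleftrightarrow> p dvd k"
 using G.pow_eq_id[OF sG] ord_s by simp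

lemma tpow_eq_iff: "\<tau> ^$G (k::nat) = 1$G \<longleftrightarrow> r dvd k"
 using G.pow_eq_id[OF tG] ord_t by simp

lemma spow_mod: "\<sigma> ^$G (k mod p) = \<sigma> ^$G k"
proof -
 have "\<sigma> ^$G (p * (k div p)) = 1$G" by (simp add: spow_eq_iff)
 thus ?thesis using G.nat_pow_mult[OF sG, of "p * (k div p)" "k mod p"] sG by simp
qed

lemma tpow_mod: "\<tau> ^$G (k mod r) = \<tau> ^$G k"
proof -
 have "\<tau> ^$G (r * (k div r)) = 1$G" by (simp add: tpow_eq_iff)
 thus ?thesis using G.nat_pow_mult[OF tG, of "r * (k div r)" "k mod r"] tG by simp
qed

lemma spow_cong: "[k = k'] (mod p) ==> \<sigma> ^$G k = \<sigma> ^$G k'"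
 using spow_mod[of k] spow_mod[of k'] by (simp add: cong_def)

lemma tau_sigma: "\<tau> *$G \<sigma> = \<sigma> ^$G s *$G \<tau>"
proof -
 have "\<sigma> ^$G s *$G \<tau> = \<tau> *$G \<sigma> *$G (inv\<^bsub>G\<^esub> \<tau> *$G \<tau>)"
  unfolding conj[symmetric] using sG tG by (simp add: G.m_assoc)
 thus ?thesis using sG tG by simp
qed

lemma tau_spow: "\<tau> *$G \<sigma> ^$G k = \<sigma> ^$G (s * k) *$G \<tau>"
proof (induction k)
 case (Suc k)
 have "\<tau> *$G \<sigma> ^$G Suc k = \<sigma> ^$G (s * k) *$G (\<tau> *$G \<sigma>)"
  using Suc spow sG tG by (simp add: G.m_assoc[symmetric])
 also have "\<dots> = \<sigma> ^$G (s * k) *$G \<sigma> ^$G s *$G \<tau>"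
  unfolding tau_sigma using spow sG tG by (simp add: G.m_assoc)
 finally show ?case using sG by (simp add: G.nat_pow_mult add.commute)
qed (use sG tG in simp)

lemma tpow_spow: "\<tau> ^$G l *$G \<sigma> ^$G k = \<sigma> ^$G (s ^ l * k) *$G \<tau> ^$G l"
proof (induction l arbitrary: k)
 case (Suc l)
 have "\<tau> ^$G Suc l *$G \<sigma> ^$G k = \<tau> ^$G l *$G (\<tau> *$G \<sigma> ^$G k)"
  using spow sG tG by (simp add: G.m_assoc)
 also have "\<dots> = (\<tau> ^$G l *$G \<sigma> ^$G (s * k)) *$G \<tau>"
  unfolding tau_spow using spow tpow tG by (simp add: G.m_assoc)
 also have "\<dots> = \<sigma> ^$G (s ^ l * (s * k)) *$G \<tau> ^$G Suc l"
  unfolding Suc.IH using spow tpow tG by (simp add: G.m_assoc)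
 finally show ?case by (simp add: mult_ac)
qed (use spow in simp)

lemma el_mult: "el k l *$G el k' l' = el (k + s ^ l * k') (l + l')"
proof -
 have "el k l *$G el k' l' = \<sigma> ^$G k *$G (\<tau> ^$G l *$G \<sigma> ^$G k') *$G \<tau> ^$G l'"
  unfolding el_def using spow tpow by (simp add: G.m_assoc)
 also have "\<dots> = (\<sigma> ^$G k *$G \<sigma> ^$G (s ^ l * k')) *$G (\<tau> ^$G l *$G \<tau> ^$G l')"
  unfolding tpow_spow using spow tpow by (simp add: G.m_assoc)
 finally show ?thesis using sG tG by (simp add: G.nat_pow_mult el_def)
qed

lemma el_mod: "el (k mod p) (l mod r) = el k l"
 by (simp add: el_def spow_mod tpow_mod)

lemma el_simps: "el k 0 = \<sigma> ^$G k" "el 0 l = \<tau> ^$G l" "el 1 0 = \<sigma>" "el 0 1 = \<tau>" "el 0 0 = 1$G"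
 using sG tG by (simp_all add: el_def spow tpow)

lemma Gamma_el: "\<Gamma> = {el k l | k l. True}"
proof
 have "subgroup {el k l | k l. True} G"
 proof (rule G.subgroupI)
  show "{el k l | k l. True} \<subseteq> carrier G" using el_closed by auto
  show "{el k l | k l. True} \<noteq> {}" by auto
  fix a b assume a: "a \<in> {el k l | k l. True}" and b: "b \<in> {el k l | k l. True}"
  show "a *$G b \<in> {el k l | k l. True}" using a b by clarify (use el_mult in blast)
  obtain k l where kl: "a = el k l" using a by blast
  \<comment> \<open>Exponents are natural numbers: (r - 1) l and (p - 1) k stand for - l and -
    k.\<close>
  have "el (s ^ ((r - 1) * l) * ((p - 1) * k)) ((r - 1) * l) *$G el k l = 1$G"
  proof -
   have "s ^ ((r - 1) * l) * ((p - 1) * k) + s ^ ((r - 1) * l) * k = p * (s ^ ((r - 1) * l) * k)"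
    using p0 by (cases p) (simp_all add: algebra_simps)
   moreover have "(r - 1) * l + l = r * l" using r_pos by (cases r) simp_all
   ultimately show ?thesis
    unfolding el_mult by (simp add: el_def spow_eq_iff[THEN iffD2] tpow_eq_iff[THEN iffD2])
  qed
  hence "inv\<^bsub>G\<^esub> a = el (s ^ ((r - 1) * l) * ((p - 1) * k)) ((r - 1) * l)"
   unfolding kl by (rule G.inv_equality[OF _ el_closed el_closed])
  thus "inv\<^bsub>G\<^esub> a \<in> {el k l | k l. True}" by blast
 qed
 moreover have "\<sigma> \<in> {el k l | k l. True}" "\<tau> \<in> {el k l | k l. True}"
  using el_simps(3,4) by (metis (mono_tags, lifting) mem_Collect_eq)+
 ultimately show "\<Gamma> \<subseteq> {el k l | k l. True}"
  unfolding Gamma by (intro G.generate_subgroup_incl) auto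
 show "{el k l | k l. True} \<subseteq> \<Gamma>"
 proof
  fix a assume "a \<in> {el k l | k l. True}"
  then obtain k l where a: "a = el k l" by blast
  have sub: "subgroup \<Gamma> G" unfolding Gamma by (rule G.generate_is_subgroup) (use sG tG in auto)
  have "\<sigma> \<in> \<Gamma>" "\<tau> \<in> \<Gamma>" unfolding Gamma by (auto intro: generate.incl)
  hence "\<sigma> ^$G k \<in> \<Gamma>" "\<tau> ^$G l \<in> \<Gamma>"
   using subgroup.one_closed[OF sub] subgroup.m_closed[OF sub] by (induction k; induction l; simp)+
  thus "a \<in> \<Gamma>" unfolding a el_def by (rule subgroup.m_closed[OF sub])
 qed
qed

lemma el_Gamma: "el k l \<in> \<Gamma>" using Gamma_el by blast

text \<open>With the powers of \<sigma> on one side and those of \<tau> on the other, the common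
  value has an order dividing both p and r. These are coprime, since r divides p - 1.\<close>

lemma el_inj:
 assumes eq: "el k l = el k' l'" shows "[k = k'] (mod p)" "[l = l'] (mod r)"
proof -
 define x where "x = \<sigma> ^$G ((p - 1) * k' + k)"
 have "\<sigma> ^$G ((p - 1) * k') *$G el k l *$G \<tau> ^$G ((r - 1) * l) =
   \<sigma> ^$G ((p - 1) * k') *$G el k' l' *$G \<tau> ^$G ((r - 1) * l)" using eq by simp
 hence "el ((p - 1) * k') 0 *$G el k l *$G el 0 ((r - 1) * l) = el ((p - 1) * k') 0 *$G el k' l' *$G el 0 ((r - 1) * l)"
  by (simp add: el_simps)
 hence "el ((p - 1) * k' + k) (l + (r - 1) * l) = el ((p - 1) * k' + k') (l' + (r - 1) * l)"
  by (simp add: el_mult)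
 moreover have "(p - 1) * k' + k' = p * k'" using p0 by (cases p) simp_all
 moreover have "l + (r - 1) * l = r * l" using r_pos by (cases r) simp_all
 ultimately have xt: "x = \<tau> ^$G (l' + (r - 1) * l)"
  using spow tpow by (simp add: el_def x_def spow_eq_iff[THEN iffD2] tpow_eq_iff[THEN iffD2])
 have xG: "x \<in>$G" by (simp add: x_def spow)
 have "x ^$G p = 1$G" unfolding x_def using sG by (simp add: G.nat_pow_pow spow_eq_iff)
 moreover have "x ^$G r = 1$G" unfolding xt using tG by (simp add: G.nat_pow_pow tpow_eq_iff)
 ultimately have "G.ord x dvd p" "G.ord x dvd r" using G.pow_eq_id[OF xG] by simp_all
 moreover have "coprime p r" using prime_imp_coprime[OF prime p_not_dvd_r] .
 ultimately have "G.ord x = 1" using coprime_common_divisor by (metis nat_dvd_1_iff_1)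
 hence x1: "x = 1$G" using G.ord_eq_1[OF xG] by simp
 have "p dvd (p - 1) * k' + k" using x1 spow_eq_iff unfolding x_def by simp
 hence "[(p - 1) * k' + k + k' = k'] (mod p)" by (simp add: cong_def mod_simps dvd_eq_mod_eq_0) (metis add_0 mod_add_left_eq)
 moreover have "(p - 1) * k' + k + k' = p * k' + k" using p0 by (cases p) (simp_all add: algebra_simps)
 ultimately show "[k = k'] (mod p)" unfolding cong_def by (metis mod_mult_self4)
 have "r dvd l' + (r - 1) * l" using x1 tpow_eq_iff unfolding xt by simp
 hence "[l' + (r - 1) * l + l = l] (mod r)" by (simp add: cong_def mod_simps dvd_eq_mod_eq_0) (metis add_0 mod_add_left_eq)
 moreover have "l' + (r - 1) * l + l = r * l + l'" using r_pos by (cases r) (simp_all add: algebra_simps)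
 ultimately show "[l = l'] (mod r)" unfolding cong_def by (metis mod_mult_self4)
qed

lemma el_bij: "bij_betw (%z. el (fst z) (snd z)) ({..<p} \<times> {..<r}) \<Gamma>"
proof (rule bij_betw_imageI)
 show "inj_on (%z. el (fst z) (snd z)) ({..<p} \<times> {..<r})"
 proof (rule inj_onI)
  fix z z' assume z: "z \<in> {..<p} \<times> {..<r}" "z' \<in> {..<p} \<times> {..<r}" "el (fst z) (snd z) = el (fst z') (snd z')"
  from el_inj[OF z(3)] show "z = z'" using z(1,2) by (auto simp: cong_def)
 qed
 show "(%z. el (fst z) (snd z)) ` ({..<p} \<times> {..<r}) = \<Gamma>"
 proof
  show "\<Gamma> \<subseteq> (%z. el (fst z) (snd z)) ` ({..<p} \<times> {..<r})"
  proof
   fix a assume "a \<in> \<Gamma>"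
   then obtain k l where "a = el (k mod p) (l mod r)" unfolding Gamma_el el_mod by blast
   thus "a \<in> (%z. el (fst z) (snd z)) ` ({..<p} \<times> {..<r})"
    using p0 r_pos by (intro image_eqI[of _ _ "(k mod p, l mod r)"]) auto
  qed
 qed (use el_Gamma in auto)
qed

lemma finite_Gamma: "finite \<Gamma>"
 using bij_betw_finite[OF el_bij] by simp

end

locale metacyclic_setup = decomp_setup p G \<Gamma> j D I \<phi> + metacyclic_group p G \<Gamma> r s \<sigma> \<tau>
 for p and G :: "'g monoid" and \<Gamma> j D I \<phi> r s \<sigma> \<tau> +
 fixes \<rho> :: "nat => int"
 assumes rho: "\<rho> \<in> Units Zp" and rho_root: "\<exists>n>0. \<rho> ^$Zp (n::nat) = 1$Zp"
  and rho_s: "\<rho> 1 = int s mod int p"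
begin

lemma finsum_Gamma:
 assumes "abelian_group B" "!!g. g \<in> \<Gamma> ==> f g \<in>$B"
 shows "(\<Oplus>$B g\<in>\<Gamma>. f g) = (\<Oplus>$B k\<in>{..<p}. \<Oplus>$B l\<in>{..<r}. f (el k l))"
proof -
 interpret B: abelian_group B by fact
 have "(\<Oplus>$B k\<in>{..<p}. \<Oplus>$B l\<in>{..<r}. f (el k l)) = (\<Oplus>$B z\<in>{..<p} \<times> {..<r}. f (el (fst z) (snd z)))"
  by (rule B.finsum_product) (use assms(2) el_Gamma in auto)
 also have "\<dots> = (\<Oplus>$B g\<in>\<Gamma>. f g)"
  by (rule B.finsum_bij[OF el_bij, symmetric]) (rule assms(2))
 finally show ?thesis ..
qed

subsection \<open>Lattices with prescribed action of \<open>\<sigma>\<close> and \<open>\<tau>\<close>\<close>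

text \<open>The relations S^p = 1, T^r = 1 and T S = S^s T make \<sigma>^k \<tau>^l \<mapsto> S^k
  T^l a well-defined representation of \<Gamma>. The double sum in \<open>gamma_mod\<close> is the
  resulting action of the group ring.\<close>

lemma gamma_mod:
 fixes M :: "(nat => int, 'm) module"
 assumes M: "left_module Zp M"
  and S: "!!x. x \<in>$M ==> S x \<in>$M"
   "!!x y. [|x \<in>$M; y \<in>$M|] ==> S (x +$M y) = S x +$M S y"
   "!!c x. [|c \<in>$Zp; x \<in>$M|] ==> S (c \<odot>$M x) = c \<odot>$M S x"
  and T: "!!x. x \<in>$M ==> T x \<in>$M"
   "!!x y. [|x \<in>$M; y \<in>$M|] ==> T (x +$M y) = T x +$M T y"
   "!!c x. [|c \<in>$Zp; x \<in>$M|] ==> T (c \<odot>$M x) = c \<odot>$M T x"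
  and Sp: "!!x. x \<in>$M ==> (S ^^ p) x = x" and Tr: "!!x. x \<in>$M ==> (T ^^ r) x = x"
  and TS: "!!x. x \<in>$M ==> T (S x) = (S ^^ s) (T x)"
 shows "left_module Lam (gamma_mod p r G \<sigma> \<tau> M S T)"
  and "[|c \<in>$Zp; x \<in>$M|] ==>
   gr_mono Zp GG c (el k l) \<odot>$(gamma_mod p r G \<sigma> \<tau> M S T) x = c \<odot>$M (S ^^ k) ((T ^^ l) x)"
proof -
 interpret M: left_module Zp M by fact
 have Sn: "(S ^^ n) x \<in>$M" "y \<in>$M ==> (S ^^ n) (x +$M y) = (S ^^ n) x +$M (S ^^ n) y"
  "c \<in>$Zp ==> (S ^^ n) (c \<odot>$M x) = c \<odot>$M (S ^^ n) x" if "x \<in>$M" for x y c n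
 proof -
  show cl: "(S ^^ n) x \<in>$M" for n using that by (induction n) (simp_all add: S)
  have cl': "(S ^^ n) x \<in>$M" if "x \<in>$M" for n x using that by (induction n) (simp_all add: S)
  show "y \<in>$M ==> (S ^^ n) (x +$M y) = (S ^^ n) x +$M (S ^^ n) y" using that
   by (induction n) (simp_all add: S cl')
  show "c \<in>$Zp ==> (S ^^ n) (c \<odot>$M x) = c \<odot>$M (S ^^ n) x" using that
   by (induction n) (simp_all add: S cl')
 qed
 have Tn: "(T ^^ n) x \<in>$M" "y \<in>$M ==> (T ^^ n) (x +$M y) = (T ^^ n) x +$M (T ^^ n) y"
  "c \<in>$Zp ==> (T ^^ n) (c \<odot>$M x) = c \<odot>$M (T ^^ n) x" if "x \<in>$M" for x y c n
 proof -
  show cl: "(T ^^ n) x \<in>$M" for n using that by (induction n) (simp_all add: T)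
  have cl': "(T ^^ n) x \<in>$M" if "x \<in>$M" for n x using that by (induction n) (simp_all add: T)
  show "y \<in>$M ==> (T ^^ n) (x +$M y) = (T ^^ n) x +$M (T ^^ n) y" using that
   by (induction n) (simp_all add: T cl')
  show "c \<in>$Zp ==> (T ^^ n) (c \<odot>$M x) = c \<odot>$M (T ^^ n) x" using that
   by (induction n) (simp_all add: T cl')
 qed
 have Spn: "(S ^^ (p * n)) x = x" if "x \<in>$M" for n x
  using that by (induction n) (simp_all add: funpow_add Sp)
 have Trn: "(T ^^ (r * n)) x = x" if "x \<in>$M" for n x
  using that by (induction n) (simp_all add: funpow_add Tr)
 have Sc: "(S ^^ k) x = (S ^^ (k mod p)) x" if "x \<in>$M" for k x
 proof -
  have "(S ^^ (k mod p + p * (k div p))) x = (S ^^ (k mod p)) x" unfolding funpow_add by (simp add: Spn[OF that])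
  thus ?thesis by simp
 qed
 have Tc: "(T ^^ k) x = (T ^^ (k mod r)) x" if "x \<in>$M" for k x
 proof -
  have "(T ^^ (k mod r + r * (k div r))) x = (T ^^ (k mod r)) x" unfolding funpow_add by (simp add: Trn[OF that])
  thus ?thesis by simp
 qed
 have TSk: "T ((S ^^ k) x) = (S ^^ (s * k)) (T x)" if "x \<in>$M" for k x
  using that
 proof (induction k)
  case (Suc k)
  thus ?case using TS[OF Sn(1)[OF Suc.prems, of k]] by (simp add: funpow_add)
 qed simp
 have TlSk: "(T ^^ l) ((S ^^ k) x) = (S ^^ (s ^ l * k)) ((T ^^ l) x)" if "x \<in>$M" for k l x
  using that
 proof (induction l)
  case (Suc l)
  thus ?case using TSk[OF Tn(1)[OF Suc.prems, of l]] by (simp add: mult_ac)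
 qed simp
 \<comment> \<open>Some pair of exponents of g; by \<open>el_inj\<close> every choice gives the same
   operator.\<close>
 define kl where "kl g = (SOME z. g = el (fst z) (snd z))" for g
 define \<psi> where "\<psi> g x = (S ^^ fst (kl g)) ((T ^^ snd (kl g)) x)" for g x
 have psi: "\<psi> (el k l) x = (S ^^ k) ((T ^^ l) x)" if x: "x \<in>$M" for k l x
 proof -
  have "el k l = el (fst (k, l)) (snd (k, l))" by simp
  hence "el k l = el (fst (kl (el k l))) (snd (kl (el k l)))" unfolding kl_def by (rule someI)
  from el_inj[OF this] have "fst (kl (el k l)) mod p = k mod p" "snd (kl (el k l)) mod r = l mod r" by (simp_all add: cong_def)
  hence "(T ^^ snd (kl (el k l))) x = (T ^^ l) x" "(S ^^ fst (kl (el k l))) ((T ^^ l) x) = (S ^^ k) ((T ^^ l) x)"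
   using Tc[OF x] Sc[OF Tn(1)[OF x]] by metis+
  thus ?thesis by (simp add: \<psi>_def)
 qed
 have ex: "\<exists>k l. g = el k l" if "g \<in>$GG" for g using that Gamma_el by auto
 interpret R: group_rep Zp GG M \<psi>
 proof (intro group_rep.intro group_rep_axioms.intro lam.fin_group_cring_axioms M)
  fix g x y c assume "g \<in>$GG" and x: "x \<in>$M"
  then obtain k l where g: "g = el k l" using ex by blast
  show "\<psi> g x \<in>$M" using x by (simp add: g psi Sn Tn)
  show "\<psi> g (x +$M y) = \<psi> g x +$M \<psi> g y" if "y \<in>$M" using x that by (simp add: g psi Sn Tn)
  show "\<psi> g (c \<odot>$M x) = c \<odot>$M \<psi> g x" if "c \<in>$Zp" using x that by (simp add: g psi Sn Tn M.smult_closed)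
  fix h assume "h \<in>$GG"
  then obtain k' l' where h: "h = el k' l'" using ex by blast
  show "\<psi> (g *$GG h) x = \<psi> g (\<psi> h x)"
   using x TlSk[OF Tn(1)[OF x, of l'], of l k'] by (simp add: g h el_mult psi Sn Tn funpow_add)
 next
  fix x assume "x \<in>$M"
  thus "\<psi> 1$GG x = x" using psi[of x 0 0] by (simp add: el_simps)
 qed
 let ?N = "mk_mod (carrier M) 0$M (\<oplus>$M) R.act" and ?W = "gamma_mod p r G \<sigma> \<tau> M S T"
 have W: "carrier ?W = carrier M" "0$?W = 0$M" "x +$?W y = x +$M y" for x y by (simp_all add: gamma_mod_def)
 have act: "a \<odot>$?W x = R.act a x" if a: "a \<in>$Lam" and x: "x \<in>$M" for a x
 proof -
  have cl: "a g \<odot>$M \<psi> g x \<in>$M" if "g \<in> \<Gamma>" for g using R.term_closed[OF a x] that by simp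
  have "R.act a x = (\<Oplus>$M k\<in>{..<p}. \<Oplus>$M l\<in>{..<r}. a (el k l) \<odot>$M \<psi> (el k l) x)"
   unfolding gr_act_def using finsum_Gamma[OF M.M.abelian_group_axioms cl] by simp
  thus ?thesis by (simp add: gamma_mod_def el_def[symmetric] psi[OF x])
 qed
 have h: "id \<in> lmod_hom Lam ?N ?W" by (rule lmod_homI) (simp_all add: W act)
 show "left_module Lam ?W"
  by (rule left_module_image[OF R.rep_left_module h]) (simp_all add: W)
 show "gr_mono Zp GG c (el k l) \<odot>$?W x = c \<odot>$M (S ^^ k) ((T ^^ l) x)" if "c \<in>$Zp" "x \<in>$M"
  using that act[OF lam.gr_mono_closed[OF that(1)] that(2)] R.act_mono[OF that(1) _ that(2), of "el k l"] el_Gamma psi by simp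
qed

lemma rho_closed: "\<rho> \<in>$Zp" using rho by auto

text \<open>The left side is a root of unity with residue s^r = 1, and 1 is the only such root of
  unity.\<close>

lemma rho_pow_r: "\<rho> ^$Zp r = 1$Zp"
proof -
 obtain n :: nat where n: "n > 0" "\<rho> ^$Zp n = 1$Zp" using rho_root by blast
 have "(\<rho> ^$Zp r) 1 = int (s ^ r) mod int p"
  unfolding residue_simps(5)[OF rho_closed] rho_s by (simp add: mod_simps)
 also have "\<dots> = 1"
  using s_pow_r p_gt_1 unfolding cong_int_iff[symmetric] by (simp add: cong_def)
 finally have "(\<rho> ^$Zp r) 1 = 1" .
 moreover have "(\<rho> ^$Zp r) ^$Zp n = 1$Zp"
 proof -
  have "(\<rho> ^$Zp r) ^$Zp n = (\<rho> ^$Zp n) ^$Zp r"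
   using rho_closed by (simp add: Zp.nat_pow_pow mult.commute)
  thus ?thesis by (simp add: n(2))
 qed
 ultimately show ?thesis using padic_root_of_unity[of "\<rho> ^$Zp r" n] n(1) rho_closed by simp
qed

lemma rho_pow_eq_one: "\<rho> ^$Zp (k::nat) = 1$Zp \<longleftrightarrow> r dvd k"
proof
 assume "r dvd k"
 then obtain m where "k = r * m" by (auto simp: dvd_def)
 thus "\<rho> ^$Zp k = 1$Zp"
  using rho_closed rho_pow_r by (simp add: Zp.nat_pow_pow[symmetric])
next
 assume "\<rho> ^$Zp k = 1$Zp"
 hence "(\<rho> ^$Zp k) 1 = 1" using residue_simps(7) by simp
 hence "int (s ^ k) mod int p = 1"
  unfolding residue_simps(5)[OF rho_closed] rho_s by (simp add: mod_simps)
 hence "[int (s ^ k) = int 1] (mod int p)" using p_gt_1 by (simp add: cong_def)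
 hence "[s ^ k = 1] (mod p)" unfolding cong_int_iff .
 thus "r dvd k" using ord_divides by (simp add: r)
qed

definition rhoi :: "nat => int" where "rhoi = inv\<^bsub>Zp\<^esub> \<rho>"

lemma rhoi_closed: "rhoi \<in>$Zp" and rhoi: "rhoi *$Zp \<rho> = 1$Zp"
 using rho by (simp_all add: rhoi_def)

lemma rhoi_pow: "rhoi ^$Zp (k::nat) *$Zp \<rho> ^$Zp k = 1$Zp"
 using rhoi_closed rho_closed rhoi by (simp add: Zp.nat_pow_distrib[symmetric])

lemma rhoi_pow_r: "rhoi ^$Zp r = 1$Zp"
 using rhoi_pow[of r] rho_pow_r rhoi_closed by simp

definition rinv :: "nat => int" where "rinv = inv\<^bsub>Zp\<^esub> ([r] \<cdot>$Zp 1$Zp)"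

lemma rinv_closed: "rinv \<in>$Zp" and rinv: "rinv *$Zp ([r] \<cdot>$Zp 1$Zp) = 1$Zp"
 using of_nat_unit[OF p_not_dvd_r] by (simp_all add: rinv_def)

text \<open>Orthogonality for a cyclic group of order r. For y \<noteq> 1 the factor y - 1 is a unit
  and can be cancelled from (y - 1) times the sum, which is y^r - 1 = 0.\<close>

lemma geometric_sum:
 assumes y: "y \<in>$Zp" and yr: "y ^$Zp r = 1$Zp"
 shows "rinv *$Zp (\<Oplus>$Zp l\<in>{..<r}. y ^$Zp l) = (if y = 1$Zp then 1$Zp else 0$Zp)"
proof (cases "y = 1$Zp")
 case True
 have "(\<Oplus>$Zp l\<in>{..<r}. 1$Zp ^$Zp l) = [r] \<cdot>$Zp 1$Zp"
  using Zp.add.finprod_const[of "1$Zp" "{..<r}"] by simp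
 thus ?thesis using True rinv by simp
next
 case False
 have c: "(\<Oplus>$Zp l\<in>{..<n}. y ^$Zp l) \<in>$Zp" for n :: nat using y by (intro Zp.finsum_closed) auto
 have g: "(y -$Zp 1$Zp) *$Zp (\<Oplus>$Zp l\<in>{..<n}. y ^$Zp l) = y ^$Zp n -$Zp 1$Zp" for n :: nat
 proof (induction n)
  case 0
  thus ?case using y by (simp add: a_minus_def Zp.r_neg)
 next
  case (Suc n)
  define S where "S = (\<Oplus>$Zp l\<in>{..<n}. y ^$Zp l)"
  have S: "S \<in>$Zp" unfolding S_def by (rule c)
  define q where "q = y ^$Zp n"
  have q: "q \<in>$Zp" using y by (simp add: q_def)
  have IH: "(y -$Zp 1$Zp) *$Zp S = q -$Zp 1$Zp" using Suc by (simp add: S_def q_def)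
  have "(\<Oplus>$Zp l\<in>{..<Suc n}. y ^$Zp l) = q +$Zp S"
   unfolding lessThan_Suc S_def q_def using y by (subst Zp.finsum_insert) auto
  hence "(y -$Zp 1$Zp) *$Zp (\<Oplus>$Zp l\<in>{..<Suc n}. y ^$Zp l)
    = (y -$Zp 1$Zp) *$Zp q +$Zp (y -$Zp 1$Zp) *$Zp S"
   using y q S by (simp add: Zp.r_distr)
  also have "\<dots> = q *$Zp y -$Zp 1$Zp"
   unfolding IH using y q Zp.one_closed by algebra
  finally show ?case by (simp add: q_def)
 qed
 have U: "y -$Zp 1$Zp \<in> Units Zp" by (rule root_of_unity_minus_one[OF y r_pos yr False])
 have "(y -$Zp 1$Zp) *$Zp (\<Oplus>$Zp l\<in>{..<r}. y ^$Zp l) = 0$Zp"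
  unfolding g yr by (simp add: a_minus_def Zp.r_neg)
 also have "\<dots> = (y -$Zp 1$Zp) *$Zp 0$Zp" using Zp.Units_closed[OF U] by simp
 finally have "(\<Oplus>$Zp l\<in>{..<r}. y ^$Zp l) = 0$Zp"
  by (rule Zp.Units_l_cancel[OF U c Zp.zero_closed, THEN iffD1])
 thus ?thesis using False rinv_closed by simp
qed

subsection \<open>The idempotents of \<open>\<int>\<^sub>p[\<langle>\<tau>\<rangle>]\<close>\<close>

text \<open>The l-th term of the idempotent e_i, which is 1/r times the sum of \<rho>^{-il} \<tau>^l
  over l < r and belongs to the eigenvalue \<rho>^i of \<tau>.\<close>

definition tm :: "nat => nat => 'g => nat => int" where
 "tm i l = gr_mono Zp GG (rinv *$Zp rhoi ^$Zp (i * l)) (el 0 l)"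

definition idem :: "nat => 'g => nat => int" where
 "idem i = (\<Oplus>$Lam l\<in>{..<r}. tm i l)"

lemma tm_closed: "tm i l \<in>$Lam"
 unfolding tm_def by (rule lam.gr_mono_closed) (use rinv_closed rhoi_closed in simp)

lemma idem_closed: "idem i \<in>$Lam"
 unfolding idem_def by (rule lam.RG.finsum_closed) (use tm_closed in auto)

abbreviation "cst \<equiv> gr_const Zp GG"
abbreviation "gel k l \<equiv> gr_of Zp GG (el k l)"

lemma cst_closed: "c \<in>$Zp ==> cst c \<in>$Lam" by (rule lam.gr_const_closed)
lemma gel_closed: "gel k l \<in>$Lam" by (rule lam.gr_of_closed)

lemma gel_mult: "gel k l *$Lam gel k' l' = gel (k + s ^ l * k') (l + l')"
 using lam.gr_of_mult[of "el k l" "el k' l'"] el_Gamma el_mult by simp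

text \<open>An eigenvector of \<tau> with eigenvalue \<rho>^i. It is instantiated with e_i in the
  group ring, with 1 in L_1^i and with \<open>lambda\<close>^i in Z_p[\<zeta>]; one computation of
  the action on w serves all three.\<close>

definition eigen :: "('g => nat => int, 'w) module => nat => 'w => bool" where
 "eigen W i w \<longleftrightarrow> left_module Lam W \<and> w \<in>$W \<and> gel 0 1 \<odot>$W w = cst (\<rho> ^$Zp i) \<odot>$W w"

lemma eigen_pow:
 assumes "eigen W i w" shows "gel 0 l \<odot>$W w = cst (\<rho> ^$Zp (i * l)) \<odot>$W w"
proof -
 interpret W: left_module Lam W using assms by (simp add: eigen_def)
 have w: "w \<in>$W" and t: "gel 0 1 \<odot>$W w = cst (\<rho> ^$Zp i) \<odot>$W w" using assms by (auto simp: eigen_def)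
 show ?thesis
 proof (induction l)
  case 0
  have "gel 0 0 = 1$Lam" using lam.gr_of_one by (simp add: el_simps)
  thus ?case using ring_hom_one[OF lam.gr_const_hom] by simp
 next
  case (Suc l)
  have c: "cst (\<rho> ^$Zp (k::nat)) \<in>$Lam" for k using rho_closed by (simp add: cst_closed)
  have "gel 0 (Suc l) \<odot>$W w = gel 0 1 \<odot>$W (gel 0 l \<odot>$W w)"
   using W.smult_assoc[OF gel_closed gel_closed w, of 0 1 0 l] gel_mult[of 0 1 0 l] by simp
  also have "\<dots> = cst (\<rho> ^$Zp (i * l)) \<odot>$W (gel 0 1 \<odot>$W w)"
   unfolding Suc using W.smult_assoc[OF gel_closed c w, of 0 1 "i * l"] W.smult_assoc[OF c gel_closed w, of "i * l" 0 1]
    lam.gr_const_central[OF _ gel_closed, of "\<rho> ^$Zp (i * l)" 0 1] rho_closed by simp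
  also have "\<dots> = cst (\<rho> ^$Zp (i * Suc l)) \<odot>$W w"
   unfolding t using W.smult_assoc[OF c c w, symmetric] rho_closed
    ring_hom_mult[OF lam.gr_const_hom, of "\<rho> ^$Zp (i * l)" "\<rho> ^$Zp i", symmetric]
   by (simp add: Zp.nat_pow_mult add.commute)
  finally show ?case .
 qed
qed

lemma eigen_mono:
 assumes e: "eigen W i w" and c: "c \<in>$Zp"
 shows "gr_mono Zp GG c (el k l) \<odot>$W w = gr_mono Zp GG (c *$Zp \<rho> ^$Zp (i * l)) (el k 0) \<odot>$W w"
proof -
 interpret W: left_module Lam W using e by (simp add: eigen_def)
 have w: "w \<in>$W" using e by (simp add: eigen_def)
 have q: "\<rho> ^$Zp (i * l) \<in>$Zp" using rho_closed by simp
 have m: "gr_mono Zp GG c (el k 0) \<in>$Lam" by (rule lam.gr_mono_closed[OF c])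
 have "gr_mono Zp GG c (el k l) = gr_mono Zp GG c (el k 0) *$Lam gel 0 l"
  using lam.gr_mono_mult[OF c Zp.one_closed, of "el k 0" "el 0 l"] el_Gamma c by (simp add: gr_of_mono el_mult)
 hence "gr_mono Zp GG c (el k l) \<odot>$W w = gr_mono Zp GG c (el k 0) \<odot>$W (cst (\<rho> ^$Zp (i * l)) \<odot>$W w)"
  using W.smult_assoc[OF m gel_closed w, of 0 l] eigen_pow[OF e, of l] by simp
 also have "\<dots> = (gr_mono Zp GG c (el k 0) *$Lam cst (\<rho> ^$Zp (i * l))) \<odot>$W w"
  using W.smult_assoc[OF m cst_closed[OF q] w] by simp
 also have "gr_mono Zp GG c (el k 0) *$Lam cst (\<rho> ^$Zp (i * l)) = gr_mono Zp GG (c *$Zp \<rho> ^$Zp (i * l)) (el k 0)"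
  unfolding gr_const_def
  using lam.gr_mono_mult[OF c q, of "el k 0" "1$GG"] el_Gamma[of k 0] el_closed[of k 0] subgroup.one_closed[OF sgGamma] by simp
 finally show ?thesis .
qed

text \<open>On w the l-th term acts as y^l / r with y = \<rho>^(i - i'), so orthogonality
  applies.\<close>

lemma idem_eigen:
 assumes e: "eigen W i w"
 shows "idem i' \<odot>$W w = (if \<rho> ^$Zp i = \<rho> ^$Zp i' then w else 0$W)"
proof -
 interpret W: left_module Lam W using e by (simp add: eigen_def)
 have w: "w \<in>$W" using e by (simp add: eigen_def)
 define y where "y = rhoi ^$Zp i' *$Zp \<rho> ^$Zp i"
 have y: "y \<in>$Zp" using rhoi_closed rho_closed by (simp add: y_def)
 have yr: "y ^$Zp r = 1$Zp"
  using rhoi_closed rho_closed rhoi_pow_r rho_pow_r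
  by (simp add: y_def Zp.nat_pow_distrib Zp.nat_pow_pow mult.commute[of _ r])
   (simp add: Zp.nat_pow_pow[symmetric])
 have y1: "y = 1$Zp \<longleftrightarrow> \<rho> ^$Zp i = \<rho> ^$Zp i'"
 proof
  assume "y = 1$Zp"
  hence "\<rho> ^$Zp i' *$Zp (rhoi ^$Zp i' *$Zp \<rho> ^$Zp i) = \<rho> ^$Zp i'"
   using rho_closed by (simp add: y_def)
  moreover have "\<rho> ^$Zp i' *$Zp (rhoi ^$Zp i' *$Zp \<rho> ^$Zp i) =
    (rhoi ^$Zp i' *$Zp \<rho> ^$Zp i') *$Zp \<rho> ^$Zp i"
   using rhoi_closed rho_closed by (simp add: Zp.m_ac)
  ultimately show "\<rho> ^$Zp i = \<rho> ^$Zp i'" using rho_closed by (simp add: rhoi_pow)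
 qed (simp add: y_def rhoi_pow)
 have tw: "tm i' l \<odot>$W w = cst (rinv *$Zp y ^$Zp l) \<odot>$W w" for l
 proof -
  have c: "rinv *$Zp rhoi ^$Zp (i' * l) \<in>$Zp" using rinv_closed rhoi_closed by simp
  have "rinv *$Zp rhoi ^$Zp (i' * l) *$Zp \<rho> ^$Zp (i * l) = rinv *$Zp y ^$Zp l"
   using rinv_closed rhoi_closed rho_closed
   by (simp add: y_def Zp.nat_pow_distrib Zp.nat_pow_pow Zp.m_assoc)
  thus ?thesis
   unfolding tm_def eigen_mono[OF e c] by (simp add: el_simps gr_const_def)
 qed
 have "idem i' \<odot>$W w = (\<Oplus>$W l\<in>{..<r}. tm i' l \<odot>$W w)"
  unfolding idem_def by (rule W.smult_finsum_left[OF w]) (use tm_closed in auto)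
 also have "\<dots> = (\<Oplus>$W l\<in>{..<r}. cst (rinv *$Zp y ^$Zp l) \<odot>$W w)" unfolding tw ..
 also have "\<dots> = (\<Oplus>$Lam l\<in>{..<r}. cst (rinv *$Zp y ^$Zp l)) \<odot>$W w"
  by (rule W.smult_finsum_left[OF w, symmetric]) (use rinv_closed y in "auto intro!: cst_closed")
 also have "(\<Oplus>$Lam l\<in>{..<r}. cst (rinv *$Zp y ^$Zp l)) = cst (\<Oplus>$Zp l\<in>{..<r}. rinv *$Zp y ^$Zp l)"
  by (rule additive_finsum[OF Zp.abelian_group_axioms lam.RG.abelian_group_axioms, symmetric])
   (use rinv_closed y in "auto intro!: cst_closed simp: ring_hom_add[OF lam.gr_const_hom]")
 also have "(\<Oplus>$Zp l\<in>{..<r}. rinv *$Zp y ^$Zp l) = rinv *$Zp (\<Oplus>$Zp l\<in>{..<r}. y ^$Zp l)"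
  by (rule Zp.finsum_rdistr[symmetric]) (use rinv_closed y in auto)
 also have "\<dots> = (if y = 1$Zp then 1$Zp else 0$Zp)" by (rule geometric_sum[OF y yr])
 finally have "idem i' \<odot>$W w = cst (if y = 1$Zp then 1$Zp else 0$Zp) \<odot>$W w" .
 thus ?thesis
  using ring_hom_one[OF lam.gr_const_hom] ring_hom_zero[OF lam.gr_const_hom Zp.ring_axioms lam.group_ring_ring] w
  by (simp add: y1 W.smult_one W.smult_zero_left)
qed

lemma tm_periodic: "tm i (l mod r) = tm i l"
proof -
 have "rhoi ^$Zp (i * (r * q + m)) = rhoi ^$Zp (i * m)" for q m
 proof -
  have "rhoi ^$Zp (i * (r * q + m)) = (rhoi ^$Zp r) ^$Zp (i * q) *$Zp rhoi ^$Zp (i * m)"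
   using rhoi_closed by (simp add: Zp.nat_pow_pow Zp.nat_pow_mult distrib_left mult.left_commute)
  thus ?thesis using rhoi_closed by (simp add: rhoi_pow_r)
 qed
 from this[of "l div r" "l mod r"] have "rhoi ^$Zp (i * l) = rhoi ^$Zp (i * (l mod r))" by simp
 moreover have "el 0 (l mod r) = el 0 l" by (simp add: el_def tpow_mod)
 ultimately show ?thesis by (simp add: tm_def)
qed

lemma gel_tm: "gel 0 1 *$Lam tm i l = cst (\<rho> ^$Zp i) *$Lam tm i (Suc l)"
 and tm_gel: "tm i l *$Lam gel 0 1 = gel 0 1 *$Lam tm i l"
proof -
 define c where "c l = rinv *$Zp rhoi ^$Zp (i * l)" for l
 have c: "c l \<in>$Zp" for l using rinv_closed rhoi_closed by (simp add: c_def)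
 have q: "\<rho> ^$Zp i \<in>$Zp" using rho_closed by simp
 have one: "1$G \<in> \<Gamma>" by (rule subgroup.one_closed[OF sgGamma])
 have "\<rho> ^$Zp i *$Zp c (Suc l) = c l *$Zp (rhoi ^$Zp i *$Zp \<rho> ^$Zp i)"
  using rinv_closed rhoi_closed rho_closed by (simp add: c_def Zp.nat_pow_mult[symmetric] Zp.m_ac)
 hence cS: "\<rho> ^$Zp i *$Zp c (Suc l) = c l" using c by (simp add: rhoi_pow)
 show "gel 0 1 *$Lam tm i l = cst (\<rho> ^$Zp i) *$Lam tm i (Suc l)"
  unfolding tm_def gr_of_mono gr_const_def c_def[symmetric]
  using lam.gr_mono_mult[OF Zp.one_closed c, of "el 0 1" "el 0 l" l] lam.gr_mono_mult[OF q c, of "1$GG" "el 0 (Suc l)" "Suc l"]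
   el_Gamma one c el_closed by (simp add: el_mult cS)
 show "tm i l *$Lam gel 0 1 = gel 0 1 *$Lam tm i l"
  unfolding tm_def gr_of_mono c_def[symmetric]
  using lam.gr_mono_mult[OF Zp.one_closed c, of "el 0 1" "el 0 l" l] lam.gr_mono_mult[OF c Zp.one_closed, of "el 0 l" "el 0 1" l]
   el_Gamma c by (simp add: el_mult)
qed

lemma shift_bij: "bij_betw (%l. Suc l mod r) {..<r} {..<r}"
proof (rule bij_betw_imageI)
 show inj: "inj_on (%l. Suc l mod r) {..<r}"
 proof (rule inj_onI)
  fix a b assume ab: "a \<in> {..<r}" "b \<in> {..<r}" "Suc a mod r = Suc b mod r"
  hence "[a + 1 = b + 1] (mod r)" by (simp add: cong_def)
  hence "[a = b] (mod r)" using cong_add_rcancel_nat by blast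
  thus "a = b" using ab by (simp add: cong_def)
 qed
 show "(%l. Suc l mod r) ` {..<r} = {..<r}"
  by (rule endo_inj_surj[OF _ _ inj]) (use r_pos in auto)
qed

lemma gel_idem: "gel 0 1 *$Lam idem i = cst (\<rho> ^$Zp i) *$Lam idem i"
proof -
 have tf: "f \<in> {..<r} \<rightarrow> carrier Lam" if "!!l. f l \<in>$Lam" for f :: "nat => _" using that by auto
 have c: "cst (\<rho> ^$Zp i) \<in>$Lam" using rho_closed by (simp add: cst_closed)
 have "gel 0 1 *$Lam idem i = (\<Oplus>$Lam l\<in>{..<r}. gel 0 1 *$Lam tm i l)"
  unfolding idem_def by (rule lam.RG.finsum_rdistr[OF _ gel_closed tf[OF tm_closed]]) simp
 also have "\<dots> = (\<Oplus>$Lam l\<in>{..<r}. cst (\<rho> ^$Zp i) *$Lam tm i (Suc l mod r))"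
  unfolding gel_tm tm_periodic ..
 also have "\<dots> = cst (\<rho> ^$Zp i) *$Lam (\<Oplus>$Lam l\<in>{..<r}. tm i (Suc l mod r))"
  by (rule lam.RG.finsum_rdistr[OF _ c tf[OF tm_closed], symmetric]) simp
 also have "(\<Oplus>$Lam l\<in>{..<r}. tm i (Suc l mod r)) = idem i"
  unfolding idem_def by (rule lam.RG.finsum_bij[OF shift_bij tm_closed, symmetric])
 finally show ?thesis .
qed

lemma idem_gel: "idem i *$Lam gel 0 1 = gel 0 1 *$Lam idem i"
proof -
 have tf: "(%l. tm i l) \<in> {..<r} \<rightarrow> carrier Lam" using tm_closed by auto
 have "idem i *$Lam gel 0 1 = (\<Oplus>$Lam l\<in>{..<r}. tm i l *$Lam gel 0 1)"
  unfolding idem_def by (rule lam.RG.finsum_ldistr[OF _ gel_closed tf]) simp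
 also have "\<dots> = gel 0 1 *$Lam idem i"
  unfolding tm_gel idem_def by (rule lam.RG.finsum_rdistr[OF _ gel_closed tf, symmetric]) simp
 finally show ?thesis .
qed

lemma eigen_idem: "eigen (reg_mod Lam) i (idem i)"
 unfolding eigen_def using left_module_reg[OF lam.group_ring_ring] idem_closed gel_idem by simp

lemma rho_pow_inj:
 assumes "i \<in> {1..r}" "i' \<in> {1..r}" shows "\<rho> ^$Zp i = \<rho> ^$Zp i' \<longleftrightarrow> i = i'"
proof -
 have *: "i = i'" if ii: "i \<le> i'" "i \<in> {1..r}" "i' \<in> {1..r}" "\<rho> ^$Zp i = \<rho> ^$Zp i'" for i i'
 proof -
  have "rhoi ^$Zp i *$Zp \<rho> ^$Zp (i + (i' - i)) = 1$Zp" using ii(1,4) rhoi_pow[of i] by simp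
  hence "\<rho> ^$Zp (i' - i) = 1$Zp"
   using rhoi_closed rho_closed rhoi_pow[of i] by (simp add: Zp.nat_pow_mult[symmetric] Zp.m_assoc[symmetric])
  hence "r dvd i' - i" by (simp add: rho_pow_eq_one)
  thus ?thesis using ii(1-3) by (auto dest: dvd_imp_le)
 qed
 show ?thesis using *[of i i'] *[of i' i] assms by (cases "i \<le> i'") auto
qed

lemma idem_mult:
 assumes "i \<in> {1..r}" "i' \<in> {1..r}"
 shows "idem i' *$Lam idem i = (if i = i' then idem i else 0$Lam)"
 using idem_eigen[OF eigen_idem, of i' i] rho_pow_inj[OF assms] by simp

text \<open>Orthogonality in the other index: the coefficient of \<tau>^l is the mean of
  \<rho>^{-il} over i, which is 1 for l = 0 and 0 for 0 < l < r.\<close>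

lemma idem_sum: "(\<Oplus>$Lam i\<in>{1..r}. idem i) = 1$Lam"
proof -
 have rc: "rinv *$Zp rhoi ^$Zp (k::nat) \<in>$Zp" for k using rinv_closed rhoi_closed by simp
 have add: "gr_mono Zp GG (\<Oplus>$Zp i\<in>A. f i) g = (\<Oplus>$Lam i\<in>A. gr_mono Zp GG (f i) g)" if "f \<in> A \<rightarrow> carrier Zp" for f and A :: "nat set" and g
  by (rule additive_finsum[where h = "%c. gr_mono Zp GG c g", OF Zp.abelian_group_axioms lam.RG.abelian_group_axioms])
   (use that in "auto simp: lam.gr_mono_closed lam.gr_mono_add")
 have coef: "(\<Oplus>$Zp i\<in>{1..r}. rinv *$Zp rhoi ^$Zp (i * l)) = (if l = 0 then 1$Zp else 0$Zp)" if "l < r" for l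
 proof -
  define y where "y = rhoi ^$Zp l"
  have y: "y \<in>$Zp" using rhoi_closed by (simp add: y_def)
  have yr: "y ^$Zp r = 1$Zp"
   using rhoi_closed rhoi_pow_r Zp.nat_pow_pow[OF rhoi_closed, of r l]
   by (simp add: y_def Zp.nat_pow_pow mult.commute)
  have y1: "y = 1$Zp \<longleftrightarrow> l = 0"
  proof
   assume "y = 1$Zp"
   hence "\<rho> ^$Zp l = 1$Zp" using rhoi_pow[of l] rho_closed by (simp add: y_def)
   thus "l = 0" using \<open>l < r\<close> by (auto simp: rho_pow_eq_one dest: dvd_imp_le)
  qed (simp add: y_def)
  have "bij_betw Suc {..<r} {1..r}" by (simp add: bij_betw_def image_Suc_lessThan)
  hence "(\<Oplus>$Zp i\<in>{1..r}. rinv *$Zp rhoi ^$Zp (i * l)) = (\<Oplus>$Zp i\<in>{..<r}. rinv *$Zp rhoi ^$Zp (Suc i * l))"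
   by (rule Zp.finsum_bij) (rule rc)
  also have "\<dots> = (\<Oplus>$Zp i\<in>{..<r}. (y *$Zp rinv) *$Zp y ^$Zp i)"
   using rinv_closed rhoi_closed
   by (intro Zp.finsum_cong' refl) (auto simp: y_def Zp.nat_pow_pow Zp.nat_pow_mult[symmetric] Zp.m_ac mult.commute)
  also have "\<dots> = (y *$Zp rinv) *$Zp (\<Oplus>$Zp i\<in>{..<r}. y ^$Zp i)"
   by (rule Zp.finsum_rdistr[symmetric]) (use rinv_closed y in auto)
  also have "\<dots> = y *$Zp (if y = 1$Zp then 1$Zp else 0$Zp)"
   unfolding geometric_sum[OF y yr, symmetric] using rinv_closed y by (intro Zp.m_assoc Zp.finsum_closed) auto
  finally show ?thesis using y1 y by auto
 qed
 have "(\<Oplus>$Lam i\<in>{1..r}. idem i) = (\<Oplus>$Lam l\<in>{..<r}. \<Oplus>$Lam i\<in>{1..r}. tm i l)"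
  unfolding idem_def by (rule lam.RG.finsum_swap) (simp_all add: tm_closed)
 also have "\<dots> = (\<Oplus>$Lam l\<in>{..<r}. if l = 0 then 1$Lam else 0$Lam)"
 proof (rule lam.RG.finsum_cong'[OF refl])
  fix l assume l: "l \<in> {..<r}"
  have "(\<Oplus>$Lam i\<in>{1..r}. tm i l) = gr_mono Zp GG (\<Oplus>$Zp i\<in>{1..r}. rinv *$Zp rhoi ^$Zp (i * l)) (el 0 l)"
   unfolding tm_def by (rule add[symmetric]) (use rc in auto)
  also have "\<dots> = (if l = 0 then 1$Lam else 0$Lam)"
   using coef l lam.gr_of_one by (auto simp: el_simps gr_of_mono gr_mono_def group_ring_sel(4))
  finally show "(\<Oplus>$Lam i\<in>{1..r}. tm i l) = (if l = 0 then 1$Lam else 0$Lam)" .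
 qed auto
 also have "\<dots> = 1$Lam" by (rule lam.RG.finsum_delta) (use r_pos in auto)
 finally show ?thesis .
qed

text \<open>The coordinates of a e_i with respect to the \<sigma>^k e_i: on an eigenvector \<tau>^l
  becomes the scalar \<rho>^(il), and the terms are collected by k.\<close>

definition bcoef :: "nat => ('g => nat => int) => nat => nat => int" where
 "bcoef i a k = (\<Oplus>$Zp l\<in>{..<r}. a (el k l) *$Zp \<rho> ^$Zp (i * l))"

lemma coeff_el: "a \<in>$Lam ==> a (el k l) \<in>$Zp"
 using lam.gr_coeff_closed[of a "el k l"] el_Gamma by simp

lemma bcoef_closed: "a \<in>$Lam ==> bcoef i a k \<in>$Zp"
 unfolding bcoef_def using coeff_el rho_closed by (intro Zp.finsum_closed) auto

lemma eigen_expand: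
 assumes e: "eigen W i w" and a: "a \<in>$Lam"
 shows "a \<odot>$W w = (\<Oplus>$W k\<in>{..<p}. gr_mono Zp GG (bcoef i a k) (el k 0) \<odot>$W w)"
proof -
 interpret W: left_module Lam W using e by (simp add: eigen_def)
 have w: "w \<in>$W" using e by (simp add: eigen_def)
 have cl: "gr_mono Zp GG (a g) g \<in>$Lam" if "g \<in> \<Gamma>" for g
  using lam.gr_coeff_closed[OF a, of g] that by (intro lam.gr_mono_closed) simp
 have q: "a (el k l) *$Zp \<rho> ^$Zp (i * l) \<in>$Zp" for k l using coeff_el[OF a] rho_closed by simp
 have "a = (\<Oplus>$Lam g\<in>\<Gamma>. gr_mono Zp GG (a g) g)" using lam.gr_expand[OF a] by simp
 hence "a \<odot>$W w = (\<Oplus>$Lam g\<in>\<Gamma>. gr_mono Zp GG (a g) g) \<odot>$W w" by simp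
 also have "\<dots> = (\<Oplus>$W g\<in>\<Gamma>. gr_mono Zp GG (a g) g \<odot>$W w)"
  by (rule W.smult_finsum_left[OF w]) (use cl in auto)
 also have "\<dots> = (\<Oplus>$W k\<in>{..<p}. \<Oplus>$W l\<in>{..<r}. gr_mono Zp GG (a (el k l)) (el k l) \<odot>$W w)"
  by (rule finsum_Gamma[OF W.M.abelian_group_axioms]) (rule W.smult_closed[OF cl w])
 also have "\<dots> = (\<Oplus>$W k\<in>{..<p}. gr_mono Zp GG (bcoef i a k) (el k 0) \<odot>$W w)"
 proof (rule W.M.finsum_cong'[OF refl])
  fix k
  have "(\<Oplus>$W l\<in>{..<r}. gr_mono Zp GG (a (el k l)) (el k l) \<odot>$W w)
    = (\<Oplus>$W l\<in>{..<r}. gr_mono Zp GG (a (el k l) *$Zp \<rho> ^$Zp (i * l)) (el k 0) \<odot>$W w)"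
   unfolding eigen_mono[OF e coeff_el[OF a]] ..
  also have "\<dots> = (\<Oplus>$Lam l\<in>{..<r}. gr_mono Zp GG (a (el k l) *$Zp \<rho> ^$Zp (i * l)) (el k 0)) \<odot>$W w"
   by (rule W.smult_finsum_left[OF w, symmetric]) (use q in "auto simp: lam.gr_mono_closed")
  also have "(\<Oplus>$Lam l\<in>{..<r}. gr_mono Zp GG (a (el k l) *$Zp \<rho> ^$Zp (i * l)) (el k 0)) = gr_mono Zp GG (bcoef i a k) (el k 0)"
   unfolding bcoef_def
   by (rule additive_finsum[where h = "%c. gr_mono Zp GG c (el k 0)", OF Zp.abelian_group_axioms lam.RG.abelian_group_axioms, symmetric])
    (use q in "auto simp: lam.gr_mono_closed lam.gr_mono_add")
  finally show "(\<Oplus>$W l\<in>{..<r}. gr_mono Zp GG (a (el k l)) (el k l) \<odot>$W w) = gr_mono Zp GG (bcoef i a k) (el k 0) \<odot>$W w" .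
 qed (use w in "auto intro!: W.smult_closed lam.gr_mono_closed bcoef_closed[OF a]")
 finally show ?thesis .
qed

end

section \<open>The characters of \<Gamma> and the lattices L_1, L_2\<close>

context metacyclic_setup
begin

interpretation Z: cring Z by (rule Z_cring)

abbreviation "K1 \<equiv> L1 p r G \<sigma> \<tau> \<rho>"
abbreviation "K2 \<equiv> L2 p r s G \<sigma> \<tau>"

lemma cst_el: "cst c = gr_mono Zp GG c (el 0 0)"
 by (simp add: gr_const_def el_simps)

lemma gel_el: "gel k l = gr_mono Zp GG 1$Zp (el k l)"
 by (simp add: gr_of_mono)

lemma mult_funpow:
 assumes "c \<in>$Zp" "x \<in>$Zp"
 shows "((%x. c *$Zp x) ^^ l) x = c ^$Zp l *$Zp x"
proof (induction l)
 case (Suc l)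
 thus ?case using assms by (simp add: Zp.m_ac)
qed (use assms in simp)

lemma rho_pow_mult: "(\<rho> ^$Zp i) ^$Zp (l::nat) = \<rho> ^$Zp (i * l)" for i :: nat
 using rho_closed by (simp add: Zp.nat_pow_pow)

lemma K1_module: "left_module Lam (K1 i)"
 and K1_mono: "[|c \<in>$Zp; x \<in>$Zp|] ==>
  gr_mono Zp GG c (el k l) \<odot>$(K1 i) x = c *$Zp (\<rho> ^$Zp (i * l) *$Zp x)"
proof -
 have q: "\<rho> ^$Zp i \<in>$Zp" using rho_closed by simp
 have qr: "\<rho> ^$Zp (i * r) = 1$Zp" by (simp add: rho_pow_eq_one)
 have reg: "left_module Zp (reg_mod Zp)" by (rule left_module_reg[OF Zp.ring_axioms])
 note * = q reg mult_funpow[OF q] rho_pow_mult qr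
 show "left_module Lam (K1 i)"
  unfolding L1_def by (rule gamma_mod(1)) (use * in "simp_all add: Zp.r_distr Zp.m_lcomm")
 show "gr_mono Zp GG c (el k l) \<odot>$(K1 i) x = c *$Zp (\<rho> ^$Zp (i * l) *$Zp x)" if c: "c \<in>$Zp" and x: "x \<in>$Zp"
 proof -
  have "gr_mono Zp GG c (el k l) \<odot>$(K1 i) x = c \<odot>$(reg_mod Zp) (id ^^ k) (((%x. \<rho> ^$Zp i *$Zp x) ^^ l) x)"
   unfolding L1_def by (rule gamma_mod(2)) (use * c x in "simp_all add: Zp.r_distr Zp.m_lcomm")
  thus ?thesis using mult_funpow[OF q x] rho_pow_mult by simp
 qed
qed

lemma K1_sel: "carrier (K1 i) = carrier Zp" "0$(K1 i) = 0$Zp" "x +$(K1 i) y = x +$Zp y"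
 by (simp_all add: L1_def gamma_mod_def)

text \<open>The character \<chi>_i, obtained as the scalar by which the group ring acts on
  L_1^i.\<close>

definition chi :: "nat => ('g => nat => int) => nat => int" where
 "chi i a = a \<odot>$(K1 i) 1$Zp"

lemma chi_mono: "c \<in>$Zp ==> chi i (gr_mono Zp GG c (el k l)) = c *$Zp \<rho> ^$Zp (i * l)"
 using K1_mono[of c "1$Zp" i k l] rho_closed by (simp add: chi_def)

lemma chi_cst: "c \<in>$Zp ==> chi i (cst c) = c"
 and chi_gel: "chi i (gel k l) = \<rho> ^$Zp (i * l)"
 using rho_closed by (simp_all add: cst_el gel_el chi_mono)

lemma chi_closed: "a \<in>$Lam ==> chi i a \<in>$Zp"
 using left_module.smult_closed[OF K1_module, of a "1$Zp" i] by (simp add: chi_def K1_sel)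

lemma K1_smult:
 assumes a: "a \<in>$Lam" and x: "x \<in>$Zp"
 shows "a \<odot>$(K1 i) x = chi i a *$Zp x"
proof -
 interpret K: left_module Lam "K1 i" by (rule K1_module)
 have cx: "cst x \<in>$Lam" by (rule cst_closed[OF x])
 have c1: "cst c \<odot>$(K1 i) y = c *$Zp y" if "c \<in>$Zp" "y \<in>$Zp" for c y
  using K1_mono[OF that, of i 0 0] that by (simp add: cst_el)
 have "a \<odot>$(K1 i) x = (a *$Lam cst x) \<odot>$(K1 i) 1$Zp"
  using K.smult_assoc[OF a cx, of "1$Zp"] c1[OF x] x by (simp add: K1_sel)
 also have "\<dots> = cst x \<odot>$(K1 i) chi i a"
  using lam.gr_const_central[OF x a] K.smult_assoc[OF cx a, of "1$Zp"] by (simp add: K1_sel chi_def)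
 finally show ?thesis using c1[OF x chi_closed[OF a]] Zp.m_comm[OF x chi_closed[OF a]] by simp
qed

lemma chi_hom: "chi i \<in> ring_hom Lam Zp"
proof (rule ring_hom_memI)
 interpret K: left_module Lam "K1 i" by (rule K1_module)
 fix a b assume a: "a \<in>$Lam" and b: "b \<in>$Lam"
 show "chi i a \<in>$Zp" by (rule chi_closed[OF a])
 show "chi i (a +$Lam b) = chi i a +$Zp chi i b"
  using K.smult_l_distr[OF a b, of "1$Zp"] by (simp add: chi_def K1_sel)
 show "chi i (a *$Lam b) = chi i a *$Zp chi i b"
  using K.smult_assoc[OF a b, of "1$Zp"] K1_smult[OF a chi_closed[OF b]] by (simp add: chi_def K1_sel)
next
 interpret K: left_module Lam "K1 i" by (rule K1_module)
 show "chi i 1$Lam = 1$Zp" using K.smult_one[of "1$Zp"] by (simp add: chi_def K1_sel)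
qed

lemma chi_simps:
 "[|a \<in>$Lam; b \<in>$Lam|] ==> chi i (a +$Lam b) = chi i a +$Zp chi i b"
 "[|a \<in>$Lam; b \<in>$Lam|] ==> chi i (a *$Lam b) = chi i a *$Zp chi i b"
 "chi i 1$Lam = 1$Zp" "chi i 0$Lam = 0$Zp"
 "[|a \<in>$Lam; b \<in>$Lam|] ==> chi i (a -$Lam b) = chi i a -$Zp chi i b"
 using chi_hom ring_hom_zero[OF chi_hom lam.group_ring_ring Zp.ring_axioms]
  ring_hom_minus[OF lam.group_ring_ring Zp.ring_axioms chi_hom]
 by (auto simp: ring_hom_def)

lemma chi_finsum: "f \<in> A \<rightarrow> carrier Lam ==> chi i (\<Oplus>$Lam k\<in>A. f k) = (\<Oplus>$Zp k\<in>A. chi i (f k))"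
 by (rule additive_finsum[OF lam.RG.abelian_group_axioms Zp.abelian_group_axioms])
  (simp_all add: chi_closed chi_simps)

lemma eigen_K1: "eigen (K1 i) i 1$Zp"
 unfolding eigen_def
 using K1_module chi_gel[of i 0 1] chi_cst[of "\<rho> ^$Zp i" i] rho_closed by (simp add: K1_sel chi_def)

text \<open>Expand the action of a on the eigenvector 1 of L_1^i, where \<sigma> is trivial.\<close>

lemma chi_bcoef:
 assumes a: "a \<in>$Lam" shows "chi i a = (\<Oplus>$Zp k\<in>{..<p}. bcoef i a k)"
proof -
 interpret K: left_module Lam "K1 i" by (rule K1_module)
 have "chi i a = (\<Oplus>$(K1 i) k\<in>{..<p}. bcoef i a k)"
  unfolding chi_def eigen_expand[OF eigen_K1 a]
  using K1_mono[OF bcoef_closed[OF a] Zp.one_closed] bcoef_closed[OF a]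
  by (intro K.M.finsum_cong') (auto simp: K1_sel)
 also have "\<dots> = (\<Oplus>$Zp k\<in>{..<p}. bcoef i a k)"
  by (rule additive_finsum[where h = "%x. x", OF K.M.abelian_group_axioms Zp.abelian_group_axioms])
   (use bcoef_closed[OF a] in "auto simp: K1_sel")
 finally show ?thesis .
qed

subsection \<open>The lattices \<open>\<pi>\<^sup>i \<int>\<^sub>p[\<zeta>]\<close>\<close>

abbreviation "\<theta> \<equiv> zeta_aut p s"

lemma theta_pow:
 shows "\<theta> ^^ l \<in> ring_hom Z Z" and "c \<in>$Zp ==> (\<theta> ^^ l) (\<kappa> c) = \<kappa> c"
  and "(\<theta> ^^ l) \<zeta> = \<zeta> ^$Z (s ^ l)"
proof -
 show h: "\<theta> ^^ l \<in> ring_hom Z Z" for l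
 proof (induction l)
  case 0 thus ?case by (auto intro!: ring_hom_memI)
 next
  case (Suc l) thus ?case using ring_hom_trans[OF Suc zeta_aut(1)[OF cop]] by (simp add: comp_def)
 qed
 show "c \<in>$Zp ==> (\<theta> ^^ l) (\<kappa> c) = \<kappa> c"
  by (induction l) (simp_all add: zeta_aut(2)[OF cop])
 have pow: "\<theta> (\<zeta> ^$Z (n::nat)) = \<zeta> ^$Z (s * n)" for n
 proof (induction n)
  case 0 thus ?case using ring_hom_one[OF zeta_aut(1)[OF cop]] by simp
 next
  case (Suc n)
  thus ?case using ring_hom_mult[OF zeta_aut(1)[OF cop], of "\<zeta> ^$Z n" \<zeta>]
   by (simp add: zeta_aut(3)[OF cop] Z.nat_pow_mult add.commute)
 qed
 show "(\<theta> ^^ l) \<zeta> = \<zeta> ^$Z (s ^ l)"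
  by (induction l) (simp_all add: pow)
qed

lemma theta_simps:
 "x \<in>$Z ==> (\<theta> ^^ l) x \<in>$Z"
 "[|x \<in>$Z; y \<in>$Z|] ==> (\<theta> ^^ l) (x +$Z y) = (\<theta> ^^ l) x +$Z (\<theta> ^^ l) y"
 "[|x \<in>$Z; y \<in>$Z|] ==> (\<theta> ^^ l) (x *$Z y) = (\<theta> ^^ l) x *$Z (\<theta> ^^ l) y"
 "(\<theta> ^^ l) 1$Z = 1$Z"
 "[|x \<in>$Z; y \<in>$Z|] ==> (\<theta> ^^ l) (x -$Z y) = (\<theta> ^^ l) x -$Z (\<theta> ^^ l) y"
 using theta_pow(1)[of l] ring_hom_minus[OF Z.ring_axioms Z.ring_axioms theta_pow(1)[of l]]
 by (auto simp: ring_hom_def)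

lemma theta_nat_pow: "x \<in>$Z ==> (\<theta> ^^ l) (x ^$Z (n::nat)) = (\<theta> ^^ l) x ^$Z n"
 by (induction n) (simp_all add: theta_simps)

lemma theta_pow_r:
 assumes x: "x \<in>$Z" shows "(\<theta> ^^ r) x = x"
proof -
 obtain c where c: "!!k. c k \<in>$Zp" "x = zsum c" using zsum_span[OF x] by blast
 have t: "\<kappa> (c k) *$Z \<zeta> ^$Z k \<in>$Z" for k using c(1) by simp
 have "(\<theta> ^^ r) x = (\<Oplus>$Z k\<in>{..<p}. (\<theta> ^^ r) (\<kappa> (c k) *$Z \<zeta> ^$Z k))"
  unfolding c(2) zsum_def
  by (rule additive_finsum[OF Z.abelian_group_axioms Z.abelian_group_axioms]) (use t in "auto simp: theta_simps")
 also have "\<dots> = x"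
 proof -
  have "(\<theta> ^^ r) (\<kappa> (c k) *$Z \<zeta> ^$Z k) = \<kappa> (c k) *$Z \<zeta> ^$Z k" for k
  proof -
   have "\<zeta> ^$Z (s ^ r) = \<zeta>" using zeta_pow_cong[OF s_pow_r] by simp
   thus ?thesis using c(1)[of k] by (simp add: theta_simps theta_pow theta_nat_pow)
  qed
  thus ?thesis unfolding c(2) zsum_def by simp
 qed
 finally show ?thesis .
qed

lemma theta_pi: "\<exists>w\<in>carrier Z. (\<theta> ^^ l) \<pi> = \<pi> *$Z w"
proof -
 obtain y where y: "y \<in>$Z" "1$Z -$Z \<zeta> ^$Z (s ^ l) = \<pi> *$Z (\<kappa> ([(s ^ l)] \<cdot>$Zp 1$Zp) +$Z \<pi> *$Z y)"
  using one_minus_zeta_pow[of "s ^ l"] by blast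
 have "(\<theta> ^^ l) \<pi> = 1$Z -$Z \<zeta> ^$Z (s ^ l)"
  unfolding pi_zeta_def by (simp add: theta_simps theta_pow)
 thus ?thesis unfolding y(2) using y(1) by (intro bexI[of _ "\<kappa> ([(s ^ l)] \<cdot>$Zp 1$Zp) +$Z \<pi> *$Z y"]) auto
qed

abbreviation "zid i \<equiv> {\<pi> ^$Z (i::nat) *$Z x | x. x \<in>$Z}"
abbreviation "zmod N \<equiv> mk_mod N 0$Z (\<oplus>$Z) (%(c :: nat => int) x. \<kappa> c *$Z x)"

lemma zid_closed: "x \<in> zid i ==> x \<in>$Z" by auto

lemma zid_0: "zid 0 = carrier Z"
proof
 show "carrier Z \<subseteq> zid 0"
 proof
  fix x assume "x \<in>$Z"
  thus "x \<in> zid 0" by (intro CollectI exI[of _ x]) simp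
 qed
qed auto

lemma zid_mult: "x \<in> zid i ==> y \<in>$Z ==> y *$Z x \<in> zid i"
proof clarify
 fix x assume x: "x \<in>$Z" "y \<in>$Z"
 thus "\<exists>z. y *$Z (\<pi> ^$Z i *$Z x) = \<pi> ^$Z i *$Z z \<and> z \<in>$Z"
  by (intro exI[of _ "y *$Z x"]) (simp add: Z.m_lcomm)
qed

lemma zid_add: "x \<in> zid i ==> y \<in> zid i ==> x +$Z y \<in> zid i"
proof clarify
 fix x y assume x: "x \<in>$Z" "y \<in>$Z"
 thus "\<exists>z. \<pi> ^$Z i *$Z x +$Z \<pi> ^$Z i *$Z y = \<pi> ^$Z i *$Z z \<and> z \<in>$Z"
  by (intro exI[of _ "x +$Z y"]) (simp add: Z.r_distr)
qed

lemma zid_zero: "0$Z \<in> zid i"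
 by (rule CollectI, intro exI[of _ "0$Z"]) simp

lemma zid_theta: "x \<in> zid i ==> (\<theta> ^^ l) x \<in> zid i"
proof clarify
 fix x assume x: "x \<in>$Z"
 obtain w where w: "w \<in>$Z" "(\<theta> ^^ l) \<pi> = \<pi> *$Z w" using theta_pi by blast
 have "(\<theta> ^^ l) (\<pi> ^$Z i *$Z x) = \<pi> ^$Z i *$Z (w ^$Z i *$Z (\<theta> ^^ l) x)"
  using x w theta_simps(1)[OF x] by (simp add: theta_simps(3) theta_nat_pow Z.nat_pow_distrib Z.m_assoc)
 thus "\<exists>z. (\<theta> ^^ l) (\<pi> ^$Z i *$Z x) = \<pi> ^$Z i *$Z z \<and> z \<in>$Z"
  using w x theta_simps(1)[OF x] by (intro exI[of _ "w ^$Z i *$Z (\<theta> ^^ l) x"]) simp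
qed

lemma zmod_carrier: "left_module Zp (zmod (carrier Z))"
 by (rule left_moduleI[OF Zp.ring_axioms abelian_mk_mod[OF Z.abelian_group_axioms]])
  (simp_all add: kappa_simps Z.l_distr Z.r_distr Z.m_assoc)

lemma zmod_zid: "left_module Zp (zmod (zid i))"
proof -
 have sub: "submod Zp (zmod (carrier Z)) (zid i)"
 proof (rule submodI)
  show "zid i \<subseteq> carrier (zmod (carrier Z))" using zid_closed by (simp only: mk_mod_simps) blast
  show "0$(zmod (carrier Z)) \<in> zid i" unfolding mk_mod_simps by (rule zid_zero)
  show "x +$(zmod (carrier Z)) y \<in> zid i" if "x \<in> zid i" "y \<in> zid i" for x y
   unfolding mk_mod_simps by (rule zid_add[OF that])
  show "a \<odot>$(zmod (carrier Z)) x \<in> zid i" if "a \<in>$Zp" "x \<in> zid i" for a x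
   unfolding mk_mod_simps by (rule zid_mult[OF that(2) kappa_closed[OF that(1)]])
 qed
 have "left_module Zp ((zmod (carrier Z))\<lparr>carrier := zid i\<rparr>)"
  by (rule left_module.left_module_submod[OF zmod_carrier sub])
 thus ?thesis by (simp add: mk_mod_def)
qed

lemma zeta_funpow:
 assumes "x \<in>$Z" shows "((%x. \<zeta> *$Z x) ^^ k) x = \<zeta> ^$Z k *$Z x"
proof (induction k)
 case (Suc k)
 thus ?case using assms by (simp add: Z.m_ac)
qed (use assms in simp)

lemma K2_def': "K2 i = gamma_mod p r G \<sigma> \<tau> (zmod (zid i)) (%x. \<zeta> *$Z x) \<theta>"
 by (simp add: L2_def Let_def pi_zeta_def)

lemma K2_module: "left_module Lam (K2 i)"
 and K2_mono: "[|c \<in>$Zp; x \<in> zid i|] ==>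
  gr_mono Zp GG c (el k l) \<odot>$(K2 i) x = \<kappa> c *$Z (\<zeta> ^$Z k *$Z (\<theta> ^^ l) x)"
proof -
 let ?M = "zmod (zid i)"
 have a1: "\<zeta> *$Z x \<in>$?M" if "x \<in>$?M" for x using that zid_mult[of x i \<zeta>] by simp
 have a2: "\<zeta> *$Z (x +$?M y) = \<zeta> *$Z x +$?M \<zeta> *$Z y" if "x \<in>$?M" "y \<in>$?M" for x y
  using that zid_closed[of _ i] by (simp add: Z.r_distr del: mem_Collect_eq)
 have a3: "\<zeta> *$Z (c \<odot>$?M x) = c \<odot>$?M (\<zeta> *$Z x)" if "c \<in>$Zp" "x \<in>$?M" for c x
  using that zid_closed[of _ i] by (simp add: Z.m_lcomm del: mem_Collect_eq)
 have a4: "\<theta> x \<in>$?M" if "x \<in>$?M" for x using that zid_theta[of x i 1] by simp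
 have a5: "\<theta> (x +$?M y) = \<theta> x +$?M \<theta> y" if "x \<in>$?M" "y \<in>$?M" for x y
  using that zid_closed[of _ i] theta_simps(2)[of x y 1] by (simp del: mem_Collect_eq)
 have a6: "\<theta> (c \<odot>$?M x) = c \<odot>$?M \<theta> x" if "c \<in>$Zp" "x \<in>$?M" for c x
  using that zid_closed[of _ i] theta_simps(3)[of "\<kappa> c" x 1] theta_pow(2)[of c 1] by (simp del: mem_Collect_eq)
 have a7: "((%x. \<zeta> *$Z x) ^^ p) x = x" if "x \<in>$?M" for x
  using that zid_closed[of x i] by (simp add: zeta_funpow zeta_pow_p del: mem_Collect_eq)
 have a8: "(\<theta> ^^ r) x = x" if "x \<in>$?M" for x
  using that zid_closed[of x i] by (simp add: theta_pow_r del: mem_Collect_eq)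
 have a9: "\<theta> (\<zeta> *$Z x) = ((%x. \<zeta> *$Z x) ^^ s) (\<theta> x)" if "x \<in>$?M" for x
  using that zid_closed[of x i] theta_simps(3)[of \<zeta> x 1] theta_pow(3)[of 1] theta_simps(1)[of x 1]
  by (simp add: zeta_funpow del: mem_Collect_eq)
 show "left_module Lam (K2 i)" unfolding K2_def'
  by (rule gamma_mod(1)[OF zmod_zid a1 a2 a3 a4 a5 a6 a7 a8 a9])
 show "gr_mono Zp GG c (el k l) \<odot>$(K2 i) x = \<kappa> c *$Z (\<zeta> ^$Z k *$Z (\<theta> ^^ l) x)" if c: "c \<in>$Zp" and x: "x \<in> zid i"
 proof -
  have x': "x \<in>$?M" using x by simp
  have "gr_mono Zp GG c (el k l) \<odot>$(K2 i) x = c \<odot>$?M ((%x. \<zeta> *$Z x) ^^ k) ((\<theta> ^^ l) x)"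
   unfolding K2_def' by (rule gamma_mod(2)[OF zmod_zid a1 a2 a3 a4 a5 a6 a7 a8 a9 c x'])
  thus ?thesis using zeta_funpow[OF theta_simps(1)[OF zid_closed[OF x]]] by simp
 qed
qed

lemma K2_sel: "carrier (K2 i) = zid i" "0$(K2 i) = 0$Z" "x +$(K2 i) y = x +$Z y"
 by (simp_all add: K2_def' gamma_mod_def)

text \<open>The action on each ideal is the restriction of the action on Z_p[\<zeta>], so all
  computations can be made in \<open>K2 0\<close>.\<close>

lemma K2_smult:
 assumes a: "a \<in>$Lam" and x: "x \<in> zid i"
 shows "a \<odot>$(K2 i) x = a \<odot>$(K2 0) x"
proof -
 interpret K: left_module Lam "K2 i" by (rule K2_module)
 interpret V: left_module Lam "K2 0" by (rule K2_module)
 have xi: "x \<in>$(K2 i)" and x0: "x \<in>$(K2 0)" and xz: "x \<in> zid 0"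
  using x zid_closed[OF x] zid_0 by (simp_all add: K2_sel)
 have c: "b \<odot>$(K2 i) x \<in>$Z" if "b \<in>$Lam" for b
  using K.smult_closed[OF that xi] zid_closed unfolding K2_sel by blast
 have c0: "b \<odot>$(K2 0) x \<in>$Z" if "b \<in>$Lam" for b
  using V.smult_closed[OF that x0] zid_0 unfolding K2_sel by blast
 show ?thesis
 proof (rule lam.gr_additive_eq[OF Z.abelian_group_axioms c _ c0 _ _ a])
  fix b b' assume b: "b \<in>$Lam" "b' \<in>$Lam"
  show "(b +$Lam b') \<odot>$(K2 i) x = b \<odot>$(K2 i) x +$Z b' \<odot>$(K2 i) x"
   using K.smult_l_distr[OF b xi] by (simp add: K2_sel)
  show "(b +$Lam b') \<odot>$(K2 0) x = b \<odot>$(K2 0) x +$Z b' \<odot>$(K2 0) x"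
   using V.smult_l_distr[OF b x0] by (simp add: K2_sel)
 next
  fix c g assume c: "c \<in>$Zp" and g: "g \<in>$GG"
  obtain k l where "g = el k l" using g Gamma_el by auto
  thus "gr_mono Zp GG c g \<odot>$(K2 i) x = gr_mono Zp GG c g \<odot>$(K2 0) x"
   using K2_mono[OF c x] K2_mono[OF c xz] by simp
 qed
qed

subsection \<open>An eigenvector of \<open>\<tau>\<close> generating \<open>\<pi>\<close>\<close>

lemma finsum_mod_pi:
 assumes d: "!!l. d l \<in>$Zp" and f: "!!l. \<exists>y\<in>carrier Z. f l = \<kappa> (d l) +$Z \<pi> *$Z y"
 shows "\<exists>y\<in>carrier Z. (\<Oplus>$Z l\<in>{..<n::nat}. f l) = \<kappa> (\<Oplus>$Zp l\<in>{..<n}. d l) +$Z \<pi> *$Z y"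
proof -
 obtain y where y: "!!l. y l \<in>$Z" "!!l. f l = \<kappa> (d l) +$Z \<pi> *$Z y l" using f by metis
 have "(\<Oplus>$Z l\<in>{..<n}. f l) = (\<Oplus>$Z l\<in>{..<n}. \<kappa> (d l)) +$Z (\<Oplus>$Z l\<in>{..<n}. \<pi> *$Z y l)"
  unfolding y(2) by (rule Z.finsum_addf) (use y(1) d in auto)
 also have "(\<Oplus>$Z l\<in>{..<n}. \<kappa> (d l)) = \<kappa> (\<Oplus>$Zp l\<in>{..<n}. d l)"
  by (rule additive_finsum[OF Zp.abelian_group_axioms Z.abelian_group_axioms, symmetric]) (use d in "auto simp: kappa_simps")
 also have "(\<Oplus>$Z l\<in>{..<n}. \<pi> *$Z y l) = \<pi> *$Z (\<Oplus>$Z l\<in>{..<n}. y l)"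
  by (rule Z.finsum_rdistr[symmetric]) (use y(1) in auto)
 finally show ?thesis using y(1) by (intro bexI) (auto intro: Z.finsum_closed)
qed

lemma zsum_mod_pi:
 assumes c: "!!k. c k \<in>$Zp"
 shows "\<exists>y\<in>carrier Z. zsum c = \<kappa> (\<Oplus>$Zp k\<in>{..<p}. c k) +$Z \<pi> *$Z y"
 unfolding zsum_def
proof (rule finsum_mod_pi[OF c])
 fix k :: nat
 obtain y where y: "y \<in>$Z" "1$Z -$Z \<zeta> ^$Z k = \<pi> *$Z (\<kappa> ([k] \<cdot>$Zp 1$Zp) +$Z \<pi> *$Z y)"
  using one_minus_zeta_pow[of k] by blast
 define w where "w = \<kappa> ([k] \<cdot>$Zp 1$Zp) +$Z \<pi> *$Z y"
 define z where "z = \<zeta> ^$Z k"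
 define q where "q = \<kappa> (c k)"
 have w: "w \<in>$Z" and z: "z \<in>$Z" and q: "q \<in>$Z" using y(1) c[of k] by (simp_all add: w_def z_def q_def)
 have "q *$Z z = q *$Z (1$Z -$Z (1$Z -$Z z))" using z q Z.one_closed by algebra
 also have "\<dots> = q +$Z \<pi> *$Z (\<ominus>$Z (q *$Z w))"
  using y(2) q w pi_closed Z.one_closed unfolding z_def[symmetric] w_def[symmetric] by algebra
 finally show "\<exists>y\<in>carrier Z. \<kappa> (c k) *$Z \<zeta> ^$Z k = \<kappa> (c k) +$Z \<pi> *$Z y"
  unfolding z_def q_def using w q by (intro bexI[of _ "\<ominus>$Z (q *$Z w)"]) (auto simp: q_def)
qed

text \<open>The component of \<pi> in the eigenspace of \<tau> for \<rho>. While \<zeta> \<mapsto>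
  \<zeta>^s multiplies \<pi> by some element of Z_p[\<zeta>], it multiplies this component by a
  constant of Z_p.\<close>

definition lambda :: "(nat => nat => int) set" where "lambda = idem 1 \<odot>$(K2 0) \<pi>"

lemma finsum_K2_0:
 assumes "f \<in> A \<rightarrow> carrier Z" shows "(\<Oplus>$(K2 0) k\<in>A. f k) = (\<Oplus>$Z k\<in>A. f k)"
 by (rule additive_finsum[where h = "%x. x", OF left_moduleD(2)[OF K2_module] Z.abelian_group_axioms])
  (use assms zid_0 in "simp_all add: K2_sel del: mem_Collect_eq")

lemma finsum_residue_cong:
 fixes n :: nat
 assumes "!!l. d l \<in>$Zp" "!!l. d' l \<in>$Zp" "!!l. d l 1 = d' l 1"
 shows "(\<Oplus>$Zp l\<in>{..<n}. d l) 1 = (\<Oplus>$Zp l\<in>{..<n}. d' l) 1"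
proof (induction n)
 case (Suc n)
 have c: "(\<Oplus>$Zp l\<in>{..<n}. d l) \<in>$Zp" "(\<Oplus>$Zp l\<in>{..<n}. d' l) \<in>$Zp"
  using assms(1,2) by (auto intro: Zp.finsum_closed)
 have "(\<Oplus>$Zp l\<in>{..<Suc n}. d l) = d n +$Zp (\<Oplus>$Zp l\<in>{..<n}. d l)"
  "(\<Oplus>$Zp l\<in>{..<Suc n}. d' l) = d' n +$Zp (\<Oplus>$Zp l\<in>{..<n}. d' l)"
  unfolding lessThan_Suc using assms(1,2) by (simp_all add: Zp.finsum_insert)
 thus ?case using residue_simps(2)[OF assms(1) c(1)] residue_simps(2)[OF assms(2) c(2)] assms(3) Suc by simp
qed simp

text \<open>The l-th term of e_1 \<pi> is \<rho>^{-l} / r times 1 - \<zeta>^(s^l), and the latter is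
  s^l \<pi> modulo \<pi>^2. Since \<rho> is congruent to s, each of the r terms contributes 1/r to
  the residue of the cofactor of \<pi>; that residue is 1, and the cofactor is a unit.\<close>

lemma lambda_unit: "\<exists>v\<in>Units Z. lambda = \<pi> *$Z v"
proof -
 interpret V: left_module Lam "K2 0" by (rule K2_module)
 define c where "c l = rinv *$Zp rhoi ^$Zp (1 * l)" for l :: nat
 define n where "n l = [(s ^ l)] \<cdot>$Zp 1$Zp" for l
 have c: "c l \<in>$Zp" and n: "n l \<in>$Zp" for l using rinv_closed rhoi_closed by (simp_all add: c_def n_def)
 have pz: "\<pi> \<in> zid 0" using zid_0 by simp
 obtain y where y: "!!l. y l \<in>$Z" "!!l. 1$Z -$Z \<zeta> ^$Z (s ^ l) = \<pi> *$Z (\<kappa> (n l) +$Z \<pi> *$Z y l)"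
 proof -
  have "\<forall>l. \<exists>y. y \<in>$Z \<and> 1$Z -$Z \<zeta> ^$Z (s ^ l) = \<pi> *$Z (\<kappa> (n l) +$Z \<pi> *$Z y)"
   unfolding n_def using one_minus_zeta_pow by blast
  thus thesis using that by metis
 qed
 define f where "f l = \<kappa> (c l) *$Z (\<kappa> (n l) +$Z \<pi> *$Z y l)" for l
 have f: "f l \<in>$Z" for l using c n y(1) by (simp add: f_def)
 have tmpi: "tm 1 l \<odot>$(K2 0) \<pi> = \<pi> *$Z f l" for l
 proof -
  have "(\<theta> ^^ l) \<pi> = 1$Z -$Z \<zeta> ^$Z (s ^ l)"
   unfolding pi_zeta_def by (simp add: theta_simps theta_pow)
  hence "tm 1 l \<odot>$(K2 0) \<pi> = \<kappa> (c l) *$Z (\<pi> *$Z (\<kappa> (n l) +$Z \<pi> *$Z y l))"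
   unfolding tm_def c_def[symmetric] K2_mono[OF c pz] using y(1) n c by (simp add: y(2))
  thus ?thesis unfolding f_def using c n y(1) by (simp add: Z.m_lcomm)
 qed
 have "lambda = (\<Oplus>$(K2 0) l\<in>{..<r}. tm 1 l \<odot>$(K2 0) \<pi>)"
  unfolding lambda_def idem_def by (rule V.smult_finsum_left) (use pz tm_closed in "auto simp: K2_sel")
 also have "\<dots> = (\<Oplus>$Z l\<in>{..<r}. \<pi> *$Z f l)"
  unfolding tmpi by (rule finsum_K2_0) (use f in auto)
 also have "\<dots> = \<pi> *$Z (\<Oplus>$Z l\<in>{..<r}. f l)"
  by (rule Z.finsum_rdistr[symmetric]) (use f in auto)
 finally have lam: "lambda = \<pi> *$Z (\<Oplus>$Z l\<in>{..<r}. f l)" .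
 have "\<exists>y\<in>carrier Z. f l = \<kappa> (c l *$Zp n l) +$Z \<pi> *$Z y" for l
  using c n y(1) by (intro bexI[of _ "\<kappa> (c l) *$Z y l"]) (simp_all add: f_def kappa_simps Z.r_distr Z.m_lcomm)
 then obtain z where z: "z \<in>$Z" "(\<Oplus>$Z l\<in>{..<r}. f l) = \<kappa> (\<Oplus>$Zp l\<in>{..<r}. c l *$Zp n l) +$Z \<pi> *$Z z"
  using finsum_mod_pi[of "%l. c l *$Zp n l" f r] c n by auto
 have "(c l *$Zp n l) 1 = rinv 1" for l
 proof -
  have "n l 1 = (\<rho> ^$Zp l) 1"
   unfolding residue_simps(5)[OF rho_closed] rho_s n_def by (simp add: residue_simps[unfolded One_nat_def] mod_simps)
  hence "(c l *$Zp n l) 1 = (c l *$Zp \<rho> ^$Zp l) 1"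
   using residue_simps(1)[OF c n] residue_simps(1)[OF c, of "\<rho> ^$Zp l"] rho_closed by simp
  also have "c l *$Zp \<rho> ^$Zp l = rinv"
   using rinv_closed rhoi_closed rho_closed by (simp add: c_def Zp.m_assoc rhoi_pow)
  finally show ?thesis .
 qed
 hence "(\<Oplus>$Zp l\<in>{..<r}. c l *$Zp n l) 1 = (\<Oplus>$Zp l\<in>{..<r}. rinv) 1"
  by (intro finsum_residue_cong) (use c n rinv_closed in auto)
 also have "(\<Oplus>$Zp l\<in>{..<r}. rinv) = 1$Zp"
 proof -
  have "(\<Oplus>$Zp l\<in>{..<r}. rinv) = rinv *$Zp (\<Oplus>$Zp l\<in>{..<r}. 1$Zp ^$Zp l)"
   using rinv_closed by (subst Zp.finsum_rdistr) simp_all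
  thus ?thesis using geometric_sum[of "1$Zp"] by simp
 qed
 finally have res: "(\<Oplus>$Zp l\<in>{..<r}. c l *$Zp n l) 1 \<noteq> 0" using residue_simps(7) by simp
 have "(\<Oplus>$Z l\<in>{..<r}. f l) \<in> Units Z"
  unfolding z(2) by (rule zeta_unit[where c = "\<Oplus>$Zp l\<in>{..<r}. c l *$Zp n l", OF _ res z(1)]) (use c n in "auto intro: Zp.finsum_closed")
 thus ?thesis using lam by blast
qed

lemma lambda_closed: "lambda \<in>$Z"
 using lambda_unit Z.Units_closed by fastforce

lemma K2_0_gel: "x \<in>$Z ==> gel k l \<odot>$(K2 0) x = \<zeta> ^$Z k *$Z (\<theta> ^^ l) x"
 and K2_0_cst: "x \<in>$Z ==> c \<in>$Zp ==> cst c \<odot>$(K2 0) x = \<kappa> c *$Z x"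
 using K2_mono[of "1$Zp" x 0 k l] K2_mono[of c x 0 0 0] zid_0 theta_simps(1)[of x l]
 by (simp_all add: gel_el cst_el kappa_simps del: mem_Collect_eq)

lemma theta_lambda: "\<theta> lambda = \<kappa> \<rho> *$Z lambda"
proof -
 interpret V: left_module Lam "K2 0" by (rule K2_module)
 have pz: "\<pi> \<in>$(K2 0)" using zid_0 by (simp add: K2_sel)
 have q: "\<rho> ^$Zp (1::nat) \<in>$Zp" using rho_closed by simp
 have "gel 0 1 \<odot>$(K2 0) lambda = cst (\<rho> ^$Zp (1::nat)) \<odot>$(K2 0) lambda"
  unfolding lambda_def
  using V.smult_assoc[OF gel_closed idem_closed pz, of 0 1 1] V.smult_assoc[OF cst_closed[OF q] idem_closed pz, of 1] gel_idem[of 1] by simp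
 thus ?thesis
  using K2_0_gel[OF lambda_closed, of 0 1] K2_0_cst[OF lambda_closed q] theta_simps(1)[OF lambda_closed, of 1] rho_closed by simp
qed

lemma theta_lambda_pow: "\<theta> (lambda ^$Z (i::nat)) = \<kappa> (\<rho> ^$Zp i) *$Z lambda ^$Z i"
proof (induction i)
 case 0 thus ?case using theta_simps(4)[of 1] by (simp add: kappa_simps)
next
 case (Suc i)
 have q: "\<rho> ^$Zp i \<in>$Zp" using rho_closed by simp
 have "\<theta> (lambda ^$Z Suc i) = \<theta> (lambda ^$Z i) *$Z \<theta> lambda"
  using theta_simps(3)[of "lambda ^$Z i" lambda 1] lambda_closed by simp
 thus ?case unfolding Suc.IH theta_lambda
  using q rho_closed lambda_closed by (simp add: kappa_simps Z.m_ac)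
qed

lemma eigen_K2: "eigen (K2 0) i (lambda ^$Z i)"
 unfolding eigen_def
 using K2_module[of 0] zid_0 lambda_closed theta_lambda_pow[of i] rho_closed
  K2_0_gel[of "lambda ^$Z i" 0 1] K2_0_cst[of "lambda ^$Z i" "\<rho> ^$Zp i"]
 by (simp add: K2_sel del: mem_Collect_eq)

lemma K2_lambda:
 assumes a: "a \<in>$Lam"
 shows "a \<odot>$(K2 0) lambda ^$Z i = zsum (bcoef i a) *$Z lambda ^$Z i"
proof -
 interpret V: left_module Lam "K2 0" by (rule K2_module)
 have l: "lambda ^$Z i \<in>$Z" using lambda_closed by simp
 have lz: "lambda ^$Z i \<in> zid 0" using l zid_0 by blast
 have "gr_mono Zp GG (bcoef i a k) (el k 0) \<odot>$(K2 0) lambda ^$Z i = \<kappa> (bcoef i a k) *$Z \<zeta> ^$Z k *$Z lambda ^$Z i" for k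
  using K2_mono[OF bcoef_closed[OF a] lz, of i k k 0] l bcoef_closed[OF a] by (simp add: Z.m_assoc)
 hence "a \<odot>$(K2 0) lambda ^$Z i = (\<Oplus>$(K2 0) k\<in>{..<p}. \<kappa> (bcoef i a k) *$Z \<zeta> ^$Z k *$Z lambda ^$Z i)"
  unfolding eigen_expand[OF eigen_K2 a] by simp
 also have "\<dots> = (\<Oplus>$Z k\<in>{..<p}. \<kappa> (bcoef i a k) *$Z \<zeta> ^$Z k *$Z lambda ^$Z i)"
  by (rule finsum_K2_0) (use l bcoef_closed[OF a] in auto)
 also have "\<dots> = zsum (bcoef i a) *$Z lambda ^$Z i"
  unfolding zsum_def by (rule Z.finsum_ldistr[symmetric]) (use l bcoef_closed[OF a] in auto)
 finally show ?thesis .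
qed

text \<open>\<open>lambda\<close> is a unit times \<pi>, and \<pi> is not a zero divisor.\<close>

lemma lambda_pow_cancel:
 assumes x: "x \<in>$Z" and z: "x *$Z lambda ^$Z (i::nat) = 0$Z"
 shows "x = 0$Z"
 using x z
proof (induction i arbitrary: x)
 case (Suc i)
 obtain v where v: "v \<in> Units Z" "lambda = \<pi> *$Z v" using lambda_unit by blast
 have vc: "v \<in>$Z" by (rule Z.Units_closed[OF v(1)])
 have "(x *$Z lambda) *$Z lambda ^$Z i = 0$Z"
  using Suc.prems lambda_closed by (simp add: Z.m_ac)
 hence "x *$Z lambda = 0$Z" using Suc.IH[of "x *$Z lambda"] Suc.prems(1) lambda_closed by simp
 hence "\<pi> *$Z (v *$Z x) = 0$Z" using v(2) vc Suc.prems(1) by (simp add: Z.m_ac)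
 hence "v *$Z x = 0$Z" using pi_nonzero_divisor vc Suc.prems(1) by simp
 hence "v *$Z x = v *$Z 0$Z" using vc by simp
 thus ?case by (rule Z.Units_l_cancel[OF v(1) Suc.prems(1) Z.zero_closed, THEN iffD1])
qed simp

end

section \<open>Left ideals generated by an idempotent\<close>

definition left_multiples :: "('r, 'a) ring_scheme => 'r => 'r set" where
 "left_multiples R f = {a *$R f | a. a \<in>$R}"

lemma (in ring) left_multiples_idem:
 assumes f: "f \<in>$R" "f \<otimes> f = f"
 shows "x \<in> left_multiples R f \<longleftrightarrow> x \<in>$R \<and> x \<otimes> f = x"
 unfolding left_multiples_def using f by (auto simp: m_assoc) metis

lemma (in ring) left_multiples_submod:
 assumes f: "f \<in>$R"
 shows "submod R (reg_mod R) (left_multiples R f)"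
proof (rule submodI)
 show "left_multiples R f \<subseteq> carrier (reg_mod R)" using f by (auto simp: left_multiples_def)
 show "0$(reg_mod R) \<in> left_multiples R f"
  using f unfolding left_multiples_def by (auto intro!: exI[of _ "\<zero>"])
next
 fix x y assume "x \<in> left_multiples R f" "y \<in> left_multiples R f"
 then obtain a b where "a \<in>$R" "b \<in>$R" "x = a \<otimes> f" "y = b \<otimes> f"
  unfolding left_multiples_def by blast
 thus "x +$(reg_mod R) y \<in> left_multiples R f"
  using f unfolding left_multiples_def by (auto intro!: exI[of _ "a \<oplus> b"] simp: l_distr)
next
 fix b x assume "b \<in>$R" "x \<in> left_multiples R f"
 then obtain a where "a \<in>$R" "x = a \<otimes> f" unfolding left_multiples_def by blast
 thus "b \<odot>$(reg_mod R) x \<in> left_multiples R f"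
  using f \<open>b \<in>$R\<close> unfolding left_multiples_def by (auto intro!: exI[of _ "b \<otimes> a"] simp: m_assoc)
qed

text \<open>R is the direct sum of R f and R (1 - f).\<close>

lemma (in ring) fg_projective_idem:
 assumes f: "f \<in>$R" "f \<otimes> f = f"
 shows "fg_projective R ((reg_mod R)\<lparr>carrier := left_multiples R f\<rparr>)"
proof -
 let ?g = "\<one> \<ominus> f"
 have g: "?g \<in>$R" using f by simp
 have fg: "f \<otimes> ?g = \<zero>" "?g \<otimes> f = \<zero>" and gg: "?g \<otimes> ?g = ?g"
 proof -
  show "f \<otimes> ?g = \<zero>" "?g \<otimes> f = \<zero>"
   using f by (simp_all add: minus_eq r_distr l_distr r_minus l_minus r_neg)
  have "?g \<otimes> ?g = ?g \<ominus> f \<otimes> ?g"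
   using f g by (simp add: minus_eq l_distr l_minus)
  thus "?g \<otimes> ?g = ?g" using \<open>f \<otimes> ?g = \<zero>\<close> g by (simp add: minus_eq)
 qed
 let ?P = "(reg_mod R)\<lparr>carrier := left_multiples R f\<rparr>" and ?Q = "(reg_mod R)\<lparr>carrier := left_multiples R ?g\<rparr>"
 have P: "left_module R ?P" and Q: "left_module R ?Q"
  using left_module.left_module_submod[OF left_module_reg[OF ring_axioms]] left_multiples_submod f(1) g by auto
 have iso: "lmod_iso R (reg_mod R) (oplus_mod ?P ?Q)"
 proof (rule lmod_isoI[where h = "%a. (a \<otimes> f, a \<otimes> ?g)" and g = "%z. fst z \<oplus> snd z"])
  show "(%a. (a \<otimes> f, a \<otimes> ?g)) \<in> lmod_hom R (reg_mod R) (oplus_mod ?P ?Q)"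
   by (rule lmod_homI) (use f g in "auto simp: l_distr m_assoc left_multiples_def")
  show "fst (x \<otimes> f, x \<otimes> ?g) \<oplus> snd (x \<otimes> f, x \<otimes> ?g) = x" if "x \<in>$(reg_mod R)" for x
  proof -
   have "f \<oplus> ?g = \<one>" using f by (simp add: minus_eq a_lcomm[of f \<one>] r_neg)
   thus ?thesis using that f g r_distr[of f ?g x] by simp
  qed
 next
  fix z assume "z \<in>$(oplus_mod ?P ?Q)"
  then obtain x y where z: "z = (x, y)" and x: "x \<in>$R" "x \<otimes> f = x" and y: "y \<in>$R" "y \<otimes> ?g = y"
   using left_multiples_idem[OF f] left_multiples_idem[OF g gg] by (cases z) auto
  show "fst z \<oplus> snd z \<in>$(reg_mod R)" using x y by (simp add: z)
  have "x \<otimes> ?g = \<zero>" using m_assoc[OF x(1) f(1) g] x fg by simp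
  moreover have "y \<otimes> f = \<zero>" using m_assoc[OF y(1) g f(1)] y fg by simp
  ultimately show "((fst z \<oplus> snd z) \<otimes> f, (fst z \<oplus> snd z) \<otimes> ?g) = z"
   using x y f g by (simp add: z l_distr)
 qed
 have "fg_projective R (oplus_mod ?P ?Q)"
  by (rule fg_projective_iso[OF fg_projective_reg[OF ring_axioms] iso left_module_oplus[OF P Q]])
 thus ?thesis
  \<comment> \<open>Constant sequences code the elements of the complement.\<close>
  by (rule fg_projective_summand[where c = "%x n. x", OF _ P Q]) (auto simp: inj_on_def fun_eq_iff)
qed

lemma (in padic) finsum_const: "x \<in>$Zp ==> finite A ==> (\<Oplus>$Zp k\<in>A. x) = [card A] \<cdot>$Zp x"
 using Zp.add.finprod_const[of x A] by simp

section \<open>Division by p\<close>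

context padic
begin

lemma p_mult_cancel:
 assumes x: "x \<in>$Zp" and y: "y \<in>$Zp" and eq: "pp *$Zp x = pp *$Zp y"
 shows "x = y"
proof -
 have "pp *$Zp (x -$Zp y) = 0$Zp"
  using x y eq by (simp add: a_minus_def Zp.r_distr Zp.r_minus Zp.r_neg)
 hence "x -$Zp y = 0$Zp"
  using padic_torsion_free[of "x -$Zp y" p] x y prime_gt_0_nat[OF prime] padic_smult_mult[of "x -$Zp y" p] by simp
 thus ?thesis using x y by (simp add: Zp.r_right_minus_eq)
qed

definition divp :: "(nat => int) => nat => int" where
 "divp x = (SOME y. y \<in>$Zp \<and> x = pp *$Zp y)"

lemma divp:
 assumes "x \<in>$Zp" "x 1 = 0" shows "divp x \<in>$Zp" "pp *$Zp divp x = x"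
proof -
 have "\<exists>y. y \<in>$Zp \<and> x = pp *$Zp y" using padic_divide_p[OF assms] by blast
 from someI_ex[OF this] show "divp x \<in>$Zp" "pp *$Zp divp x = x" by (simp_all add: divp_def)
qed

lemma divp_eqI:
 assumes "y \<in>$Zp" "x = pp *$Zp y" shows "divp x = y"
proof -
 have "\<exists>y. y \<in>$Zp \<and> x = pp *$Zp y" using assms by blast
 from someI_ex[OF this] show ?thesis using p_mult_cancel[of "divp x" y] assms by (simp add: divp_def)
qed

text \<open>The group ring of the group generated by \<sigma> embeds into the product of Z_p and
  Z_p[\<zeta>]: vanishing in Z_p[\<zeta>] makes the coordinates constant, and then their sum is p
  times the constant.\<close>

lemma zsum_zero_coeff:
 assumes c: "!!k. c k \<in>$Zp" and z: "zsum c = 0$Z" and s: "(\<Oplus>$Zp k\<in>{..<p}. c k) = 0$Zp" and n: "n < p"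
 shows "c n = 0$Zp"
proof -
 have "(\<Oplus>$Zp k\<in>{..<p}. c k) = (\<Oplus>$Zp k\<in>{..<p}. c 0)"
  by (rule Zp.finsum_cong') (use c zsum_eq_zero[OF c z] in blast)+
 also have "\<dots> = [p] \<cdot>$Zp c 0" using finsum_const[OF c, of "{..<p}" 0] by simp
 finally have "[p] \<cdot>$Zp c 0 = 0$Zp" by (rule trans[OF sym s])
 thus ?thesis using padic_torsion_free[OF c] prime_gt_0_nat[OF prime] zsum_eq_zero[OF c z n] by metis
qed

end

section \<open>Splitting the ideal of congruences \<chi>_i(a) = 0 modulo p\<close>

context metacyclic_setup
begin

interpretation Z: cring Z by (rule Z_cring)

definition avec :: "(nat => nat => int) => 'g => nat => int" where
 "avec c = (\<Oplus>$Lam k\<in>{..<p}. gr_mono Zp GG (c k) (el k 0))"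

context
 fixes c :: "nat => nat => int" assumes c: "!!k. c k \<in>$Zp"
begin

lemma avec_closed: "avec c \<in>$Lam"
 unfolding avec_def by (rule lam.RG.finsum_closed) (use c lam.gr_mono_closed in auto)

lemma chi_avec: "chi i (avec c) = (\<Oplus>$Zp k\<in>{..<p}. c k)"
proof -
 have "chi i (avec c) = (\<Oplus>$Zp k\<in>{..<p}. chi i (gr_mono Zp GG (c k) (el k 0)))"
  unfolding avec_def by (rule chi_finsum) (use c lam.gr_mono_closed in auto)
 thus ?thesis using chi_mono[OF c, of i _ _ 0] c by simp
qed

lemma avec_K2:
 assumes x: "x \<in>$Z" shows "avec c \<odot>$(K2 0) x = zsum c *$Z x"
proof -
 interpret V: left_module Lam "K2 0" by (rule K2_module)
 have xz: "x \<in> zid 0" using x zid_0 by blast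
 have "avec c \<odot>$(K2 0) x = (\<Oplus>$(K2 0) k\<in>{..<p}. gr_mono Zp GG (c k) (el k 0) \<odot>$(K2 0) x)"
  unfolding avec_def by (rule V.smult_finsum_left) (use c xz lam.gr_mono_closed in "simp_all add: K2_sel del: mem_Collect_eq")
 also have "\<dots> = (\<Oplus>$(K2 0) k\<in>{..<p}. \<kappa> (c k) *$Z \<zeta> ^$Z k *$Z x)"
  using K2_mono[OF c xz, of _ _ 0] x c by (simp add: Z.m_assoc)
 also have "\<dots> = (\<Oplus>$Z k\<in>{..<p}. \<kappa> (c k) *$Z \<zeta> ^$Z k *$Z x)"
  by (rule finsum_K2_0) (use x c in auto)
 also have "\<dots> = zsum c *$Z x"
  unfolding zsum_def by (rule Z.finsum_ldistr[symmetric]) (use x c in auto)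
 finally show ?thesis .
qed

end

text \<open>Take a = x N + B (1 - \<sigma>) with N the sum of the powers of \<sigma>. N has
  character p and acts as zero on Z_p[\<zeta>], while 1 - \<sigma> has character zero and acts as
  \<pi>; so the two conditions are met independently by x and B.\<close>

lemma split_surj:
 assumes x: "x \<in>$Zp" and y: "y \<in> zid (i + 1)"
 shows "\<exists>a\<in>carrier Lam. chi i a = pp *$Zp x \<and> a \<odot>$(K2 0) lambda ^$Z i = y"
proof -
 interpret V: left_module Lam "K2 0" by (rule K2_module)
 have V0: "carrier (K2 0) = carrier Z" using zid_0 by (simp add: K2_sel)
 obtain z where z: "z \<in>$Z" "y = \<pi> ^$Z (i + 1) *$Z z" using y by blast
 obtain v where v: "v \<in> Units Z" "lambda = \<pi> *$Z v" using lambda_unit by blast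
 have vc: "v \<in>$Z" "inv\<^bsub>Z\<^esub> v \<in>$Z" "v *$Z inv\<^bsub>Z\<^esub> v = 1$Z" using v(1) Z.Units_closed by auto
 \<comment> \<open>As \<open>lambda\<close> = \<pi> v, this gives t \<pi> \<open>lambda\<close>^i =
   \<pi>^(i+1) z = y.\<close>
 define t where "t = z *$Z (inv\<^bsub>Z\<^esub> v) ^$Z i"
 have t: "t \<in>$Z" using z vc by (simp add: t_def)
 define l where "l = lambda ^$Z i"
 have l: "l \<in>$Z" using lambda_closed by (simp add: l_def)
 have lt: "t *$Z (\<pi> *$Z l) = y"
 proof -
  have "t *$Z (\<pi> *$Z l) = \<pi> ^$Z (i + 1) *$Z z *$Z (v ^$Z i *$Z (inv\<^bsub>Z\<^esub> v) ^$Z i)"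
   unfolding t_def l_def v(2) using z(1) vc by (simp add: Z.nat_pow_distrib Z.m_ac)
  also have "v ^$Z i *$Z (inv\<^bsub>Z\<^esub> v) ^$Z i = 1$Z"
   using Z.nat_pow_distrib[OF vc(1,2), of i] vc(3) by simp
  finally show ?thesis using z by simp
 qed
 obtain c where c: "!!k. c k \<in>$Zp" "t = zsum c" using zsum_span[OF t] by blast
 define N where "N = avec (%k. 1$Zp)"
 have N: "N \<in>$Lam" unfolding N_def by (rule avec_closed) simp
 have chiN: "chi i N = pp" unfolding N_def using chi_avec[of "%k. 1$Zp" i] finsum_const[of "1$Zp" "{..<p}"] by simp
 have Nl: "N \<odot>$(K2 0) l = 0$Z"
  unfolding N_def using avec_K2[of "%k. 1$Zp" l] l zeta_sum by (simp add: zsum_def kappa_simps)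
 define B where "B = avec c"
 have B: "B \<in>$Lam" unfolding B_def by (rule avec_closed[OF c(1)])
 define D1 where "D1 = 1$Lam -$Lam gel 1 0"
 have D1: "D1 \<in>$Lam" using gel_closed by (simp add: D1_def)
 have D1l: "D1 \<odot>$(K2 0) l = \<pi> *$Z l"
 proof -
  have "D1 \<odot>$(K2 0) l = l -$(K2 0) gel 1 0 \<odot>$(K2 0) l"
   unfolding D1_def a_minus_def using gel_closed[of 1 0] l V0
   by (simp add: V.smult_l_distr V.smult_neg_left V.smult_one)
  also have "gel 1 0 \<odot>$(K2 0) l = \<zeta> *$Z l" using K2_0_gel[OF l, of 1 0] by simp
  also have "l -$(K2 0) \<zeta> *$Z l = l -$Z \<zeta> *$Z l"
  proof -
   have "\<ominus>$(K2 0) w = \<ominus>$Z w" if "w \<in>$Z" for w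
   proof (rule V.M.minus_equality)
    show "\<ominus>$Z w +$(K2 0) w = 0$(K2 0)" using that by (simp add: K2_sel Z.l_neg)
   qed (use that V0 in auto)
   thus ?thesis using l by (simp add: a_minus_def K2_sel)
  qed
  also have "\<dots> = \<pi> *$Z l" unfolding pi_zeta_def using l by (simp add: a_minus_def Z.l_distr Z.l_minus)
  finally show ?thesis .
 qed
 have chiD1: "chi i D1 = 0$Zp"
  unfolding D1_def using chi_simps(5)[OF lam.RG.one_closed gel_closed, of i 1 0] chi_gel[of i 1 0]
  by (simp add: chi_simps(3) a_minus_def Zp.r_neg)
 define a where "a = cst x *$Lam N +$Lam B *$Lam D1"
 have cx: "cst x \<in>$Lam" by (rule cst_closed[OF x])
 have xN: "cst x *$Lam N \<in>$Lam" and BD: "B *$Lam D1 \<in>$Lam" using cx N B D1 by auto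
 have aL: "a \<in>$Lam" unfolding a_def using xN BD by simp
 have pc: "pp \<in>$Zp" by simp
 have "chi i a = pp *$Zp x"
  unfolding a_def using chi_simps(1)[OF xN BD] chi_simps(2)[OF cx N] chi_simps(2)[OF B D1]
  by (simp add: chi_cst[OF x] chiN chiD1 chi_closed[OF B] x Zp.m_comm[OF x pc])
 moreover have "a \<odot>$(K2 0) l = y"
 proof -
  have lV: "l \<in>$(K2 0)" using l V0 by simp
  have "a \<odot>$(K2 0) l = cst x \<odot>$(K2 0) (N \<odot>$(K2 0) l) +$Z B \<odot>$(K2 0) (D1 \<odot>$(K2 0) l)"
   unfolding a_def V.smult_l_distr[OF xN BD lV] V.smult_assoc[OF cx N lV] V.smult_assoc[OF B D1 lV] by (simp add: K2_sel)
  also have "\<dots> = t *$Z (\<pi> *$Z l)"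
   unfolding Nl D1l B_def c(2)
   using avec_K2[OF c(1), of "\<pi> *$Z l"] l t K2_0_cst[OF Z.zero_closed x] x unfolding c(2) by simp
  finally show ?thesis using lt by simp
 qed
 ultimately show ?thesis using aL by (auto simp: l_def)
qed

definition esum :: "nat set => 'g => nat => int" where
 "esum S = (\<Oplus>$Lam i\<in>S. idem i)"

definition char_ideal :: "nat set => ('g => nat => int) set" where
 "char_ideal S = {a \<in> carrier Lam. \<forall>i\<in>S. chi i a 1 = 0}"

lemma esum_closed: "esum S \<in>$Lam"
 unfolding esum_def by (rule lam.RG.finsum_closed) (use idem_closed in auto)

lemma char_ideal_submod: "submod Lam (reg_mod Lam) (char_ideal S)"
proof (rule submodI)
 show "char_ideal S \<subseteq> carrier (reg_mod Lam)" by (auto simp: char_ideal_def)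
 show "0$(reg_mod Lam) \<in> char_ideal S" by (simp add: char_ideal_def chi_simps(4) padic_sel)
 show "x +$(reg_mod Lam) y \<in> char_ideal S" if "x \<in> char_ideal S" "y \<in> char_ideal S" for x y
  using that by (auto simp: char_ideal_def chi_simps(1) padic_sel(5))
 show "a \<odot>$(reg_mod Lam) x \<in> char_ideal S" if "a \<in>$Lam" "x \<in> char_ideal S" for a x
  using that by (auto simp: char_ideal_def chi_simps(2) padic_sel(2))
qed

context
 fixes S assumes S: "S \<subseteq> {1..r}"
begin

lemma finS: "finite S" using S finite_subset by blast

text \<open>Only the i-th idempotent survives on an eigenvector for \<rho>^i, because \<rho>, ...,
  \<rho>^r are distinct.\<close>

lemma eigen_sum:
 assumes e: "eigen W i w" and i: "i \<in> S" and a: "!!i. i \<in> S ==> a i \<in>$Lam"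
 shows "(\<Oplus>$Lam i\<in>S. a i *$Lam idem i) \<odot>$W w = a i \<odot>$W w"
proof -
 interpret W: left_module Lam W using e by (simp add: eigen_def)
 have w: "w \<in>$W" using e by (simp add: eigen_def)
 have "(\<Oplus>$Lam i\<in>S. a i *$Lam idem i) \<odot>$W w = (\<Oplus>$W i'\<in>S. (a i' *$Lam idem i') \<odot>$W w)"
  by (rule W.smult_finsum_left[OF w]) (use a idem_closed in auto)
 also have "\<dots> = (\<Oplus>$W i'\<in>S. if i' = i then a i \<odot>$W w else 0$W)"
 proof (rule W.M.finsum_cong'[OF refl])
  fix i' assume i': "i' \<in> S"
  have r: "i \<in> {1..r}" "i' \<in> {1..r}" using i i' S by blast+
  have "(a i' *$Lam idem i') \<odot>$W w = a i' \<odot>$W (idem i' \<odot>$W w)"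
   by (rule W.smult_assoc[OF a[OF i'] idem_closed w])
  also have "\<dots> = (if i' = i then a i \<odot>$W w else 0$W)"
   using idem_eigen[OF e, of i'] rho_pow_inj[OF r] a[OF i'] by (auto simp: W.smult_zero_right)
  finally show "(a i' *$Lam idem i') \<odot>$W w = (if i' = i then a i \<odot>$W w else 0$W)" .
 qed (use W.smult_closed[OF a[OF i] w] in auto)
 also have "\<dots> = a i \<odot>$W w" by (rule W.M.finsum_delta[OF finS i W.smult_closed[OF a[OF i] w]])
 finally show ?thesis .
qed

lemma eigen_esum: assumes "eigen W i w" "i \<in> S" shows "esum S \<odot>$W w = w"
proof -
 have w: "left_module Lam W" "w \<in>$W" using assms(1) by (simp_all add: eigen_def)
 show ?thesis
  using eigen_sum[OF assms, of "%_. 1$Lam"] left_module.smult_one[OF w] idem_closed by (simp add: esum_def)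
qed

lemma eigen_fsum: assumes "eigen W i w" "i \<in> S" shows "(1$Lam -$Lam esum S) \<odot>$W w = 0$W"
proof -
 interpret W: left_module Lam W using assms(1) by (simp add: eigen_def)
 have w: "w \<in>$W" using assms(1) by (simp_all add: eigen_def)
 show ?thesis
  using w esum_closed eigen_esum[OF assms]
  by (simp add: a_minus_def W.smult_l_distr W.smult_neg_left W.smult_one W.M.r_neg)
qed

lemma idem_esum: assumes "i \<in> S" shows "idem i *$Lam esum S = idem i"
proof -
 have "idem i *$Lam esum S = (\<Oplus>$Lam i'\<in>S. idem i *$Lam idem i')"
  unfolding esum_def by (rule lam.RG.finsum_rdistr) (use finS idem_closed in auto)
 also have "\<dots> = (\<Oplus>$Lam i'\<in>S. if i' = i then idem i else 0$Lam)"
  using idem_mult[OF subsetD[OF S] subsetD[OF S], of _ i] assms idem_closed by (intro lam.RG.finsum_cong') auto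
 also have "\<dots> = idem i" by (rule lam.RG.finsum_delta) (use finS assms idem_closed in auto)
 finally show ?thesis .
qed

abbreviation "fS \<equiv> 1$Lam -$Lam esum S"

lemma fS_closed: "fS \<in>$Lam" using esum_closed by simp

lemma idem_fsum: assumes "i \<in> S" shows "idem i *$Lam fS = 0$Lam"
 using idem_esum[OF assms] idem_closed[of i] esum_closed
 by (simp add: a_minus_def lam.RG.r_distr lam.RG.r_minus lam.RG.r_neg)

lemma esum_fsum: "esum S *$Lam fS = 0$Lam"
proof -
 have "esum S *$Lam fS = (\<Oplus>$Lam i\<in>S. idem i *$Lam fS)"
  unfolding esum_def[of S, THEN arg_cong[where f = "%x. x *$Lam fS"]]
  by (rule lam.RG.finsum_ldistr) (use finS idem_closed fS_closed in auto)
 also have "\<dots> = 0$Lam" using idem_fsum by (intro lam.RG.add.finprod_one_eqI) auto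
 finally show ?thesis .
qed

lemma fS_idem: "fS *$Lam fS = fS"
proof -
 have "fS *$Lam fS = fS -$Lam esum S *$Lam fS"
  using fS_closed esum_closed by (simp add: a_minus_def lam.RG.l_distr lam.RG.l_minus)
 thus ?thesis using esum_fsum fS_closed by (simp add: a_minus_def lam.RG.ring_simprules)
qed

text \<open>Three kinds of components: \<chi>_i(a) divided by p, the action on
  \<open>lambda\<close>^i, and the part outside S. On the last the ideal imposes no condition; it
  runs through a left ideal generated by an idempotent, hence projective.\<close>

definition splitting :: "('g => nat => int) => (nat => (nat => int) \<times> (nat => nat => int) set) \<times> ('g => nat => int)" where
 "splitting a = ((\<lambda>i\<in>S. (divp (chi i a), a \<odot>$(K2 0) lambda ^$Z i)), a *$Lam fS)"

abbreviation "MS \<equiv> dsum_mod S (%i. oplus_mod (K1 i) (K2 (i + 1)))"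
abbreviation "PS \<equiv> (reg_mod Lam)\<lparr>carrier := left_multiples Lam fS\<rparr>"
abbreviation "LS \<equiv> (reg_mod Lam)\<lparr>carrier := char_ideal S\<rparr>"

lemma LS_module: "left_module Lam LS"
 by (rule left_module.left_module_submod[OF left_module_reg[OF lam.group_ring_ring] char_ideal_submod])

lemma PS_projective: "fg_projective Lam PS"
 by (rule lam.RG.fg_projective_idem[OF fS_closed fS_idem])

lemma MS_module: "left_module Lam MS"
 by (rule left_module_dsum[OF lam.group_ring_ring]) (rule left_module_oplus[OF K1_module K2_module])

text \<open>On \<open>lambda\<close>^i the element a acts as multiplication by an element congruent
  to \<chi>_i(a) modulo \<pi>. As p divides \<chi>_i(a) and \<pi> divides p, one factor \<pi> is
  gained beyond the i factors in \<open>lambda\<close>^i; this is the origin of the index i +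
  1.\<close>

lemma char_ideal_K2:
 assumes a: "a \<in> char_ideal S" and i: "i \<in> S"
 shows "a \<odot>$(K2 0) lambda ^$Z i \<in> zid (i + 1)"
proof -
 have aL: "a \<in>$Lam" and z: "chi i a 1 = 0" using a i by (auto simp: char_ideal_def)
 have b: "bcoef i a k \<in>$Zp" for k by (rule bcoef_closed[OF aL])
 have "\<exists>y\<in>carrier Z. zsum (bcoef i a) = \<kappa> (chi i a) +$Z \<pi> *$Z y"
  unfolding chi_bcoef[OF aL] by (rule zsum_mod_pi[OF b])
 then obtain y where y: "y \<in>$Z" "zsum (bcoef i a) = \<kappa> (chi i a) +$Z \<pi> *$Z y" by blast
 obtain w where w: "w \<in>$Z" "\<kappa> pp = \<pi> *$Z w" using p_in_pi by blast
 define q where "q = \<kappa> (divp (chi i a))"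
 have d: "divp (chi i a) \<in>$Zp" by (rule divp(1)[OF chi_closed[OF aL] z])
 have q: "q \<in>$Z" using d by (simp add: q_def)
 have "\<kappa> (chi i a) = \<kappa> pp *$Z q"
  unfolding q_def using kappa_simps(2)[OF _ d, of pp] divp(2)[OF chi_closed[OF aL] z] by simp
 hence zs: "zsum (bcoef i a) = \<pi> *$Z (w *$Z q +$Z y)"
  unfolding y(2) w(2) using w(1) q y(1) by (simp add: Z.r_distr Z.m_assoc)
 define t where "t = w *$Z q +$Z y"
 have t: "t \<in>$Z" using w(1) q y(1) by (simp add: t_def)
 obtain v where v: "v \<in> Units Z" "lambda = \<pi> *$Z v" using lambda_unit by blast
 have vc: "v \<in>$Z" by (rule Z.Units_closed[OF v(1)])
 have "a \<odot>$(K2 0) lambda ^$Z i = \<pi> *$Z t *$Z (\<pi> *$Z v) ^$Z i"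
  unfolding K2_lambda[OF aL] zs t_def by (simp only: v(2))
 also have "\<dots> = \<pi> ^$Z (i + 1) *$Z (t *$Z v ^$Z i)"
  using t vc by (simp add: Z.nat_pow_distrib Z.m_ac)
 finally have "a \<odot>$(K2 0) lambda ^$Z i = \<pi> ^$Z (i + 1) *$Z (t *$Z v ^$Z i)" .
 moreover have "t *$Z v ^$Z i \<in>$Z" using t vc by simp
 ultimately show ?thesis by (intro CollectI exI conjI)
qed

lemma splitting_hom: "splitting \<in> lmod_hom Lam LS (oplus_mod MS PS)"
proof (rule lmod_homI)
 have lz: "lambda ^$Z (i::nat) \<in>$(K2 0)" for i using lambda_closed zid_0 by (simp add: K2_sel)
 interpret V: left_module Lam "K2 0" by (rule K2_module)
 {
  fix a assume "a \<in>$LS"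
  hence a: "a \<in> char_ideal S" and aL: "a \<in>$Lam" by (auto simp: char_ideal_def)
  have z: "chi i a 1 = 0" if "i \<in> S" for i using a that by (simp add: char_ideal_def)
  show "splitting a \<in>$(oplus_mod MS PS)"
   unfolding splitting_def
   using divp(1)[OF chi_closed[OF aL] z] char_ideal_K2[OF a] aL
   by (auto simp: K1_sel K2_sel left_multiples_def simp del: mem_Collect_eq)
  fix b
  {
   assume "b \<in>$LS"
   hence b: "b \<in> char_ideal S" and bL: "b \<in>$Lam" by (auto simp: char_ideal_def)
   have zb: "chi i b 1 = 0" if "i \<in> S" for i using b that by (simp add: char_ideal_def)
   have "divp (chi i (a +$Lam b)) = divp (chi i a) +$Zp divp (chi i b)" if i: "i \<in> S" for i
    by (rule divp_eqI) (use divp[OF chi_closed[OF aL] z[OF i]] divp[OF chi_closed[OF bL] zb[OF i]] in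
      "simp_all add: chi_simps(1)[OF aL bL] Zp.r_distr")
   thus "splitting (a +$LS b) = splitting a +$(oplus_mod MS PS) splitting b"
    unfolding splitting_def using V.smult_l_distr[OF aL bL lz] aL bL fS_closed
    by (auto simp: K1_sel K2_sel lam.RG.l_distr intro!: restrict_ext)
  }
  assume bL: "b \<in>$Lam"
  have "divp (chi i (b *$Lam a)) = chi i b *$Zp divp (chi i a)" if i: "i \<in> S" for i
  proof (rule divp_eqI)
   note d = divp[OF chi_closed[OF aL] z[OF i]]
   show "chi i b *$Zp divp (chi i a) \<in>$Zp" using d(1) chi_closed[OF bL] by simp
   have "chi i b *$Zp (pp *$Zp divp (chi i a)) = pp *$Zp (chi i b *$Zp divp (chi i a))"
    by (rule Zp.m_lcomm) (use d(1) chi_closed[OF bL] in auto)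
   thus "chi i (b *$Lam a) = pp *$Zp (chi i b *$Zp divp (chi i a))"
    unfolding d(2) chi_simps(2)[OF bL aL] .
  qed
  moreover have "b \<odot>$(K2 (i + 1)) (a \<odot>$(K2 0) lambda ^$Z i) = (b *$Lam a) \<odot>$(K2 0) lambda ^$Z i" if i: "i \<in> S" for i
   using K2_smult[OF bL char_ideal_K2[OF a i]] V.smult_assoc[OF bL aL lz] by simp
  moreover have "b \<odot>$(K1 i) divp (chi i a) = chi i b *$Zp divp (chi i a)" if i: "i \<in> S" for i
   by (rule K1_smult[OF bL divp(1)[OF chi_closed[OF aL] z[OF i]]])
  ultimately show "splitting (b \<odot>$LS a) = b \<odot>$(oplus_mod MS PS) splitting a"
   unfolding splitting_def using aL bL fS_closed
   by (auto simp: lam.RG.m_assoc intro!: restrict_ext)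
 }
qed

text \<open>For i in S all coordinates of d e_i vanish by \<open>zsum_zero_coeff\<close>. So d is
  killed by the idempotents of S and equals its part outside S.\<close>

lemma splitting_kernel:
 assumes d: "d \<in>$Lam" and c: "!!i. i \<in> S ==> chi i d = 0$Zp"
  and l: "!!i. i \<in> S ==> d \<odot>$(K2 0) lambda ^$Z i = 0$Z" and f: "d *$Lam fS = 0$Lam"
 shows "d = 0$Lam"
proof -
 have di: "d *$Lam idem i = 0$Lam" if i: "i \<in> S" for i
 proof -
  have b: "bcoef i d k \<in>$Zp" for k by (rule bcoef_closed[OF d])
  have "zsum (bcoef i d) = 0$Z"
   by (rule lambda_pow_cancel[OF zsum_closed[OF b]]) (use l[OF i] K2_lambda[OF d] in simp)
  hence "bcoef i d k = 0$Zp" if "k < p" for k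
   using zsum_zero_coeff[OF b _ _ that] c[OF i] chi_bcoef[OF d] by simp
  moreover have "gr_mono Zp GG 0$Zp g = 0$Lam" for g
   by (simp add: gr_mono_def group_ring_sel)
  ultimately have "(\<Oplus>$Lam k\<in>{..<p}. gr_mono Zp GG (bcoef i d k) (el k 0) *$Lam idem i) = 0$Lam"
   using idem_closed[of i] by (intro lam.RG.add.finprod_one_eqI) auto
  moreover have "(\<Oplus>$(reg_mod Lam) k\<in>{..<p}. gr_mono Zp GG (bcoef i d k) (el k 0) *$Lam idem i) =
    (\<Oplus>$Lam k\<in>{..<p}. gr_mono Zp GG (bcoef i d k) (el k 0) *$Lam idem i)"
   by (rule additive_finsum[where h = "%x. x", OF left_moduleD(2)[OF left_module_reg[OF lam.group_ring_ring]] lam.RG.abelian_group_axioms])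
    (use b lam.gr_mono_closed idem_closed in auto)
  ultimately show ?thesis using eigen_expand[OF eigen_idem d, of i] by simp
 qed
 have "d *$Lam esum S = (\<Oplus>$Lam i\<in>S. d *$Lam idem i)"
  unfolding esum_def by (rule lam.RG.finsum_rdistr) (use finS d idem_closed in auto)
 also have "\<dots> = 0$Lam" using di by (intro lam.RG.add.finprod_one_eqI) auto
 finally have "d *$Lam fS = d" using d esum_closed by (simp add: a_minus_def lam.RG.r_distr lam.RG.r_minus lam.RG.ring_simprules)
 thus ?thesis using f by simp
qed

lemma splitting_inj: "inj_on splitting (char_ideal S)"
proof (rule inj_onI)
 fix a b assume a: "a \<in> char_ideal S" and b: "b \<in> char_ideal S" and eq: "splitting a = splitting b"
 interpret V: left_module Lam "K2 0" by (rule K2_module)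
 have lz: "lambda ^$Z (i::nat) \<in>$(K2 0)" for i using lambda_closed zid_0 by (simp add: K2_sel)
 have aL: "a \<in>$Lam" and bL: "b \<in>$Lam" using a b by (auto simp: char_ideal_def)
 have i: "divp (chi i a) = divp (chi i b)" "a \<odot>$(K2 0) lambda ^$Z i = b \<odot>$(K2 0) lambda ^$Z i" if "i \<in> S" for i
 proof -
  have "fst (splitting a) i = fst (splitting b) i" using eq by simp
  thus "divp (chi i a) = divp (chi i b)" "a \<odot>$(K2 0) lambda ^$Z i = b \<odot>$(K2 0) lambda ^$Z i"
   using that by (simp_all add: splitting_def)
 qed
 have "a -$Lam b = 0$Lam"
 proof (rule splitting_kernel)
  show "a -$Lam b \<in>$Lam" using aL bL by simp
  fix k assume k: "k \<in> S"
  have "chi k a 1 = 0" "chi k b 1 = 0" using a b k by (auto simp: char_ideal_def)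
  hence "chi k a = chi k b" using i(1)[OF k] divp(2)[OF chi_closed[OF aL]] divp(2)[OF chi_closed[OF bL]] by metis
  thus "chi k (a -$Lam b) = 0$Zp"
   using chi_simps(5)[OF aL bL] chi_closed[OF bL] by (simp add: a_minus_def Zp.r_neg)
  show "(a -$Lam b) \<odot>$(K2 0) lambda ^$Z k = 0$Z"
   using i(2)[OF k] V.smult_l_distr[OF aL _ lz, of "\<ominus>$Lam b" k] V.smult_neg_left[OF bL lz] bL V.M.r_neg[OF V.smult_closed[OF bL lz], of k]
   by (simp add: a_minus_def) (simp add: K2_sel)
 next
  show "(a -$Lam b) *$Lam fS = 0$Lam"
  proof -
   have "a *$Lam fS = b *$Lam fS" using eq by (simp add: splitting_def)
   moreover define f where "f = fS"
   moreover have "f \<in>$Lam" using fS_closed by (simp add: f_def)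
   ultimately show ?thesis unfolding f_def[symmetric]
    using aL bL by (simp add: a_minus_def lam.RG.l_distr lam.RG.l_minus lam.RG.r_neg)
  qed
 qed
 thus "a = b" using aL bL lam.RG.r_right_minus_eq by simp
qed

text \<open>Solve the problem for each i separately, glue the solutions with the idempotents e_i,
  and add the prescribed part outside S; orthogonality prevents any interference.\<close>

lemma splitting_surj:
 assumes m: "m \<in>$MS" and w: "w \<in> left_multiples Lam fS"
 shows "\<exists>a\<in>char_ideal S. splitting a = (m, w)"
proof -
 interpret V: left_module Lam "K2 0" by (rule K2_module)
 have lz: "lambda ^$Z (i::nat) \<in>$(K2 0)" for i using lambda_closed zid_0 by (simp add: K2_sel)
 have wL: "w \<in>$Lam" and wf: "w *$Lam fS = w"
  using w lam.RG.left_multiples_idem[OF fS_closed fS_idem] by auto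
 have mi: "fst (m i) \<in>$Zp" "snd (m i) \<in> zid (i + 1)" if "i \<in> S" for i
 proof -
  have "m i \<in> carrier (oplus_mod (K1 i) (K2 (i + 1)))" using m that by auto
  hence "m i \<in> carrier Zp \<times> zid (i + 1)" by (simp only: oplus_mod_simps K1_sel K2_sel)
  thus "fst (m i) \<in>$Zp" "snd (m i) \<in> zid (i + 1)" by (simp_all only: mem_Times_iff)
 qed
 have "\<forall>i\<in>S. \<exists>a\<in>carrier Lam. chi i a = pp *$Zp fst (m i) \<and> a \<odot>$(K2 0) lambda ^$Z i = snd (m i)"
  using split_surj[OF mi] by blast
 then obtain a where a: "!!i. i \<in> S ==> a i \<in>$Lam" "!!i. i \<in> S ==> chi i (a i) = pp *$Zp fst (m i)"
  "!!i. i \<in> S ==> a i \<odot>$(K2 0) lambda ^$Z i = snd (m i)" by metis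
 define A where "A = (\<Oplus>$Lam i\<in>S. a i *$Lam idem i)"
 have A: "A \<in>$Lam" unfolding A_def by (rule lam.RG.finsum_closed) (use a idem_closed in auto)
 have act: "(A +$Lam w) \<odot>$W x = a i \<odot>$W x" if e: "eigen W i x" and i: "i \<in> S" for W i and x :: 'w
 proof -
  interpret W: left_module Lam W using e by (simp add: eigen_def)
  have x: "x \<in>$W" using e by (simp add: eigen_def)
  have "w \<odot>$W x = w \<odot>$W (fS \<odot>$W x)" using W.smult_assoc[OF wL fS_closed x] wf by simp
  also have "\<dots> = 0$W" unfolding eigen_fsum[OF e i] by (rule W.smult_zero_right[OF wL])
  finally show ?thesis
   using W.smult_l_distr[OF A wL x] eigen_sum[OF e i, of a] a(1) W.smult_closed[OF a(1)[OF i] x] by (simp add: A_def)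
 qed
 have chiA: "chi i (A +$Lam w) = pp *$Zp fst (m i)" if "i \<in> S" for i
  using act[OF eigen_K1 that] a(2)[OF that] by (simp add: chi_def)
 have "A *$Lam fS = (\<Oplus>$Lam i\<in>S. a i *$Lam idem i *$Lam fS)"
  unfolding A_def by (rule lam.RG.finsum_ldistr[OF finS fS_closed]) (use a idem_closed in auto)
 also have "\<dots> = 0$Lam"
  using idem_fsum lam.RG.m_assoc[OF a(1) idem_closed fS_closed] a(1) by (intro lam.RG.add.finprod_one_eqI) simp_all
 finally have Af: "(A +$Lam w) *$Lam fS = w" using lam.RG.l_distr[OF A wL fS_closed] wf wL by simp
 have "pp 1 = 0" by (simp add: residue_simps[unfolded One_nat_def])
 hence "(pp *$Zp x) 1 = 0" for x by (simp add: padic_sel(2))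
 hence "A +$Lam w \<in> char_ideal S" using A wL chiA by (simp add: char_ideal_def)
 moreover have "splitting (A +$Lam w) = (m, w)"
 proof -
  have "fst (splitting (A +$Lam w)) = m"
  proof
   fix i
   show "fst (splitting (A +$Lam w)) i = m i"
   proof (cases "i \<in> S")
    case True
    thus ?thesis
     using divp_eqI[OF mi(1)[OF True] chiA[OF True]] act[OF eigen_K2 True] a(3)[OF True] by (simp add: splitting_def)
   next
    case False
    thus ?thesis using m by (auto simp: splitting_def)
   qed
  qed
  thus ?thesis using Af by (auto simp: splitting_def)
 qed
 ultimately show ?thesis by blast
qed

theorem char_ideal_proj_equiv: "proj_equiv Lam LS MS"
proof -
 have R: "ring Lam" by (rule lam.group_ring_ring)
 have "bij_betw splitting (carrier LS) (carrier (oplus_mod MS PS))"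
  unfolding bij_betw_def
 proof
  show "inj_on splitting (carrier LS)" using splitting_inj by simp
  show "splitting ` carrier LS = carrier (oplus_mod MS PS)"
  proof
   show "splitting ` carrier LS \<subseteq> carrier (oplus_mod MS PS)" using lmod_homD(1)[OF splitting_hom] by blast
   show "carrier (oplus_mod MS PS) \<subseteq> splitting ` carrier LS"
   proof
    fix z assume z: "z \<in>$(oplus_mod MS PS)"
    hence "z \<in> carrier MS \<times> left_multiples Lam fS" unfolding oplus_mod_simps(1) by simp
    hence "fst z \<in>$MS" "snd z \<in> left_multiples Lam fS" by (simp_all only: mem_Times_iff)
    then obtain a where "a \<in> char_ideal S" "splitting a = (fst z, snd z)" using splitting_surj by blast
    thus "z \<in> splitting ` carrier LS" by (auto intro!: image_eqI[of _ _ a])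
   qed
  qed
 qed
 hence iso: "lmod_iso Lam LS (oplus_mod MS PS)" unfolding lmod_iso_def using splitting_hom by blast
 \<comment> \<open>Projective equivalence has a projective summand on each side; on the side of the
   ideal it is the zero module.\<close>
 have F0: "left_module Lam (free_mod Lam 0)" by (rule left_module_free[OF R])
 have "lmod_iso Lam (oplus_mod LS (free_mod Lam 0)) LS"
  by (rule lmod_iso_sym[OF LS_module oplus_trivial[OF LS_module F0 free_mod_0[OF R]]])
 hence "lmod_iso Lam (oplus_mod LS (free_mod Lam 0)) (oplus_mod MS PS)" using iso by (rule lmod_iso_trans)
 thus ?thesis
  by (rule proj_equivI[OF LS_module MS_module PS_projective fg_projective_trivial[OF F0 free_mod_0[OF R]]])
qed

end

end

section \<open>Left ideals generated by 1 - e + e b\<close>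

context ring
begin

context
 fixes e b assumes e: "e \<in>$R" "e \<otimes> e = e" and b: "b \<in>$R" "e \<otimes> b = b \<otimes> e"
begin

text \<open>Right multiplication by this element is the identity on R (1 - e) and multiplication by
  b on R e.\<close>

definition blend where "blend = (\<one> \<ominus> e) \<oplus> e \<otimes> b"

lemma blend_closed: "blend \<in>$R" using e b by (simp add: blend_def)

lemma mult_blend:
 assumes x: "x \<in>$R" shows "x \<otimes> blend = (x \<ominus> x \<otimes> e) \<oplus> x \<otimes> e \<otimes> b"
 unfolding blend_def using x e b by (simp add: minus_eq r_distr r_minus m_assoc)

lemma mult_blend_annihilated:
 assumes x: "x \<in>$R" "x \<otimes> e = \<zero>" shows "x \<otimes> blend = x"
 using mult_blend[OF x(1)] x b by (simp add: minus_eq)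

text \<open>The multiplier is b (1 - e) + e: its first summand is fixed by right multiplication with
  \<open>blend\<close>, and e \<open>blend\<close> = e b = b e.\<close>

lemma blend_generates: "\<exists>x\<in>carrier R. b = x \<otimes> blend"
proof
 have x: "b \<otimes> (\<one> \<ominus> e) \<in>$R" using e b by simp
 have "b \<otimes> (\<one> \<ominus> e) \<otimes> e = \<zero>"
  using e b by (simp add: minus_eq r_distr l_distr r_minus l_minus m_assoc r_neg)
 hence "b \<otimes> (\<one> \<ominus> e) \<otimes> blend = b \<otimes> (\<one> \<ominus> e)" by (rule mult_blend_annihilated[OF x])
 moreover have "e \<otimes> blend = e \<otimes> b" using mult_blend[OF e(1)] e b by (simp add: minus_eq r_neg)
 ultimately have "(b \<otimes> (\<one> \<ominus> e) \<oplus> e) \<otimes> blend = b \<otimes> (\<one> \<ominus> e) \<oplus> b \<otimes> e"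
  using x e b blend_closed by (simp add: l_distr)
 also have "\<dots> = b" using e b by (simp add: minus_eq r_distr r_minus a_assoc l_neg)
 finally show "b = (b \<otimes> (\<one> \<ominus> e) \<oplus> e) \<otimes> blend" ..
 show "b \<otimes> (\<one> \<ominus> e) \<oplus> e \<in>$R" using x e by simp
qed

text \<open>From \<open>blend\<close> e = e b follows (x e) b = 0, hence x e = 0, and then x
  \<open>blend\<close> = x.\<close>

lemma blend_cancel:
 assumes inj: "!!y. y \<in>$R ==> y \<otimes> b = \<zero> ==> y = \<zero>"
  and x: "x \<in>$R" "x \<otimes> blend = \<zero>"
 shows "x = \<zero>"
proof -
 have "blend \<otimes> e = e \<otimes> b"
  unfolding blend_def using e b m_assoc[of b e e] by (simp add: minus_eq l_distr l_minus r_neg m_assoc b(2)[symmetric])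
 hence "x \<otimes> (e \<otimes> b) = x \<otimes> (blend \<otimes> e)" by (simp only:)
 hence "x \<otimes> e \<otimes> b = x \<otimes> blend \<otimes> e" by (simp only: m_assoc[OF x(1) e(1) b(1)] m_assoc[OF x(1) blend_closed e(1)])
 also have "\<dots> = \<zero>" using x e by simp
 finally have "x \<otimes> e = \<zero>" using inj[of "x \<otimes> e"] x e by simp
 thus ?thesis using mult_blend_annihilated[of x] x by simp
qed

end

end

section \<open>The case that p does not divide the order of I\<close>

context decomp_setup
begin

lemma LL_submod: "submod Lam (reg_mod Lam) LL"
 and LL_I: "i \<in> I ==> u i -$Lam 1$Lam \<in> LL" and LL_beta: "beta \<in> LL"
 using LL_rel_ideal by (auto simp: rel_ideal_def)

lemma LL_closed: "x \<in> LL ==> x \<in>$Lam"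
 and LL_add: "x \<in> LL ==> y \<in> LL ==> x +$Lam y \<in> LL"
 and LL_mult: "a \<in>$Lam ==> x \<in> LL ==> a *$Lam x \<in> LL"
 and LL_finsum: "f \<in> A \<rightarrow> LL ==> (\<Oplus>$Lam k\<in>A. f k) \<in> LL"
proof -
 note s = submodD[OF LL_submod]
 interpret L: left_module Lam "reg_mod Lam" by (rule left_module_reg[OF lam.group_ring_ring])
 show c: "x \<in> LL ==> x \<in>$Lam" for x using s(2)[of x] by simp
 show "x \<in> LL ==> y \<in> LL ==> x +$Lam y \<in> LL" using s(4)[of x y] by simp
 show "a \<in>$Lam ==> x \<in> LL ==> a *$Lam x \<in> LL" using s(5)[of a x] by simp
 assume f: "f \<in> A \<rightarrow> LL"
 have "(\<Oplus>$(reg_mod Lam) k\<in>A. f k) = (\<Oplus>$Lam k\<in>A. f k)"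
  by (rule additive_finsum[where h = "%x. x", OF L.M.abelian_group_axioms lam.RG.abelian_group_axioms])
   (use f c in auto)
 thus "(\<Oplus>$Lam k\<in>A. f k) \<in> LL" using L.submod_finsum[OF LL_submod f] by simp
qed

lemma LL_minus: "x \<in> LL ==> y \<in> LL ==> x -$Lam y \<in> LL"
proof -
 assume x: "x \<in> LL" and y: "y \<in> LL"
 have "\<ominus>$Lam y = (\<ominus>$Lam 1$Lam) *$Lam y" using LL_closed[OF y] by (simp add: lam.RG.l_minus)
 hence "\<ominus>$Lam y \<in> LL" using LL_mult[OF _ y, of "\<ominus>$Lam 1$Lam"] by simp
 thus ?thesis using LL_add[OF x] by (simp add: a_minus_def)
qed

abbreviation "LLM \<equiv> (reg_mod Lam)\<lparr>carrier := LL\<rparr>"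

lemma LL_module: "left_module Lam LLM"
 by (rule left_module.left_module_submod[OF left_module_reg[OF lam.group_ring_ring] LL_submod])

lemma Lam_smult_eq:
 assumes "x \<in>$Lam" shows "[(k::nat)] \<cdot>$Lam x = gr_const Zp GG ([k] \<cdot>$Zp 1$Zp) *$Lam x"
proof -
 have "gr_const Zp GG ([k] \<cdot>$Zp 1$Zp) = [k] \<cdot>$Lam 1$Lam"
  using ring_hom_add_pow[OF Zp.ring_axioms lam.group_ring_ring lam.gr_const_hom Zp.one_closed, of k]
   ring_hom_one[OF lam.gr_const_hom] by simp
 thus ?thesis using assms lam.RG.add_pow_ldistr[of "1$Lam" x k] by simp
qed

lemma Lam_torsion_free:
 assumes x: "x \<in>$Lam" and k: "k > 0" and z: "[(k::nat)] \<cdot>$Lam x = 0$Lam"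
 shows "x = 0$Lam"
proof (rule lam.gr_eqI[OF x])
 fix g assume g: "g \<in>$GG"
 have app: "(%a. a g) (0$Lam) = 0$Zp" using g by (simp add: group_ring_sel)
 have "([n] \<cdot>$Lam x) g = [n] \<cdot>$Zp x g" for n :: nat
 proof (induction n)
  case 0 thus ?case using app by simp
 next
  case (Suc n) thus ?case using g x lam.gr_coeff_closed[OF x g] by (simp add: group_ring_sel)
 qed
 hence "[k] \<cdot>$Zp x g = 0$Zp" using z app by metis
 thus "x g = 0$Lam g" using padic_torsion_free[OF lam.gr_coeff_closed[OF x g] k] app by simp
qed simp

lemma psi_carrier: "psi \<in>$G" using psi(1) D_sub by blast

text \<open>The hypothesis says that x u(\<psi>) = (1 + m) x for m = #I. After N = #G iterations
  u(\<psi>) has become 1, so ((1 + m)^N - 1) x = 0 with a positive integer factor, and the group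
  ring is torsion-free.\<close>

lemma beta_cancel:
 assumes x: "x \<in>$Lam" and z: "x *$Lam beta = 0$Lam" shows "x = 0$Lam"
proof -
 define m where "m = card I"
 have m: "m > 0"
  using I_sub subgroup.one_closed[OF normal_imp_subgroup[OF nI]] finite_subset[OF subset_trans[OF I_sub subgroup.subset[OF sgD]] finG]
  by (auto simp: m_def card_gt_0_iff)
 have U: "u psi \<in>$Lam" by (rule u_closed)
 have xU: "x *$Lam u psi \<in>$Lam" using x U by simp
 have "x *$Lam beta = (x -$Lam x *$Lam u psi) +$Lam [m] \<cdot>$Lam x"
  unfolding beta_def m_def[symmetric] using x U lam.RG.add_pow_rdistr[OF x lam.RG.one_closed, of m]
  by (simp add: a_minus_def lam.RG.r_distr lam.RG.r_minus)
 hence e: "(x -$Lam x *$Lam u psi) +$Lam [m] \<cdot>$Lam x = 0$Lam" using z by simp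
 have xu: "x *$Lam u psi = [(1 + m)] \<cdot>$Lam x"
 proof -
  define w where "w = x *$Lam u psi"
  define y where "y = [m] \<cdot>$Lam x"
  have w: "w \<in>$Lam" and y: "y \<in>$Lam" using xU x by (simp_all add: w_def y_def)
  have "w = w +$Lam ((x -$Lam w) +$Lam y)" using e w unfolding w_def[symmetric] y_def[symmetric] by simp
  also have "(x -$Lam w) +$Lam y = \<ominus>$Lam w +$Lam (x +$Lam y)" using w x y by (simp add: a_minus_def lam.RG.a_ac)
  also have "w +$Lam \<dots> = x +$Lam y" using w x y by (simp add: lam.RG.r_neg2)
  finally show ?thesis using x by (simp add: w_def y_def lam.RG.add.nat_pow_mult[symmetric] lam.RG.a_comm)
 qed
 have xun: "x *$Lam u (psi ^$G n) = [((1 + m) ^ n)] \<cdot>$Lam x" for n :: nat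
 proof (induction n)
  case 0 thus ?case using x by (simp add: u_one)
 next
  case (Suc n)
  have "x *$Lam u (psi ^$G Suc n) = [((1 + m) ^ n)] \<cdot>$Lam x *$Lam u psi"
   using x psi_carrier u_closed Suc by (simp add: u_mult lam.RG.m_assoc[symmetric])
  also have "\<dots> = [((1 + m) ^ n)] \<cdot>$Lam ([(1 + m)] \<cdot>$Lam x)"
   using lam.RG.add_pow_ldistr[OF x U] xu by simp
  also have "\<dots> = [((1 + m) ^ Suc n)] \<cdot>$Lam x"
   using lam.RG.add.nat_pow_pow[OF x, of "(1 + m) ^ n" "1 + m"] by (simp only: power_Suc)
  finally show ?case .
 qed
 define N where "N = order G"
 have N: "N > 0" using G.order_gt_0_iff_finite finG by (simp add: N_def)
 have "psi ^$G N = 1$G" unfolding N_def by (rule G.pow_order_eq_1[OF psi_carrier])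
 hence x1: "[((1 + m) ^ N)] \<cdot>$Lam x = x" using xun[of N] x by (simp add: u_one)
 have gt: "(1 + m) ^ N > 1" using N m by (intro one_less_power) auto
 define q where "q = (1 + m) ^ N - 1"
 have q: "q > 0" "(1 + m) ^ N = q + 1" using gt by (simp_all add: q_def)
 have "[q] \<cdot>$Lam x +$Lam x = x" using x1 x unfolding q(2) by simp
 hence "[q] \<cdot>$Lam x = 0$Lam" using x lam.RG.add.l_cancel_one[of x "[q] \<cdot>$Lam x"] by (simp add: lam.RG.a_comm)
 thus ?thesis by (rule Lam_torsion_free[OF x q(1)])
qed

lemma I_carrier: "i \<in> I ==> i \<in>$G" using I_sub D_sub by blast

lemma fin_I: "finite I" using finite_subset[OF _ finG] I_carrier by blast

lemma sg_I: "subgroup I G"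
 using G.incl_subgroup[OF sgD normal_imp_subgroup[OF nI]] .

lemma projective_tame:
 assumes np: "\<not> p dvd card I"
 shows "fg_projective Lam LLM"
proof -
 define m where "m = card I"
 define c where "c = inv\<^bsub>Zp\<^esub> ([m] \<cdot>$Zp 1$Zp)"
 have mU: "[m] \<cdot>$Zp 1$Zp \<in> Units Zp" using of_nat_unit[OF np] by (simp add: m_def)
 have c: "c \<in>$Zp" "c *$Zp ([m] \<cdot>$Zp 1$Zp) = 1$Zp" using mU by (simp_all add: c_def)
 define C where "C = gr_const Zp GG c"
 have C: "C \<in>$Lam" unfolding C_def by (rule lam.gr_const_closed[OF c(1)])
 have Cm: "C *$Lam ([m] \<cdot>$Lam x) = x" if x: "x \<in>$Lam" for x
 proof -
  have "C *$Lam ([m] \<cdot>$Lam x) = (C *$Lam gr_const Zp GG ([m] \<cdot>$Zp 1$Zp)) *$Lam x"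
   unfolding Lam_smult_eq[OF x] using C x lam.gr_const_closed[of "[m] \<cdot>$Zp 1$Zp"] by (simp add: lam.RG.m_assoc)
  also have "C *$Lam gr_const Zp GG ([m] \<cdot>$Zp 1$Zp) = 1$Lam"
   unfolding C_def using ring_hom_mult[OF lam.gr_const_hom c(1), of "[m] \<cdot>$Zp 1$Zp"] ring_hom_one[OF lam.gr_const_hom] c(2) by simp
  finally show ?thesis using x by simp
 qed
 \<comment> \<open>The norm element of I. N / m is the averaging idempotent e; it commutes with
   \<open>beta\<close> because conjugation by an element of D permutes I.\<close>
 define N where "N = (\<Oplus>$Lam i\<in>I. u i)"
 have uc: "u \<in> A \<rightarrow> carrier Lam" for A using u_closed by auto
 have N: "N \<in>$Lam" unfolding N_def by (rule lam.RG.finsum_closed[OF uc])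
 define e where "e = C *$Lam N"
 have e: "e \<in>$Lam" using C N by (simp add: e_def)
 have uN: "u i *$Lam N = N" if i: "i \<in> I" for i
 proof -
  have bij: "bij_betw (%x. i *$G x) I I"
   by (rule bij_betw_byWitness[where f' = "%x. inv\<^bsub>G\<^esub> i *$G x"])
    (use i I_carrier subgroup.m_closed[OF sg_I] subgroup.m_inv_closed[OF sg_I] in "auto simp: G.m_assoc[symmetric]")
  have "u i *$Lam N = (\<Oplus>$Lam x\<in>I. u i *$Lam u x)"
   unfolding N_def by (rule lam.RG.finsum_rdistr[OF fin_I u_closed uc])
  also have "\<dots> = (\<Oplus>$Lam x\<in>I. u (i *$G x))"
   using i I_carrier u_closed by (intro lam.RG.finsum_cong') (auto simp: u_mult)
  also have "\<dots> = N" unfolding N_def by (rule lam.RG.finsum_bij[OF bij u_closed, symmetric])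
  finally show ?thesis .
 qed
 have uD: "u d *$Lam N = N *$Lam u d" if d: "d \<in> D" for d
 proof -
  have dG: "d \<in>$G" by (rule D_sub[OF d])
  have conj: "x \<in> I ==> y \<in> D ==> y *$G x *$G inv\<^bsub>G\<^esub> y \<in> I" for x y
   using normal.inv_op_closed2[OF nI, of y x] G.m_inv_consistent[OF sgD] by simp
  have bij: "bij_betw (%x. d *$G x *$G inv\<^bsub>G\<^esub> d) I I"
  proof (rule bij_betw_byWitness[where f' = "%x. inv\<^bsub>G\<^esub> d *$G x *$G d"])
   show "\<forall>a\<in>I. inv\<^bsub>G\<^esub> d *$G (d *$G a *$G inv\<^bsub>G\<^esub> d) *$G d = a"
    using dG I_carrier by (simp add: G.m_assoc) (simp add: G.m_assoc[symmetric])
   show "\<forall>a\<in>I. d *$G (inv\<^bsub>G\<^esub> d *$G a *$G d) *$G inv\<^bsub>G\<^esub> d = a"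
    using dG I_carrier by (simp add: G.m_assoc) (simp add: G.m_assoc[symmetric])
   show "(%x. d *$G x *$G inv\<^bsub>G\<^esub> d) ` I \<subseteq> I" using conj d by auto
   show "(%x. inv\<^bsub>G\<^esub> d *$G x *$G d) ` I \<subseteq> I"
    using conj[OF _ subgroup.m_inv_closed[OF sgD d]] dG by auto
  qed
  have "N *$Lam u d = (\<Oplus>$Lam x\<in>I. u (d *$G x *$G inv\<^bsub>G\<^esub> d)) *$Lam u d"
   unfolding N_def using lam.RG.finsum_bij[OF bij, of u] u_closed by simp
  also have "\<dots> = (\<Oplus>$Lam x\<in>I. u (d *$G x *$G inv\<^bsub>G\<^esub> d) *$Lam u d)"
   by (rule lam.RG.finsum_ldistr[OF fin_I u_closed]) (use u_closed in auto)
  also have "\<dots> = (\<Oplus>$Lam x\<in>I. u d *$Lam u x)"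
  proof (rule lam.RG.finsum_cong'[OF refl])
   fix x assume "x \<in> I"
   hence x: "x \<in>$G" by (rule I_carrier)
   have "d *$G x *$G inv\<^bsub>G\<^esub> d *$G d = d *$G x" using x dG by (simp add: G.m_assoc)
   thus "u (d *$G x *$G inv\<^bsub>G\<^esub> d) *$Lam u d = u d *$Lam u x"
    using x dG u_mult[of "d *$G x *$G inv\<^bsub>G\<^esub> d" d] u_mult[of d x] by simp
  qed (use u_closed in auto)
  also have "\<dots> = u d *$Lam N"
   unfolding N_def by (rule lam.RG.finsum_rdistr[OF fin_I u_closed uc, symmetric])
  finally show ?thesis ..
 qed
 have Cc: "a *$Lam C = C *$Lam a" if "a \<in>$Lam" for a
  using lam.gr_const_central[OF c(1) that] by (simp add: C_def)
 have ue: "u i *$Lam e = e" if i: "i \<in> I" for i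
  using uN[OF i] Cc[OF u_closed[of i]] C N u_closed[of i] unfolding e_def
  by (simp add: lam.RG.m_assoc[symmetric]) (simp add: lam.RG.m_assoc)
 have NN: "N *$Lam N = [m] \<cdot>$Lam N"
 proof -
  have "N *$Lam N = (\<Oplus>$Lam i\<in>I. u i *$Lam N)"
   using lam.RG.finsum_ldistr[OF fin_I N uc] unfolding N_def[symmetric] .
  also have "\<dots> = (\<Oplus>$Lam i\<in>I. N)" using uN N by (intro lam.RG.finsum_cong') auto
  also have "\<dots> = [m] \<cdot>$Lam N" unfolding m_def by (rule lam.RG.add.finprod_const[OF N, simplified])
  finally show ?thesis .
 qed
 have "e *$Lam e = C *$Lam (C *$Lam (N *$Lam N))"
  using Cc[OF N] C N unfolding e_def by (simp add: lam.RG.m_assoc) (simp add: lam.RG.m_assoc[symmetric])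
 hence ee: "e *$Lam e = e" unfolding NN Cm[OF N] e_def[symmetric] .
 have eu: "e *$Lam u psi = u psi *$Lam e"
  using uD[OF psi(1)] Cc[OF u_closed[of psi]] C N u_closed[of psi] unfolding e_def
  by (simp add: lam.RG.m_assoc[symmetric]) (simp add: lam.RG.m_assoc)
 have eb: "e *$Lam beta = beta *$Lam e"
  unfolding beta_def using eu e u_closed[of psi] lam.RG.add_pow_rdistr[OF e lam.RG.one_closed] lam.RG.add_pow_ldistr[OF lam.RG.one_closed e]
  by (simp add: a_minus_def lam.RG.r_distr lam.RG.l_distr lam.RG.r_minus lam.RG.l_minus)
 note B = e ee beta_closed eb
 define g where "g = lam.RG.blend e beta"
 have g: "g \<in>$Lam" unfolding g_def by (rule lam.RG.blend_closed[OF B])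
 have ge: "g = (1$Lam -$Lam e) +$Lam e *$Lam beta"
  unfolding g_def by (rule lam.RG.blend_def[OF B])
 \<comment> \<open>The upper bound for \<open>LL\<close>. Each u(i) - 1 is killed by right
   multiplication with e, so right multiplication with g leaves it unchanged.\<close>
 have "rel_ideal (left_multiples Lam g)"
  unfolding rel_ideal_def
 proof (intro conjI ballI)
  show "submod Lam (reg_mod Lam) (left_multiples Lam g)" by (rule lam.RG.left_multiples_submod[OF g])
  show "beta \<in> left_multiples Lam g"
   using lam.RG.blend_generates[OF B] by (auto simp: left_multiples_def g_def)
  fix i assume i: "i \<in> I"
  have ui: "u i -$Lam 1$Lam \<in>$Lam" using u_closed by simp
  have "(u i -$Lam 1$Lam) *$Lam e = 0$Lam"
   using ue[OF i] e u_closed[of i] by (simp add: a_minus_def lam.RG.l_distr lam.RG.l_minus lam.RG.r_neg)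
  hence "(u i -$Lam 1$Lam) *$Lam g = u i -$Lam 1$Lam"
   unfolding g_def by (rule lam.RG.mult_blend_annihilated[OF B ui])
  thus "u i -$Lam 1$Lam \<in> left_multiples Lam g"
   unfolding left_multiples_def using ui by (intro CollectI exI[of _ "u i -$Lam 1$Lam"]) simp
 qed
 hence sub: "LL \<subseteq> left_multiples Lam g" by (rule LL_least)
 have "g \<in> LL"
 proof -
  \<comment> \<open>The lower bound: this sum of relations, multiplied by - 1/m, is 1 - e, and e
    \<open>beta\<close> is a multiple of a relation as well.\<close>
  have d: "(\<Oplus>$Lam i\<in>I. u i -$Lam 1$Lam) = N -$Lam [m] \<cdot>$Lam 1$Lam"
  proof -
   have "(\<Oplus>$Lam i\<in>I. u i +$Lam \<ominus>$Lam 1$Lam) = N +$Lam (\<Oplus>$Lam i\<in>I. \<ominus>$Lam 1$Lam)"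
    unfolding N_def by (rule lam.RG.finsum_addf[OF uc]) simp
   also have "(\<Oplus>$Lam i\<in>I. \<ominus>$Lam 1$Lam) = [m] \<cdot>$Lam (\<ominus>$Lam 1$Lam)"
    unfolding m_def using lam.RG.add.finprod_const[of "\<ominus>$Lam 1$Lam" I] by simp
   also have "\<dots> = \<ominus>$Lam ([m] \<cdot>$Lam 1$Lam)"
    using lam.RG.add.nat_pow_inv[OF lam.RG.one_closed, of m] by (simp add: a_inv_def)
   finally show ?thesis by (simp add: a_minus_def)
  qed
  have "(\<Oplus>$Lam i\<in>I. u i -$Lam 1$Lam) \<in> LL" by (rule LL_finsum) (use LL_I in auto)
  hence "(\<ominus>$Lam C) *$Lam (N -$Lam [m] \<cdot>$Lam 1$Lam) \<in> LL" unfolding d using LL_mult C by blast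
  moreover have "(\<ominus>$Lam C) *$Lam (N -$Lam [m] \<cdot>$Lam 1$Lam) = 1$Lam -$Lam e"
   using C N Cm[of "1$Lam"] e
   by (simp add: a_minus_def lam.RG.r_distr lam.RG.r_minus lam.RG.l_minus e_def[symmetric] lam.RG.a_comm)
  ultimately have "1$Lam -$Lam e \<in> LL" by simp
  thus ?thesis unfolding ge by (rule LL_add[OF _ LL_mult[OF e LL_beta]])
 qed
 hence "left_multiples Lam g \<subseteq> LL" using LL_mult by (auto simp: left_multiples_def)
 with sub have eq: "LL = left_multiples Lam g" by blast
 have inj: "x = 0$Lam" if "x \<in>$Lam" "x *$Lam g = 0$Lam" for x
  using lam.RG.blend_cancel[OF B beta_cancel that(1)] that(2) by (simp add: g_def)
 have "lmod_iso Lam (reg_mod Lam) LLM"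
  unfolding lmod_iso_def
 proof (rule bexI[of _ "%x. x *$Lam g"])
  show "(%x. x *$Lam g) \<in> lmod_hom Lam (reg_mod Lam) LLM"
   by (rule lmod_homI) (use g in "auto simp: eq left_multiples_def lam.RG.l_distr lam.RG.m_assoc")
  show "bij_betw (%x. x *$Lam g) (carrier (reg_mod Lam)) (carrier LLM)"
  proof (rule bij_betw_imageI)
   show "(%x. x *$Lam g) ` carrier (reg_mod Lam) = carrier LLM" by (auto simp: eq left_multiples_def)
   show "inj_on (%x. x *$Lam g) (carrier (reg_mod Lam))"
   proof (rule inj_onI)
    fix x y assume x: "x \<in>$(reg_mod Lam)" and y: "y \<in>$(reg_mod Lam)" and xy: "x *$Lam g = y *$Lam g"
    have "(x -$Lam y) *$Lam g = 0$Lam"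
     using x y xy g by (simp add: a_minus_def lam.RG.l_distr lam.RG.l_minus lam.RG.r_neg)
    hence "x -$Lam y = 0$Lam" using inj[of "x -$Lam y"] x y by simp
    thus "x = y" using x y lam.RG.r_right_minus_eq by simp
   qed
  qed
 qed
 thus ?thesis by (rule fg_projective_iso[OF fg_projective_reg[OF lam.group_ring_ring] _ LL_module])
qed

end

lemma (in abelian_group) minus_chain:
 assumes "x \<in>$G" "y \<in>$G" "z \<in>$G"
 shows "(x \<ominus> y) \<oplus> (y \<ominus> z) = x \<ominus> z" and "(x \<ominus> z) \<ominus> (x \<ominus> y) = y \<ominus> z"
proof -
 have *: "(x \<ominus> y) \<oplus> (y \<ominus> z) = x \<ominus> z" if "x \<in>$G" "y \<in>$G" "z \<in>$G" for x y z
  using that by (simp add: minus_eq a_assoc r_neg1 r_neg2)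
 show "(x \<ominus> y) \<oplus> (y \<ominus> z) = x \<ominus> z" by (rule *[OF assms])
 have "(x \<ominus> z) \<ominus> (x \<ominus> y) = (y \<ominus> x) \<oplus> (x \<ominus> z)"
  using assms by (simp add: minus_eq minus_add a_ac)
 thus "(x \<ominus> z) \<ominus> (x \<ominus> y) = y \<ominus> z" using *[of y x z] assms by simp
qed

lemma (in abelian_group) minus_add_cancel:
 assumes "x \<in>$G" "y \<in>$G" "z \<in>$G"
 shows "z \<ominus> ((x \<ominus> y) \<oplus> z) = y \<ominus> x"
proof -
 define w where "w = x \<ominus> y"
 have w: "w \<in>$G" using assms by (simp add: w_def)
 have "z \<ominus> (w \<oplus> z) = \<ominus> w"
  using w assms by (simp add: minus_eq minus_add a_lcomm[of z "\<ominus> w" "\<ominus> z"] r_neg)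
 also have "\<dots> = y \<ominus> x" using assms by (simp add: w_def minus_eq minus_add a_comm)
 finally show ?thesis by (simp add: w_def)
qed

section \<open>The case that p divides the order of I\<close>

context metacyclic_setup
begin

lemma square_Gamma: assumes g: "g \<in>$G" shows "g *$G g \<in> \<Gamma>"
proof (cases "g \<in> \<Gamma>")
 case True
 thus ?thesis by (intro subgroup.m_closed[OF sgGamma])
next
 case False
 hence h: "g *$G j \<in> \<Gamma>" using cover[OF g] by blast
 have "(g *$G j) *$G (g *$G j) = g *$G (g *$G j) *$G j"
  using g jG jc[of "g *$G j"] by (simp add: G.m_assoc)
 also have "\<dots> = g *$G g" using g jG mult_j_j[of "g *$G g"] by (simp add: G.m_assoc)
 finally show ?thesis using subgroup.m_closed[OF sgGamma h h] by simp
qed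

lemma el_pow: "\<exists>k'. el k l ^$G (n::nat) = el k' (n * l)"
proof (induction n)
 case 0 thus ?case using el_simps(5) by (metis G.nat_pow_0 mult_0)
next
 case (Suc n)
 then obtain k' where "el k l ^$G n = el k' (n * l)" by blast
 hence "el k l ^$G Suc n = el (k' + s ^ (n * l) * k) (Suc n * l)" by (simp add: el_mult add.commute)
 thus ?case by blast
qed

text \<open>The square lies in \<Gamma>, which has index two, and the r-th power of \<sigma>^k
  \<tau>^l has \<tau>-exponent r l.\<close>

lemma pow_2r: assumes g: "g \<in>$G" shows "\<exists>k. g ^$G (2 * r) = \<sigma> ^$G (k::nat)"
proof -
 obtain k l where kl: "g *$G g = el k l" using square_Gamma[OF g] Gamma_el by auto
 obtain k' where k': "el k l ^$G r = el k' (r * l)" using el_pow by blast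
 have "g ^$G (2 * r) = (g ^$G (2::nat)) ^$G r" using g by (simp add: G.nat_pow_pow)
 also have "g ^$G (2::nat) = el k l" using g kl by (simp add: numeral_2_eq_2)
 also have "el k l ^$G r = \<sigma> ^$G k'"
  unfolding k' using el_mod[of k' "r * l"] spow_mod[of k'] by (simp add: el_simps)
 finally show ?thesis by blast
qed

lemma order_G: "order G = 2 * (p * r)"
proof -
 have cG: "card \<Gamma> = p * r" using bij_betw_same_card[OF el_bij] by simp
 have "carrier G = \<Gamma> \<union> (%g. g *$G j) ` \<Gamma>"
 proof
  show "carrier G \<subseteq> \<Gamma> \<union> (%g. g *$G j) ` \<Gamma>"
  proof
   fix g assume g: "g \<in>$G"
   show "g \<in> \<Gamma> \<union> (%g. g *$G j) ` \<Gamma>"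
    using cover[OF g] mult_j_j[OF g] by (metis UnI1 UnI2 image_eqI)
  qed
  show "\<Gamma> \<union> (%g. g *$G j) ` \<Gamma> \<subseteq> carrier G" using Gamma_sub jG by auto
 qed
 moreover have "\<Gamma> \<inter> (%g. g *$G j) ` \<Gamma> = {}" using Gamma_j Gamma_sub by blast
 moreover have "card ((%g. g *$G j) ` \<Gamma>) = card \<Gamma>"
  by (rule card_image) (use Gamma_sub jG in "auto simp: inj_on_def")
 moreover have "finite \<Gamma>" using finite_subset[OF _ finG] Gamma_sub by blast
 ultimately show ?thesis using cG by (simp add: order_def card_Un_disjoint)
qed

lemma card_I_dvd: "card I dvd 2 * (p * r)"
 using G.lagrange[OF sg_I] unfolding order_G by (metis dvd_triv_right)

lemma p_not_dvd_2r: "\<not> p dvd 2 * r"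
proof
 assume "p dvd 2 * r"
 hence "p dvd 2" using p_not_dvd_r prime_dvd_mult_iff[OF prime] by blast
 hence "p \<le> 2" by (simp add: dvd_imp_le)
 thus False using odd prime_gt_1_nat[OF prime] by (auto simp: numeral_2_eq_2 le_Suc_eq)
qed

lemma p_dvd_card_I: assumes "\<sigma> \<in> I" shows "p dvd card I"
proof -
 have sub: "subgroup (generate G {\<sigma>}) G" using G.generate_is_subgroup sG by simp
 have "generate G {\<sigma>} \<subseteq> I" using G.generate_subgroup_incl[OF _ sg_I] assms by simp
 hence "subgroup (generate G {\<sigma>}) (G\<lparr>carrier := I\<rparr>)" by (rule G.subgroup_incl[OF sub sg_I])
 from group.lagrange[OF G.subgroup_imp_group[OF sg_I] this]
 have "card (generate G {\<sigma>}) dvd card I" unfolding order_def by (metis dvd_triv_right partial_object.simps(1) partial_object.surjective partial_object.update_convs(1))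
 thus ?thesis using G.generate_pow_card[OF sG] ord_s by simp
qed

text \<open>Sylow's theorem gives an element x of order p in I. Its power x^(2r) is a power of
  \<sigma>, and nontrivial because p does not divide 2 r; so a further power of it is
  \<sigma>.\<close>

lemma sigma_in_I:
 assumes "p dvd card I" shows "\<sigma> \<in> I"
proof -
 let ?I = "G\<lparr>carrier := I\<rparr>"
 have gI: "group ?I" by (rule G.subgroup_imp_group[OF sg_I])
 have "order ?I = p ^ 1 * (card I div p)" using assms by (simp add: order_def)
 then obtain H where H: "subgroup H ?I" "card H = p"
  using sylow_thm[OF prime gI, of 1 "card I div p"] fin_I by auto
 have HI: "H \<subseteq> I" using subgroup.subset[OF H(1)] by simp
 have HG: "subgroup H G" using G.incl_subgroup[OF sg_I H(1)] .
 have "\<exists>x\<in>H. x \<noteq> 1$G"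
 proof (rule ccontr)
  assume "\<not> ?thesis"
  hence "H \<subseteq> {1$G}" by blast
  hence "card H \<le> 1" using card_mono[of "{1$G}" H] by simp
  thus False using H(2) prime_gt_1_nat[OF prime] by simp
 qed
 then obtain x where x: "x \<in> H" "x \<noteq> 1$G" by blast
 have xG: "x \<in>$G" using x HI I_carrier by blast
 have "x ^$(G\<lparr>carrier := H\<rparr>) order (G\<lparr>carrier := H\<rparr>) = 1$(G\<lparr>carrier := H\<rparr>)"
  by (rule group.pow_order_eq_1[OF G.subgroup_imp_group[OF HG]]) (use x in simp)
 hence "x ^$G p = 1$G" using H(2) G.nat_pow_consistent by (simp add: order_def)
 hence "G.ord x dvd p" using G.pow_eq_id[OF xG] by simp
 hence ox: "G.ord x = p" using prime x(2) G.ord_eq_1[OF xG] by (auto simp: prime_nat_iff)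
 obtain k where k: "x ^$G (2 * r) = \<sigma> ^$G (k::nat)" using pow_2r[OF xG] by blast
 have "x ^$G (2 * r) \<noteq> 1$G" using G.pow_eq_id[OF xG] ox p_not_dvd_2r by simp
 hence "\<not> p dvd k" unfolding k spow_eq_iff .
 hence "coprime k p" using prime_imp_coprime[OF prime] by (simp add: coprime_commute)
 then obtain n where n: "[k * n = 1] (mod p)" using cong_solve_coprime_nat[of k p] unfolding One_nat_def by blast
 have powI: "y ^$G (n::nat) \<in> I" if "y \<in> I" for y n
  using that subgroup.one_closed[OF sg_I] subgroup.m_closed[OF sg_I] by (induction n) simp_all
 have "(\<sigma> ^$G k) ^$G n \<in> I" unfolding k[symmetric] using powI x HI by blast
 thus ?thesis using spow_cong[OF n] sG by (simp add: G.nat_pow_pow)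
qed

definition nc :: "nat => 'g => nat => int" where "nc n = cst ([n] \<cdot>$Zp 1$Zp)"

lemma nc_closed: "nc n \<in>$Lam" unfolding nc_def by (rule cst_closed) simp

lemma nc_eq: "nc n = [n] \<cdot>$Lam 1$Lam"
 using Lam_smult_eq[OF lam.RG.one_closed, of n] nc_closed[of n] by (simp add: nc_def)

lemma nc_add: "nc (n + k) = nc n +$Lam nc k"
 unfolding nc_eq using lam.RG.add.nat_pow_mult[OF lam.RG.one_closed, of n k] by simp

lemma nc_mult: "nc (n * k) = nc n *$Lam nc k"
proof -
 have "nc n *$Lam nc k = [n] \<cdot>$Lam nc k"
  unfolding nc_def[of n] using Lam_smult_eq[OF nc_closed[of k], of n] by simp
 also have "\<dots> = nc (n * k)"
  unfolding nc_eq using lam.RG.add.nat_pow_pow[OF lam.RG.one_closed, of n k] by (simp add: mult.commute)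
 finally show ?thesis ..
qed

lemma nc_1: "nc 1 = 1$Lam" by (simp add: nc_eq)

lemma nc_central: "a \<in>$Lam ==> nc n *$Lam a = a *$Lam nc n"
 unfolding nc_def by (rule lam.gr_const_central) simp

lemma nc_prime_part:
 assumes "nc (p * q) \<in> LL" "\<not> p dvd q" shows "nc p \<in> LL"
proof -
 define c where "c = inv\<^bsub>Zp\<^esub> ([q] \<cdot>$Zp 1$Zp)"
 have U: "[q] \<cdot>$Zp 1$Zp \<in> Units Zp" by (rule of_nat_unit[OF assms(2)])
 have c: "c \<in>$Zp" "c *$Zp ([q] \<cdot>$Zp 1$Zp) = 1$Zp" using U by (simp_all add: c_def)
 have cq: "cst c *$Lam nc q = 1$Lam"
  unfolding nc_def using ring_hom_mult[OF lam.gr_const_hom c(1), of "[q] \<cdot>$Zp 1$Zp"] ring_hom_one[OF lam.gr_const_hom] c(2) by simp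
 have "cst c *$Lam nc (q * p) = cst c *$Lam nc q *$Lam nc p"
  unfolding nc_mult using cst_closed[OF c(1)] nc_closed by (simp add: lam.RG.m_assoc)
 hence "cst c *$Lam nc (p * q) = nc p" using cq nc_closed by (simp add: mult.commute)
 thus ?thesis using LL_mult[OF cst_closed[OF c(1)] assms(1)] by simp
qed

lemma u_inv: "g \<in>$G ==> u (inv\<^bsub>G\<^esub> g) *$Lam u g = 1$Lam"
 by (metis G.inv_closed G.l_inv u_mult u_one)

text \<open>The stabiliser of the class of 1 in Z_p[\<Gamma>] / \<open>LL\<close>.\<close>

definition KK :: "'g set" where "KK = {g \<in> carrier G. u g -$Lam 1$Lam \<in> LL}"

lemma KK_subgroup: "subgroup KK G"
proof (rule G.subgroupI)
 show "KK \<subseteq> carrier G" by (auto simp: KK_def)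
 have z: "1$Lam -$Lam 1$Lam = 0$Lam" by (simp add: a_minus_def lam.RG.r_neg)
 have "1$G \<in> KK" using submodD(3)[OF LL_submod] by (simp add: KK_def u_one z)
 thus "KK \<noteq> {}" by blast
next
 fix g assume "g \<in> KK"
 hence g: "g \<in>$G" "u g -$Lam 1$Lam \<in> LL" by (auto simp: KK_def)
 have m: "(\<ominus>$Lam u (inv\<^bsub>G\<^esub> g)) *$Lam (u g -$Lam 1$Lam) = u (inv\<^bsub>G\<^esub> g) -$Lam 1$Lam"
  using u_closed u_inv[OF g(1)]
  by (simp add: a_minus_def lam.RG.r_distr lam.RG.r_minus lam.RG.l_minus u_one lam.RG.a_comm)
 have "(\<ominus>$Lam u (inv\<^bsub>G\<^esub> g)) *$Lam (u g -$Lam 1$Lam) \<in> LL"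
  by (rule LL_mult[OF _ g(2)]) (use u_closed in simp)
 thus "inv\<^bsub>G\<^esub> g \<in> KK" unfolding m using g by (simp add: KK_def)
next
 fix g h assume "g \<in> KK" "h \<in> KK"
 hence g: "g \<in>$G" "u g -$Lam 1$Lam \<in> LL" and h: "h \<in>$G" "u h -$Lam 1$Lam \<in> LL" by (auto simp: KK_def)
 have "u g *$Lam (u h -$Lam 1$Lam) +$Lam (u g -$Lam 1$Lam) \<in> LL"
  by (rule LL_add[OF LL_mult[OF u_closed h(2)] g(2)])
 also have "u g *$Lam (u h -$Lam 1$Lam) = u (g *$G h) -$Lam u g"
  using u_closed g h by (simp add: u_mult a_minus_def lam.RG.r_distr lam.RG.r_minus)
 also have "(u (g *$G h) -$Lam u g) +$Lam (u g -$Lam 1$Lam) = u (g *$G h) -$Lam 1$Lam"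
  by (rule lam.RG.minus_chain(1)[OF u_closed u_closed lam.RG.one_closed])
 finally show "g *$G h \<in> KK" using g h by (simp add: KK_def)
qed

lemma beta_nc: "beta = (1$Lam -$Lam u psi) +$Lam nc (card I)"
 by (simp add: beta_def nc_eq)

text \<open>By \<open>beta\<close>, u(\<psi>) is congruent to the integer 1 + #I. As
  \<open>LL\<close> is a left ideal, this relation may be multiplied by u(\<psi>^n) from the left;
  the integer is central and is moved in front, where the induction hypothesis applies.\<close>

lemma psi_pow_LL: "u (psi ^$G n) -$Lam nc ((1 + card I) ^ n) \<in> LL" for n :: nat
proof (induction n)
 case 0
 have z: "1$Lam -$Lam 1$Lam = 0$Lam" by (simp add: a_minus_def lam.RG.r_neg)
 show ?case using submodD(3)[OF LL_submod] nc_1 by (simp add: u_one z)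
next
 case (Suc n)
 define m where "m = card I"
 define a where "a = u (psi ^$G n)"
 define A where "A = nc ((1 + m) ^ n)"
 define B where "B = nc (1 + m)"
 define b where "b = u psi"
 have cl: "a \<in>$Lam" "b \<in>$Lam" "A \<in>$Lam" "B \<in>$Lam"
  using u_closed nc_closed by (simp_all add: a_def b_def A_def B_def)
 have IH: "a -$Lam A \<in> LL" using Suc by (simp add: a_def A_def m_def)
 have "(\<ominus>$Lam a) *$Lam beta \<in> LL" by (rule LL_mult[OF _ LL_beta]) (use cl in simp)
 also have "(\<ominus>$Lam a) *$Lam beta = a *$Lam b -$Lam a *$Lam B"
 proof -
  have "B = 1$Lam +$Lam nc m" unfolding B_def nc_add nc_1 ..
  moreover have "nc m \<in>$Lam" by (rule nc_closed)
  ultimately show ?thesis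
   unfolding beta_nc m_def[symmetric] b_def[symmetric] using cl
   by (simp add: a_minus_def lam.RG.r_distr lam.RG.r_minus lam.RG.l_minus lam.RG.minus_add lam.RG.a_ac)
 qed
 finally have 1: "a *$Lam b -$Lam a *$Lam B \<in> LL" .
 have "B *$Lam (a -$Lam A) \<in> LL" by (rule LL_mult[OF cl(4) IH])
 also have "B *$Lam (a -$Lam A) = a *$Lam B -$Lam B *$Lam A"
  using cl nc_central[OF cl(1), of "1 + m"] unfolding B_def[symmetric] by (simp add: a_minus_def lam.RG.r_distr lam.RG.r_minus)
 finally have 2: "a *$Lam B -$Lam B *$Lam A \<in> LL" .
 have "a *$Lam b -$Lam B *$Lam A \<in> LL"
  using LL_add[OF 1 2] lam.RG.minus_chain(1)[of "a *$Lam b" "a *$Lam B" "B *$Lam A"] cl by simp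
 moreover have "u (psi ^$G Suc n) = a *$Lam b" using psi_carrier by (simp add: a_def b_def u_mult)
 moreover have "nc ((1 + m) ^ Suc n) = B *$Lam A" unfolding A_def B_def nc_mult[symmetric] by simp
 ultimately show ?case by (simp add: m_def)
qed

lemma psi_closed: "psi \<in> D" by (rule psi(1))

context
 assumes genQ: "carrier Q = generate Q {\<phi>}" and sI: "\<sigma> \<in> I"
begin

text \<open>For m = #I the element (1 + m)^(2r) - 1 = m S lies in \<open>LL\<close>, with a
  geometric sum S congruent to 2 r modulo p. Since m divides 2 p r it contains p exactly once, so m
  S is p times a unit of Z_p.\<close>

lemma p_LL: "nc p \<in> LL"
proof -
 define m where "m = card I"
 obtain m' where m': "m = p * m'" using p_dvd_card_I[OF sI] by (auto simp: m_def)
 have nm: "\<not> p dvd m'"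
 proof
  assume "p dvd m'"
  hence "p * p dvd m" unfolding m' by simp
  also have "m dvd p * (2 * r)" using card_I_dvd by (simp add: m_def mult_ac)
  finally have "p dvd 2 * r" using p0 by simp
  thus False using p_not_dvd_2r by blast
 qed
 define S where "S n = (\<Sum>k<n. (1 + m) ^ k)" for n
 have pw: "(1 + m) ^ n = 1 + m * S n" for n by (induction n) (simp_all add: S_def algebra_simps)
 have "[S n = n] (mod p)" for n
 proof (induction n)
  case (Suc n)
  have "[(1 + m) ^ n = 1] (mod p)" by (subst pw) (simp only: m' cong_def mult.assoc mod_mult_self2)
  from cong_add[OF Suc this] show ?case by (simp add: S_def)
 qed (simp add: S_def)
 hence "\<not> p dvd S (2 * r)" using p_not_dvd_2r cong_dvd_iff by blast
 hence nq: "\<not> p dvd m' * S (2 * r)" using nm prime_dvd_mult_iff[OF prime] by blast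
 obtain k where k: "psi ^$G (2 * r) = \<sigma> ^$G (k::nat)" using pow_2r[OF psi_carrier] by blast
 have "\<sigma> ^$G k \<in> I"
  using sI subgroup.one_closed[OF sg_I] subgroup.m_closed[OF sg_I] by (induction k) simp_all
 hence 1: "u (psi ^$G (2 * r)) -$Lam 1$Lam \<in> LL" unfolding k by (rule LL_I)
 have "nc ((1 + m) ^ (2 * r)) -$Lam 1$Lam \<in> LL"
  using LL_minus[OF 1 psi_pow_LL[of "2 * r"]] lam.RG.minus_chain(2)[OF u_closed nc_closed lam.RG.one_closed] by (simp add: m_def)
 also have "nc ((1 + m) ^ (2 * r)) = 1$Lam +$Lam nc (p * (m' * S (2 * r)))"
  by (subst pw) (simp only: nc_add nc_1 m' mult.assoc)
 also have "(1$Lam +$Lam nc (p * (m' * S (2 * r)))) -$Lam 1$Lam = nc (p * (m' * S (2 * r)))"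
  using nc_closed[of "p * (m' * S (2 * r))"]
  by (simp add: a_minus_def lam.RG.a_comm[of "1$Lam"] lam.RG.a_assoc lam.RG.r_neg)
 finally show ?thesis using nq by (rule nc_prime_part)
qed

text \<open>As #I and \<open>beta\<close> are in \<open>LL\<close>, \<psi> fixes the class of 1, and
  so does I. Because \<phi> generates D/I, the lift \<psi> and I generate D.\<close>

lemma D_KK: "D \<subseteq> KK"
proof
 obtain m' where m': "card I = p * m'" using p_dvd_card_I[OF sI] by auto
 have "nc (card I) \<in> LL" unfolding m' mult.commute[of p] nc_mult by (rule LL_mult[OF nc_closed p_LL])
 hence "nc (card I) -$Lam beta \<in> LL" using LL_beta by (rule LL_minus)
 also have "nc (card I) -$Lam beta = u psi -$Lam 1$Lam"
  unfolding beta_nc by (rule lam.RG.minus_add_cancel[OF lam.RG.one_closed u_closed nc_closed])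
 finally have psiK: "psi \<in> KK" using psi_carrier by (simp add: KK_def)
 interpret HD: group HD by (rule group_HD)
 interpret Q: group Q by (rule group_Q)
 let ?c = "%d. I #>$G d"
 interpret c: group_hom HD Q ?c by (rule group_hom.intro[OF group_HD group_Q]) (unfold_locales, rule coset_hom)
 have "\<exists>d\<in>D. d \<in> KK \<and> ?c d = C" if "C \<in> generate Q {\<phi>}" for C
  using that
 proof (induction C)
  case one
  show ?case using c.hom_one subgroup.one_closed[OF sgD] subgroup.one_closed[OF KK_subgroup] by auto
 next
  case (incl h)
  have "?c (inv\<^bsub>G\<^esub> psi) = inv\<^bsub>Q\<^esub> (inv\<^bsub>Q\<^esub> \<phi>)"
   using c.hom_inv[of psi] psi G.m_inv_consistent[OF sgD psi(1)] by simp
  hence "?c (inv\<^bsub>G\<^esub> psi) = h" using incl phi by simp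
  thus ?case using subgroup.m_inv_closed[OF sgD psi(1)] subgroup.m_inv_closed[OF KK_subgroup psiK] by blast
 next
  case (inv h)
  thus ?case using psi psiK by blast
 next
  case (eng C C')
  then obtain d d' where d: "d \<in> D" "d \<in> KK" "?c d = C" "d' \<in> D" "d' \<in> KK" "?c d' = C'" by blast
  have "?c (d *$G d') = C *$Q C'" using c.hom_mult[of d d'] d by simp
  thus ?case using d subgroup.m_closed[OF sgD] subgroup.m_closed[OF KK_subgroup] by blast
 qed
 note rep = this
 interpret rel: rel_setup p G \<Gamma> j D I \<phi> LL by unfold_locales (rule LL_rel_ideal)
 fix d assume d: "d \<in> D"
 have "?c d \<in> generate Q {\<phi>}" using d carrier_Q genQ by auto
 then obtain d' where d': "d' \<in> D" "d' \<in> KK" "?c d' = ?c d" using rep by blast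
 have "u d -$Lam u d' \<in> LL" by (rule rel.u_coset[OF d d'(1) d'(3)[symmetric]])
 moreover have "u d' -$Lam 1$Lam \<in> LL" using d'(2) by (simp add: KK_def)
 ultimately have "u d -$Lam 1$Lam \<in> LL"
  using LL_add lam.RG.minus_chain(1)[OF u_closed u_closed lam.RG.one_closed] by metis
 thus "d \<in> KK" using D_sub[OF d] by (simp add: KK_def)
qed

lemma projective_ramified_j:
 assumes jD: "j \<in> D" shows "fg_projective Lam LLM"
proof -
 have "u j = \<ominus>$Lam 1$Lam" using jn jj lam.gr_of_one by (simp add: u_def)
 moreover have "u j -$Lam 1$Lam \<in> LL" using D_KK jD by (auto simp: KK_def)
 ultimately have "\<ominus>$Lam 1$Lam -$Lam 1$Lam \<in> LL" by simp
 hence "(\<ominus>$Lam 1$Lam) *$Lam (\<ominus>$Lam 1$Lam -$Lam 1$Lam) \<in> LL" by (intro LL_mult) simp_all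
 also have "(\<ominus>$Lam 1$Lam) *$Lam (\<ominus>$Lam 1$Lam -$Lam 1$Lam) = nc 2"
  unfolding one_add_one[symmetric] nc_add nc_1 by (simp add: a_minus_def lam.RG.r_distr lam.RG.l_minus)
 finally have n2: "nc 2 \<in> LL" .
 define c where "c = inv\<^bsub>Zp\<^esub> ([(2::nat)] \<cdot>$Zp 1$Zp)"
 have "\<not> p dvd 2" using p_not_dvd_2r by auto
 hence U: "[(2::nat)] \<cdot>$Zp 1$Zp \<in> Units Zp" by (rule of_nat_unit)
 have c: "c \<in>$Zp" "c *$Zp ([(2::nat)] \<cdot>$Zp 1$Zp) = 1$Zp" using U by (simp_all add: c_def)
 have "cst c *$Lam nc 2 = 1$Lam"
  unfolding nc_def using ring_hom_mult[OF lam.gr_const_hom c(1), of "[(2::nat)] \<cdot>$Zp 1$Zp"] ring_hom_one[OF lam.gr_const_hom] c(2) by simp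
 hence one: "1$Lam \<in> LL" using LL_mult[OF cst_closed[OF c(1)] n2] by simp
 have "a \<in> LL" if "a \<in>$Lam" for a using LL_mult[OF that one] that by simp
 hence "LL = carrier Lam" using LL_closed by blast
 hence "LLM = reg_mod Lam" by (simp add: reg_mod_def mk_mod_def)
 thus ?thesis using fg_projective_reg[OF lam.group_ring_ring] by simp
qed

lemma sigma_pow_LL: "gel k 0 -$Lam 1$Lam \<in> LL"
proof -
 have "\<sigma> ^$G k \<in> I"
  using sI subgroup.one_closed[OF sg_I] subgroup.m_closed[OF sg_I] by (induction k) simp_all
 hence "u (el k 0) -$Lam 1$Lam \<in> LL" using LL_I by (simp add: el_simps)
 thus ?thesis using el_Gamma[of k 0] by (simp add: u_def)
qed

text \<open>In a left ideal \<sigma>^k - 1 cannot be multiplied by e_i from the right. But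
  \<sigma>^k \<tau>^l = \<tau>^l \<sigma>^k' for a suitable k', which brings a factor \<sigma>^k' -
  1 to the right end of each term.\<close>

lemma sigma_idem_LL: "(gel k 0 -$Lam 1$Lam) *$Lam idem i \<in> LL"
proof -
 have "(gel k 0 -$Lam 1$Lam) *$Lam tm i l \<in> LL" for l
 proof -
  define c where "c = cst (rinv *$Zp rhoi ^$Zp (i * l))"
  have cz: "rinv *$Zp rhoi ^$Zp (i * l) \<in>$Zp" using rinv_closed rhoi_closed by simp
  have c: "c \<in>$Lam" unfolding c_def by (rule cst_closed[OF cz])
  have tm: "tm i l = c *$Lam gel 0 l"
   unfolding tm_def c_def by (rule lam.gr_mono_const[OF cz]) (simp add: el_Gamma)
  \<comment> \<open>Modulo p the factor s^((r-1) l) is the inverse of s^l.\<close>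
  define k' where "k' = s ^ ((r - 1) * l) * k"
  have "[s ^ l * k' = k] (mod p)"
  proof -
   have "l + (r - 1) * l = r * l" using r_pos by (cases r) simp_all
   hence "s ^ l * k' = (s ^ r) ^ l * k"
    by (simp add: k'_def mult.assoc[symmetric] power_add[symmetric] power_mult[symmetric])
   moreover have "[(s ^ r) ^ l * k = 1 ^ l * k] (mod p)" by (intro cong_mult cong_pow s_pow_r cong_refl)
   ultimately show ?thesis by simp
  qed
  hence "el (s ^ l * k') l = el k l" using spow_cong by (simp add: el_def)
  hence gg: "gel k 0 *$Lam gel 0 l = gel 0 l *$Lam gel k' 0" unfolding gel_mult by simp
  have cg: "gel k 0 *$Lam c = c *$Lam gel k 0"
   unfolding c_def by (rule lam.gr_const_central[OF cz gel_closed, symmetric])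
  have "gel k 0 *$Lam (c *$Lam gel 0 l) = c *$Lam (gel 0 l *$Lam gel k' 0)"
   unfolding gg[symmetric] using cg c gel_closed lam.RG.m_assoc by metis
  hence "(gel k 0 -$Lam 1$Lam) *$Lam tm i l = (c *$Lam gel 0 l) *$Lam (gel k' 0 -$Lam 1$Lam)"
   unfolding tm using c gel_closed[of k 0] gel_closed[of 0 l] gel_closed[of k' 0]
   by (simp add: a_minus_def lam.RG.l_distr lam.RG.r_distr lam.RG.l_minus lam.RG.r_minus lam.RG.m_assoc)
  thus ?thesis using LL_mult[OF _ sigma_pow_LL[of k'], of "c *$Lam gel 0 l"] c gel_closed by simp
 qed
 hence "(\<Oplus>$Lam l\<in>{..<r}. (gel k 0 -$Lam 1$Lam) *$Lam tm i l) \<in> LL" by (intro LL_finsum) auto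
 also have "(\<Oplus>$Lam l\<in>{..<r}. (gel k 0 -$Lam 1$Lam) *$Lam tm i l) = (gel k 0 -$Lam 1$Lam) *$Lam idem i"
  unfolding idem_def by (rule lam.RG.finsum_rdistr[symmetric]) (use tm_closed gel_closed in auto)
 finally show ?thesis .
qed

text \<open>With b_k = \<open>bcoef i a k\<close>, a e_i is the sum of the b_k (\<sigma>^k - 1) e_i
  plus \<chi>_i(a) e_i, since the b_k add up to \<chi>_i(a). The former are in \<open>LL\<close> by
  \<open>sigma_idem_LL\<close>, the latter is a multiple of p.\<close>

lemma component_LL:
 assumes a: "a \<in>$Lam" and z: "chi i a 1 = 0" shows "a *$Lam idem i \<in> LL"
proof -
 have b: "bcoef i a k \<in>$Zp" for k by (rule bcoef_closed[OF a])
 let ?B = "%k. cst (bcoef i a k)"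
 have B: "?B k \<in>$Lam" for k by (rule cst_closed[OF b])
 have idc: "idem i \<in>$Lam" by (rule idem_closed)
 interpret L: left_module Lam "reg_mod Lam" by (rule left_module_reg[OF lam.group_ring_ring])
 have "a *$Lam idem i = (\<Oplus>$(reg_mod Lam) k\<in>{..<p}. gr_mono Zp GG (bcoef i a k) (el k 0) *$Lam idem i)"
  using eigen_expand[OF eigen_idem a, of i] by simp
 also have "\<dots> = (\<Oplus>$Lam k\<in>{..<p}. gr_mono Zp GG (bcoef i a k) (el k 0) *$Lam idem i)"
  by (rule additive_finsum[where h = "%x. x", OF L.M.abelian_group_axioms lam.RG.abelian_group_axioms])
   (use b lam.gr_mono_closed idem_closed in auto)
 also have "\<dots> = (\<Oplus>$Lam k\<in>{..<p}. ?B k *$Lam ((gel k 0 -$Lam 1$Lam) *$Lam idem i) +$Lam ?B k *$Lam idem i)"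
 proof (rule lam.RG.finsum_cong'[OF refl])
  fix k
  have g: "gel k 0 \<in>$Lam" by (rule gel_closed)
  have "gr_mono Zp GG (bcoef i a k) (el k 0) = ?B k *$Lam gel k 0"
   by (rule lam.gr_mono_const[OF b]) (simp add: el_Gamma)
  thus "gr_mono Zp GG (bcoef i a k) (el k 0) *$Lam idem i =
    ?B k *$Lam ((gel k 0 -$Lam 1$Lam) *$Lam idem i) +$Lam ?B k *$Lam idem i"
   using B[of k] g idc
   by (simp add: a_minus_def lam.RG.l_distr lam.RG.r_distr lam.RG.l_minus lam.RG.r_minus lam.RG.m_assoc lam.RG.a_assoc lam.RG.l_neg)
 qed (use B idc gel_closed in auto)
 also have "\<dots> = (\<Oplus>$Lam k\<in>{..<p}. ?B k *$Lam ((gel k 0 -$Lam 1$Lam) *$Lam idem i)) +$Lam (\<Oplus>$Lam k\<in>{..<p}. ?B k *$Lam idem i)"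
  by (rule lam.RG.finsum_addf) (use B idc gel_closed in auto)
 also have "(\<Oplus>$Lam k\<in>{..<p}. ?B k *$Lam idem i) = cst (chi i a) *$Lam idem i"
 proof -
  have "cst (chi i a) = (\<Oplus>$Lam k\<in>{..<p}. ?B k)"
   unfolding chi_bcoef[OF a]
   by (rule additive_finsum[OF Zp.abelian_group_axioms lam.RG.abelian_group_axioms])
    (use b cst_closed ring_hom_add[OF lam.gr_const_hom] in auto)
  thus ?thesis using lam.RG.finsum_ldistr[OF _ idc, of "{..<p}" ?B] B by simp
 qed
 finally have e: "a *$Lam idem i = (\<Oplus>$Lam k\<in>{..<p}. ?B k *$Lam ((gel k 0 -$Lam 1$Lam) *$Lam idem i)) +$Lam cst (chi i a) *$Lam idem i" .
 have "(\<Oplus>$Lam k\<in>{..<p}. ?B k *$Lam ((gel k 0 -$Lam 1$Lam) *$Lam idem i)) \<in> LL"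
  by (rule LL_finsum) (use LL_mult[OF B sigma_idem_LL] in auto)
 moreover have "cst (chi i a) *$Lam idem i \<in> LL"
 proof -
  note d = divp[OF chi_closed[OF a] z]
  have q: "cst (divp (chi i a)) \<in>$Lam" by (rule cst_closed[OF d(1)])
  have "cst (chi i a) = nc p *$Lam cst (divp (chi i a))"
   unfolding nc_def using ring_hom_mult[OF lam.gr_const_hom _ d(1), of pp] d(2) by simp
  hence "cst (chi i a) *$Lam idem i = nc p *$Lam (cst (divp (chi i a)) *$Lam idem i)"
   using q idc nc_closed by (simp add: lam.RG.m_assoc)
  also have "\<dots> = (cst (divp (chi i a)) *$Lam idem i) *$Lam nc p"
   by (rule nc_central) (use q idc in simp)
  finally show ?thesis using LL_mult[OF _ p_LL, of "cst (divp (chi i a)) *$Lam idem i"] q idc by simp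
 qed
 ultimately show ?thesis unfolding e by (rule LL_add)
qed

lemma idem_gel_pow: "idem i *$Lam gel 0 f = cst (\<rho> ^$Zp (i * f)) *$Lam idem i"
proof -
 have "idem i *$Lam gel 0 f = gel 0 f *$Lam idem i"
 proof (induction f)
  case 0 thus ?case using lam.gr_of_one idem_closed by (simp add: el_simps)
 next
  case (Suc f)
  have g: "gel 0 (Suc f) = gel 0 f *$Lam gel 0 1" by (simp add: gel_mult)
  show ?case unfolding g
   using lam.RG.m_assoc[OF idem_closed gel_closed gel_closed, of i 0 f 0 1] Suc
    lam.RG.m_assoc[OF gel_closed idem_closed gel_closed, of 0 f i 0 1] idem_gel[of i]
    lam.RG.m_assoc[OF gel_closed gel_closed idem_closed, of 0 f 0 1 i] by simp
 qed
 thus ?thesis using eigen_pow[OF eigen_idem, of f i] by simp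
qed

text \<open>In the applications the sign \<epsilon> tells whether \<delta> lies in \<Gamma> or in
  \<Gamma> j, and \<epsilon> \<rho>^(if) is the value of \<chi>_i at u(\<delta>). Where this value
  is 1, \<chi>_i kills all relations modulo p. Where it is not, the value minus 1 is a unit, and
  u(\<delta>) - 1 brings e_i itself into \<open>LL\<close>.\<close>

lemma LL_char_ideal:
 assumes eps: "\<epsilon> = 1$Zp \<or> \<epsilon> = \<ominus>$Zp 1$Zp"
  and d: "\<delta> \<in>$G" "u \<delta> = cst \<epsilon> *$Lam gel 0 f" and D: "D = generate G {\<sigma>, \<delta>}"
 shows "LL = char_ideal {i \<in> {1..r}. \<epsilon> *$Zp \<rho> ^$Zp (i * f) = 1$Zp}"
proof
 let ?S = "{i \<in> {1..r}. \<epsilon> *$Zp \<rho> ^$Zp (i * f) = 1$Zp}"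
 have e: "\<epsilon> \<in>$Zp" "\<epsilon> *$Zp \<epsilon> = 1$Zp" using eps by (auto simp: Zp.l_minus)
 have dD: "\<delta> \<in> D" "\<sigma> \<in> D" unfolding D by (auto intro: generate.incl)
 have "chi i (u g) = 1$Zp" if i: "i \<in> ?S" and g: "g \<in> D" for i g
 proof -
  let ?H = "{g \<in> carrier G. chi i (u g) = 1$Zp}"
  have "subgroup ?H G"
  proof (rule G.subgroupI)
   show "?H \<noteq> {}" using u_one chi_simps(3) G.one_closed by force
   show "inv\<^bsub>G\<^esub> a \<in> ?H" if "a \<in> ?H" for a
   proof -
    have "chi i (u (inv\<^bsub>G\<^esub> a)) *$Zp chi i (u a) = 1$Zp"
     using that chi_simps(2)[OF u_closed u_closed, of i "inv\<^bsub>G\<^esub> a" a] u_inv by (simp add: chi_simps(3))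
    thus ?thesis using that chi_closed[OF u_closed] by simp
   qed
   show "a *$G b \<in> ?H" if "a \<in> ?H" "b \<in> ?H" for a b
    using that u_mult[of a b] chi_simps(2)[OF u_closed u_closed, of i a b] by simp
  qed auto
  moreover have "\<sigma> \<in> ?H"
  proof -
   have "u \<sigma> = gel 1 0" using el_Gamma[of 1 0] unfolding el_simps(3) by (simp add: u_def)
   thus ?thesis using sG chi_gel[of i 1 0] by simp
  qed
  moreover have "\<delta> \<in> ?H"
   using d i e chi_simps(2)[OF cst_closed[OF e(1)] gel_closed, of i 0 f] by (simp add: chi_cst chi_gel)
  ultimately have "D \<subseteq> ?H" unfolding D by (intro G.generate_subgroup_incl) auto
  thus ?thesis using g by blast
 qed
 note chiD = this
 have "rel_ideal (char_ideal ?S)"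
  unfolding rel_ideal_def
 proof (intro conjI ballI)
  show "submod Lam (reg_mod Lam) (char_ideal ?S)" by (rule char_ideal_submod)
  have z: "1$Zp -$Zp 1$Zp = 0$Zp" by (simp add: a_minus_def Zp.r_neg)
  show "u g -$Lam 1$Lam \<in> char_ideal ?S" if g: "g \<in> I" for g
   using chi_simps(5)[OF u_closed lam.RG.one_closed, of _ g] chiD[OF _ subsetD[OF I_sub g]] u_closed z
   by (simp add: char_ideal_def chi_simps(3) padic_sel(4))
  have "chi i beta 1 = 0" if i: "i \<in> ?S" for i
  proof -
   have "chi i (1$Lam -$Lam u psi) = 0$Zp"
    using chi_simps(5)[OF lam.RG.one_closed u_closed] chiD[OF i psi(1)] z by (simp add: chi_simps(3))
   moreover have "chi i (nc (card I)) = [card I] \<cdot>$Zp 1$Zp" unfolding nc_def by (rule chi_cst) simp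
   ultimately have "chi i beta = [card I] \<cdot>$Zp 1$Zp"
    unfolding beta_nc using chi_simps(1)[OF _ nc_closed, of "1$Lam -$Lam u psi" i] u_closed by simp
   thus ?thesis using residue_simps(6)[of "card I"] p_dvd_card_I[OF sI] by (auto elim!: dvdE)
  qed
  thus "beta \<in> char_ideal ?S" using beta_closed by (simp add: char_ideal_def)
 qed
 thus "LL \<subseteq> char_ideal ?S" by (rule LL_least)
 show "char_ideal ?S \<subseteq> LL"
 proof
  fix a assume "a \<in> char_ideal ?S"
  hence a: "a \<in>$Lam" "!!i. i \<in> ?S ==> chi i a 1 = 0" by (auto simp: char_ideal_def)
  have "a *$Lam idem i \<in> LL" if i: "i \<in> {1..r}" for i
  proof (cases "i \<in> ?S")
   case True
   thus ?thesis using component_LL a by blast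
  next
   case False
   define y where "y = \<epsilon> *$Zp \<rho> ^$Zp (i * f)"
   have y: "y \<in>$Zp" using e rho_closed by (simp add: y_def)
   \<comment> \<open>y is a root of unity; the exponent r takes care of \<rho>, the factor 2 of the
     sign.\<close>
   have "y ^$Zp (2 * r) = (\<epsilon> *$Zp \<epsilon>) ^$Zp r *$Zp \<rho> ^$Zp (i * f * (2 * r))"
    unfolding y_def using e(1) rho_closed
    by (simp add: Zp.nat_pow_distrib Zp.nat_pow_pow Zp.nat_pow_mult mult_2)
   moreover have "\<rho> ^$Zp (i * f * (2 * r)) = 1$Zp" unfolding rho_pow_eq_one by simp
   ultimately have yp: "y ^$Zp (2 * r) = 1$Zp" using e(2) by simp
   have "y \<noteq> 1$Zp" using False i by (simp add: y_def)
   hence U: "y -$Zp 1$Zp \<in> Units Zp" using root_of_unity_minus_one[OF y _ yp] r_pos by simp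
   define c where "c = inv\<^bsub>Zp\<^esub> (y -$Zp 1$Zp)"
   have c: "c \<in>$Zp" "c *$Zp (y -$Zp 1$Zp) = 1$Zp" using U by (simp_all add: c_def)
   have dK: "u \<delta> -$Lam 1$Lam \<in> LL" using D_KK dD by (auto simp: KK_def)
   have idc: "idem i \<in>$Lam" by (rule idem_closed)
   have ec: "cst \<epsilon> \<in>$Lam" and yc: "cst y \<in>$Lam" and cc: "cst c \<in>$Lam"
    using cst_closed e y c by auto
   have "idem i *$Lam u \<delta> = cst \<epsilon> *$Lam (idem i *$Lam gel 0 f)"
    unfolding d(2) using lam.RG.m_assoc[OF idc ec gel_closed, of 0 f] lam.RG.m_assoc[OF ec idc gel_closed, of 0 f]
     lam.gr_const_central[OF e(1) idc] by simp
   also have "\<dots> = cst y *$Lam idem i"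
    unfolding idem_gel_pow y_def using ring_hom_mult[OF lam.gr_const_hom e(1), of "\<rho> ^$Zp (i * f)"] rho_closed ec idc
     cst_closed[of "\<rho> ^$Zp (i * f)"] by (simp add: lam.RG.m_assoc)
   finally have iu: "idem i *$Lam u \<delta> = cst y *$Lam idem i" .
   have "idem i *$Lam (u \<delta> -$Lam 1$Lam) = (cst y -$Lam 1$Lam) *$Lam idem i"
    using iu idc u_closed yc by (simp add: a_minus_def lam.RG.r_distr lam.RG.l_distr lam.RG.r_minus lam.RG.l_minus)
   also have "cst y -$Lam 1$Lam = cst (y -$Zp 1$Zp)"
    using ring_hom_minus[OF Zp.ring_axioms lam.group_ring_ring lam.gr_const_hom y Zp.one_closed] ring_hom_one[OF lam.gr_const_hom] by simp
   finally have "cst c *$Lam (idem i *$Lam (u \<delta> -$Lam 1$Lam)) = (cst c *$Lam cst (y -$Zp 1$Zp)) *$Lam idem i"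
    using cc idc cst_closed[of "y -$Zp 1$Zp"] y by (simp add: lam.RG.m_assoc)
   also have "cst c *$Lam cst (y -$Zp 1$Zp) = 1$Lam"
    using ring_hom_mult[OF lam.gr_const_hom c(1), of "y -$Zp 1$Zp"] y c(2) ring_hom_one[OF lam.gr_const_hom] by simp
   finally have "idem i = cst c *$Lam (idem i *$Lam (u \<delta> -$Lam 1$Lam))" using idc by simp
   hence "idem i \<in> LL" using LL_mult[OF cc LL_mult[OF idc dK]] by simp
   thus ?thesis by (rule LL_mult[OF a(1)])
  qed
  hence "(\<Oplus>$Lam i\<in>{1..r}. a *$Lam idem i) \<in> LL" by (intro LL_finsum) auto
  also have "(\<Oplus>$Lam i\<in>{1..r}. a *$Lam idem i) = a *$Lam (\<Oplus>$Lam i\<in>{1..r}. idem i)"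
   by (rule lam.RG.finsum_rdistr[symmetric]) (use a idem_closed in auto)
  finally show "a \<in> LL" unfolding idem_sum using a by simp
 qed
qed

end

end

section \<open>The possible subgroups D and I, and the cases of the formula\<close>

context metacyclic_setup
begin

text \<open>The exponent b matters only modulo 2; allowing all natural numbers gives uniform rules
  for products and powers.\<close>

definition tj :: "nat => nat => 'g" where "tj l b = \<tau> ^$G l *$G j ^$G b"

lemma jpow_comm: "g \<in>$G ==> j ^$G (b::nat) *$G g = g *$G j ^$G b"
proof (induction b)
 case (Suc b)
 have "j ^$G Suc b *$G g = j ^$G b *$G (g *$G j)" using Suc.prems jG by (simp add: G.m_assoc jc[OF Suc.prems])
 also have "\<dots> = g *$G j ^$G b *$G j" using Suc jG by (simp add: G.m_assoc[symmetric])
 finally show ?case using Suc.prems jG by (simp add: G.m_assoc)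
qed (simp add: jG)

lemma tj_closed: "tj l b \<in>$G" using tG jG by (simp add: tj_def)

lemma tj_mult: "tj l b *$G tj l' b' = tj (l + l') (b + b')"
proof -
 have "tj l b *$G tj l' b' = \<tau> ^$G l *$G (j ^$G b *$G \<tau> ^$G l') *$G j ^$G b'"
  unfolding tj_def using tG jG by (simp add: G.m_assoc)
 also have "\<dots> = (\<tau> ^$G l *$G \<tau> ^$G l') *$G (j ^$G b *$G j ^$G b')"
  unfolding jpow_comm[OF tpow] using tG jG by (simp add: G.m_assoc)
 finally show ?thesis using tG jG by (simp add: G.nat_pow_mult tj_def)
qed

lemma tj_pow: "tj l b ^$G (n::nat) = tj (n * l) (n * b)"
proof (induction n)
 case (Suc n) thus ?case by (simp add: tj_mult add.commute)
qed (simp add: tj_def)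

lemma jpow_mod: "j ^$G (b mod 2) = j ^$G (b::nat)"
proof -
 have "(j ^$G (2::nat)) ^$G (b div 2) = 1$G" using jG jj by (simp add: numeral_2_eq_2)
 hence "j ^$G (2 * (b div 2)) = 1$G" using jG by (simp add: G.nat_pow_pow)
 thus ?thesis using G.nat_pow_mult[OF jG, of "2 * (b div 2)" "b mod 2"] jG by simp
qed

lemma tj_mod: "tj l (b mod 2) = tj l b" by (simp add: tj_def jpow_mod)

lemma carrier_tj: assumes g: "g \<in>$G" obtains k l b :: nat where "g = \<sigma> ^$G k *$G tj l b"
proof (cases "g \<in> \<Gamma>")
 case True
 then obtain k l where "g = el k l" using Gamma_el by auto
 hence "g = \<sigma> ^$G k *$G tj l 0" using tG by (simp add: el_def tj_def)
 thus thesis by (rule that)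
next
 case False
 then obtain k l where "g *$G j = el k l" using cover[OF g] Gamma_el by auto
 hence "g = el k l *$G j" using mult_j_j[OF g] by simp
 hence "g = \<sigma> ^$G k *$G tj l 1" using sG tG jG by (simp add: el_def tj_def G.m_assoc)
 thus thesis by (rule that)
qed

lemma subgroup_pow: "subgroup H G ==> h \<in> H ==> h ^$G (n::nat) \<in> H"
 using subgroup.one_closed[of H G] subgroup.m_closed[of H G] by (induction n) auto

lemma subgroup_cancel:
 assumes H: "subgroup H G" and x: "x \<in> H" and y: "y \<in>$G" and xy: "x *$G y \<in> H"
 shows "y \<in> H"
proof -
 have xG: "x \<in>$G" using subgroup.subset[OF H] x by blast
 have "inv\<^bsub>G\<^esub> x *$G (x *$G y) \<in> H" using subgroup.m_closed[OF H subgroup.m_inv_closed[OF H x] xy] .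
 thus ?thesis using xG y by (simp add: G.m_assoc[symmetric])
qed

text \<open>As \<sigma> is in H, membership of \<sigma>^k \<delta>^q depends on q alone. Take for t
  the least positive exponent with \<delta>^t in H; division with remainder shows that it divides
  all the others.\<close>

lemma subgroup_above_sigma:
 assumes H: "subgroup H G" and sH: "\<sigma> \<in> H" and d: "\<delta> \<in>$G"
  and cov: "!!h. h \<in> H ==> \<exists>k q. h = \<sigma> ^$G (k::nat) *$G \<delta> ^$G (q::nat)"
  and e: "e > 0" "\<delta> ^$G (e::nat) \<in> H"
 obtains t where "t > 0" "t dvd e" "H = generate G {\<sigma>, \<delta> ^$G t}"
proof -
 define t where "t = (LEAST t::nat. t > 0 \<and> \<delta> ^$G t \<in> H)"
 have t: "t > 0" "\<delta> ^$G t \<in> H"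
 proof -
  have "\<exists>t::nat. t > 0 \<and> \<delta> ^$G t \<in> H" using e by blast
  from LeastI_ex[OF this] show "t > 0" "\<delta> ^$G t \<in> H" by (simp_all add: t_def)
 qed
 have dv: "t dvd q" if q: "\<delta> ^$G q \<in> H" for q :: nat
 proof -
  have "(\<delta> ^$G t) ^$G (q div t) *$G \<delta> ^$G (q mod t) = \<delta> ^$G q"
   using d by (simp add: G.nat_pow_pow G.nat_pow_mult)
  hence "\<delta> ^$G (q mod t) \<in> H"
   using subgroup_cancel[OF H subgroup_pow[OF H t(2)], of "\<delta> ^$G (q mod t)" "q div t"] q d by simp
  moreover have "q mod t < t" using t(1) by simp
  ultimately have "q mod t = 0" using not_less_Least[of "q mod t" "%t. t > 0 \<and> \<delta> ^$G t \<in> H"] by (auto simp: t_def)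
  thus ?thesis by (simp add: dvd_eq_mod_eq_0)
 qed
 have sub: "{\<sigma>, \<delta> ^$G t} \<subseteq> carrier G" using sG d by simp
 have "H = generate G {\<sigma>, \<delta> ^$G t}"
 proof
  show "generate G {\<sigma>, \<delta> ^$G t} \<subseteq> H" by (rule G.generate_subgroup_incl[OF _ H]) (use sH t in auto)
  show "H \<subseteq> generate G {\<sigma>, \<delta> ^$G t}"
  proof
   fix h assume h: "h \<in> H"
   then obtain k q :: nat where hk: "h = \<sigma> ^$G k *$G \<delta> ^$G q" using cov by blast
   have "\<delta> ^$G q \<in> H" using subgroup_cancel[OF H subgroup_pow[OF H sH]] h d unfolding hk by simp
   then obtain a where "q = t * a" using dv by blast
   hence "h = \<sigma> ^$G k *$G (\<delta> ^$G t) ^$G a" using d by (simp add: hk G.nat_pow_pow)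
   moreover have g: "subgroup (generate G {\<sigma>, \<delta> ^$G t}) G" by (rule G.generate_is_subgroup[OF sub])
   moreover have "\<sigma> \<in> generate G {\<sigma>, \<delta> ^$G t}" "\<delta> ^$G t \<in> generate G {\<sigma>, \<delta> ^$G t}" by (auto intro: generate.incl)
   ultimately show "h \<in> generate G {\<sigma>, \<delta> ^$G t}" using subgroup_pow[OF g] subgroup.m_closed[OF g] by simp
  qed
 qed
 thus thesis using that t(1) dv[OF e(2)] by blast
qed

text \<open>Let f be the least positive l for which some \<tau>^l j^b is in D. Since j is not in D,
  such an element is determined by l, so all of them are powers of \<delta> = \<tau>^f j^b. For e =
  r / f the power \<delta>^e = j^(eb) lies in D, hence equals 1; so b = 1 forces e to be
  even.\<close>

lemma decomposition_group:
 assumes sI: "\<sigma> \<in> I" and jD: "j \<notin> D"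
 obtains f t b where "f > 0" "b < (2::nat)" "t > 0" "f dvd r" "t dvd r div f" "b = 1 ==> even (r div f)"
  "D = generate G {\<sigma>, tj f b}" "I = generate G {\<sigma>, tj f b ^$G t}"
proof -
 have sD: "\<sigma> \<in> D" using sI I_sub by blast
 define P where "P l \<longleftrightarrow> l > 0 \<and> (\<exists>b. tj l b \<in> D)" for l
 define f where "f = (LEAST l. P l)"
 have tjr: "tj r 0 = 1$G" using tpow_eq_iff[of r] by (simp add: tj_def)
 have "P r" unfolding P_def using r_pos tjr subgroup.one_closed[OF sgD] by metis
 hence "P f" unfolding f_def by (rule LeastI)
 then obtain b' where f: "f > 0" and b': "tj f b' \<in> D" by (auto simp: P_def)
 define b where "b = b' mod 2"
 have b2: "b < 2" by (simp add: b_def)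
 define \<delta> where "\<delta> = tj f b"
 have dD: "\<delta> \<in> D" using b' by (simp add: \<delta>_def b_def tj_mod)
 have dG: "\<delta> \<in>$G" by (rule D_sub[OF dD])
 have dpow: "\<delta> ^$G q = tj (q * f) (q * b)" for q :: nat unfolding \<delta>_def by (rule tj_pow)
 have j1: "j ^$G (c::nat) = 1$G" if "j ^$G c \<in> D" for c
 proof -
  have "c mod 2 = 0 \<or> c mod 2 = 1" by auto
  thus ?thesis using that jD jpow_mod[of c] jG by auto
 qed
 have key: "f dvd l \<and> tj l c = \<delta> ^$G (l div f)" if lc: "tj l c \<in> D" for l c
 proof -
  define q where "q = l div f"
  define l0 where "l0 = l mod f"
  \<comment> \<open>Adding q b to c serves as subtracting it, because j^2 = 1.\<close>
  have "\<delta> ^$G q *$G tj l0 (c + q * b) = tj l (c + 2 * (q * b))"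
   unfolding dpow tj_mult by (simp add: q_def l0_def add.commute add.left_commute mult_2)
  also have "\<dots> = tj l c" using tj_mod[of l "c + 2 * (q * b)"] tj_mod[of l c] by simp
  finally have e: "\<delta> ^$G q *$G tj l0 (c + q * b) = tj l c" .
  hence l0D: "tj l0 (c + q * b) \<in> D"
   using subgroup_cancel[OF sgD subgroup_pow[OF sgD dD] tj_closed] lc by metis
  moreover have "l0 < f" using f by (simp add: l0_def)
  ultimately have l0: "l0 = 0" using not_less_Least[of l0 P] by (auto simp: f_def P_def)
  have "tj l0 (c + q * b) = 1$G"
   using j1[of "c + q * b"] l0D jG unfolding l0 by (simp add: tj_def)
  hence "tj l c = \<delta> ^$G q" using e dG by simp
  thus ?thesis using l0 by (auto simp: q_def l0_def)
 qed
 have fr: "f dvd r" using key[of r 0] tjr subgroup.one_closed[OF sgD] by simp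
 define e where "e = r div f"
 have ef: "e * f = r" using fr by (simp add: e_def)
 have e0: "e > 0" using ef r_pos by (cases e) auto
 have cov: "\<exists>k q. g = \<sigma> ^$G (k::nat) *$G \<delta> ^$G (q::nat)" if g: "g \<in> D" for g
 proof -
  obtain k l c :: nat where gk: "g = \<sigma> ^$G k *$G tj l c" using carrier_tj[OF D_sub[OF g]] by blast
  have "tj l c \<in> D" using subgroup_cancel[OF sgD subgroup_pow[OF sgD sD] tj_closed] g unfolding gk by blast
  hence "tj l c = \<delta> ^$G (l div f)" using key by blast
  hence "g = \<sigma> ^$G k *$G \<delta> ^$G (l div f)" using gk by simp
  thus ?thesis by blast
 qed
 have de: "\<delta> ^$G e = j ^$G (e * b)"
  unfolding dpow ef using tpow_eq_iff[of r] jG by (simp add: tj_def)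
 hence de1: "\<delta> ^$G e = 1$G" using j1 subgroup_pow[OF sgD dD, of e] by simp
 have ev: "even e" if "b = 1"
 proof (rule ccontr)
  assume "odd e"
  hence "e mod 2 = 1" by presburger
  hence "\<delta> ^$G e = j" using de that jpow_mod[of e] jG by simp
  thus False using de1 jD subgroup.one_closed[OF sgD] by simp
 qed
 \<comment> \<open>Applied with exponent 1, the lemma on subgroups containing \<sigma> yields a
   divisor of 1 for D; for I it is applied with exponent e.\<close>
 have "\<delta> ^$G (1::nat) \<in> D" using dD dG by simp
 then obtain t1 :: nat where t1: "t1 > 0" "t1 dvd 1" "D = generate G {\<sigma>, \<delta> ^$G t1}"
  using subgroup_above_sigma[OF sgD sD dG cov zero_less_one] by blast
 hence Dg: "D = generate G {\<sigma>, \<delta>}" using dG by simp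
 have covI: "\<exists>k q. g = \<sigma> ^$G (k::nat) *$G \<delta> ^$G (q::nat)" if "g \<in> I" for g
  using cov that I_sub by blast
 have "\<delta> ^$G e \<in> I" unfolding de1 by (rule subgroup.one_closed[OF sg_I])
 then obtain t :: nat where "t > 0" "t dvd e" "I = generate G {\<sigma>, \<delta> ^$G t}"
  using subgroup_above_sigma[OF sg_I sI dG covI e0] by blast
 thus thesis using that[OF f b2 _ fr] ev Dg unfolding e_def \<delta>_def by blast
qed

context
 assumes genQ: "carrier Q = generate Q {\<phi>}"
begin

lemma Phi_projective:
 assumes "\<not> (p dvd card I \<and> j \<notin> D)" shows "Phi Lam AM = fg_projective_class Lam"
proof -
 have "fg_projective Lam LLM"
  using assms projective_tame projective_ramified_j[OF genQ sigma_in_I] by blast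
 thus ?thesis unfolding Phi_A_minus by (rule proj_class_projective)
qed

text \<open>Common to both families of pairs (D, I), which differ only in \<epsilon> and
  \<delta>.\<close>

lemma Phi_wild:
 assumes "\<sigma> \<in> I" "\<epsilon> = 1$Zp \<or> \<epsilon> = \<ominus>$Zp 1$Zp"
  "\<delta> \<in>$G" "u \<delta> = cst \<epsilon> *$Lam gel 0 f" "D = generate G {\<sigma>, \<delta>}"
  and S: "S = {i \<in> {1..r}. \<epsilon> *$Zp \<rho> ^$Zp (i * f) = 1$Zp}"
 shows "Phi Lam AM = proj_class Lam (dsum_mod S (%i. oplus_mod (K1 i) (K2 (i + 1))))"
proof -
 have S': "S \<subseteq> {1..r}" by (auto simp: S)
 have "LL = char_ideal S" unfolding S by (rule LL_char_ideal[OF genQ assms(1-5)])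
 hence "proj_equiv Lam LLM (dsum_mod S (%i. oplus_mod (K1 i) (K2 (i + 1))))"
  using char_ideal_proj_equiv[OF S'] by simp
 thus ?thesis
  unfolding Phi_A_minus by (rule proj_class_cong[OF LL_module MS_module[OF S']])
qed

lemma Phi_split:
 assumes d: "d dvd e" "e dvd r"
  and D: "D = generate G {\<sigma>, \<tau> ^$G (r div e)}" and I: "I = generate G {\<sigma>, \<tau> ^$G (r div d)}"
 shows "Phi Lam AM = proj_class Lam (dsum_mod {i \<in> {1..r}. e dvd i} (%i. oplus_mod (K1 i) (K2 (i + 1))))"
proof (rule Phi_wild[where \<epsilon> = "1$Zp" and f = "r div e", OF _ _ _ _ D])
 show "\<sigma> \<in> I" unfolding I by (auto intro: generate.incl)
 have "u (el 0 (r div e)) = gel 0 (r div e)" using el_Gamma by (simp add: u_def)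
 thus "u (\<tau> ^$G (r div e)) = cst 1$Zp *$Lam gel 0 (r div e)"
  using ring_hom_one[OF lam.gr_const_hom] gel_closed[of 0 "r div e"] by (simp add: el_simps)
 have "e dvd i \<longleftrightarrow> r dvd i * (r div e)" for i
 proof -
  obtain q where q: "r = e * q" using d(2) by blast
  hence "e > 0" "q > 0" using r_pos by (auto intro: gr0I)
  thus ?thesis by (simp add: q)
 qed
 thus "{i \<in> {1..r}. e dvd i} = {i \<in> {1..r}. 1$Zp *$Zp \<rho> ^$Zp (i * (r div e)) = 1$Zp}"
  using rho_closed by (simp add: rho_pow_eq_one)
qed (use tG in auto)

lemma one_neq_minus_one: "1$Zp \<noteq> \<ominus>$Zp 1$Zp"
proof
 assume a: "1$Zp = \<ominus>$Zp 1$Zp"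
 have "[(2::nat)] \<cdot>$Zp 1$Zp = 1$Zp +$Zp 1$Zp" by (simp add: numeral_2_eq_2)
 also have "\<dots> = 0$Zp" by (subst a) (simp add: Zp.l_neg)
 finally have "1$Zp = 0$Zp" by (rule padic_torsion_free[OF Zp.one_closed zero_less_numeral])
 from fun_cong[OF this, of 1] show False unfolding residue_simps(7,8) by simp
qed

text \<open>For x = \<rho>^k the condition is x = - 1. If x^2 = 1 and x \<noteq> 1, then x - 1 is a
  unit and can be cancelled from (x - 1)(x + 1) = 0.\<close>

lemma minus_rho_pow: "\<ominus>$Zp 1$Zp *$Zp \<rho> ^$Zp (k::nat) = 1$Zp \<longleftrightarrow> r dvd 2 * k \<and> \<not> r dvd k"
proof -
 define x where "x = \<rho> ^$Zp k"
 have x: "x \<in>$Zp" using rho_closed by (simp add: x_def)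
 have x1: "x = 1$Zp \<longleftrightarrow> r dvd k" unfolding x_def by (rule rho_pow_eq_one)
 have "x *$Zp x = \<rho> ^$Zp (2 * k)" unfolding x_def using rho_closed by (simp add: Zp.nat_pow_mult mult_2)
 hence x2: "x *$Zp x = 1$Zp \<longleftrightarrow> r dvd 2 * k" using rho_pow_eq_one by simp
 have "\<ominus>$Zp 1$Zp *$Zp x = 1$Zp \<longleftrightarrow> x = \<ominus>$Zp 1$Zp"
 proof -
  have "\<ominus>$Zp 1$Zp *$Zp x = \<ominus>$Zp x" using x by (simp add: Zp.l_minus)
  thus ?thesis using x Zp.minus_minus by (metis Zp.one_closed)
 qed
 also have "\<dots> \<longleftrightarrow> x *$Zp x = 1$Zp \<and> x \<noteq> 1$Zp"
 proof
  assume "x = \<ominus>$Zp 1$Zp"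
  thus "x *$Zp x = 1$Zp \<and> x \<noteq> 1$Zp"
   using one_neq_minus_one by (auto simp: Zp.l_minus)
 next
  assume a: "x *$Zp x = 1$Zp \<and> x \<noteq> 1$Zp"
  hence U: "x -$Zp 1$Zp \<in> Units Zp"
   using root_of_unity_minus_one[OF x, of 2] x by (simp add: numeral_2_eq_2)
  have "(x -$Zp 1$Zp) *$Zp (x +$Zp 1$Zp) = x *$Zp x -$Zp 1$Zp"
   using x by (simp add: a_minus_def Zp.l_distr Zp.r_distr Zp.l_minus Zp.a_assoc Zp.r_neg1)
  also have "\<dots> = 0$Zp" using a by (simp add: a_minus_def Zp.r_neg)
  also have "\<dots> = (x -$Zp 1$Zp) *$Zp 0$Zp" using x by simp
  finally have "x +$Zp 1$Zp = 0$Zp"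
   by (rule Zp.Units_l_cancel[OF U _ Zp.zero_closed, THEN iffD1, rotated]) (use x in simp)
  thus "x = \<ominus>$Zp 1$Zp" using Zp.minus_equality[of x "1$Zp"] x by simp
 qed
 finally show ?thesis unfolding x1 x2 by (simp add: x_def)
qed

text \<open>\<tau>^(r/e) j lies outside \<Gamma>, so u gives it the sign - 1, and - \<rho>^(i r/e) =
  1 says that i is an odd multiple of e/2.\<close>

lemma Phi_twisted:
 assumes d: "d dvd e" "e dvd r" "even e"
  and D: "D = generate G {\<sigma>, \<tau> ^$G (r div e) *$G j}"
  and I: "I = generate G {\<sigma>, (\<tau> ^$G (r div e) *$G j) ^$G (e div d)}"
 shows "Phi Lam AM = proj_class Lam (dsum_mod {i \<in> {1..r}. e div 2 dvd i \<and> \<not> e dvd i}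
  (%i. oplus_mod (K1 i) (K2 (i + 1))))"
proof (rule Phi_wild[where \<epsilon> = "\<ominus>$Zp 1$Zp" and f = "r div e", OF _ _ _ _ D])
 let ?t = "\<tau> ^$G (r div e)"
 show "\<sigma> \<in> I" unfolding I by (auto intro: generate.incl)
 have t: "?t \<in> \<Gamma>" "?t \<in>$G" using el_Gamma[of 0 "r div e"] tG by (simp_all add: el_simps)
 have "cst (\<ominus>$Zp 1$Zp) = \<ominus>$Lam 1$Lam"
  using additive_neg[OF Zp.abelian_group_axioms lam.RG.abelian_group_axioms, of cst "1$Zp"]
   cst_closed ring_hom_add[OF lam.gr_const_hom] ring_hom_one[OF lam.gr_const_hom] by simp
 moreover have "u (?t *$G j) = \<ominus>$Lam gel 0 (r div e)"
  unfolding u_def using Gamma_j[OF t(2)] t mult_j_j[OF t(2)] by (simp add: el_simps)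
 ultimately show "u (?t *$G j) = cst (\<ominus>$Zp 1$Zp) *$Lam gel 0 (r div e)"
  using gel_closed[of 0 "r div e"] by (simp add: lam.RG.l_minus)
 have "e div 2 dvd i \<and> \<not> e dvd i \<longleftrightarrow> r dvd 2 * (i * (r div e)) \<and> \<not> r dvd i * (r div e)" for i
 proof -
  obtain q where q: "r = e * q" using d(2) by blast
  obtain h where h: "e = 2 * h" using d(3) by blast
  have "h > 0" "q > 0" using r_pos q h by (auto intro: gr0I)
  thus ?thesis by (simp add: q h mult.assoc[symmetric])
 qed
 thus "{i \<in> {1..r}. e div 2 dvd i \<and> \<not> e dvd i} =
   {i \<in> {1..r}. \<ominus>$Zp 1$Zp *$Zp \<rho> ^$Zp (i * (r div e)) = 1$Zp}"
  unfolding minus_rho_pow by simp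
qed (use tG jG in auto)

end

text \<open>In terms of the exponents f and t of \<open>decomposition_group\<close> the parameters
  are e = r / f and d = e / t; b = 0 and b = 1 give the two families.\<close>

lemma classification:
 assumes "p dvd card I" "j \<notin> D"
 shows "(\<exists>d e. d dvd e \<and> e dvd r \<and>
   D = generate G {\<sigma>, \<tau> ^$G (r div e)} \<and> I = generate G {\<sigma>, \<tau> ^$G (r div d)}) \<or>
  (\<exists>d e. d dvd e \<and> e dvd r \<and> even e \<and>
   D = generate G {\<sigma>, \<tau> ^$G (r div e) *$G j} \<and>
   I = generate G {\<sigma>, (\<tau> ^$G (r div e) *$G j) ^$G (e div d)})"
proof -
 obtain f t b where f: "f > 0" "b < (2::nat)" "t > 0" "f dvd r" "t dvd r div f" "b = 1 ==> even (r div f)"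
  and D: "D = generate G {\<sigma>, tj f b}" and I: "I = generate G {\<sigma>, tj f b ^$G t}"
  using decomposition_group[OF sigma_in_I[OF assms(1)] assms(2)] by metis
 obtain e where e: "r = f * e" using f(4) by blast
 have re: "r div f = e" using e f(1) by simp
 obtain d where d: "e = t * d" using f(5) unfolding re by blast
 have pos: "d > 0" "e > 0" using r_pos e d by (auto intro: gr0I)
 have div: "r div e = f" "r div d = t * f" "e div d = t" "d dvd e" "e dvd r"
  using pos by (simp_all add: e) (simp_all add: d mult.assoc[symmetric])
 show ?thesis
 proof (cases "b = 0")
  case True
  have "tj f 0 = \<tau> ^$G (r div e)" "tj f 0 ^$G t = \<tau> ^$G (r div d)"
   using tG unfolding tj_pow div by (simp_all add: tj_def)
  thus ?thesis using D I div(4,5) unfolding True by metis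
 next
  case False
  hence b: "b = 1" using f(2) by simp
  have "tj f 1 = \<tau> ^$G (r div e) *$G j" using jG by (simp add: tj_def div)
  hence "D = generate G {\<sigma>, \<tau> ^$G (r div e) *$G j}"
   "I = generate G {\<sigma>, (\<tau> ^$G (r div e) *$G j) ^$G (e div d)}"
   using D I unfolding b div(3) by simp_all
  thus ?thesis using div(4,5) f(6)[OF b] unfolding re by blast
 qed
qed

end

text \<open>The last conjunct makes the case distinction complete: outside the first case every pair
  (D, I) belongs to one of the two families for which the class is computed.\<close>

theorem theorem4p6:
  fixes p r s :: nat
    and G :: "'g monoid" and \<Gamma> :: "'g set" and \<sigma> \<tau> j :: 'g
    and D I :: "'g set" and \<phi> :: "'g set"
    and \<rho> :: "nat \<Rightarrow> int"
  defines "\<Lambda> \<equiv> group_ring (padic_int p) (G\<lparr>carrier := \<Gamma>\<rparr>)"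
    and "A\<^sub>p \<equiv> A_minus p G \<Gamma> j D I \<phi>"
    and "K1 \<equiv> L1 p r G \<sigma> \<tau> \<rho>"
    and "K2 \<equiv> L2 p r s G \<sigma> \<tau>"
  assumes "prime p" and "odd p"
    and "coprime s p" and "r = ord p s"
    \<comment> \<open>the group \<open>G = \<Gamma> \<times> {1, j}\<close>\<close>
    and "group G" and "\<sigma> \<in> carrier G" and "\<tau> \<in> carrier G" and "j \<in> carrier G"
    and "group.ord G \<sigma> = p" and "group.ord G \<tau> = r"
    and "\<tau> \<otimes>\<^bsub>G\<^esub> \<sigma> \<otimes>\<^bsub>G\<^esub> inv\<^bsub>G\<^esub> \<tau> = \<sigma> [^]\<^bsub>G\<^esub> s"
    and "\<Gamma> = generate G {\<sigma>, \<tau>}"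
    and "group.ord G j = 2" and "j \<notin> \<Gamma>"
    and "\<And>g. g \<in> carrier G \<Longrightarrow> g \<otimes>\<^bsub>G\<^esub> j = j \<otimes>\<^bsub>G\<^esub> g"
    and "carrier G = \<Gamma> <#>\<^bsub>G\<^esub> {\<one>\<^bsub>G\<^esub>, j}"
    \<comment> \<open>the subgroups \<open>I \<subseteq> D\<close> and the generator \<open>\<phi>\<close> of \<open>D/I\<close>\<close>
    and "subgroup D G" and "I \<lhd> (G\<lparr>carrier := D\<rparr>)"
    and "\<phi> \<in> carrier ((G\<lparr>carrier := D\<rparr>) Mod I)"
    and "carrier ((G\<lparr>carrier := D\<rparr>) Mod I) = generate ((G\<lparr>carrier := D\<rparr>) Mod I) {\<phi>}"
    \<comment> \<open>the root of unity \<open>\<rho>\<close> with \<open>\<rho> \<equiv> s\<close> modulo \<open>p\<close>\<close>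
    and "\<rho> \<in> Units (padic_int p)" and "\<exists>n>0. \<rho> [^]\<^bsub>padic_int p\<^esub> (n::nat) = \<one>\<^bsub>padic_int p\<^esub>"
    and "\<rho> \<ominus>\<^bsub>padic_int p\<^esub> [s] \<cdot>\<^bsub>padic_int p\<^esub> \<one>\<^bsub>padic_int p\<^esub>
           \<in> PIdl\<^bsub>padic_int p\<^esub> ([p] \<cdot>\<^bsub>padic_int p\<^esub> \<one>\<^bsub>padic_int p\<^esub>)"
  shows "(\<not> (p dvd card I \<and> j \<notin> D) \<longrightarrow> Phi \<Lambda> A\<^sub>p = fg_projective_class \<Lambda>) \<and>
    (\<forall>d e. d dvd e \<and> e dvd r \<and>
       D = generate G {\<sigma>, \<tau> [^]\<^bsub>G\<^esub> (r div e)} \<and> I = generate G {\<sigma>, \<tau> [^]\<^bsub>G\<^esub> (r div d)} \<longrightarrow>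
       Phi \<Lambda> A\<^sub>p = proj_class \<Lambda>
         (dsum_mod {i \<in> {1..r}. e dvd i} (\<lambda>i. oplus_mod (K1 i) (K2 (i + 1))))) \<and>
    (\<forall>d e. d dvd e \<and> e dvd r \<and> even e \<and>
       D = generate G {\<sigma>, \<tau> [^]\<^bsub>G\<^esub> (r div e) \<otimes>\<^bsub>G\<^esub> j} \<and>
       I = generate G {\<sigma>, (\<tau> [^]\<^bsub>G\<^esub> (r div e) \<otimes>\<^bsub>G\<^esub> j) [^]\<^bsub>G\<^esub> (e div d)} \<longrightarrow>
       Phi \<Lambda> A\<^sub>p = proj_class \<Lambda>
         (dsum_mod {i \<in> {1..r}. e div 2 dvd i \<and> \<not> e dvd i}
            (\<lambda>i. oplus_mod (K1 i) (K2 (i + 1))))) \<and>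
    (p dvd card I \<and> j \<notin> D \<longrightarrow>
       (\<exists>d e. d dvd e \<and> e dvd r \<and>
          D = generate G {\<sigma>, \<tau> [^]\<^bsub>G\<^esub> (r div e)} \<and>
          I = generate G {\<sigma>, \<tau> [^]\<^bsub>G\<^esub> (r div d)}) \<or>
       (\<exists>d e. d dvd e \<and> e dvd r \<and> even e \<and>
          D = generate G {\<sigma>, \<tau> [^]\<^bsub>G\<^esub> (r div e) \<otimes>\<^bsub>G\<^esub> j} \<and>
          I = generate G {\<sigma>, (\<tau> [^]\<^bsub>G\<^esub> (r div e) \<otimes>\<^bsub>G\<^esub> j) [^]\<^bsub>G\<^esub> (e div d)}))"
proof -
 interpret G: group G by fact
 interpret grp: metacyclic_group p G \<Gamma> r s \<sigma> \<tau>
  by unfold_locales (fact assms)+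
 have genQ: "carrier ((G\<lparr>carrier := D\<rparr>) Mod I) = generate ((G\<lparr>carrier := D\<rparr>) Mod I) {\<phi>}"
  and rho_ideal: "\<rho> -$(padic_int p) [s] \<cdot>$(padic_int p) 1$(padic_int p)
   \<in> PIdl\<^bsub>padic_int p\<^esub> ([p] \<cdot>$(padic_int p) 1$(padic_int p))"
  and jG: "j \<in>$G" and jc: "!!g. g \<in>$G ==> g *$G j = j *$G g"
  and ord_j: "group.ord G j = 2" and rU: "\<rho> \<in> Units (padic_int p)"
  and cG: "carrier G = \<Gamma> <#>$G {1$G, j}"
  by (fact assms)+
 have sg: "subgroup \<Gamma> G"
  unfolding grp.Gamma by (rule G.generate_is_subgroup) (use grp.sG grp.tG in simp)
 have Gamma_sub: "h \<in>$G" if "h \<in> \<Gamma>" for h using subgroup.mem_carrier[OF sg that] .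
 have cov: "g \<in> \<Gamma> \<or> (\<exists>h\<in>\<Gamma>. g = h *$G j)" if g: "g \<in>$G" for g
 proof -
  have "\<exists>h\<in>\<Gamma>. \<exists>x\<in>{1$G, j}. g = h *$G x" using g unfolding cG set_mult_def by blast
  thus ?thesis using Gamma_sub G.r_one by (metis insertE singletonD)
 qed
 have "carrier G \<subseteq> \<Gamma> \<union> (%h. h *$G j) ` \<Gamma>" using cov by blast
 hence fin: "finite (carrier G)" using grp.finite_Gamma finite_subset by blast
 have "j ^$G (2::nat) = 1$G" using G.pow_ord_eq_1[OF jG] unfolding ord_j .
 hence jj: "j *$G j = 1$G" using jG by (simp add: numeral_2_eq_2)
 have cover: "g \<in> \<Gamma> \<or> g *$G j \<in> \<Gamma>" if g: "g \<in>$G" for g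
 proof (cases "g \<in> \<Gamma>")
  case False
  then obtain h where h: "h \<in> \<Gamma>" "g = h *$G j" using cov[OF g] by blast
  have "g *$G j = h" unfolding h(2) using Gamma_sub[OF h(1)] jG by (simp add: G.m_assoc jj)
  thus ?thesis using h(1) by simp
 qed simp
 have rc: "\<rho> \<in> carrier grp.Zp" by (rule grp.Zp.Units_closed[OF rU])
 \<comment> \<open>The congruence modulo the ideal generated by p is read off in component 1, the
   residue modulo p.\<close>
 have rho_s: "\<rho> 1 = int s mod int p"
 proof -
  obtain x where x: "x \<in> carrier grp.Zp" "\<rho> -$(grp.Zp) [s] \<cdot>$(grp.Zp) 1$(grp.Zp) = x *$(grp.Zp) ([p] \<cdot>$(grp.Zp) 1$(grp.Zp))"
   using rho_ideal unfolding cgenideal_def by blast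
  have "(\<rho> -$(grp.Zp) [s] \<cdot>$(grp.Zp) 1$(grp.Zp)) 1 = x 1 * (([p] \<cdot>$(grp.Zp) 1$(grp.Zp)) 1) mod int p"
   unfolding x(2) by (rule grp.residue_simps(1)[OF x(1)]) simp
  also have "\<dots> = 0" unfolding grp.residue_simps(6) by simp
  finally have "(\<rho> 1 - int s mod int p) mod int p = 0"
   unfolding grp.residue_simps(3)[OF rc grp.Zp.add.nat_pow_closed[OF grp.Zp.one_closed]] grp.residue_simps(6) .
  hence "int p dvd \<rho> 1 - int s mod int p" by (rule mod_0_imp_dvd)
  hence "\<rho> 1 mod int p = int s mod int p mod int p" by (simp only: mod_eq_dvd_iff)
  moreover have "\<rho> 1 mod int p = \<rho> 1" using grp.padic_mod[OF rc, of 1] by simp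
  ultimately show ?thesis by simp
 qed
 interpret metacyclic_setup p G \<Gamma> j D I \<phi> r s \<sigma> \<tau> \<rho>
 proof (intro metacyclic_setup.intro decomp_setup.intro decomp_setup_axioms.intro metacyclic_setup_axioms.intro)
  show "padic p" "group G" "metacyclic_group p G \<Gamma> r s \<sigma> \<tau>"
   by (fact grp.padic_axioms G.group_axioms grp.metacyclic_group_axioms)+
 qed (fact assms fin sg jj rho_s cover jc)+
 show ?thesis
  unfolding \<Lambda>_def A\<^sub>p_def K1_def K2_def
 proof (intro conjI impI allI)
  show "Phi Lam AM = fg_projective_class Lam" if "\<not> (p dvd card I \<and> j \<notin> D)"
   by (rule Phi_projective[OF genQ that])
 next
  fix d e
  assume "d dvd e \<and> e dvd r \<and>
   D = generate G {\<sigma>, \<tau> ^$G (r div e)} \<and> I = generate G {\<sigma>, \<tau> ^$G (r div d)}"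
  thus "Phi Lam AM = proj_class Lam
    (dsum_mod {i \<in> {1..r}. e dvd i} (%i. oplus_mod (L1 p r G \<sigma> \<tau> \<rho> i) (L2 p r s G \<sigma> \<tau> (i + 1))))"
   by (elim conjE) (rule Phi_split[OF genQ])
 next
  fix d e
  assume "d dvd e \<and> e dvd r \<and> even e \<and>
   D = generate G {\<sigma>, \<tau> ^$G (r div e) *$G j} \<and>
   I = generate G {\<sigma>, (\<tau> ^$G (r div e) *$G j) ^$G (e div d)}"
  thus "Phi Lam AM = proj_class Lam
    (dsum_mod {i \<in> {1..r}. e div 2 dvd i \<and> \<not> e dvd i}
     (%i. oplus_mod (L1 p r G \<sigma> \<tau> \<rho> i) (L2 p r s G \<sigma> \<tau> (i + 1))))"
   by (elim conjE) (rule Phi_twisted[OF genQ])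
 next
  assume "p dvd card I \<and> j \<notin> D"
  thus "(\<exists>d e. d dvd e \<and> e dvd r \<and>
     D = generate G {\<sigma>, \<tau> ^$G (r div e)} \<and>
     I = generate G {\<sigma>, \<tau> ^$G (r div d)}) \<or>
    (\<exists>d e. d dvd e \<and> e dvd r \<and> even e \<and>
     D = generate G {\<sigma>, \<tau> ^$G (r div e) *$G j} \<and>
     I = generate G {\<sigma>, (\<tau> ^$G (r div e) *$G j) ^$G (e div d)})"
   using classification by blast
 qed
qed

end
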